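(* Fix $\vartheta\in(0,1)$, $r>\vartheta$ and $h_0\in(-1,1)$. Consider $Y=X\beta+\sigma z$, $z\sim N(0,I_n)$, $\sigma>0$ known, where $X$ is deterministic with Gram matrix $X'X=G$, $G(i,j)=1\{i=j\}+h_0\cdot1\{|j-i|=1,\ \max(i,j)\text{ even}\}$, and $\beta=b\circ\mu$ with $b$ having i.i.d. Bernoulli$(\epsilon_p)$ entries, $\epsilon_p=p^{-\vartheta}$, and $\mu\in\Theta_p(\tau_p)=\{\mu:|\mu_i|\ge\tau_p\ \forall i\}$, $\tau_p=\sigma\sqrt{2r\log p}$. For $\star\in\{gs,ss,lasso\}$ let $\hat\beta^\star$ be, respectively, Graphlet Screening with $(\delta,m_0)=(0,2)$ and the other tuning as described below; subset selection (minimizer of $\frac12\|Y-X\beta\|^2+\frac12\lambda_{ss}^2\|\beta\|_0$); and the lasso (minimizer of $\frac12\|Y-X\beta\|^2+\lambda_{lasso}\|\beta\|_1$), where $\lambda_{ss},\lambda_{lasso}$ are set ideally given $(\vartheta,r)$ (i.e., to minimize the worst-case risk; they may depend on $(\vartheta,r,p,h_0)$ but not on $\mu$). Then as $p\to\infty$, $\sup_{\mu\in\Theta_p(\tau_p)}\mathbb E\sum_{j=1}^p1\{\mathrm{sgn}(\hat\beta^\star_j)\ne\mathrm{sgn}(\beta_j)\}=L_pp^{1-\rho_\star(\vartheta,r,h_0)}$, where $$\rho_{gs}=\min\Big\{\frac{(\vartheta+r)^2}{4r},\ \vartheta+\frac{(1-|h_0|)r}{2},\ 2\vartheta+\frac{\{[(1-h_0^2)r-\vartheta]_+\}^2}{4(1-h_0^2)r}\Big\},$$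 $$\rho_{ss}=\min\Big\{\frac{(\vartheta+r)^2}{4r},\ \vartheta+\frac{(1-|h_0|)r}{2},\ \rho^{(1)}_{ss},\ \rho^{(2)}_{ss}\Big\},$$ $$\rho_{lasso}=\min\Big\{\frac{(\vartheta+r)^2}{4r},\ \vartheta+\frac{(1-|h_0|)r}{2(1+\sqrt{1-h_0^2})},\ \rho^{(1)}_{lasso},\ \rho^{(2)}_{lasso}\Big\},$$ with the auxiliary functions defined in the context.
   Context: $x_+=\max(x,0)$; $L_p$ is a positive multi-$\log(p)$ factor ($L_pp^\delta\to\infty$, $L_pp^{-\delta}\to0$ for all fixed $\delta>0$); expectations are over $b$ and $z$. Auxiliary functions of $(\vartheta,r,h_0)$: $\rho^{(1)}_{ss}=2\vartheta$ if $r/\vartheta\le2/(1-h_0^2)$, and $=[2\vartheta+(1-h_0^2)r]^2/[4(1-h_0^2)r]$ otherwise; $\rho^{(2)}_{ss}=2\vartheta$ if $r/\vartheta\le2/(1-|h_0|)$, and $=2[\sqrt{2(1-|h_0|)r}-\sqrt{(1-|h_0|)r-\vartheta}]^2$ otherwise; $\rho^{(3)}_{lasso}=\{(2|h_0|)^{-1}[(1-h_0^2)\sqrt r-\sqrt{(1-h_0^2)(1-|h_0|)^2r-4|h_0|(1-|h_0|)\vartheta}]\}^2$; $\rho^{(4)}_{lasso}=\vartheta+\frac{(1-|h_0|)^3(1+|h_0|)}{16h_0^2}[(1+|h_0|)\sqrt r-\sqrt{(1-|h_0|)^2r-4|h_0|\vartheta/(1-h_0^2)}]^2$; $\rho^{(1)}_{lasso}=2\vartheta$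 if $r/\vartheta\le2/(1-|h_0|)^2$, and $=\rho^{(3)}_{lasso}$ otherwise; $\rho^{(2)}_{lasso}=2\vartheta$ if $r/\vartheta\le(1+|h_0|)/(1-|h_0|)^3$, and $=\rho^{(4)}_{lasso}$ otherwise. Graphlet Screening with parameters $(m_0,\delta,t,u^{gs},v^{gs})$, columns of $X$ denoted $x_j$: let $\Omega^{*,\delta}(i,j)=G(i,j)1\{|G(i,j)|\ge\delta\}$ and $\mathcal G^{*,\delta}$ the graph on $\{1,\dots,p\}$ with an edge $i\ne j$ iff $\Omega^{*,\delta}(i,j)\ne0$. $P^I$ is the orthogonal projection onto $\mathrm{span}\{x_j:j\in I\}$ ($P^\emptyset=0$), $X^{\otimes,I}$ the columns indexed by $I$, $A^{I,J}$ a submatrix. GS-step: list vertex sets of size $\le m_0$ inducing connected subgraphs of $\mathcal G^{*,\delta}$ in increasing size, ties lexicographic; starting from $\mathcal U=\emptyset$, for each listed $\mathcal I_0$ let $\hat F=\mathcal I_0\cap\mathcal U$, $\hat D=\mathcal I_0\setminus\mathcal U$, and if $\hat D\ne\emptyset$ and $\|P^{\mathcal I_0}Y\|^2-\|P^{\hat F}Y\|^2>t(\hat D,\hat F)$ add $\hat D$ to $\mathcal U$; the final set is $\mathcal U_p^*$. GC-step: for each connected component $\mathcal I_0$ of the subgraph induced by $\mathcal U_p^*$, $\hat\beta^{\mathcal I_0}$ minimizes $\|P^{\mathcal I_0}(Y-X^{\otimes,\mathcal I_0}\xi)\|^2+(u^{gs})^2\|\xi\|_0$ over $\xi$ with all nonzero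 entries of magnitude $\ge v^{gs}$; $\hat\beta_j=0$ off $\mathcal U_p^*$. Tuning: $u^{gs}=\sigma\sqrt{2\vartheta\log p}$, $v^{gs}=\tau_p$, $t(\hat D,\hat F)=2\sigma^2q(\hat D,\hat F)\log p$ where, with $\omega=\omega(\hat D,\hat F)=\min\{\xi'(G^{\hat D,\hat D}-G^{\hat D,\hat F}(G^{\hat F,\hat F})^{-1}G^{\hat F,\hat D})\xi:\min_i|\xi_i|\ge1\}$ and a constant $q_0>0$: if $|\hat D|$ odd and $\omega r/\vartheta>|\hat D|+(|\hat D|^2-1)^{1/2}$, $\sqrt{q_0}\le\sqrt q\le\sqrt{\omega r}-\sqrt{(\vartheta+\omega r)^2/(4\omega r)-(|\hat D|+1)\vartheta/2}$; if $|\hat D|$ even and $\omega r/\vartheta\ge2|\hat D|$, $\sqrt{q_0}\le\sqrt q\le\sqrt{\omega r}-\sqrt{\omega r/4-|\hat D|\vartheta/2}$; otherwise $q$ is a constant $\ge q_0$.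
   Formalization: At h_0=0, where the formulas for ρ^(3)_lasso and ρ^(4)_lasso read 0/0, their limits as h_0→0 are used, namely (r+2ϑ)²/(4r) and ϑ+(ϑ+r)²/(4r); neither affects the minimum defining ρ_lasso there. *)

theory Defs
  imports "HOL-Probability.Probability" "HOL-Library.List_Lexorder"
begin

section \<open>Conventions\<close>

text \<open>Coefficient indices are 1..p, observation indices are 1..n.
 A design is X :: nat => nat => real with entry X k j (row k, column j).
 Vectors are functions nat => real; only the listed coordinates matter.\<close>

definition pos :: "real \<Rightarrow> real" where "pos x = max x 0"

section \<open>Gram matrix of the theorem\<close>

definition Gmat :: "real \<Rightarrow> nat \<Rightarrow> nat \<Rightarrow> real" where
  "Gmat h0 i j = (if i = j then 1 else 0)
     + h0 * (if (i = j + 1 \<or> j = i + 1) \<and> even (max i j) then 1 else 0)"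

definition gram_is :: "nat \<Rightarrow> nat \<Rightarrow> (nat \<Rightarrow> nat \<Rightarrow> real) \<Rightarrow> (nat \<Rightarrow> nat \<Rightarrow> real) \<Rightarrow> bool" where
  "gram_is n p X G = (\<forall>i\<in>{1..p}. \<forall>j\<in>{1..p}. (\<Sum>k\<in>{1..n}. X k i * X k j) = G i j)"

section \<open>Linear algebra helpers\<close>

definition Xmul :: "nat \<Rightarrow> nat \<Rightarrow> (nat \<Rightarrow> nat \<Rightarrow> real) \<Rightarrow> (nat \<Rightarrow> real) \<Rightarrow> nat \<Rightarrow> real" where
  "Xmul n p X b = (\<lambda>k. if k \<in> {1..n} then (\<Sum>j\<in>{1..p}. X k j * b j) else 0)"

definition sqn :: "nat \<Rightarrow> (nat \<Rightarrow> real) \<Rightarrow> real" where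
  "sqn n v = (\<Sum>k\<in>{1..n}. (v k)\<^sup>2)"

definition ipn :: "nat \<Rightarrow> (nat \<Rightarrow> real) \<Rightarrow> (nat \<Rightarrow> real) \<Rightarrow> real" where
  "ipn n v w = (\<Sum>k\<in>{1..n}. v k * w k)"

text \<open>span of the columns x_j, j in I (vectors set to 0 outside 1..n)\<close>
definition colspan :: "nat \<Rightarrow> (nat \<Rightarrow> nat \<Rightarrow> real) \<Rightarrow> nat set \<Rightarrow> (nat \<Rightarrow> real) set" where
  "colspan n X I = {(\<lambda>k. if k \<in> {1..n} then (\<Sum>j\<in>I. c j * X k j) else 0) | c. True}"

text \<open>orthogonal projection P^I onto span{x_j : j in I}; P^{} = 0\<close>
definition proj :: "nat \<Rightarrow> (nat \<Rightarrow> nat \<Rightarrow> real) \<Rightarrow> nat set \<Rightarrow> (nat \<Rightarrow> real) \<Rightarrow> nat \<Rightarrow> real" where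
  "proj n X I Y = (THE v. v \<in> colspan n X I \<and> (\<forall>w\<in>colspan n X I. ipn n (\<lambda>k. Y k - v k) w = 0))"

text \<open>vectors with coordinates indexed by 1..p\<close>
definition coefs :: "nat \<Rightarrow> (nat \<Rightarrow> real) set" where
  "coefs p = {b. \<forall>j. j \<notin> {1..p} \<longrightarrow> b j = 0}"

definition l0 :: "nat \<Rightarrow> (nat \<Rightarrow> real) \<Rightarrow> nat" where
  "l0 p b = card {j\<in>{1..p}. b j \<noteq> 0}"

definition l1 :: "nat \<Rightarrow> (nat \<Rightarrow> real) \<Rightarrow> real" where
  "l1 p b = (\<Sum>j\<in>{1..p}. \<bar>b j\<bar>)"

text \<open>inverse of the submatrix A^{F,F} (entries outside F x F set to 0)\<close>
definition subinv :: "(nat \<Rightarrow> nat \<Rightarrow> real) \<Rightarrow> nat set \<Rightarrow> nat \<Rightarrow> nat \<Rightarrow> real" where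
  "subinv A F = (THE M. (\<forall>i\<in>F. \<forall>k\<in>F. (\<Sum>j\<in>F. A i j * M j k) = (if i = k then 1 else 0))
                       \<and> (\<forall>i j. i \<notin> F \<or> j \<notin> F \<longrightarrow> M i j = 0))"

text \<open>omega(D,F) = min { xi'(G^{DD} - G^{DF}(G^{FF})^{-1}G^{FD}) xi : min_i |xi_i| >= 1 }\<close>
definition omega :: "(nat \<Rightarrow> nat \<Rightarrow> real) \<Rightarrow> nat set \<Rightarrow> nat set \<Rightarrow> real" where
  "omega G D F = Inf {(\<Sum>i\<in>D. \<Sum>j\<in>D. xi i * (G i j - (\<Sum>k\<in>F. \<Sum>l\<in>F. G i k * subinv G F k l * G l j)) * xi j)
                      | xi. \<forall>i\<in>D. \<bar>xi i\<bar> \<ge> 1}"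

section \<open>Estimators\<close>

definition ss_est :: "nat \<Rightarrow> nat \<Rightarrow> (nat \<Rightarrow> nat \<Rightarrow> real) \<Rightarrow> real \<Rightarrow> (nat \<Rightarrow> real) \<Rightarrow> nat \<Rightarrow> real" where
  "ss_est n p X lam Y = (SOME b. b \<in> coefs p \<and>
     (\<forall>b'\<in>coefs p. sqn n (\<lambda>k. Y k - Xmul n p X b k) / 2 + lam\<^sup>2 * real (l0 p b) / 2
                   \<le> sqn n (\<lambda>k. Y k - Xmul n p X b' k) / 2 + lam\<^sup>2 * real (l0 p b') / 2))"

definition lasso_est :: "nat \<Rightarrow> nat \<Rightarrow> (nat \<Rightarrow> nat \<Rightarrow> real) \<Rightarrow> real \<Rightarrow> (nat \<Rightarrow> real) \<Rightarrow> nat \<Rightarrow> real" where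
  "lasso_est n p X lam Y = (SOME b. b \<in> coefs p \<and>
     (\<forall>b'\<in>coefs p. sqn n (\<lambda>k. Y k - Xmul n p X b k) / 2 + lam * l1 p b
                   \<le> sqn n (\<lambda>k. Y k - Xmul n p X b' k) / 2 + lam * l1 p b'))"

text \<open>Graph G^{*,delta}: edge i~j iff i \<noteq> j and G(i,j) 1{|G(i,j)| >= delta} \<noteq> 0\<close>
definition gedge :: "(nat \<Rightarrow> nat \<Rightarrow> real) \<Rightarrow> real \<Rightarrow> nat \<Rightarrow> nat \<Rightarrow> bool" where
  "gedge G del i j = (i \<noteq> j \<and> G i j * (if \<bar>G i j\<bar> \<ge> del then 1 else 0) \<noteq> 0)"

definition induced_rel :: "(nat \<Rightarrow> nat \<Rightarrow> real) \<Rightarrow> real \<Rightarrow> nat set \<Rightarrow> (nat \<times> nat) set" where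
  "induced_rel G del I = {(i, j). i \<in> I \<and> j \<in> I \<and> gedge G del i j}"

definition connected_in :: "(nat \<Rightarrow> nat \<Rightarrow> real) \<Rightarrow> real \<Rightarrow> nat set \<Rightarrow> bool" where
  "connected_in G del I = (I \<noteq> {} \<and> (\<forall>i\<in>I. \<forall>j\<in>I. (i, j) \<in> (induced_rel G del I)\<^sup>*))"

text \<open>vertex sets of size <= m0 inducing connected subgraphs, listed by increasing size,
  ties broken lexicographically (on the increasingly sorted lists of elements);
  key = card I # sorted list of I, ordered lexicographically\<close>
definition gs_list :: "nat \<Rightarrow> (nat \<Rightarrow> nat \<Rightarrow> real) \<Rightarrow> real \<Rightarrow> nat \<Rightarrow> nat set list" where
  "gs_list p G del m0 = map (\<lambda>x. set (tl x))
     (sorted_list_of_set {card I # sorted_list_of_set I | I. I \<subseteq> {1..p} \<and> card I \<le> m0 \<and> connected_in G del I})"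

definition gs_step :: "nat \<Rightarrow> nat \<Rightarrow> (nat \<Rightarrow> nat \<Rightarrow> real) \<Rightarrow> (nat \<Rightarrow> nat \<Rightarrow> real) \<Rightarrow> real \<Rightarrow> nat
                         \<Rightarrow> (nat set \<Rightarrow> nat set \<Rightarrow> real) \<Rightarrow> (nat \<Rightarrow> real) \<Rightarrow> nat set" where
  "gs_step n p X G del m0 t Y = foldl (\<lambda>U I0. let F = I0 \<inter> U; D = I0 - U in
       if D \<noteq> {} \<and> sqn n (proj n X I0 Y) - sqn n (proj n X F Y) > t D F then U \<union> D else U)
     {} (gs_list p G del m0)"

text \<open>connected component of j in the subgraph induced by U\<close>
definition component :: "(nat \<Rightarrow> nat \<Rightarrow> real) \<Rightarrow> real \<Rightarrow> nat set \<Rightarrow> nat \<Rightarrow> nat set" where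
  "component G del U j = {k \<in> U. (j, k) \<in> (induced_rel G del U)\<^sup>*}"

definition gc_fit :: "nat \<Rightarrow> nat \<Rightarrow> (nat \<Rightarrow> nat \<Rightarrow> real) \<Rightarrow> real \<Rightarrow> real \<Rightarrow> nat set \<Rightarrow> (nat \<Rightarrow> real) \<Rightarrow> nat \<Rightarrow> real" where
  "gc_fit n p X u v I0 Y = (let adm = {xi. (\<forall>k. k \<notin> I0 \<longrightarrow> xi k = 0) \<and> (\<forall>k\<in>I0. xi k \<noteq> 0 \<longrightarrow> \<bar>xi k\<bar> \<ge> v)};
       obj = (\<lambda>xi. sqn n (proj n X I0 (\<lambda>k. Y k - Xmul n p X xi k)) + u\<^sup>2 * real (card {k\<in>I0. xi k \<noteq> 0}))
     in SOME xi. xi \<in> adm \<and> (\<forall>xi'\<in>adm. obj xi \<le> obj xi'))"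

definition gs_est :: "nat \<Rightarrow> nat \<Rightarrow> (nat \<Rightarrow> nat \<Rightarrow> real) \<Rightarrow> (nat \<Rightarrow> nat \<Rightarrow> real) \<Rightarrow> real \<Rightarrow> nat
                        \<Rightarrow> (nat set \<Rightarrow> nat set \<Rightarrow> real) \<Rightarrow> real \<Rightarrow> real \<Rightarrow> (nat \<Rightarrow> real) \<Rightarrow> nat \<Rightarrow> real" where
  "gs_est n p X G del m0 t u v Y = (let U = gs_step n p X G del m0 t Y in
     (\<lambda>j. if j \<in> U then gc_fit n p X u v (component G del U j) Y j else 0))"

section \<open>Model and risk\<close>

definition std_normal_measure :: "real measure" where
  "std_normal_measure = density lborel std_normal_density"

definition beta_of :: "(nat \<Rightarrow> bool) \<Rightarrow> (nat \<Rightarrow> real) \<Rightarrow> nat \<Rightarrow> real" where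
  "beta_of b mu = (\<lambda>j. (if b j then 1 else 0) * mu j)"

definition Yobs :: "nat \<Rightarrow> nat \<Rightarrow> (nat \<Rightarrow> nat \<Rightarrow> real) \<Rightarrow> real \<Rightarrow> (nat \<Rightarrow> real) \<Rightarrow> (nat \<Rightarrow> real) \<Rightarrow> nat \<Rightarrow> real" where
  "Yobs n p X sig beta z = (\<lambda>k. Xmul n p X beta k + sig * z k)"

definition hamm :: "nat \<Rightarrow> (nat \<Rightarrow> real) \<Rightarrow> (nat \<Rightarrow> real) \<Rightarrow> nat" where
  "hamm p bh beta = card {j\<in>{1..p}. sgn (bh j) \<noteq> sgn (beta j)}"

text \<open>E sum_j 1{sgn(hat beta_j) \<noteq> sgn(beta_j)}, expectation over b (iid Bernoulli(eps)) and z ~ N(0,I_n)\<close>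
definition risk :: "nat \<Rightarrow> nat \<Rightarrow> (nat \<Rightarrow> nat \<Rightarrow> real) \<Rightarrow> real \<Rightarrow> real
                     \<Rightarrow> ((nat \<Rightarrow> real) \<Rightarrow> nat \<Rightarrow> real) \<Rightarrow> (nat \<Rightarrow> real) \<Rightarrow> ennreal" where
  "risk n p X sig eps est mu =
     (\<integral>\<^sup>+ b. (\<integral>\<^sup>+ z. ennreal (real (hamm p (est (Yobs n p X sig (beta_of b mu) z)) (beta_of b mu)))
              \<partial>(PiM {1..n} (\<lambda>_. std_normal_measure)))
        \<partial>(PiM {1..p} (\<lambda>_. measure_pmf (bernoulli_pmf eps))))"

definition Theta :: "nat \<Rightarrow> real \<Rightarrow> (nat \<Rightarrow> real) set" where
  "Theta p tau = {mu. \<forall>i\<in>{1..p}. \<bar>mu i\<bar> \<ge> tau}"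

text \<open>L_p: positive factor with L_p p^d \<rightarrow> \<infinity> and L_p p^{-d} \<rightarrow> 0 for every fixed d > 0\<close>
definition Lp_factor :: "(nat \<Rightarrow> real) \<Rightarrow> bool" where
  "Lp_factor L = ((\<forall>p. 0 < L p) \<and>
     (\<forall>d>0. filterlim (\<lambda>p. L p * real p powr d) at_top sequentially
            \<and> ((\<lambda>p. L p * real p powr (- d)) \<longlonglongrightarrow> 0)))"

section \<open>Exponents\<close>

definition rho_gs :: "real \<Rightarrow> real \<Rightarrow> real \<Rightarrow> real" where
  "rho_gs th r h = Min {(th + r)\<^sup>2 / (4 * r), th + (1 - \<bar>h\<bar>) * r / 2,
      2 * th + (pos ((1 - h\<^sup>2) * r - th))\<^sup>2 / (4 * (1 - h\<^sup>2) * r)}"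

definition rho_ss1 :: "real \<Rightarrow> real \<Rightarrow> real \<Rightarrow> real" where
  "rho_ss1 th r h = (if r / th \<le> 2 / (1 - h\<^sup>2) then 2 * th
     else (2 * th + (1 - h\<^sup>2) * r)\<^sup>2 / (4 * (1 - h\<^sup>2) * r))"

definition rho_ss2 :: "real \<Rightarrow> real \<Rightarrow> real \<Rightarrow> real" where
  "rho_ss2 th r h = (if r / th \<le> 2 / (1 - \<bar>h\<bar>) then 2 * th
     else 2 * (sqrt (2 * (1 - \<bar>h\<bar>) * r) - sqrt ((1 - \<bar>h\<bar>) * r - th))\<^sup>2)"

definition rho_ss :: "real \<Rightarrow> real \<Rightarrow> real \<Rightarrow> real" where
  "rho_ss th r h = Min {(th + r)\<^sup>2 / (4 * r), th + (1 - \<bar>h\<bar>) * r / 2, rho_ss1 th r h, rho_ss2 th r h}"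

text \<open>At h = 0 the formulas for rho^(3), rho^(4) are 0/0; we use their continuous extension
  (limit as h \<rightarrow> 0), see NOTES.md.\<close>
definition rho_lasso3 :: "real \<Rightarrow> real \<Rightarrow> real \<Rightarrow> real" where
  "rho_lasso3 th r h = (if h = 0 then (r + 2 * th)\<^sup>2 / (4 * r) else
     ((1 / (2 * \<bar>h\<bar>)) * ((1 - h\<^sup>2) * sqrt r
        - sqrt ((1 - h\<^sup>2) * (1 - \<bar>h\<bar>)\<^sup>2 * r - 4 * \<bar>h\<bar> * (1 - \<bar>h\<bar>) * th)))\<^sup>2)"

definition rho_lasso4 :: "real \<Rightarrow> real \<Rightarrow> real \<Rightarrow> real" where
  "rho_lasso4 th r h = (if h = 0 then th + (th + r)\<^sup>2 / (4 * r) else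
     th + (1 - \<bar>h\<bar>) ^ 3 * (1 + \<bar>h\<bar>) / (16 * h\<^sup>2)
        * ((1 + \<bar>h\<bar>) * sqrt r - sqrt ((1 - \<bar>h\<bar>)\<^sup>2 * r - 4 * \<bar>h\<bar> * th / (1 - h\<^sup>2)))\<^sup>2)"

definition rho_lasso1 :: "real \<Rightarrow> real \<Rightarrow> real \<Rightarrow> real" where
  "rho_lasso1 th r h = (if r / th \<le> 2 / (1 - \<bar>h\<bar>)\<^sup>2 then 2 * th else rho_lasso3 th r h)"

definition rho_lasso2 :: "real \<Rightarrow> real \<Rightarrow> real \<Rightarrow> real" where
  "rho_lasso2 th r h = (if r / th \<le> (1 + \<bar>h\<bar>) / (1 - \<bar>h\<bar>) ^ 3 then 2 * th else rho_lasso4 th r h)"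

definition rho_lasso :: "real \<Rightarrow> real \<Rightarrow> real \<Rightarrow> real" where
  "rho_lasso th r h = Min {(th + r)\<^sup>2 / (4 * r), th + (1 - \<bar>h\<bar>) * r / (2 * (1 + sqrt (1 - h\<^sup>2))),
      rho_lasso1 th r h, rho_lasso2 th r h}"

section \<open>Admissible GS threshold exponents q\<close>

text \<open>q p D F is the exponent in t(D,F) = 2 sig^2 q(D,F) log p. In the "otherwise" case it
  must be a constant (independent of p) >= q0; we allow this constant to depend on
  (|D|, |F|, omega(D,F)).\<close>
definition q_admissible :: "real \<Rightarrow> real \<Rightarrow> real \<Rightarrow> real \<Rightarrow> (nat \<Rightarrow> nat \<Rightarrow> real \<Rightarrow> real)
       \<Rightarrow> (nat \<Rightarrow> nat set \<Rightarrow> nat set \<Rightarrow> real) \<Rightarrow> bool" where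
  "q_admissible th r h q0 qc q = (\<forall>p D F.
     D \<subseteq> {1..p} \<longrightarrow> F \<subseteq> {1..p} \<longrightarrow> D \<noteq> {} \<longrightarrow> D \<inter> F = {} \<longrightarrow>
     (let w = omega (Gmat h) D F; d = real (card D) in
     (if odd (card D) \<and> w * r / th > d + sqrt (d\<^sup>2 - 1) then
        0 \<le> q p D F \<and> sqrt q0 \<le> sqrt (q p D F) \<and>
        sqrt (q p D F) \<le> sqrt (w * r) - sqrt ((th + w * r)\<^sup>2 / (4 * w * r) - (d + 1) * th / 2)
      else if even (card D) \<and> w * r / th \<ge> 2 * d then
        0 \<le> q p D F \<and> sqrt q0 \<le> sqrt (q p D F) \<and>
        sqrt (q p D F) \<le> sqrt (w * r) - sqrt (w * r / 4 - d * th / 2)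
      else q p D F = qc (card D) (card F) w \<and> qc (card D) (card F) w \<ge> q0)))"

end

(* The Gram matrix is block diagonal with 2 x 2 blocks, so each estimator splits into independent problems for
   two correlations; after division by sigma sqrt(2 log p) the signals have size at least sqrt r and the
   noise on a block has squared norm R2 with P(R2 >= x) = p^(-x), up to small powers of p.
   Upper bounds: on a block with m signals, an error forces R2 >= rho - m theta, pointwise in the noise; as m
   signals cost p^(-m theta), each block errs with probability at most p^(-rho).
   Lower bounds: for each term of the minimum defining rho there are signals and a half plane (or an open
   set touching one) of noise on which the estimator errs. For subset selection and the lasso, one such event
   needs a small and another a large tuning parameter; the terms of rho other than those free of the tuning
   parameter are the values at which two such costs balance, so no choice of lambda beats the minimum. *)
theory Submission
  imports Defs "HOL-Real_Asymp.Real_Asymp"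
begin

section \<open>Gaussian tails in the plane\<close>

abbreviation gauss_vec :: "nat \<Rightarrow> (nat \<Rightarrow> real) measure" where
  "gauss_vec n \<equiv> PiM {1..n} (\<lambda>_. std_normal_measure)"

lemma prob_space_std_normal: "prob_space std_normal_measure"
  unfolding std_normal_measure_def by (rule prob_space_normal_density) simp

lemma sets_std_normal [simp, measurable_cong]: "sets std_normal_measure = sets borel"
  by (simp add: std_normal_measure_def)

lemma space_std_normal [simp]: "space std_normal_measure = UNIV"
  by (simp add: std_normal_measure_def)

lemma std_normal_tail_upper:
  assumes "0 \<le> x"
  shows "emeasure std_normal_measure {x..} \<le> ennreal (exp (- x\<^sup>2 / 2))"
proof -
  have "emeasure std_normal_measure {x..}
      = (\<integral>\<^sup>+t. ennreal (std_normal_density t) * indicator {x..} t \<partial>lborel)"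
    unfolding std_normal_measure_def by (subst emeasure_density) auto
  also have "\<dots> = ennreal \<bar>1\<bar> * (\<integral>\<^sup>+t. ennreal (std_normal_density (x + 1 * t)) * indicator {x..} (x + 1 * t) \<partial>lborel)"
    by (rule nn_integral_real_affine) auto
  also have "\<dots> \<le> (\<integral>\<^sup>+t. ennreal (exp (- x\<^sup>2 / 2)) * ennreal (std_normal_density t) \<partial>lborel)"
  proof -
    have "std_normal_density (x + t) \<le> exp (- x\<^sup>2 / 2) * std_normal_density t" if "0 \<le> t" for t
    proof -
      have "- (x + t)\<^sup>2 / 2 \<le> - x\<^sup>2 / 2 + - t\<^sup>2 / 2"
        using assms that by (simp add: power2_sum)
      then have "exp (- (x + t)\<^sup>2 / 2) \<le> exp (- x\<^sup>2 / 2) * exp (- t\<^sup>2 / 2)"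
        by (simp flip: exp_add)
      from mult_left_mono[OF this, of "1 / sqrt (2 * pi)"]
      show ?thesis by (simp add: std_normal_density_def mult_ac)
    qed
    then show ?thesis
      by (auto intro!: nn_integral_mono simp: indicator_def simp flip: ennreal_mult)
  qed
  also have "\<dots> = ennreal (exp (- x\<^sup>2 / 2)) * (\<integral>\<^sup>+t. ennreal (std_normal_density t) \<partial>lborel)"
    by (rule nn_integral_cmult) auto
  also have "(\<integral>\<^sup>+t. ennreal (std_normal_density t) \<partial>lborel) = 1"
    by (subst nn_integral_eq_integral) auto
  finally show ?thesis by simp
qed

lemma std_normal_tail_lower:
  assumes "0 \<le> x"
  shows "ennreal (std_normal_density (x + 1)) \<le> emeasure std_normal_measure {x..}"
proof -
  have "ennreal (std_normal_density (x + 1))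
      = (\<integral>\<^sup>+t. ennreal (std_normal_density (x + 1)) * indicator {x..x+1} t \<partial>lborel)"
    by (subst nn_integral_cmult_indicator) auto
  also have "\<dots> \<le> (\<integral>\<^sup>+t. ennreal (std_normal_density t) * indicator {x..} t \<partial>lborel)"
  proof -
    have "std_normal_density (x + 1) \<le> std_normal_density t" if "x \<le> t" "t \<le> x + 1" for t
      using that assms by (auto simp: std_normal_density_def intro!: divide_right_mono power_mono)
    then show ?thesis
      by (auto intro!: nn_integral_mono simp: indicator_def)
  qed
  also have "\<dots> = emeasure std_normal_measure {x..}"
    unfolding std_normal_measure_def by (subst emeasure_density) auto
  finally show ?thesis .
qed

lemma lincomb_measurable [measurable]:
  "(\<lambda>z. \<Sum>k\<in>{1..n}. c k * z k) \<in> borel_measurable (gauss_vec n)"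
  by measurable

lemma lincomb_tail_eq:
  assumes c: "(\<Sum>k\<in>{1..n}. (c k)\<^sup>2) = 1"
  shows "emeasure (gauss_vec n) {z \<in> space (gauss_vec n). x \<le> (\<Sum>k\<in>{1..n}. c k * z k)}
    = emeasure std_normal_measure {x..}"
proof -
  interpret P: prob_space "gauss_vec n" by (rule prob_space_PiM) (rule prob_space_std_normal)
  define I where "I = {k\<in>{1..n}. c k \<noteq> 0}"
  have sumI: "(\<Sum>k\<in>I. f k * c k) = (\<Sum>k\<in>{1..n}. f k * c k)" for f :: "nat \<Rightarrow> real"
    unfolding I_def by (rule sum.mono_neutral_left) auto
  have cI: "(\<Sum>k\<in>I. (c k)\<^sup>2) = 1"
    using c sumI[of c] by (simp add: power2_eq_square)
  have ne: "I \<noteq> {}" using cI by auto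
  have fin: "finite I" by (auto simp: I_def)
  have indep0: "P.indep_vars (\<lambda>_. std_normal_measure) (\<lambda>k z. z k) I"
  proof (rule P.indep_vars_subset)
    have "distr (gauss_vec n) (gauss_vec n) (\<lambda>z. \<lambda>k\<in>{1..n}. z k) = distr (gauss_vec n) (gauss_vec n) (\<lambda>z. z)"
      by (rule distr_cong) (auto simp: space_PiM PiE_def extensional_restrict)
    also have "\<dots> = PiM {1..n} (\<lambda>k. distr (gauss_vec n) std_normal_measure (\<lambda>z. z k))"
      by (simp, rule PiM_cong) (auto intro!: distr_PiM_component[symmetric] prob_space_std_normal)
    finally show "P.indep_vars (\<lambda>_. std_normal_measure) (\<lambda>k z. z k) {1..n}"
      using ne I_def by (subst P.indep_vars_iff_distr_eq_PiM') (auto cong: measurable_cong_sets)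
  qed (auto simp: I_def)
  have indep: "P.indep_vars (\<lambda>_. borel) (\<lambda>k z. c k * z k) I"
    by (rule P.indep_vars_compose2[OF indep0]) auto
  have "distributed (gauss_vec n) lborel (\<lambda>z. c k * z k) (normal_density 0 \<bar>c k\<bar>)" if k: "k \<in> I" for k
  proof -
    have d: "distr (gauss_vec n) std_normal_measure (\<lambda>z. z k) = std_normal_measure"
      using k by (intro distr_PiM_component) (auto simp: I_def intro: prob_space_std_normal)
    have "distr (gauss_vec n) lborel (\<lambda>z. z k) = distr (gauss_vec n) std_normal_measure (\<lambda>z. z k)"
      by (rule distr_cong) auto
    with d have "distributed (gauss_vec n) lborel (\<lambda>z. z k) (normal_density 0 1)"
      using k unfolding distributed_def by (auto simp: std_normal_measure_def I_def)
    from P.normal_density_affine[OF this, of "c k" 0] k show ?thesis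
      by (auto simp: I_def)
  qed
  then have "distributed (gauss_vec n) lborel (\<lambda>z. \<Sum>k\<in>I. c k * z k)
      (normal_density (\<Sum>k\<in>I. 0) (sqrt (\<Sum>k\<in>I. \<bar>c k\<bar>\<^sup>2)))"
    using fin ne indep by (intro P.sum_indep_normal) (auto simp: I_def)
  moreover have "(\<Sum>k\<in>I. c k * z k) = (\<Sum>k\<in>{1..n}. c k * z k)" for z
    using sumI[of z] by (simp add: mult.commute)
  ultimately have "distributed (gauss_vec n) lborel (\<lambda>z. \<Sum>k\<in>{1..n}. c k * z k) std_normal_density"
    using cI by simp
  then have "distr (gauss_vec n) lborel (\<lambda>z. \<Sum>k\<in>{1..n}. c k * z k) = std_normal_measure"
    by (simp add: distributed_def std_normal_measure_def)
  then have "emeasure std_normal_measure {x..} = emeasure (distr (gauss_vec n) lborel (\<lambda>z. \<Sum>k\<in>{1..n}. c k * z k)) {x..}"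
    by simp
  also have "\<dots> = emeasure (gauss_vec n) ((\<lambda>z. \<Sum>k\<in>{1..n}. c k * z k) -` {x..} \<inter> space (gauss_vec n))"
    by (rule emeasure_distr) auto
  finally show ?thesis by (simp add: vimage_def Int_def conj_commute)
qed

lemma lincomb_tail_upper:
  assumes c: "(\<Sum>k\<in>{1..n}. (c k)\<^sup>2) \<le> 1" and x: "0 < x"
  shows "emeasure (gauss_vec n) {z \<in> space (gauss_vec n). x \<le> (\<Sum>k\<in>{1..n}. c k * z k)} \<le> ennreal (exp (- x\<^sup>2 / 2))"
proof (cases "(\<Sum>k\<in>{1..n}. (c k)\<^sup>2) = 0")
  case True
  then have "\<forall>k\<in>{1..n}. c k = 0" by (subst (asm) sum_nonneg_eq_0_iff) auto
  then have "{z \<in> space (gauss_vec n). x \<le> (\<Sum>k\<in>{1..n}. c k * z k)} = {}" using x by simp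
  then show ?thesis by (simp only: emeasure_empty zero_le)
next
  case False
  define s where "s = sqrt (\<Sum>k\<in>{1..n}. (c k)\<^sup>2)"
  have S: "0 < (\<Sum>k\<in>{1..n}. (c k)\<^sup>2)" using False by (simp add: sum_nonneg order_less_le)
  then have s: "0 < s" "s \<le> 1" "s\<^sup>2 = (\<Sum>k\<in>{1..n}. (c k)\<^sup>2)" using c by (auto simp: s_def)
  have "(\<Sum>k\<in>{1..n}. (c k / s)\<^sup>2) = 1"
    using s S by (simp add: power_divide flip: sum_divide_distrib)
  from lincomb_tail_eq[OF this, of "x / s"]
  have "emeasure (gauss_vec n) {z \<in> space (gauss_vec n). x / s \<le> (\<Sum>k\<in>{1..n}. c k / s * z k)}
      = emeasure std_normal_measure {x / s..}" .
  moreover have "x / s \<le> (\<Sum>k\<in>{1..n}. c k / s * z k) \<longleftrightarrow> x \<le> (\<Sum>k\<in>{1..n}. c k * z k)" for z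
    using s by (simp add: field_simps flip: sum_divide_distrib)
  ultimately have "emeasure (gauss_vec n) {z \<in> space (gauss_vec n). x \<le> (\<Sum>k\<in>{1..n}. c k * z k)}
     = emeasure std_normal_measure {x / s..}" by simp
  also have "\<dots> \<le> ennreal (exp (- (x / s)\<^sup>2 / 2))"
    using s x by (intro std_normal_tail_upper) auto
  also have "\<dots> \<le> ennreal (exp (- x\<^sup>2 / 2))"
  proof -
    have "x \<le> x / s" using s x by (simp add: le_divide_eq mult_left_le)
    then have "x\<^sup>2 \<le> (x/s)\<^sup>2" using x by (intro power_mono) auto
    then show ?thesis by (intro ennreal_leI) simp
  qed
  finally show ?thesis .
qed

lemma finite_direction_net:
  fixes \<eta> :: real assumes "0 < \<eta>"
  obtains E :: "(real \<times> real) set" where "finite E" "\<And>e. e \<in> E \<Longrightarrow> (fst e)\<^sup>2 + (snd e)\<^sup>2 = 1"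
    "\<And>x y. x\<^sup>2 + y\<^sup>2 \<noteq> 0 \<Longrightarrow> \<exists>e\<in>E. (1 - \<eta>) * sqrt (x\<^sup>2 + y\<^sup>2) < fst e * x + snd e * y"
proof -
  let ?S = "sphere 0 1 :: (real \<times> real) set"
  have "compact ?S" by simp
  moreover have "?S \<subseteq> (\<Union>e\<in>?S. {v. 1 - \<eta> < inner e v})"
    using assms by (auto simp: norm_eq_1)
  moreover have "open {v. 1 - \<eta> < inner e v}" for e :: "real \<times> real"
    by (intro open_Collect_less continuous_intros)
  ultimately obtain E where E: "E \<subseteq> ?S" "finite E" "?S \<subseteq> (\<Union>e\<in>E. {v. 1 - \<eta> < inner e v})"
    using compactE_image by metis
  show ?thesis
  proof
    show "finite E" by fact
    show "(fst e)\<^sup>2 + (snd e)\<^sup>2 = 1" if "e \<in> E" for e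
    proof -
      have "norm e = 1" using that E(1) by auto
      then show ?thesis by (simp add: norm_prod_def)
    qed
    fix x y :: real assume xy: "x\<^sup>2 + y\<^sup>2 \<noteq> 0"
    define s where "s = sqrt (x\<^sup>2 + y\<^sup>2)"
    have "0 < x\<^sup>2 + y\<^sup>2" using xy by (metis add_nonneg_nonneg order_less_le zero_le_power2)
    then have s: "0 < s" by (simp only: s_def real_sqrt_gt_0_iff)
    have "s\<^sup>2 = x\<^sup>2 + y\<^sup>2" by (simp add: s_def)
    then have "(x / s)\<^sup>2 + (y / s)\<^sup>2 = 1" using s xy by (simp add: power_divide flip: add_divide_distrib)
    then have "(x / s, y / s) \<in> ?S" by (simp add: norm_prod_def power_divide)
    then obtain e where e: "e \<in> E" "1 - \<eta> < inner e (x / s, y / s)" using E(3) by blast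
    have "inner e (x / s, y / s) = (fst e * x + snd e * y) / s"
      by (cases e) (simp add: add_divide_distrib)
    with e s have "(1 - \<eta>) * s < fst e * x + snd e * y" by (simp add: pos_less_divide_eq)
    with e(1) show "\<exists>e\<in>E. (1 - \<eta>) * sqrt (x\<^sup>2 + y\<^sup>2) < fst e * x + snd e * y"
      unfolding s_def by blast
  qed
qed

definition subnormal :: "nat \<Rightarrow> (nat \<Rightarrow> real) \<Rightarrow> (nat \<Rightarrow> real) \<Rightarrow> bool" where
  "subnormal n c d \<longleftrightarrow> (\<Sum>k\<in>{1..n}. (c k)\<^sup>2) \<le> 1 \<and> (\<Sum>k\<in>{1..n}. (d k)\<^sup>2) \<le> 1 \<and> (\<Sum>k\<in>{1..n}. c k * d k) = 0"

abbreviation lin :: "nat \<Rightarrow> (nat \<Rightarrow> real) \<Rightarrow> (nat \<Rightarrow> real) \<Rightarrow> real" where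
  "lin n c z \<equiv> (\<Sum>k\<in>{1..n}. c k * z k)"

lemma lin_combine: "\<alpha> * lin n c z + \<beta> * lin n d z = lin n (\<lambda>k. \<alpha> * c k + \<beta> * d k) z"
  by (simp add: sum_distrib_left sum.distrib algebra_simps)

lemma sumsq_combine:
  "(\<Sum>k\<in>{1..n}. (\<alpha> * c k + \<beta> * d k)\<^sup>2) = \<alpha>\<^sup>2 * (\<Sum>k\<in>{1..n}. (c k)\<^sup>2) + 2 * \<alpha> * \<beta> * (\<Sum>k\<in>{1..n}. c k * d k)
      + \<beta>\<^sup>2 * (\<Sum>k\<in>{1..n}. (d k :: real)\<^sup>2)"
  by (simp add: sum_distrib_left power2_sum power_mult_distrib sum.distrib algebra_simps)

lemma radius_tail:
  fixes \<eta> :: real assumes "0 < \<eta>" "\<eta> < 1"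
  obtains K :: nat where "\<And>n c d x. subnormal n c d \<Longrightarrow> 0 < x \<Longrightarrow>
    emeasure (gauss_vec n) {z \<in> space (gauss_vec n). x\<^sup>2 \<le> (lin n c z)\<^sup>2 + (lin n d z)\<^sup>2}
      \<le> ennreal (real K * exp (- ((1 - \<eta>) * x)\<^sup>2 / 2))"
proof -
  obtain E :: "(real \<times> real) set" where E: "finite E" "\<And>e. e \<in> E \<Longrightarrow> (fst e)\<^sup>2 + (snd e)\<^sup>2 = 1"
    "\<And>x y. x\<^sup>2 + y\<^sup>2 \<noteq> 0 \<Longrightarrow> \<exists>e\<in>E. (1 - \<eta>) * sqrt (x\<^sup>2 + y\<^sup>2) < fst e * x + snd e * y"
    using finite_direction_net[OF assms(1)] by blast
  show ?thesis
  proof (rule that[of "card E"])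
    fix n c d and x :: real assume cd: "subnormal n c d" and x: "0 < x"
    let ?A = "\<lambda>e. {z \<in> space (gauss_vec n). (1 - \<eta>) * x \<le> lin n (\<lambda>k. fst e * c k + snd e * d k) z}"
    have "{z \<in> space (gauss_vec n). x\<^sup>2 \<le> (lin n c z)\<^sup>2 + (lin n d z)\<^sup>2} \<subseteq> (\<Union>e\<in>E. ?A e)"
    proof
      fix z assume "z \<in> {z \<in> space (gauss_vec n). x\<^sup>2 \<le> (lin n c z)\<^sup>2 + (lin n d z)\<^sup>2}"
      then have z: "z \<in> space (gauss_vec n)" and r: "x\<^sup>2 \<le> (lin n c z)\<^sup>2 + (lin n d z)\<^sup>2" by auto
      have "0 < x\<^sup>2" using x by simp
      with r obtain e where e: "e \<in> E"
        "(1 - \<eta>) * sqrt ((lin n c z)\<^sup>2 + (lin n d z)\<^sup>2) < fst e * lin n c z + snd e * lin n d z"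
        using E(3)[of "lin n c z" "lin n d z"] by fastforce
      have "x \<le> sqrt ((lin n c z)\<^sup>2 + (lin n d z)\<^sup>2)" using r x by (intro real_le_rsqrt)
      then have "(1 - \<eta>) * x \<le> (1 - \<eta>) * sqrt ((lin n c z)\<^sup>2 + (lin n d z)\<^sup>2)"
        using assms by (intro mult_left_mono) auto
      with e z show "z \<in> (\<Union>e\<in>E. ?A e)"
        unfolding lin_combine by (intro UN_I[of e]) auto
    qed
    then have "emeasure (gauss_vec n) {z \<in> space (gauss_vec n). x\<^sup>2 \<le> (lin n c z)\<^sup>2 + (lin n d z)\<^sup>2}
        \<le> emeasure (gauss_vec n) (\<Union>e\<in>E. ?A e)"
      by (intro emeasure_mono sets.finite_UN E(1)) measurable
    also have "\<dots> \<le> (\<Sum>e\<in>E. emeasure (gauss_vec n) (?A e))"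
      by (intro emeasure_subadditive_finite E(1)) (auto, measurable)
    also have "\<dots> \<le> (\<Sum>e\<in>E. ennreal (exp (- ((1 - \<eta>) * x)\<^sup>2 / 2)))"
    proof (intro sum_mono lincomb_tail_upper)
      fix e assume e: "e \<in> E"
      have "(\<Sum>k\<in>{1..n}. (fst e * c k + snd e * d k)\<^sup>2)
          = (fst e)\<^sup>2 * (\<Sum>k\<in>{1..n}. (c k)\<^sup>2) + (snd e)\<^sup>2 * (\<Sum>k\<in>{1..n}. (d k)\<^sup>2)"
        using cd unfolding sumsq_combine subnormal_def by simp
      also have "\<dots> \<le> (fst e)\<^sup>2 * 1 + (snd e)\<^sup>2 * 1"
        using cd unfolding subnormal_def by (intro add_mono mult_left_mono) auto
      finally show "(\<Sum>k\<in>{1..n}. (fst e * c k + snd e * d k)\<^sup>2) \<le> 1" using E(2)[OF e] by simp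
    qed (use assms x in auto)
    also have "\<dots> = ennreal (real (card E) * exp (- ((1 - \<eta>) * x)\<^sup>2 / 2))"
      by (simp add: ennreal_mult ennreal_of_nat_eq_real_of_nat)
    finally show "emeasure (gauss_vec n) {z \<in> space (gauss_vec n). x\<^sup>2 \<le> (lin n c z)\<^sup>2 + (lin n d z)\<^sup>2}
      \<le> ennreal (real (card E) * exp (- ((1 - \<eta>) * x)\<^sup>2 / 2))" .
  qed
qed

lemma event_lower:
  fixes \<kappa> \<eta> d :: real assumes "0 < \<kappa>" "0 < \<eta>" "0 < d"
  shows "\<forall>\<^sub>F p in sequentially. \<forall>n c e \<alpha> \<beta>. subnormal n c e \<and> (\<Sum>k\<in>{1..n}. (c k)\<^sup>2) = 1 \<and> (\<Sum>k\<in>{1..n}. (e k)\<^sup>2) = 1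
      \<and> \<alpha>\<^sup>2 + \<beta>\<^sup>2 = 1 \<longrightarrow>
    ennreal (real p powr (- \<kappa> - d)) \<le> emeasure (gauss_vec n) {z \<in> space (gauss_vec n).
      sqrt (2 * \<kappa> * ln p) \<le> \<alpha> * lin n c z + \<beta> * lin n e z
      \<and> (lin n c z)\<^sup>2 + (lin n e z)\<^sup>2 \<le> (1 + \<eta>)\<^sup>2 * (2 * \<kappa> * ln p)}"
proof -
  define \<eta>' where "\<eta>' = \<eta> / (2 * (1 + \<eta>))"
  define \<gamma> where "\<gamma> = ((1 + \<eta> / 2)\<^sup>2 - 1) * \<kappa>"
  have \<eta>': "0 < \<eta>'" "\<eta>' < 1" "(1 - \<eta>') * (1 + \<eta>) = 1 + \<eta> / 2"
    using assms by (auto simp: \<eta>'_def field_simps)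
  have "1\<^sup>2 < (1 + \<eta> / 2)\<^sup>2" using assms by (intro power_strict_mono) auto
  then have \<gamma>: "0 < \<gamma>" using assms by (simp add: \<gamma>_def)
  obtain K :: nat where K: "\<And>n c d x. subnormal n c d \<Longrightarrow> 0 < x \<Longrightarrow>
    emeasure (gauss_vec n) {z \<in> space (gauss_vec n). x\<^sup>2 \<le> (lin n c z)\<^sup>2 + (lin n d z)\<^sup>2}
      \<le> ennreal (real K * exp (- ((1 - \<eta>') * x)\<^sup>2 / 2))"
    using radius_tail[OF \<eta>'(1,2)] by blast
  define \<delta> where "\<delta> = min d \<gamma> / 2"
  have \<delta>: "0 < \<delta>" "2 * \<delta> \<le> d" "2 * \<delta> \<le> \<gamma>" using assms \<gamma> by (auto simp: \<delta>_def)
  have ln_top: "filterlim (\<lambda>p::nat. ln (real p)) at_top sequentially"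
    by (rule filterlim_compose[OF ln_at_top filterlim_real_sequentially])
  have "\<forall>\<^sub>F t::real in at_top. exp (- \<delta> * t) \<le> exp (- sqrt (2 * \<kappa> * t) - 1 / 2) / sqrt (2 * pi)"
    using \<delta>(1) assms(1) by real_asymp
  from eventually_compose_filterlim[OF this ln_top]
  have ev1: "\<forall>\<^sub>F p::nat in sequentially. exp (- \<delta> * ln p) \<le> exp (- sqrt (2 * \<kappa> * ln p) - 1 / 2) / sqrt (2 * pi)" .
  have "\<forall>\<^sub>F t::real in at_top. (real K + 1) \<le> exp (\<delta> * t)"
    using \<delta>(1) by real_asymp
  from eventually_compose_filterlim[OF this ln_top]
  have ev2: "\<forall>\<^sub>F p::nat in sequentially. (real K + 1) \<le> exp (\<delta> * ln p)" .
  have ev3: "\<forall>\<^sub>F p::nat in sequentially. 2 \<le> p" by (rule eventually_ge_at_top)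
  show ?thesis
    using ev1 ev2 ev3
  proof eventually_elim
    case (elim p)
    define L where "L = ln (real p)"
    have L: "0 < L" using elim(3) by (simp add: L_def)
    define x where "x = sqrt (2 * \<kappa> * L)"
    have x: "0 < x" "x\<^sup>2 = 2 * \<kappa> * L" using L assms by (auto simp: x_def)
    have main: "exp (- (\<kappa> + d) * L) + real K * exp (- ((1 - \<eta>') * ((1 + \<eta>) * x))\<^sup>2 / 2) \<le> std_normal_density (x + 1)"
    proof -
      have "(1 - \<eta>') * ((1 + \<eta>) * x) = (1 + \<eta> / 2) * x" using \<eta>'(3) by (simp flip: mult.assoc)
      then have "((1 - \<eta>') * ((1 + \<eta>) * x))\<^sup>2 = ((1 + \<eta> / 2) * x)\<^sup>2" by (rule arg_cong)
      also have "\<dots> = (1 + \<eta> / 2)\<^sup>2 * (2 * \<kappa> * L)" by (simp only: power_mult_distrib x(2))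
      finally have e1: "- ((1 - \<eta>') * ((1 + \<eta>) * x))\<^sup>2 / 2 = - \<kappa> * L + - \<gamma> * L"
        by (simp only: \<gamma>_def) (simp add: algebra_simps)
      have "exp (- \<gamma> * L) \<le> exp (- \<delta> * L) * exp (- \<delta> * L)"
        using \<delta> L by (simp flip: exp_add distrib_right)
      moreover have "exp (- d * L) \<le> exp (- \<delta> * L) * exp (- \<delta> * L)"
        using \<delta> L by (simp flip: exp_add distrib_right)
      ultimately have "exp (- d * L) + real K * exp (- \<gamma> * L)
          \<le> exp (- \<delta> * L) * exp (- \<delta> * L) + real K * (exp (- \<delta> * L) * exp (- \<delta> * L))"
        by (intro add_mono mult_left_mono) auto
      also have "\<dots> = exp (- \<delta> * L) * ((real K + 1) * exp (- \<delta> * L))" by (simp add: algebra_simps)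
      also have "\<dots> \<le> exp (- \<delta> * L) * 1"
      proof (intro mult_left_mono)
        have "(real K + 1) * exp (- \<delta> * L) \<le> exp (\<delta> * L) * exp (- \<delta> * L)"
          using elim(2) by (intro mult_right_mono) (auto simp: L_def)
        then show "(real K + 1) * exp (- \<delta> * L) \<le> 1" by (simp flip: exp_add)
      qed auto
      also have "\<dots> \<le> exp (- x - 1 / 2) / sqrt (2 * pi)" using elim(1) by (simp add: L_def x_def)
      finally have "exp (- \<kappa> * L) * (exp (- d * L) + real K * exp (- \<gamma> * L))
         \<le> exp (- \<kappa> * L) * (exp (- x - 1 / 2) / sqrt (2 * pi))" by (intro mult_left_mono) auto
      also have "\<dots> = exp (- \<kappa> * L + (- x - 1 / 2)) / sqrt (2 * pi)" by (simp only: exp_add times_divide_eq_right)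
      also have "- \<kappa> * L + (- x - 1 / 2) = - (x + 1)\<^sup>2 / 2"
        using x(2) by (simp add: power2_sum field_simps)
      finally have "exp (- \<kappa> * L) * (exp (- d * L) + real K * exp (- \<gamma> * L)) \<le> std_normal_density (x + 1)"
        by (simp add: std_normal_density_def)
      moreover have "exp (- (\<kappa> + d) * L) = exp (- \<kappa> * L) * exp (- d * L)"
        by (simp add: algebra_simps flip: exp_add)
      ultimately show ?thesis unfolding e1 exp_add by (simp add: algebra_simps)
    qed
    show ?case
    proof (intro allI impI, elim conjE)
      fix n c e and \<alpha> \<beta> :: real
      assume ce: "subnormal n c e" "(\<Sum>k\<in>{1..n}. (c k)\<^sup>2) = 1" "(\<Sum>k\<in>{1..n}. (e k)\<^sup>2) = 1" "\<alpha>\<^sup>2 + \<beta>\<^sup>2 = 1"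
      interpret P: prob_space "gauss_vec n" by (rule prob_space_PiM) (rule prob_space_std_normal)
      let ?G = "{z \<in> space (gauss_vec n). x \<le> \<alpha> * lin n c z + \<beta> * lin n e z
          \<and> (lin n c z)\<^sup>2 + (lin n e z)\<^sup>2 \<le> (1 + \<eta>)\<^sup>2 * (2 * \<kappa> * L)}"
      let ?H = "{z \<in> space (gauss_vec n). x \<le> lin n (\<lambda>k. \<alpha> * c k + \<beta> * e k) z}"
      let ?R = "{z \<in> space (gauss_vec n). ((1 + \<eta>) * x)\<^sup>2 \<le> (lin n c z)\<^sup>2 + (lin n e z)\<^sup>2}"
      have "(\<Sum>k\<in>{1..n}. (\<alpha> * c k + \<beta> * e k)\<^sup>2) = 1"
        using ce unfolding sumsq_combine subnormal_def by simp
      from lincomb_tail_eq[OF this, of x] std_normal_tail_lower[of x] x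
      have H: "ennreal (std_normal_density (x + 1)) \<le> emeasure (gauss_vec n) ?H" by simp
      have "((1 + \<eta>) * x)\<^sup>2 = (1 + \<eta>)\<^sup>2 * (2 * \<kappa> * L)" by (simp add: power_mult_distrib x)
      then have sub: "?H \<subseteq> ?G \<union> ?R" unfolding lin_combine[symmetric] by force
      have "emeasure (gauss_vec n) ?H \<le> emeasure (gauss_vec n) (?G \<union> ?R)"
        by (rule emeasure_mono[OF sub]) measurable
      also have "\<dots> \<le> emeasure (gauss_vec n) ?G + emeasure (gauss_vec n) ?R"
        by (rule emeasure_subadditive) measurable
      finally have "emeasure (gauss_vec n) ?H \<le> emeasure (gauss_vec n) ?G + emeasure (gauss_vec n) ?R" .
      moreover have "emeasure (gauss_vec n) ?R \<le> ennreal (real K * exp (- ((1 - \<eta>') * ((1 + \<eta>) * x))\<^sup>2 / 2))"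
        using assms x by (intro K ce) auto
      ultimately have "emeasure (gauss_vec n) ?H \<le> emeasure (gauss_vec n) ?G
          + ennreal (real K * exp (- ((1 - \<eta>') * ((1 + \<eta>) * x))\<^sup>2 / 2))"
        by (rule order_trans[OF _ add_left_mono])
      with H have "ennreal (std_normal_density (x + 1)) \<le> emeasure (gauss_vec n) ?G
          + ennreal (real K * exp (- ((1 - \<eta>') * ((1 + \<eta>) * x))\<^sup>2 / 2))"
        by (rule order_trans)
      then have "std_normal_density (x + 1) \<le> P.prob ?G + real K * exp (- ((1 - \<eta>') * ((1 + \<eta>) * x))\<^sup>2 / 2)"
        unfolding P.emeasure_eq_measure by (simp flip: ennreal_plus)
      with main have "exp (- (\<kappa> + d) * L) \<le> P.prob ?G" by linarith
      moreover have "real p powr (- \<kappa> - d) = exp (- (\<kappa> + d) * L)"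
        using elim(3) by (simp add: powr_def L_def algebra_simps)
      ultimately have "ennreal (real p powr (- \<kappa> - d)) \<le> emeasure (gauss_vec n) ?G"
        unfolding P.emeasure_eq_measure by (intro ennreal_leI) simp
      then show "ennreal (real p powr (- \<kappa> - d)) \<le> emeasure (gauss_vec n) {z \<in> space (gauss_vec n).
      sqrt (2 * \<kappa> * ln p) \<le> \<alpha> * lin n c z + \<beta> * lin n e z
      \<and> (lin n c z)\<^sup>2 + (lin n e z)\<^sup>2 \<le> (1 + \<eta>)\<^sup>2 * (2 * \<kappa> * ln p)}"
        by (simp add: x_def L_def)
    qed
  qed
qed

lemma eventually_powr_gt: "0 < d \<Longrightarrow> \<forall>\<^sub>F p::nat in sequentially. C \<le> real p powr d" for C d :: real
  using filterlim_at_top[THEN iffD1, OF filterlim_compose[OF real_powr_at_top filterlim_real_sequentially]]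
  by blast

lemma emeasure_bernoulli_pattern:
  fixes p :: nat
  assumes \<epsilon>: "0 \<le> \<epsilon>" "\<epsilon> \<le> 1" and D: "D \<subseteq> {1..p}"
  shows "emeasure (PiM {1..p} (\<lambda>_. measure_pmf (bernoulli_pmf \<epsilon>)))
      {b \<in> space (PiM {1..p} (\<lambda>_. measure_pmf (bernoulli_pmf \<epsilon>))). \<forall>i\<in>D. b i = s i}
    = ennreal (\<Prod>i\<in>D. if s i then \<epsilon> else 1 - \<epsilon>)"
proof -
  interpret product_prob_space "\<lambda>_::nat. measure_pmf (bernoulli_pmf \<epsilon>)" "{1..p}"
    by (intro product_prob_spaceI measure_pmf.prob_space_axioms)
  have fin: "finite D" by (rule finite_subset[OF D]) (rule finite_atLeastAtMost)
  have "{b \<in> space (PiM {1..p} (\<lambda>_. measure_pmf (bernoulli_pmf \<epsilon>))). \<forall>i\<in>D. b i = s i}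
    = {b \<in> space (PiM {1..p} (\<lambda>_. measure_pmf (bernoulli_pmf \<epsilon>))). \<forall>i\<in>D. b i \<in> {s i}}" by simp
  then have "emeasure (PiM {1..p} (\<lambda>_. measure_pmf (bernoulli_pmf \<epsilon>)))
      {b \<in> space (PiM {1..p} (\<lambda>_. measure_pmf (bernoulli_pmf \<epsilon>))). \<forall>i\<in>D. b i = s i}
    = (\<Prod>i\<in>D. emeasure (measure_pmf (bernoulli_pmf \<epsilon>)) {s i})"
    using emeasure_PiM_Collect[OF D fin, of "\<lambda>i. {s i}"] by simp
  also have "\<dots> = (\<Prod>i\<in>D. ennreal (if s i then \<epsilon> else 1 - \<epsilon>))"
    using \<epsilon> by (intro prod.cong) (auto simp: emeasure_pmf_single)
  also have "\<dots> = ennreal (\<Prod>i\<in>D. if s i then \<epsilon> else 1 - \<epsilon>)"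
    using \<epsilon> by (intro prod_ennreal) auto
  finally show ?thesis .
qed

lemma measurable_bernoulli_pattern [measurable]:
  fixes p :: nat
  assumes D: "D \<subseteq> {1..p}"
  shows "{b \<in> space (PiM {1..p} (\<lambda>_. measure_pmf (bernoulli_pmf \<epsilon>))). \<forall>i\<in>D. b i = s i}
    \<in> sets (PiM {1..p} (\<lambda>_. measure_pmf (bernoulli_pmf \<epsilon>)))"
proof -
  have fin: "finite D" by (rule finite_subset[OF D]) (rule finite_atLeastAtMost)
  show ?thesis
  proof (intro sets.sets_Collect_finite_All fin)
    fix i assume "i \<in> D"
    then have "(\<lambda>b. b i) \<in> measurable (PiM {1..p} (\<lambda>_. measure_pmf (bernoulli_pmf \<epsilon>))) (measure_pmf (bernoulli_pmf \<epsilon>))"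
      using D by (intro measurable_component_singleton) auto
    from measurable_sets[OF this, of "{s i}"]
    show "{b \<in> space (PiM {1..p} (\<lambda>_. measure_pmf (bernoulli_pmf \<epsilon>))). b i = s i} \<in> sets (PiM {1..p} (\<lambda>_. measure_pmf (bernoulli_pmf \<epsilon>)))"
      by (simp add: vimage_def Int_def conj_commute)
  qed
qed

section \<open>From the Hamming risk to errors on a block\<close>

definition fstdir :: "(nat \<Rightarrow> nat \<Rightarrow> real) \<Rightarrow> nat \<Rightarrow> nat \<Rightarrow> real" where
  "fstdir X k = (\<lambda>i. X i (2 * k + 1))"

text \<open>The columns of a block after Gram--Schmidt. An odd last column is padded with the zero direction.\<close>
definition snddir :: "nat \<Rightarrow> (nat \<Rightarrow> nat \<Rightarrow> real) \<Rightarrow> real \<Rightarrow> nat \<Rightarrow> nat \<Rightarrow> real" where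
  "snddir p X h k = (\<lambda>i. if 2 * k + 2 \<le> p then (X i (2 * k + 2) - h * X i (2 * k + 1)) / sqrt (1 - h\<^sup>2) else 0)"

definition blk :: "nat \<Rightarrow> nat \<Rightarrow> nat set" where
  "blk p k = {2 * k + 1, 2 * k + 2} \<inter> {1..p}"

lemma Gmat_block:
  "Gmat h (2 * k + 1) (2 * k + 1) = 1" "Gmat h (2 * k + 2) (2 * k + 2) = 1"
  "Gmat h (2 * k + 1) (2 * k + 2) = h" "Gmat h (2 * k + 2) (2 * k + 1) = h"
  by (auto simp: Gmat_def)

lemma block_directions:
  assumes G: "gram_is n p X (Gmat h)" and h: "\<bar>h\<bar> < 1" and k: "2 * k + 1 \<le> p"
  shows "subnormal n (fstdir X k) (snddir p X h k)" "(\<Sum>i\<in>{1..n}. (fstdir X k i)\<^sup>2) = 1"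
    "2 * k + 2 \<le> p \<Longrightarrow> (\<Sum>i\<in>{1..n}. (snddir p X h k i)\<^sup>2) = 1"
proof -
  have a: "0 < 1 - h\<^sup>2" using h by (simp add: abs_square_less_1)
  have 11: "(\<Sum>i\<in>{1..n}. X i (2 * k + 1) * X i (2 * k + 1)) = 1"
    using G k unfolding gram_is_def by (metis Gmat_block(1) atLeastAtMost_iff le_add2)
  then show 1: "(\<Sum>i\<in>{1..n}. (fstdir X k i)\<^sup>2) = 1" by (simp add: fstdir_def power2_eq_square)
  have 2: "(\<Sum>i\<in>{1..n}. (snddir p X h k i)\<^sup>2) = 1 \<and> (\<Sum>i\<in>{1..n}. fstdir X k i * snddir p X h k i) = 0"
    if k2: "2 * k + 2 \<le> p"
  proof -
    have 22: "(\<Sum>i\<in>{1..n}. X i (2 * k + 2) * X i (2 * k + 2)) = 1"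
      and 12: "(\<Sum>i\<in>{1..n}. X i (2 * k + 1) * X i (2 * k + 2)) = h"
      using G k2 unfolding gram_is_def by (auto simp: Gmat_block[simplified])
    have "(\<Sum>i\<in>{1..n}. (snddir p X h k i)\<^sup>2)
        = (\<Sum>i\<in>{1..n}. (X i (2 * k + 2) * X i (2 * k + 2) - 2 * h * (X i (2 * k + 1) * X i (2 * k + 2))
            + h\<^sup>2 * (X i (2 * k + 1) * X i (2 * k + 1))) / (1 - h\<^sup>2))"
      using k2 a by (intro sum.cong refl) (simp add: snddir_def power_divide power2_diff power2_eq_square algebra_simps)
    also have "\<dots> = (1 - 2 * h * h + h\<^sup>2 * 1) / (1 - h\<^sup>2)"
      unfolding sum_divide_distrib[symmetric] sum.distrib sum_subtractf sum_distrib_left[symmetric] 11 12 22 ..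
    also have "\<dots> = 1" using a by (simp add: power2_eq_square)
    finally have A: "(\<Sum>i\<in>{1..n}. (snddir p X h k i)\<^sup>2) = 1" .
    have "(\<Sum>i\<in>{1..n}. fstdir X k i * snddir p X h k i)
       = (\<Sum>i\<in>{1..n}. (X i (2 * k + 1) * X i (2 * k + 2) - h * (X i (2 * k + 1) * X i (2 * k + 1))) / sqrt (1 - h\<^sup>2))"
      using k2 by (intro sum.cong refl) (simp add: snddir_def fstdir_def algebra_simps)
    also have "\<dots> = (h - h * 1) / sqrt (1 - h\<^sup>2)"
      unfolding sum_divide_distrib[symmetric] sum_subtractf sum_distrib_left[symmetric] 11 12 ..
    finally show ?thesis using A by simp
  qed
  then show "2 * k + 2 \<le> p \<Longrightarrow> (\<Sum>i\<in>{1..n}. (snddir p X h k i)\<^sup>2) = 1" by blast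
  show "subnormal n (fstdir X k) (snddir p X h k)"
  proof (cases "2 * k + 2 \<le> p")
    case True
    with 1 2 show ?thesis by (simp add: subnormal_def)
  next
    case False
    with 1 show ?thesis by (simp add: subnormal_def snddir_def)
  qed
qed

lemma blk_div: "j \<in> blk p k \<Longrightarrow> (j - 1) div 2 = k"
  by (auto simp: blk_def)

lemma sum_blocks: "(\<Sum>j\<in>{1..p}. f j) = (\<Sum>k<(p + 1) div 2. \<Sum>j\<in>blk p k. f j)"
proof -
  have "{1..p} = (\<Union>k\<in>{..<(p + 1) div 2}. blk p k)"
  proof (intro set_eqI iffI)
    fix j assume j: "j \<in> {1..p}"
    have "j = 2 * ((j - 1) div 2) + 1 \<or> j = 2 * ((j - 1) div 2) + 2"
      using j by (simp, presburger)
    moreover have "(j - 1) div 2 < (p + 1) div 2" using j by (simp, presburger)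
    ultimately show "j \<in> (\<Union>k\<in>{..<(p + 1) div 2}. blk p k)" using j by (auto simp: blk_def)
  qed (auto simp: blk_def)
  then have "sum f {1..p} = sum f (\<Union>k\<in>{..<(p + 1) div 2}. blk p k)" by simp
  also have "\<dots> = (\<Sum>k<(p + 1) div 2. \<Sum>j\<in>blk p k. f j)"
    proof (rule sum.UNION_disjoint)
    show "\<forall>i\<in>{..<(p + 1) div 2}. \<forall>j\<in>{..<(p + 1) div 2}. i \<noteq> j \<longrightarrow> blk p i \<inter> blk p j = {}"
      using blk_div by blast
  qed (auto simp: blk_def)
  finally show ?thesis .
qed

lemma hamm_blocks:
  "real (hamm p bh beta) = (\<Sum>k<(p + 1) div 2. \<Sum>j\<in>blk p k. of_bool (sgn (bh j) \<noteq> sgn (beta j)))"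
proof -
  have "real (hamm p bh beta) = (\<Sum>j\<in>{1..p}. of_bool (sgn (bh j) \<noteq> sgn (beta j)))"
    unfolding hamm_def by (simp add: sum.If_cases of_bool_def Int_def conj_commute)
  then show ?thesis by (simp only: sum_blocks)
qed

abbreviation bern :: "nat \<Rightarrow> real \<Rightarrow> (nat \<Rightarrow> bool) measure" where
  "bern p \<epsilon> \<equiv> PiM {1..p} (\<lambda>_. measure_pmf (bernoulli_pmf \<epsilon>))"

definition blk_err :: "nat \<Rightarrow> (nat \<Rightarrow> real) \<Rightarrow> (nat \<Rightarrow> real) \<Rightarrow> nat \<Rightarrow> bool" where
  "blk_err p bh beta k \<longleftrightarrow> (\<exists>j\<in>blk p k. sgn (bh j) \<noteq> sgn (beta j))"

lemma nn_integral_product_form: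
  assumes "finite I" and A: "\<And>i. i \<in> I \<Longrightarrow> A i \<in> sets M" and B: "\<And>i. i \<in> I \<Longrightarrow> B i \<in> sets N"
  shows "(\<integral>\<^sup>+b. (\<integral>\<^sup>+z. (\<Sum>i\<in>I. c * (indicator (A i) b * indicator (B i) z)) \<partial>N) \<partial>M)
    = (\<Sum>i\<in>I. c * (emeasure M (A i) * emeasure N (B i)))"
proof -
  have "(\<integral>\<^sup>+z. (\<Sum>i\<in>I. c * (indicator (A i) b * indicator (B i) z)) \<partial>N)
      = (\<Sum>i\<in>I. c * (indicator (A i) b * emeasure N (B i)))" for b
    using B by (subst nn_integral_sum) (auto simp: nn_integral_cmult intro!: sum.cong)
  then have "(\<integral>\<^sup>+b. (\<integral>\<^sup>+z. (\<Sum>i\<in>I. c * (indicator (A i) b * indicator (B i) z)) \<partial>N) \<partial>M)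
     = (\<integral>\<^sup>+b. (\<Sum>i\<in>I. c * (indicator (A i) b * emeasure N (B i))) \<partial>M)" by simp
  also have "\<dots> = (\<Sum>i\<in>I. c * (emeasure M (A i) * emeasure N (B i)))"
    using A by (subst nn_integral_sum) (auto simp: nn_integral_cmult nn_integral_multc intro!: sum.cong)
  finally show ?thesis .
qed

lemma risk_upper:
  fixes th \<rho> d h :: real
  assumes th: "0 < th" and rho: "0 < \<rho>" and d: "0 < d" and h: "\<bar>h\<bar> < 1"
  shows "\<forall>\<^sub>F p in sequentially. \<forall>n X sig est mu. gram_is n p X (Gmat h) \<longrightarrow>
    (\<forall>b z k. k < (p + 1) div 2 \<longrightarrow> blk_err p (est (Yobs n p X sig (beta_of b mu) z)) (beta_of b mu) k \<longrightarrow>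
       2 * ln p * (\<rho> - card {i\<in>blk p k. b i} * th) \<le> (lin n (fstdir X k) z)\<^sup>2 + (lin n (snddir p X h k) z)\<^sup>2) \<longrightarrow>
    risk n p X sig (real p powr (- th)) est mu \<le> ennreal (real p powr (1 - \<rho> + d))"
proof -
  define \<eta> where "\<eta> = min (1 / 2) (d / (4 * \<rho>))"
  have \<eta>: "0 < \<eta>" "\<eta> < 1" "4 * \<rho> * \<eta> \<le> d" using d rho by (auto simp: \<eta>_def min_def field_simps)
  define g where "g = (1 - \<eta>)\<^sup>2"
  have g: "0 \<le> g" "g \<le> 1" using \<eta> by (auto simp: g_def power_le_one)
  have "\<rho> - g * \<rho> \<le> d / 2"
  proof -
    have "1 - g \<le> 2 * \<eta>" by (simp add: g_def power2_diff)
    then have "(1 - g) * \<rho> \<le> 2 * \<eta> * \<rho>" using rho by (intro mult_right_mono) auto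
    then show ?thesis using \<eta> by (simp add: algebra_simps)
  qed
  then have grho: "\<rho> - d / 2 \<le> g * \<rho>" by simp
  obtain K :: nat where K: "\<And>n c d x. subnormal n c d \<Longrightarrow> 0 < x \<Longrightarrow>
    emeasure (gauss_vec n) {z \<in> space (gauss_vec n). x\<^sup>2 \<le> (lin n c z)\<^sup>2 + (lin n d z)\<^sup>2}
      \<le> ennreal (real K * exp (- ((1 - \<eta>) * x)\<^sup>2 / 2))"
    using radius_tail[OF \<eta>(1,2)] by blast
  define K' where "K' = real K + 1"
  have K': "1 \<le> K'" "real K \<le> K'" by (auto simp: K'_def)
  have ev1: "\<forall>\<^sub>F p::nat in sequentially. 8 * K' \<le> real p powr (d / 2)"
    using d by (intro eventually_powr_gt) auto
  have ev2: "\<forall>\<^sub>F p::nat in sequentially. 2 \<le> p" by (rule eventually_ge_at_top)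
  show ?thesis using ev1 ev2
  proof (eventually_elim, intro allI impI)
    fix p n :: nat and X sig est mu
    assume p: "8 * K' \<le> real p powr (d / 2)" "2 \<le> p" and G: "gram_is n p X (Gmat h)"
     and E: "\<forall>b z k. k < (p + 1) div 2 \<longrightarrow> blk_err p (est (Yobs n p X sig (beta_of b mu) z)) (beta_of b mu) k \<longrightarrow>
       2 * ln p * (\<rho> - card {i\<in>blk p k. b i} * th) \<le> (lin n (fstdir X k) z)\<^sup>2 + (lin n (snddir p X h k) z)\<^sup>2"
    define \<epsilon> where "\<epsilon> = real p powr (- th)"
    have \<epsilon>: "0 \<le> \<epsilon>" "\<epsilon> \<le> 1" using p th powr_mono[of "-th" 0 "real p"] by (auto simp: \<epsilon>_def)
    have lnp: "0 < ln (real p)" using p by simp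
    define M where "M = (p + 1) div 2"
    define I where "I = (SIGMA k:{..<M}. Pow (blk p k))"
    define A where "A = (\<lambda>(k::nat, D). {b \<in> space (bern p \<epsilon>). \<forall>i\<in>D. b i = True})"
    define B where "B = (\<lambda>(k, D::nat set). {z \<in> space (gauss_vec n). 2 * ln p * (\<rho> - card D * th)
        \<le> (lin n (fstdir X k) z)\<^sup>2 + (lin n (snddir p X h k) z)\<^sup>2})"
    have finI: "finite I" by (auto simp: I_def blk_def)
    have cb: "card (blk p k) \<le> 2" for k
      by (rule order_trans[OF card_mono[of "{2 * k + 1, 2 * k + 2}"]]) (auto simp: blk_def)
    have blkp: "blk p k \<subseteq> {1..p}" for k by (auto simp: blk_def)
    have point: "ennreal (real (hamm p (est (Yobs n p X sig (beta_of b mu) z)) (beta_of b mu)))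
        \<le> (\<Sum>i\<in>I. 2 * (indicator (A i) b * indicator (B i) z))"
      if b: "b \<in> space (bern p \<epsilon>)" and z: "z \<in> space (gauss_vec n)" for b z
    proof -
      let ?bh = "est (Yobs n p X sig (beta_of b mu) z)" and ?be = "beta_of b mu"
      have *: "(\<Sum>j\<in>blk p k. of_bool (sgn (?bh j) \<noteq> sgn (?be j)))
         \<le> (\<Sum>D\<in>Pow (blk p k). 2 * (indicat_real (A (k, D)) b * indicat_real (B (k, D)) z))" if k: "k < M" for k
      proof (cases "blk_err p ?bh ?be k")
        case False
        then have "(\<Sum>j\<in>blk p k. of_bool (sgn (?bh j) \<noteq> sgn (?be j))) = (0::real)"
          unfolding blk_err_def by (intro sum.neutral) auto
        then show ?thesis by (simp add: sum_nonneg)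
      next
        case True
        let ?D = "{i\<in>blk p k. b i}"
        have "(\<Sum>j\<in>blk p k. of_bool (sgn (?bh j) \<noteq> sgn (?be j))) \<le> (\<Sum>j\<in>blk p k. 1::real)"
          by (intro sum_mono) auto
        also have "\<dots> \<le> 2" using cb[of k] by simp
        also have "2 = 2 * (indicat_real (A (k, ?D)) b * indicat_real (B (k, ?D)) z)"
          using b z E True k by (auto simp: A_def B_def M_def)
        also have "\<dots> \<le> (\<Sum>D\<in>Pow (blk p k). 2 * (indicat_real (A (k, D)) b * indicat_real (B (k, D)) z))"
          by (rule member_le_sum[where f="\<lambda>D. 2 * (indicat_real (A (k, D)) b * indicat_real (B (k, D)) z)"])
            (auto simp: blk_def)
        finally show ?thesis .
      qed
      have "real (hamm p ?bh ?be) \<le> (\<Sum>k<M. \<Sum>D\<in>Pow (blk p k). 2 * (indicat_real (A (k, D)) b * indicat_real (B (k, D)) z))"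
        unfolding hamm_blocks M_def[symmetric] by (intro sum_mono *) auto
      also have "\<dots> = (\<Sum>i\<in>I. 2 * (indicat_real (A i) b * indicat_real (B i) z))"
        unfolding I_def by (subst sum.Sigma) (auto simp: blk_def split_beta)
      finally have "ennreal (real (hamm p ?bh ?be)) \<le> ennreal (\<Sum>i\<in>I. 2 * (indicat_real (A i) b * indicat_real (B i) z))"
        by (rule ennreal_leI)
      also have "\<dots> = (\<Sum>i\<in>I. ennreal (2 * (indicat_real (A i) b * indicat_real (B i) z)))"
        by (rule sum_ennreal[symmetric]) auto
      also have "\<dots> = (\<Sum>i\<in>I. 2 * (indicator (A i) b * indicator (B i) z))"
        by (intro sum.cong) (auto simp: ennreal_mult' ennreal_indicator)
      finally show ?thesis .
    qed
    have Am: "A i \<in> sets (bern p \<epsilon>)" if iI: "i \<in> I" for i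
    proof -
      obtain k D where i: "i = (k, D)" "D \<subseteq> blk p k" using iI by (auto simp: I_def)
      then have "D \<subseteq> {1..p}" using blkp by blast
      from measurable_bernoulli_pattern[OF this, of \<epsilon> "\<lambda>_. True"] show ?thesis by (simp add: A_def i)
    qed
    have Bm: "B i \<in> sets (gauss_vec n)" for i unfolding B_def by (cases i) (simp, measurable)
    have bound: "2 * (emeasure (bern p \<epsilon>) (A i) * emeasure (gauss_vec n) (B i)) \<le> ennreal (2 * K' * real p powr (- (g * \<rho>)))" if iI: "i \<in> I" for i
    proof -
      obtain k D where i: "i = (k, D)" "D \<subseteq> blk p k" "k < M" using iI by (auto simp: I_def)
      have D: "D \<subseteq> {1..p}" using i blkp by blast
      define m where "m = real (card D)"
      have eA: "emeasure (bern p \<epsilon>) (A i) = ennreal (real p powr (- (m * th)))"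
      proof -
        have "emeasure (bern p \<epsilon>) (A i) = ennreal (\<Prod>i\<in>D. \<epsilon>)"
          using emeasure_bernoulli_pattern[OF \<epsilon> D, of "\<lambda>_. True"] by (simp add: A_def i)
        also have "(\<Prod>i\<in>D. \<epsilon>) = real p powr (- (m * th))"
          using p by (simp add: \<epsilon>_def m_def powr_power)
        finally show ?thesis .
      qed
      have eB: "emeasure (bern p \<epsilon>) (A i) * emeasure (gauss_vec n) (B i) \<le> ennreal (K' * real p powr (- (g * \<rho>)))"
      proof (cases "0 < \<rho> - m * th")
        case True
        define x where "x = sqrt (2 * ln p * (\<rho> - m * th))"
        have x: "0 < x" "x\<^sup>2 = 2 * ln p * (\<rho> - m * th)" using True lnp by (auto simp: x_def)
        have k1: "2 * k + 1 \<le> p" using i(3) by (auto simp: M_def)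
        have "emeasure (gauss_vec n) (B i) \<le> ennreal (real K * exp (- ((1 - \<eta>) * x)\<^sup>2 / 2))"
          using K[OF block_directions(1)[OF G h k1] x(1)] by (simp add: B_def i x(2) m_def)
        also have "- ((1 - \<eta>) * x)\<^sup>2 / 2 = - (g * (\<rho> - m * th)) * ln p"
          by (simp add: power_mult_distrib x(2) g_def)
        also have "exp (- (g * (\<rho> - m * th)) * ln p) = real p powr (- (g * (\<rho> - m * th)))"
          using p by (simp add: powr_def)
        finally have "emeasure (bern p \<epsilon>) (A i) * emeasure (gauss_vec n) (B i)
            \<le> ennreal (real p powr (- (m * th))) * ennreal (real K * real p powr (- (g * (\<rho> - m * th))))"
          unfolding eA by (rule mult_left_mono) simp
        also have "\<dots> = ennreal (real K * real p powr (- (m * th) - (g * (\<rho> - m * th))))"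
          by (simp add: mult_ac powr_diff powr_minus divide_inverse flip: ennreal_mult powr_add)
        also have "\<dots> \<le> ennreal (K' * real p powr (- (g * \<rho>)))"
        proof (intro ennreal_leI mult_mono powr_mono K')
          have "g * (m * th) \<le> 1 * (m * th)" using g th by (intro mult_right_mono) (auto simp: m_def)
          then show "- (m * th) - (g * (\<rho> - m * th)) \<le> - (g * \<rho>)" by (simp add: algebra_simps)
        qed (use p K' in auto)
        finally show ?thesis .
      next
        case False
        interpret P: prob_space "gauss_vec n" by (rule prob_space_PiM) (rule prob_space_std_normal)
        have "emeasure (bern p \<epsilon>) (A i) * emeasure (gauss_vec n) (B i) \<le> ennreal (real p powr (- (m * th))) * 1"
          unfolding eA by (intro mult_left_mono P.emeasure_le_1) simp
        also have "\<dots> \<le> ennreal (K' * real p powr (- (g * \<rho>)))"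
        proof -
          have "g * \<rho> \<le> 1 * \<rho>" using g rho by (intro mult_right_mono) auto
          with False have "real p powr (- (m * th)) \<le> real p powr (- (g * \<rho>))" using p by (intro powr_mono) auto
          also have "1 * real p powr (- (g * \<rho>)) \<le> K' * real p powr (- (g * \<rho>))" using K' by (intro mult_right_mono) auto
          finally have "real p powr (- (m * th)) \<le> K' * real p powr (- (g * \<rho>))" by simp
          then show ?thesis by (simp add: ennreal_leI)
        qed
        finally show ?thesis .
      qed
      have "ennreal (2 * (K' * real p powr (- (g * \<rho>)))) = 2 * ennreal (K' * real p powr (- (g * \<rho>)))"
        using ennreal_mult'[of 2 "K' * real p powr (- (g * \<rho>))"] by (simp only: ennreal_numeral)
      moreover have "2 * (emeasure (bern p \<epsilon>) (A i) * emeasure (gauss_vec n) (B i)) \<le> 2 * ennreal (K' * real p powr (- (g * \<rho>)))"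
        using eB by (rule mult_left_mono) simp
      ultimately show ?thesis by (simp only: mult.assoc)
    qed
    have "risk n p X sig \<epsilon> est mu \<le> (\<integral>\<^sup>+b. (\<integral>\<^sup>+z. (\<Sum>i\<in>I. 2 * (indicator (A i) b * indicator (B i) z)) \<partial>gauss_vec n) \<partial>bern p \<epsilon>)"
      unfolding risk_def by (intro nn_integral_mono point)
    also have "\<dots> = (\<Sum>i\<in>I. 2 * (emeasure (bern p \<epsilon>) (A i) * emeasure (gauss_vec n) (B i)))"
      by (rule nn_integral_product_form) (use finI Am Bm in auto)
    also have "\<dots> \<le> (\<Sum>i\<in>I. ennreal (2 * K' * real p powr (- (g * \<rho>))))"
      by (intro sum_mono bound)
    also have "\<dots> = ennreal (real (card I) * (2 * K' * real p powr (- (g * \<rho>))))"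
      by (simp add: ennreal_mult'' ennreal_of_nat_eq_real_of_nat K'_def)
    also have "\<dots> \<le> ennreal (real p powr (1 - \<rho> + d))"
    proof (rule ennreal_leI)
      have "card I = (\<Sum>k<M. card (Pow (blk p k)))" unfolding I_def by (rule card_SigmaI) (auto simp: blk_def)
      also have "\<dots> \<le> (\<Sum>k<M. 4)"
      proof (rule sum_mono)
        fix k have "(2::nat) ^ card (blk p k) \<le> 2 ^ 2" by (rule power_increasing[OF cb]) simp
        then show "card (Pow (blk p k)) \<le> 4" by (subst card_Pow) (auto simp: blk_def)
      qed
      also have "\<dots> \<le> 4 * p" by (simp add: M_def)
      finally have cI: "real (card I) \<le> 4 * real p" by linarith
      have "real (card I) * (2 * K' * real p powr (- (g * \<rho>))) \<le> 4 * real p * (2 * K' * real p powr (- (g * \<rho>)))"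
        using cI K' by (intro mult_right_mono) auto
      also have "\<dots> = 8 * K' * (real p * real p powr (- (g * \<rho>)))" by simp
      also have "\<dots> \<le> real p powr (d / 2) * (real p * real p powr (- (g * \<rho>)))"
        using p by (intro mult_right_mono) auto
      also have "\<dots> = real p powr (d / 2 + 1 + - (g * \<rho>))" using p by (simp only: powr_add) simp
      also have "\<dots> \<le> real p powr (1 - \<rho> + d)" using p grho by (intro powr_mono) auto
      finally show "real (card I) * (2 * K' * real p powr (- (g * \<rho>))) \<le> real p powr (1 - \<rho> + d)" .
    qed
    finally show "risk n p X sig (real p powr (- th)) est mu \<le> ennreal (real p powr (1 - \<rho> + d))"
      unfolding \<epsilon>_def .
  qed
qed

lemma risk_lower:
  fixes th \<kappa> \<eta> d h :: real and s1 s2 :: bool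
  assumes th: "0 < th" and kap: "0 < \<kappa>" and eta: "0 < \<eta>" and d: "0 < d" and h: "\<bar>h\<bar> < 1"
  shows "\<forall>\<^sub>F p in sequentially. \<forall>n X sig est mu \<alpha> \<beta>. gram_is n p X (Gmat h) \<longrightarrow> \<alpha>\<^sup>2 + \<beta>\<^sup>2 = 1 \<longrightarrow>
    (\<forall>b z k. 2 * k + 2 \<le> p \<longrightarrow> b (2 * k + 1) = s1 \<longrightarrow> b (2 * k + 2) = s2 \<longrightarrow>
       sqrt (2 * \<kappa> * ln p) \<le> \<alpha> * lin n (fstdir X k) z + \<beta> * lin n (snddir p X h k) z \<longrightarrow>
       (lin n (fstdir X k) z)\<^sup>2 + (lin n (snddir p X h k) z)\<^sup>2 \<le> (1 + \<eta>)\<^sup>2 * (2 * \<kappa> * ln p) \<longrightarrow>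
       blk_err p (est (Yobs n p X sig (beta_of b mu) z)) (beta_of b mu) k) \<longrightarrow>
    ennreal (real p powr (1 - (of_bool s1 + of_bool s2) * th - \<kappa> - d)) \<le> risk n p X sig (real p powr (- th)) est mu"
proof -
  have d2: "0 < d / 2" using d by simp
  have ev1: "\<forall>\<^sub>F p::nat in sequentially. 12 \<le> real p powr (d / 2)" by (rule eventually_powr_gt[OF d2])
  have ev2: "\<forall>\<^sub>F p::nat in sequentially. 2 \<le> real p powr th" by (rule eventually_powr_gt[OF th])
  have ev3: "\<forall>\<^sub>F p::nat in sequentially. 2 \<le> p" by (rule eventually_ge_at_top)
  show ?thesis using ev1 ev2 ev3 event_lower[OF kap eta d2]
  proof (eventually_elim, intro allI impI)
    fix p n :: nat and X sig est mu and \<alpha> \<beta> :: real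
    assume p: "12 \<le> real p powr (d / 2)" "2 \<le> real p powr th" "2 \<le> p"
     and ev: "\<forall>n c e \<alpha> \<beta>. subnormal n c e \<and> (\<Sum>k\<in>{1..n}. (c k)\<^sup>2) = 1 \<and> (\<Sum>k\<in>{1..n}. (e k)\<^sup>2) = 1
      \<and> \<alpha>\<^sup>2 + \<beta>\<^sup>2 = 1 \<longrightarrow>
    ennreal (real p powr (- \<kappa> - d / 2)) \<le> emeasure (gauss_vec n) {z \<in> space (gauss_vec n).
      sqrt (2 * \<kappa> * ln p) \<le> \<alpha> * lin n c z + \<beta> * lin n e z
      \<and> (lin n c z)\<^sup>2 + (lin n e z)\<^sup>2 \<le> (1 + \<eta>)\<^sup>2 * (2 * \<kappa> * ln p)}"
     and G: "gram_is n p X (Gmat h)" and ab: "\<alpha>\<^sup>2 + \<beta>\<^sup>2 = 1"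
     and E: "\<forall>b z k. 2 * k + 2 \<le> p \<longrightarrow> b (2 * k + 1) = s1 \<longrightarrow> b (2 * k + 2) = s2 \<longrightarrow>
       sqrt (2 * \<kappa> * ln p) \<le> \<alpha> * lin n (fstdir X k) z + \<beta> * lin n (snddir p X h k) z \<longrightarrow>
       (lin n (fstdir X k) z)\<^sup>2 + (lin n (snddir p X h k) z)\<^sup>2 \<le> (1 + \<eta>)\<^sup>2 * (2 * \<kappa> * ln p) \<longrightarrow>
       blk_err p (est (Yobs n p X sig (beta_of b mu) z)) (beta_of b mu) k"
    define \<epsilon> where "\<epsilon> = real p powr (- th)"
    have "\<epsilon> * real p powr th = 1" using p by (simp add: \<epsilon>_def flip: powr_add)
    then have \<epsilon>: "0 \<le> \<epsilon>" "\<epsilon> \<le> 1 / 2" using p(2) mult_left_mono[OF p(2), of \<epsilon>] by (auto simp: \<epsilon>_def)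
    define s where "s k j = (if j = 2 * k + 1 then s1 else s2)" for k j :: nat
    define A where "A k = {b \<in> space (bern p \<epsilon>). \<forall>i\<in>{2 * k + 1, 2 * k + 2}. b i = s k i}" for k
    define B where "B k = {z \<in> space (gauss_vec n). sqrt (2 * \<kappa> * ln p) \<le> \<alpha> * lin n (fstdir X k) z + \<beta> * lin n (snddir p X h k) z
      \<and> (lin n (fstdir X k) z)\<^sup>2 + (lin n (snddir p X h k) z)\<^sup>2 \<le> (1 + \<eta>)\<^sup>2 * (2 * \<kappa> * ln p)}" for k
    define M where "M = p div 2"
    have kp: "{2 * k + 1, 2 * k + 2} \<subseteq> {1..p}" if "k < M" for k using that by (auto simp: M_def)
    have point: "(\<Sum>k<M. 1 * (indicator (A k) b * indicator (B k) z))
      \<le> ennreal (real (hamm p (est (Yobs n p X sig (beta_of b mu) z)) (beta_of b mu)))" for b z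
    proof -
      let ?bh = "est (Yobs n p X sig (beta_of b mu) z)" and ?be = "beta_of b mu"
      have *: "indicat_real (A k) b * indicat_real (B k) z \<le> (\<Sum>j\<in>blk p k. of_bool (sgn (?bh j) \<noteq> sgn (?be j)))" if k: "k < M" for k
      proof (cases "b \<in> A k \<and> z \<in> B k")
        case True
        then have "blk_err p ?bh ?be k" using k E by (auto simp: A_def B_def M_def s_def)
        then obtain j where j: "j \<in> blk p k" "sgn (?bh j) \<noteq> sgn (?be j)" by (auto simp: blk_err_def)
        then have "1 = (of_bool (sgn (?bh j) \<noteq> sgn (?be j)) :: real)" by simp
        also have "\<dots> \<le> (\<Sum>j\<in>blk p k. of_bool (sgn (?bh j) \<noteq> sgn (?be j)))"
          by (rule member_le_sum[OF j(1)]) (auto simp: blk_def)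
        finally show ?thesis using True by simp
      next
        case False
        then have "indicat_real (A k) b * indicat_real (B k) z = 0" by auto
        moreover have "0 \<le> (\<Sum>j\<in>blk p k. (of_bool (sgn (?bh j) \<noteq> sgn (?be j)) :: real))" by (rule sum_nonneg) auto
        ultimately show ?thesis by linarith
      qed
      have "(\<Sum>k<M. indicat_real (A k) b * indicat_real (B k) z) \<le> (\<Sum>k<M. \<Sum>j\<in>blk p k. of_bool (sgn (?bh j) \<noteq> sgn (?be j)))"
        by (intro sum_mono *) auto
      also have "\<dots> \<le> real (hamm p ?bh ?be)"
        unfolding hamm_blocks by (intro sum_mono2) (auto simp: M_def intro!: sum_nonneg)
      finally have "ennreal (\<Sum>k<M. indicat_real (A k) b * indicat_real (B k) z) \<le> ennreal (real (hamm p ?bh ?be))"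
        by (rule ennreal_leI)
      moreover have "ennreal (\<Sum>k<M. indicat_real (A k) b * indicat_real (B k) z) = (\<Sum>k<M. ennreal (indicat_real (A k) b * indicat_real (B k) z))"
        by (rule sum_ennreal[symmetric]) auto
      moreover have "\<dots> = (\<Sum>k<M. 1 * (indicator (A k) b * indicator (B k) z))"
        by (intro sum.cong) (auto simp: ennreal_mult' ennreal_indicator)
      ultimately show ?thesis by metis
    qed
    have bound: "ennreal (real p powr (- ((of_bool s1 + of_bool s2) * th)) / 4 * real p powr (- \<kappa> - d / 2))
       \<le> 1 * (emeasure (bern p \<epsilon>) (A k) * emeasure (gauss_vec n) (B k))" if k: "k < M" for k
    proof -
      have k2: "2 * k + 1 \<le> p" "2 * k + 2 \<le> p" using k by (auto simp: M_def)
      have "emeasure (bern p \<epsilon>) (A k) = ennreal (\<Prod>i\<in>{2 * k + 1, 2 * k + 2}. if s k i then \<epsilon> else 1 - \<epsilon>)"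
        unfolding A_def using \<epsilon> by (intro emeasure_bernoulli_pattern kp k) auto
      also have "(\<Prod>i\<in>{2 * k + 1, 2 * k + 2}. if s k i then \<epsilon> else 1 - \<epsilon>) = (if s1 then \<epsilon> else 1 - \<epsilon>) * (if s2 then \<epsilon> else 1 - \<epsilon>)"
        by (simp add: s_def)
      finally have eA: "emeasure (bern p \<epsilon>) (A k) = ennreal ((if s1 then \<epsilon> else 1 - \<epsilon>) * (if s2 then \<epsilon> else 1 - \<epsilon>))" .
      have hf: "real p powr (- (of_bool t * th)) / 2 \<le> (if t then \<epsilon> else 1 - \<epsilon>)" for t
        using \<epsilon> by (auto simp: \<epsilon>_def)
      have "real p powr (- ((of_bool s1 + of_bool s2) * th)) / 4
         = (real p powr (- (of_bool s1 * th)) / 2) * (real p powr (- (of_bool s2 * th)) / 2)"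
        by (simp add: distrib_right flip: powr_add)
      also have "\<dots> \<le> (if s1 then \<epsilon> else 1 - \<epsilon>) * (if s2 then \<epsilon> else 1 - \<epsilon>)"
        using \<epsilon> by (intro mult_mono hf) auto
      finally have 1: "ennreal (real p powr (- ((of_bool s1 + of_bool s2) * th)) / 4) \<le> emeasure (bern p \<epsilon>) (A k)"
        unfolding eA by (rule ennreal_leI)
      have 2: "ennreal (real p powr (- \<kappa> - d / 2)) \<le> emeasure (gauss_vec n) (B k)"
        using ev block_directions[OF G h k2(1)] k2 ab unfolding B_def by blast
      have "ennreal (real p powr (- ((of_bool s1 + of_bool s2) * th)) / 4 * real p powr (- \<kappa> - d / 2))
         = ennreal (real p powr (- ((of_bool s1 + of_bool s2) * th)) / 4) * ennreal (real p powr (- \<kappa> - d / 2))"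
        by (rule ennreal_mult) simp_all
      also have "\<dots> \<le> emeasure (bern p \<epsilon>) (A k) * emeasure (gauss_vec n) (B k)"
        by (rule mult_mono[OF 1 2]) simp_all
      finally show ?thesis by (simp only: mult_1)
    qed
    have "ennreal (real p powr (1 - (of_bool s1 + of_bool s2) * th - \<kappa> - d))
       \<le> ennreal (real M * (real p powr (- ((of_bool s1 + of_bool s2) * th)) / 4 * real p powr (- \<kappa> - d / 2)))"
    proof (rule ennreal_leI)
      let ?m = "(of_bool s1 + of_bool s2) * th"
      have "1 - ?m - \<kappa> - d = 1 + - ?m + (- \<kappa> - d / 2) + - (d / 2)" by simp
      then have "real p powr (1 - ?m - \<kappa> - d) = real p powr (1 + - ?m + (- \<kappa> - d / 2) + - (d / 2))" by (rule arg_cong)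
      also have "\<dots> = real p * real p powr (- ?m) * real p powr (- \<kappa> - d / 2) * real p powr (- (d / 2))"
        using p by (simp only: powr_add) simp
      also have "\<dots> \<le> real p * real p powr (- ?m) * real p powr (- \<kappa> - d / 2) * (1 / 12)"
      proof (intro mult_left_mono)
        show "real p powr (- (d / 2)) \<le> 1 / 12" using p by (simp add: powr_minus field_simps)
      qed auto
      also have "\<dots> = (real p / 3) * (real p powr (- ?m) / 4 * real p powr (- \<kappa> - d / 2))" by simp
      also have "\<dots> \<le> real M * (real p powr (- ?m) / 4 * real p powr (- \<kappa> - d / 2))"
      proof (intro mult_right_mono)
        have "p \<le> 3 * M" using p by (simp add: M_def)
        then show "real p / 3 \<le> real M" by linarith
      qed auto
      finally show "real p powr (1 - ?m - \<kappa> - d) \<le> real M * (real p powr (- ?m) / 4 * real p powr (- \<kappa> - d / 2))" .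
    qed
    also have "\<dots> = (\<Sum>k<M. ennreal (real p powr (- ((of_bool s1 + of_bool s2) * th)) / 4 * real p powr (- \<kappa> - d / 2)))"
    proof -
      have *: "ennreal (real M * c) = (\<Sum>k<M. ennreal c)" if "0 \<le> c" for c
        using that by (simp add: ennreal_mult ennreal_of_nat_eq_real_of_nat)
      show ?thesis by (rule *) simp
    qed
    also have "\<dots> \<le> (\<Sum>k<M. 1 * (emeasure (bern p \<epsilon>) (A k) * emeasure (gauss_vec n) (B k)))"
      by (intro sum_mono bound) auto
    also have "\<dots> = (\<integral>\<^sup>+b. (\<integral>\<^sup>+z. (\<Sum>k<M. 1 * (indicator (A k) b * indicator (B k) z)) \<partial>gauss_vec n) \<partial>bern p \<epsilon>)"
    proof (rule nn_integral_product_form[symmetric])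
      show "A k \<in> sets (bern p \<epsilon>)" if "k \<in> {..<M}" for k
        unfolding A_def using that by (intro measurable_bernoulli_pattern kp) auto
      show "B k \<in> sets (gauss_vec n)" for k unfolding B_def by measurable
    qed auto
    also have "\<dots> \<le> risk n p X sig \<epsilon> est mu"
      unfolding risk_def by (intro nn_integral_mono point)
    finally show "ennreal (real p powr (1 - (of_bool s1 + of_bool s2) * th - \<kappa> - d)) \<le> risk n p X sig (real p powr (- th)) est mu"
      unfolding \<epsilon>_def .
  qed
qed

section \<open>Subset selection on a block\<close>

definition qf :: "real \<Rightarrow> real \<Rightarrow> real \<Rightarrow> real" where
  "qf h x y = x\<^sup>2 + 2 * h * x * y + y\<^sup>2"

text \<open>\<open>rad2 h\<close> is dual to \<open>qf h\<close>: it is \<open>\<parallel>P z\<parallel>\<^sup>2\<close> for the projection onto the two columns, as a function of their correlations with \<open>z\<close>.\<close>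
definition rad2 :: "real \<Rightarrow> real \<Rightarrow> real \<Rightarrow> real" where
  "rad2 h x y = (x\<^sup>2 - 2 * h * x * y + y\<^sup>2) / (1 - h\<^sup>2)"

text \<open>Twice the penalized least squares objective of a block up to a constant, \<open>w1\<close> and \<open>w2\<close> being the
  correlations of the columns with \<open>Y\<close>; hence the factor 2 in the lasso penalty below.\<close>
definition Bmin :: "real \<Rightarrow> (real \<Rightarrow> real) \<Rightarrow> real \<Rightarrow> real \<Rightarrow> real \<Rightarrow> real \<Rightarrow> bool" where
  "Bmin h pen w1 w2 x y \<longleftrightarrow> (\<forall>x' y'. qf h x y - 2 * (w1 * x + w2 * y) + pen x + pen y
     \<le> qf h x' y' - 2 * (w1 * x' + w2 * y') + pen x' + pen y')"

lemma qf_swap: "qf h x y = qf h y x" by (simp add: qf_def)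
lemma rad2_swap: "rad2 h x y = rad2 h y x" by (simp add: rad2_def algebra_simps)

lemma Bmin_swap: "Bmin h pen w1 w2 x y \<Longrightarrow> Bmin h pen w2 w1 y x"
  unfolding Bmin_def
proof (intro allI)
  fix x' y' assume "\<forall>x' y'. qf h x y - 2 * (w1 * x + w2 * y) + pen x + pen y
     \<le> qf h x' y' - 2 * (w1 * x' + w2 * y') + pen x' + pen y'"
  then have "qf h x y - 2 * (w1 * x + w2 * y) + pen x + pen y
     \<le> qf h y' x' - 2 * (w1 * y' + w2 * x') + pen y' + pen x'" by blast
  then show "qf h y x - 2 * (w2 * y + w1 * x) + pen y + pen x
     \<le> qf h x' y' - 2 * (w2 * x' + w1 * y') + pen x' + pen y'"
    by (simp add: qf_swap[of h y x] qf_swap[of h x' y'] algebra_simps)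
qed

lemma abs_less_one_sq: "\<bar>h\<bar> < 1 \<Longrightarrow> 0 < 1 - h\<^sup>2" for h :: real
  by (simp add: abs_square_less_1)

lemma rad2_alt: "\<bar>h\<bar> < 1 \<Longrightarrow> rad2 h x y = x\<^sup>2 + (y - h * x)\<^sup>2 / (1 - h\<^sup>2)"
  using abs_less_one_sq[of h] unfolding rad2_def by (simp add: field_simps power2_eq_square)

lemma rad2_alt': "\<bar>h\<bar> < 1 \<Longrightarrow> rad2 h x y = y\<^sup>2 + (x - h * y)\<^sup>2 / (1 - h\<^sup>2)"
  using rad2_alt[of h y x] by (simp add: rad2_swap)

lemma rad2_ge: assumes "\<bar>h\<bar> < 1"
  shows "x\<^sup>2 \<le> rad2 h x y" "y\<^sup>2 \<le> rad2 h x y" "(y - h * x)\<^sup>2 / (1 - h\<^sup>2) \<le> rad2 h x y"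
    "(x - h * y)\<^sup>2 / (1 - h\<^sup>2) \<le> rad2 h x y" "0 \<le> rad2 h x y"
proof -
  have "0 \<le> (y - h * x)\<^sup>2 / (1 - h\<^sup>2)" "0 \<le> (x - h * y)\<^sup>2 / (1 - h\<^sup>2)"
    using abs_less_one_sq[OF assms] by simp_all
  note * = this rad2_alt[OF assms, of x y] rad2_alt'[OF assms, of x y] zero_le_power2[of x] zero_le_power2[of y]
  show "x\<^sup>2 \<le> rad2 h x y" using * by linarith
  show "y\<^sup>2 \<le> rad2 h x y" using * by linarith
  show "(y - h * x)\<^sup>2 / (1 - h\<^sup>2) \<le> rad2 h x y" using * by linarith
  show "(x - h * y)\<^sup>2 / (1 - h\<^sup>2) \<le> rad2 h x y" using * by linarith
  show "0 \<le> rad2 h x y" using * by linarith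
qed

lemma qf_alt: "qf h x y = (x + h * y)\<^sup>2 + (1 - h\<^sup>2) * y\<^sup>2"
  by (simp add: qf_def power2_eq_square algebra_simps)

lemma qf_ge: assumes "\<bar>h\<bar> < 1"
  shows "(1 - h\<^sup>2) * y\<^sup>2 \<le> qf h x y" "(1 - h\<^sup>2) * x\<^sup>2 \<le> qf h x y" "0 \<le> qf h x y"
proof -
  have "0 \<le> (1 - h\<^sup>2) * y\<^sup>2" using abs_less_one_sq[OF assms] by simp
  note * = this qf_alt[of h x y] qf_alt[of h y x] qf_swap[of h x y] zero_le_power2[of "x + h * y"] zero_le_power2[of "y + h * x"]
  show "(1 - h\<^sup>2) * y\<^sup>2 \<le> qf h x y" using * by linarith
  show "(1 - h\<^sup>2) * x\<^sup>2 \<le> qf h x y" using * by linarith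
  show "0 \<le> qf h x y" using * by linarith
qed

lemma qf_eq_0: assumes "\<bar>h\<bar> < 1" "qf h x y \<le> 0" shows "x = 0" "y = 0"
proof -
  have "(1 - h\<^sup>2) * y\<^sup>2 \<le> 0" "(1 - h\<^sup>2) * x\<^sup>2 \<le> 0"
    using qf_ge(1)[where x=x and y=y, OF assms(1)] qf_ge(2)[where x=x and y=y, OF assms(1)] assms(2) by linarith+
  then show "x = 0" "y = 0" using abs_less_one_sq[OF assms(1)] by (auto simp: mult_le_0_iff)
qed

lemma power2_le_abs_mult: "m\<^sup>2 \<le> \<bar>x * y\<bar>" if "m \<le> \<bar>x\<bar>" "m \<le> \<bar>y\<bar>" "0 \<le> m" for m x y :: real
  using that by (simp add: abs_mult power2_eq_square mult_mono)

lemma qf_ge_both: assumes h: "\<bar>h\<bar> < 1" and m: "m \<le> \<bar>x\<bar>" "m \<le> \<bar>y\<bar>" "0 \<le> m"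
  shows "2 * (1 - \<bar>h\<bar>) * m\<^sup>2 \<le> qf h x y"
proof -
  have "0 \<le> (\<bar>x\<bar> - \<bar>y\<bar>)\<^sup>2" by simp
  then have "2 * \<bar>x * y\<bar> \<le> x\<^sup>2 + y\<^sup>2" by (simp add: power2_diff abs_mult)
  moreover have "- (\<bar>h\<bar> * \<bar>x * y\<bar>) \<le> h * x * y" by (metis abs_ge_minus_self abs_mult minus_le_iff mult.assoc)
  ultimately have "2 * \<bar>x * y\<bar> - 2 * (\<bar>h\<bar> * \<bar>x * y\<bar>) \<le> qf h x y" by (simp add: qf_def)
  moreover have "(1 - \<bar>h\<bar>) * m\<^sup>2 \<le> (1 - \<bar>h\<bar>) * \<bar>x * y\<bar>"
    using h power2_le_abs_mult[OF m] by (intro mult_left_mono) auto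
  ultimately show ?thesis by (simp add: algebra_simps)
qed

lemma qf_rad2_cauchy: assumes "\<bar>h\<bar> < 1"
  shows "(\<alpha> * x + \<beta> * y)\<^sup>2 \<le> qf h \<alpha> \<beta> * rad2 h x y"
proof -
  have a: "0 < 1 - h\<^sup>2" using abs_less_one_sq[OF assms] .
  have "(1 - h\<^sup>2) * (qf h \<alpha> \<beta> * rad2 h x y - (\<alpha> * x + \<beta> * y)\<^sup>2)
      = ((\<alpha> + h * \<beta>) * (y - h * x) - (1 - h\<^sup>2) * \<beta> * x)\<^sup>2"
  proof -
    have "(1 - h\<^sup>2) * rad2 h x y = x\<^sup>2 - 2 * h * x * y + y\<^sup>2" using a by (simp add: rad2_def)
    then have "(1 - h\<^sup>2) * (qf h \<alpha> \<beta> * rad2 h x y - (\<alpha> * x + \<beta> * y)\<^sup>2)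
      = qf h \<alpha> \<beta> * (x\<^sup>2 - 2 * h * x * y + y\<^sup>2) - (1 - h\<^sup>2) * (\<alpha> * x + \<beta> * y)\<^sup>2"
      by (simp only: right_diff_distrib mult.left_commute[of "1 - h\<^sup>2" "qf h \<alpha> \<beta>"])
    also have "\<dots> = ((\<alpha> + h * \<beta>) * (y - h * x) - (1 - h\<^sup>2) * \<beta> * x)\<^sup>2"
      unfolding qf_def by algebra
    finally show ?thesis .
  qed
  then have "0 \<le> (1 - h\<^sup>2) * (qf h \<alpha> \<beta> * rad2 h x y - (\<alpha> * x + \<beta> * y)\<^sup>2)" by simp
  then show ?thesis using a by (simp add: zero_le_mult_iff)
qed

lemma obj_complete_square: assumes "\<bar>h\<bar> < 1"
  shows "qf h x y - 2 * (w1 * x + w2 * y)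
    = qf h (x - (w1 - h * w2) / (1 - h\<^sup>2)) (y - (w2 - h * w1) / (1 - h\<^sup>2)) - rad2 h w1 w2"
proof -
  define u where "u = (w1 - h * w2) / (1 - h\<^sup>2)"
  define v where "v = (w2 - h * w1) / (1 - h\<^sup>2)"
  have a: "1 - h\<^sup>2 \<noteq> 0" using abs_less_one_sq[OF assms] by simp
  have "(1 - h\<^sup>2) * u = w1 - h * w2" "(1 - h\<^sup>2) * v = w2 - h * w1" using a by (auto simp: u_def v_def)
  then have "(1 - h\<^sup>2) * (u + h * v) = (1 - h\<^sup>2) * w1" "(1 - h\<^sup>2) * (h * u + v) = (1 - h\<^sup>2) * w2"
    by algebra+
  with a have w: "w1 = u + h * v" "w2 = h * u + v" by auto
  have "w1\<^sup>2 - 2 * h * w1 * w2 + w2\<^sup>2 = (1 - h\<^sup>2) * qf h u v" unfolding w qf_def by algebra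
  then have "rad2 h w1 w2 = qf h u v" using a by (simp add: rad2_def)
  moreover have "qf h x y - 2 * (w1 * x + w2 * y) = qf h (x - u) (y - v) - qf h u v"
    unfolding w qf_def by algebra
  ultimately show ?thesis unfolding u_def v_def by simp
qed

lemma sq_pos_le: "(pos z)\<^sup>2 \<le> x\<^sup>2" if "z \<le> \<bar>x\<bar>"
  using that by (intro abs_le_square_iff[THEN iffD1]) (auto simp: pos_def)

lemma abs_gap: "(pos (m - s))\<^sup>2 \<le> n\<^sup>2" if "m \<le> \<bar>b\<bar>" "(b + n)\<^sup>2 \<le> s\<^sup>2" "0 \<le> s"
proof (rule sq_pos_le)
  have "\<bar>b + n\<bar> \<le> s" using that(2,3) by (metis abs_le_square_iff abs_of_nonneg)
  with that(1) show "m - s \<le> \<bar>n\<bar>" by linarith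
qed

lemma sgn_gap: "b\<^sup>2 \<le> n\<^sup>2" if "sgn (b + n) \<noteq> sgn b" for b n :: real
proof -
  have "\<bar>b\<bar> \<le> \<bar>n\<bar>" using that by (auto simp: sgn_if split: if_splits)
  then show ?thesis by (simp add: abs_le_square_iff)
qed

lemma pos_sq_le: "(pos (m - s))\<^sup>2 \<le> m\<^sup>2" if "0 \<le> m" "0 \<le> s"
  using that by (intro power_mono) (auto simp: pos_def)

definition ss_pen :: "real \<Rightarrow> real \<Rightarrow> real" where "ss_pen s x = (if x = 0 then 0 else s\<^sup>2)"

lemma ss_cases:
  assumes h: "\<bar>h\<bar> < 1" and B: "Bmin h (ss_pen s) w1 w2 x y"
  obtains
    (none) "x = 0" "y = 0" "w1\<^sup>2 \<le> s\<^sup>2" "w2\<^sup>2 \<le> s\<^sup>2" "rad2 h w1 w2 \<le> 2 * s\<^sup>2"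
  | (first) "x \<noteq> 0" "y = 0" "x = w1" "s\<^sup>2 \<le> w1\<^sup>2" "w2\<^sup>2 \<le> w1\<^sup>2" "(w2 - h * w1)\<^sup>2 / (1 - h\<^sup>2) \<le> s\<^sup>2"
  | (second) "x = 0" "y \<noteq> 0" "y = w2" "s\<^sup>2 \<le> w2\<^sup>2" "w1\<^sup>2 \<le> w2\<^sup>2" "(w1 - h * w2)\<^sup>2 / (1 - h\<^sup>2) \<le> s\<^sup>2"
  | (both) "x \<noteq> 0" "y \<noteq> 0" "x = (w1 - h * w2) / (1 - h\<^sup>2)" "y = (w2 - h * w1) / (1 - h\<^sup>2)"
      "2 * s\<^sup>2 \<le> rad2 h w1 w2" "s\<^sup>2 \<le> (w2 - h * w1)\<^sup>2 / (1 - h\<^sup>2)" "s\<^sup>2 \<le> (w1 - h * w2)\<^sup>2 / (1 - h\<^sup>2)"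
proof -
  let ?o = "qf h x y - 2 * (w1 * x + w2 * y) + ss_pen s x + ss_pen s y"
  have p: "ss_pen s t \<le> s\<^sup>2" for t by (simp add: ss_pen_def)
  have "?o \<le> qf h 0 0 - 2 * (w1 * 0 + w2 * 0) + ss_pen s 0 + ss_pen s 0" using B unfolding Bmin_def by blast
  then have o0: "?o \<le> 0" by (simp add: qf_def ss_pen_def)
  have "?o \<le> qf h w1 0 - 2 * (w1 * w1 + w2 * 0) + ss_pen s w1 + ss_pen s 0" using B unfolding Bmin_def by blast
  then have o1: "?o \<le> s\<^sup>2 - w1\<^sup>2" using p[of w1] by (simp add: qf_def ss_pen_def power2_eq_square)
  have "?o \<le> qf h 0 w2 - 2 * (w1 * 0 + w2 * w2) + ss_pen s 0 + ss_pen s w2" using B unfolding Bmin_def by blast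
  then have o2: "?o \<le> s\<^sup>2 - w2\<^sup>2" using p[of w2] by (simp add: qf_def ss_pen_def power2_eq_square)
  define u where "u = (w1 - h * w2) / (1 - h\<^sup>2)"
  define v where "v = (w2 - h * w1) / (1 - h\<^sup>2)"
  have "?o \<le> qf h u v - 2 * (w1 * u + w2 * v) + ss_pen s u + ss_pen s v" using B unfolding Bmin_def by blast
  moreover have "qf h u v - 2 * (w1 * u + w2 * v) = - rad2 h w1 w2"
    using obj_complete_square[OF h, of u v w1 w2] by (simp add: u_def v_def qf_def)
  ultimately have o3: "?o \<le> 2 * s\<^sup>2 - rad2 h w1 w2" using p[of u] p[of v] by linarith
  note r1 = rad2_alt[OF h, of w1 w2] and r2 = rad2_alt'[OF h, of w1 w2]
  show ?thesis
  proof (cases "x = 0"; cases "y = 0")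
    assume xy: "x = 0" "y = 0"
    then have "?o = 0" by (simp add: qf_def ss_pen_def)
    with o1 o2 o3 xy show ?thesis by (intro none) linarith+
  next
    assume xy: "x \<noteq> 0" "y = 0"
    then have o: "?o = (x - w1)\<^sup>2 - w1\<^sup>2 + s\<^sup>2" by (simp add: qf_def ss_pen_def power2_eq_square algebra_simps)
    with o1 have "(x - w1)\<^sup>2 \<le> 0" by linarith
    then have x: "x = w1" by simp
    with o have "?o = - w1\<^sup>2 + s\<^sup>2" by simp
    with o0 o2 o3 r1 xy x show ?thesis by (intro first) linarith+
  next
    assume xy: "x = 0" "y \<noteq> 0"
    then have o: "?o = (y - w2)\<^sup>2 - w2\<^sup>2 + s\<^sup>2" by (simp add: qf_def ss_pen_def power2_eq_square algebra_simps)
    with o2 have "(y - w2)\<^sup>2 \<le> 0" by linarith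
    then have x: "y = w2" by simp
    with o have "?o = - w2\<^sup>2 + s\<^sup>2" by simp
    with o0 o1 o3 r2 xy x show ?thesis by (intro second) linarith+
  next
    assume xy: "x \<noteq> 0" "y \<noteq> 0"
    then have o: "?o = qf h (x - u) (y - v) - rad2 h w1 w2 + 2 * s\<^sup>2"
      using obj_complete_square[OF h, of x y w1 w2] by (simp add: u_def v_def ss_pen_def)
    with o3 have "qf h (x - u) (y - v) \<le> 0" by linarith
    from qf_eq_0[OF h this] have x: "x = u" "y = v" by auto
    with o have "?o = - rad2 h w1 w2 + 2 * s\<^sup>2" by (simp add: qf_def)
    with o0 o1 o2 r1 r2 xy x show ?thesis unfolding u_def v_def by (intro both) linarith+
  qed
qed

lemma qf_triangle:
  assumes h: "\<bar>h\<bar> < 1" and le: "rad2 h (b1 + h * b2 + n1) (h * b1 + b2 + n2) \<le> t\<^sup>2" and t: "0 \<le> t"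
    and m: "m\<^sup>2 \<le> qf h b1 b2" "0 \<le> m"
  shows "(pos (m - t))\<^sup>2 \<le> rad2 h n1 n2"
proof -
  let ?R = "rad2 h n1 n2" and ?Q = "qf h b1 b2"
  note R = rad2_ge(5)[OF h, of n1 n2] and Q = qf_ge(3)[OF h, of b1 b2]
  have a: "1 - h\<^sup>2 \<noteq> 0" using abs_less_one_sq[OF h] by simp
  have eq: "rad2 h (b1 + h * b2 + n1) (h * b1 + b2 + n2) = ?Q + 2 * (b1 * n1 + b2 * n2) + ?R"
    using a unfolding rad2_def qf_def by (simp add: field_simps power2_eq_square)
  have "(b1 * n1 + b2 * n2)\<^sup>2 \<le> (sqrt ?Q * sqrt ?R)\<^sup>2"
    using qf_rad2_cauchy[OF h, of b1 n1 b2 n2] R Q by (simp add: power_mult_distrib)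
  then have "\<bar>b1 * n1 + b2 * n2\<bar> \<le> sqrt ?Q * sqrt ?R"
    using R Q by (metis abs_le_square_iff abs_of_nonneg mult_nonneg_nonneg real_sqrt_ge_zero)
  then have "(sqrt ?Q - sqrt ?R)\<^sup>2 \<le> ?Q + 2 * (b1 * n1 + b2 * n2) + ?R"
    using R Q by (simp add: power2_diff)
  with le eq have "(sqrt ?Q - sqrt ?R)\<^sup>2 \<le> t\<^sup>2" by simp
  then have "sqrt ?Q - sqrt ?R \<le> t" using t by (metis abs_le_square_iff abs_of_nonneg abs_le_D1)
  moreover have "m \<le> sqrt ?Q" using m by (intro real_le_rsqrt)
  ultimately have "m - t \<le> \<bar>sqrt ?R\<bar>" using R by simp
  from sq_pos_le[OF this] R show ?thesis by simp
qed

lemma ss_upper_single: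
  assumes h: "\<bar>h\<bar> < 1" and B: "Bmin h (ss_pen s) (b + n1) (h * b + n2) x y" and s: "0 \<le> s" and r: "0 \<le> r"
    and b: "sqrt r \<le> \<bar>b\<bar>" and err: "\<not> (sgn x = sgn b \<and> sgn y = 0)"
    and H: "\<kappa> \<le> s\<^sup>2" "\<kappa> \<le> (pos (sqrt r - s))\<^sup>2" "\<kappa> \<le> (1 - \<bar>h\<bar>) * r / 2"
  shows "\<kappa> \<le> rad2 h n1 n2"
  using h B
proof (cases rule: ss_cases)
  case none
  from abs_gap[OF b none(3) s] rad2_ge(1)[OF h, of n1 n2] H(2) show ?thesis by linarith
next
  case first
  then have "sgn (b + n1) \<noteq> sgn b" using err by auto
  from sgn_gap[OF this] have "b\<^sup>2 \<le> n1\<^sup>2" .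
  moreover have "r \<le> b\<^sup>2" using b r by (metis real_sqrt_le_iff real_sqrt_abs)
  moreover have "(pos (sqrt r - s))\<^sup>2 \<le> r" using pos_sq_le[of "sqrt r" s] s r by simp
  ultimately show ?thesis using rad2_ge(1)[OF h, of n1 n2] H(2) by linarith
next
  case second
  have r2: "r \<le> b\<^sup>2" using b r by (metis real_sqrt_le_iff real_sqrt_abs)
  have *: "(1 - \<bar>h\<bar>) * r / 2 \<le> rad2 h n1 n2" if g: "(1 + g) * \<bar>b\<bar> \<le> \<bar>n1 + e * n2\<bar>" "g = e * h" "e\<^sup>2 = 1" for g e
  proof -
    have g1: "\<bar>g\<bar> = \<bar>h\<bar>" using g(2,3) by (simp add: abs_mult power2_eq_1_iff) auto
    with h have pg: "0 < 1 + g" by linarith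
    have "((1 + g) * \<bar>b\<bar>)\<^sup>2 \<le> (1 * n1 + e * n2)\<^sup>2" using g(1) pg by (simp add: abs_le_square_iff[symmetric] abs_mult)
    also have "\<dots> \<le> qf h 1 e * rad2 h n1 n2" by (rule qf_rad2_cauchy[OF h])
    also have "qf h 1 e = 2 * (1 + g)" using g by (simp add: qf_def)
    finally have "(1 + g) * ((1 + g) * b\<^sup>2) \<le> (1 + g) * (2 * rad2 h n1 n2)" by (simp add: power2_eq_square algebra_simps)
    then have "(1 + g) * b\<^sup>2 \<le> 2 * rad2 h n1 n2" using pg by simp
    moreover have "(1 - \<bar>h\<bar>) * r \<le> (1 + g) * b\<^sup>2" using g1 h r2 r by (intro mult_mono) auto
    ultimately show ?thesis by simp
  qed
  have "((1 - h) * b + (n1 - n2)) * ((1 + h) * b + (n1 + n2)) \<le> 0"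
    using second(5) by (simp add: power2_eq_square algebra_simps)
  then have "(1 - h) * \<bar>b\<bar> \<le> \<bar>n1 - n2\<bar> \<or> (1 + h) * \<bar>b\<bar> \<le> \<bar>n1 + n2\<bar>"
  proof (rule contrapos_pp)
    assume "\<not> ((1 - h) * \<bar>b\<bar> \<le> \<bar>n1 - n2\<bar> \<or> (1 + h) * \<bar>b\<bar> \<le> \<bar>n1 + n2\<bar>)"
    then have n: "\<bar>n1 - n2\<bar> < (1 - h) * \<bar>b\<bar>" "\<bar>n1 + n2\<bar> < (1 + h) * \<bar>b\<bar>" by auto
    show "\<not> ((1 - h) * b + (n1 - n2)) * ((1 + h) * b + (n1 + n2)) \<le> 0"
    proof (cases "0 \<le> b")
      case True
      then have "0 < (1 - h) * b + (n1 - n2)" "0 < (1 + h) * b + (n1 + n2)" using n by auto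
      then show ?thesis by (simp add: not_le)
    next
      case False
      then have "(1 - h) * b + (n1 - n2) < 0" "(1 + h) * b + (n1 + n2) < 0" using n by auto
      then show ?thesis by (simp add: not_le mult_neg_neg)
    qed
  qed
  moreover have "\<kappa> \<le> rad2 h n1 n2" if "(1 - h) * \<bar>b\<bar> \<le> \<bar>n1 - n2\<bar>"
    using that by (intro order_trans[OF H(3) *[of "-h" "-1"]]) simp_all
  moreover have "\<kappa> \<le> rad2 h n1 n2" if "(1 + h) * \<bar>b\<bar> \<le> \<bar>n1 + n2\<bar>"
    using that by (intro order_trans[OF H(3) *[of h 1]]) simp_all
  ultimately show ?thesis by blast
next
  case both
  have "s\<^sup>2 \<le> (n2 - h * n1)\<^sup>2 / (1 - h\<^sup>2)" using both(6) by (simp add: algebra_simps)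
  with rad2_ge(3)[where x=n1 and y=n2, OF h] H(1) show ?thesis by linarith
qed

lemma sqrt_a_div: "(n / sqrt a)\<^sup>2 = n\<^sup>2 / a" if "0 < a" using that by (simp add: power_divide)

lemma ss_upper_both:
  assumes h: "\<bar>h\<bar> < 1" and B: "Bmin h (ss_pen s) (b1 + h * b2 + n1) (h * b1 + b2 + n2) x y" and s: "0 \<le> s" and r: "0 \<le> r"
    and b: "sqrt r \<le> \<bar>b1\<bar>" "sqrt r \<le> \<bar>b2\<bar>" and err: "\<not> (sgn x = sgn b1 \<and> sgn y = sgn b2)"
    and H: "\<kappa> \<le> (pos (sqrt ((1 - h\<^sup>2) * r) - s))\<^sup>2" "\<kappa> \<le> 2 * (pos (sqrt ((1 - \<bar>h\<bar>) * r) - s))\<^sup>2"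
  shows "\<kappa> \<le> rad2 h n1 n2"
proof -
  have a: "0 < 1 - h\<^sup>2" using abs_less_one_sq[OF h] .
  have *: "\<kappa> \<le> rad2 h n1 n2" if "((1 - h\<^sup>2) * b + n)\<^sup>2 / (1 - h\<^sup>2) \<le> s\<^sup>2" "sqrt r \<le> \<bar>b\<bar>" "n\<^sup>2 / (1 - h\<^sup>2) \<le> rad2 h n1 n2" for b n
  proof -
    have "((1 - h\<^sup>2) * b + n) / sqrt (1 - h\<^sup>2) = sqrt (1 - h\<^sup>2) * b + n / sqrt (1 - h\<^sup>2)"
    proof -
      have "(1 - h\<^sup>2) * b / sqrt (1 - h\<^sup>2) = (1 - h\<^sup>2) / sqrt (1 - h\<^sup>2) * b" by simp
      also have "(1 - h\<^sup>2) / sqrt (1 - h\<^sup>2) = sqrt (1 - h\<^sup>2)" using a by (intro real_div_sqrt) simp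
      finally show ?thesis by (simp add: add_divide_distrib)
    qed
    then have "(sqrt (1 - h\<^sup>2) * b + n / sqrt (1 - h\<^sup>2))\<^sup>2 \<le> s\<^sup>2"
      using that(1) sqrt_a_div[OF a] by metis
    moreover have "sqrt ((1 - h\<^sup>2) * r) \<le> \<bar>sqrt (1 - h\<^sup>2) * b\<bar>"
      using that(2) a by (simp add: real_sqrt_mult abs_mult)
    ultimately have "(pos (sqrt ((1 - h\<^sup>2) * r) - s))\<^sup>2 \<le> (n / sqrt (1 - h\<^sup>2))\<^sup>2"
      using s by (intro abs_gap)
    with that(3) sqrt_a_div[OF a] H(1) show ?thesis by (metis order_trans)
  qed
  have **: "\<kappa> \<le> rad2 h n1 n2" if "sgn (b + n / (1 - h\<^sup>2)) \<noteq> sgn b" "sqrt r \<le> \<bar>b\<bar>" "n\<^sup>2 / (1 - h\<^sup>2) \<le> rad2 h n1 n2" for b n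
  proof -
    have "b\<^sup>2 \<le> (n / (1 - h\<^sup>2))\<^sup>2" by (rule sgn_gap[OF that(1)])
    then have "(1 - h\<^sup>2) * b\<^sup>2 \<le> (1 - h\<^sup>2) * (n / (1 - h\<^sup>2))\<^sup>2" using a by (intro mult_left_mono) auto
    also have "\<dots> = n\<^sup>2 / (1 - h\<^sup>2)" using a by (simp add: power2_eq_square)
    finally have 1: "(1 - h\<^sup>2) * b\<^sup>2 \<le> rad2 h n1 n2" using that(3) by simp
    have "r \<le> b\<^sup>2" using that(2) r by (metis real_sqrt_le_iff real_sqrt_abs)
    then have "(1 - h\<^sup>2) * r \<le> (1 - h\<^sup>2) * b\<^sup>2" using a by simp
    moreover have "(pos (sqrt ((1 - h\<^sup>2) * r) - s))\<^sup>2 \<le> (1 - h\<^sup>2) * r"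
      using pos_sq_le[of "sqrt ((1 - h\<^sup>2) * r)" s] s r a by simp
    ultimately show ?thesis using 1 H(1) by linarith
  qed
  have e1: "(b1 + h * b2 + n1) - h * (h * b1 + b2 + n2) = (1 - h\<^sup>2) * b1 + (n1 - h * n2)"
   and e2: "(h * b1 + b2 + n2) - h * (b1 + h * b2 + n1) = (1 - h\<^sup>2) * b2 + (n2 - h * n1)"
    by (simp_all add: power2_eq_square algebra_simps)
  note R = rad2_ge(3)[where x=n1 and y=n2, OF h] rad2_ge(4)[where x=n1 and y=n2, OF h]
  from h B show ?thesis
  proof (cases rule: ss_cases)
    case none
    have "(sqrt (2 * ((1 - \<bar>h\<bar>) * r)))\<^sup>2 \<le> qf h b1 b2"
    proof -
      have "0 \<le> 2 * ((1 - \<bar>h\<bar>) * r)" using h r by simp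
      then have "(sqrt (2 * ((1 - \<bar>h\<bar>) * r)))\<^sup>2 = 2 * ((1 - \<bar>h\<bar>) * r)" by (rule real_sqrt_pow2)
      also have "\<dots> \<le> qf h b1 b2" using qf_ge_both[OF h b] r by (simp add: algebra_simps)
      finally show ?thesis .
    qed
    with none(5) have "(pos (sqrt (2 * ((1 - \<bar>h\<bar>) * r)) - sqrt 2 * s))\<^sup>2 \<le> rad2 h n1 n2"
      using h s r by (intro qf_triangle[OF h]) (auto simp: power_mult_distrib)
    moreover have "(pos (sqrt (2 * ((1 - \<bar>h\<bar>) * r)) - sqrt 2 * s))\<^sup>2 = 2 * (pos (sqrt ((1 - \<bar>h\<bar>) * r) - s))\<^sup>2"
    proof -
      have "sqrt (2 * ((1 - \<bar>h\<bar>) * r)) - sqrt 2 * s = sqrt 2 * (sqrt ((1 - \<bar>h\<bar>) * r) - s)"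
        by (simp only: real_sqrt_mult[of 2] right_diff_distrib)
      moreover have "pos (sqrt 2 * z) = sqrt 2 * pos z" for z by (auto simp: pos_def max_def zero_le_mult_iff mult_le_0_iff)
      ultimately show ?thesis by (simp add: power_mult_distrib)
    qed
    ultimately show ?thesis using H(2) by simp
  next
    case first
    from first(6) show ?thesis unfolding e2 by (rule *[OF _ b(2) R(1)])
  next
    case second
    from second(6) show ?thesis unfolding e1 by (rule *[OF _ b(1) R(2)])
  next
    case both
    have "x = b1 + (n1 - h * n2) / (1 - h\<^sup>2)" "y = b2 + (n2 - h * n1) / (1 - h\<^sup>2)"
      using both(3,4) a unfolding e1 e2 by (simp_all add: add_divide_distrib)
    with err have "sgn (b1 + (n1 - h * n2) / (1 - h\<^sup>2)) \<noteq> sgn b1 \<or> sgn (b2 + (n2 - h * n1) / (1 - h\<^sup>2)) \<noteq> sgn b2" by auto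
    then show ?thesis using **[OF _ b(1) R(2)] **[OF _ b(2) R(1)] by blast
  qed
qed

lemma ss_upper:
  assumes h: "\<bar>h\<bar> < 1" and B: "Bmin h (ss_pen s) (b1 + h * b2 + n1) (h * b1 + b2 + n2) x y" and s: "0 \<le> s" and r: "0 < r"
    and b: "b1 = 0 \<or> sqrt r \<le> \<bar>b1\<bar>" "b2 = 0 \<or> sqrt r \<le> \<bar>b2\<bar>" and err: "\<not> (sgn x = sgn b1 \<and> sgn y = sgn b2)"
    and th: "0 \<le> th"
    and H: "\<rho> \<le> s\<^sup>2" "\<rho> \<le> th + (pos (sqrt r - s))\<^sup>2" "\<rho> \<le> th + (1 - \<bar>h\<bar>) * r / 2"
     "\<rho> \<le> 2 * th + (pos (sqrt ((1 - h\<^sup>2) * r) - s))\<^sup>2" "\<rho> \<le> 2 * th + 2 * (pos (sqrt ((1 - \<bar>h\<bar>) * r) - s))\<^sup>2"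
  shows "\<rho> - th * (of_bool (b1 \<noteq> 0) + of_bool (b2 \<noteq> 0)) \<le> rad2 h n1 n2"
proof (cases "b1 = 0"; cases "b2 = 0")
  assume 0: "b1 = 0" "b2 = 0"
  with B have "Bmin h (ss_pen s) n1 n2 x y" by simp
  then show ?thesis
    using h
    by (cases rule: ss_cases[consumes 2, OF h]) (use 0 H err rad2_ge[where x=n1 and y=n2, OF h] in auto)
next
  assume 0: "b1 \<noteq> 0" "b2 = 0"
  with B have "Bmin h (ss_pen s) (b1 + n1) (h * b1 + n2) x y" by simp
  from ss_upper_single[OF h this s, of r "\<rho> - th"] show ?thesis using 0 H err b th r by simp
next
  assume 0: "b1 = 0" "b2 \<noteq> 0"
  with Bmin_swap[OF B] have "Bmin h (ss_pen s) (b2 + n2) (h * b2 + n1) y x" by simp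
  moreover have "\<not> (sgn y = sgn b2 \<and> sgn x = 0)" using err 0 by auto
  ultimately have "\<rho> - th \<le> rad2 h n2 n1" using 0 H b th r by (intro ss_upper_single[OF h _ s, of b2 n2 n1 y x r]) auto
  then show ?thesis using 0 by (simp add: rad2_swap[of h n1 n2])
next
  assume 0: "b1 \<noteq> 0" "b2 \<noteq> 0"
  from ss_upper_both[OF h B s, of r "\<rho> - 2 * th"] show ?thesis using 0 H err b th r by simp
qed

section \<open>The exponents as balance points\<close>

lemma pos_eq [simp]: "0 \<le> z \<Longrightarrow> pos z = z" "z \<le> 0 \<Longrightarrow> pos z = 0"
  by (auto simp: pos_def)

lemma pos_mono: "x \<le> y \<Longrightarrow> (pos x)\<^sup>2 \<le> (pos y)\<^sup>2"
  by (intro power_mono) (auto simp: pos_def)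

lemma crossing_hard:
  assumes "0 < t" "0 < A"
  obtains s where "0 < s" "s\<^sup>2 = (if A \<le> t then t else (t + A)\<^sup>2 / (4 * A))"
    "t + (pos (sqrt A - s))\<^sup>2 = (if A \<le> t then t else (t + A)\<^sup>2 / (4 * A))"
proof (cases "A \<le> t")
  case True
  then show ?thesis using assms by (intro that[of "sqrt t"]) auto
next
  case False
  define m where "m = sqrt A"
  have m: "0 < m" "A = m\<^sup>2" using assms by (auto simp: m_def)
  have "m - (t + m\<^sup>2) / (2 * m) = (m\<^sup>2 - t) / (2 * m)" using m by (simp add: field_simps power2_eq_square)
  moreover have "0 \<le> (m\<^sup>2 - t) / (2 * m)" using False m by simp
  ultimately have "(pos (m - (t + m\<^sup>2) / (2 * m)))\<^sup>2 = ((m\<^sup>2 - t) / (2 * m))\<^sup>2" by simp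
  then have "t + (pos (m - (t + m\<^sup>2) / (2 * m)))\<^sup>2 = (t + m\<^sup>2)\<^sup>2 / (4 * m\<^sup>2)"
    using m by (simp add: power_divide power_mult_distrib) (simp add: field_simps power2_eq_square)
  then show ?thesis using False m assms
    by (intro that[of "(t + m\<^sup>2) / (2 * m)"]) (auto simp: power_divide power_mult_distrib m_def[symmetric] add_pos_pos)
qed

lemma crossing_ball:
  assumes "0 < t" "0 < C"
  obtains s where "0 < s" "s\<^sup>2 = (if C \<le> 2 * t then 2 * t else 2 * (sqrt (2 * C) - sqrt (C - t))\<^sup>2)"
    "2 * t + 2 * (pos (sqrt C - s))\<^sup>2 = (if C \<le> 2 * t then 2 * t else 2 * (sqrt (2 * C) - sqrt (C - t))\<^sup>2)"
proof (cases "C \<le> 2 * t")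
  case True
  then show ?thesis using assms by (intro that[of "sqrt (2 * t)"]) auto
next
  case False
  define m where "m = sqrt C"
  define l where "l = sqrt (2 * (C - t))"
  have m: "0 < m" "C = m\<^sup>2" using assms by (auto simp: m_def)
  have l: "0 \<le> l" "l\<^sup>2 = 2 * (C - t)" using False assms by (auto simp: l_def)
  have "m \<le> l" using False by (simp add: m_def l_def)
  have "l\<^sup>2 = 2 * m\<^sup>2 - 2 * t" "0 < m\<^sup>2" using l(2) m by simp_all
  then have "l\<^sup>2 < 4 * m\<^sup>2" using assms(1) by linarith
  then have "l\<^sup>2 < (2 * m)\<^sup>2" by (simp add: power_mult_distrib)
  then have "l < 2 * m" by (rule power_less_imp_less_base) (use m in simp)
  define s where "s = 2 * m - l"
  have "sqrt 2 * sqrt (2 * C) = 2 * m" by (simp add: m_def real_sqrt_mult)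
  moreover have "sqrt 2 * sqrt (C - t) = l" by (simp only: l_def real_sqrt_mult)
  ultimately have "s = sqrt 2 * (sqrt (2 * C) - sqrt (C - t))" by (simp add: s_def right_diff_distrib)
  then have val: "s\<^sup>2 = 2 * (sqrt (2 * C) - sqrt (C - t))\<^sup>2" by (simp add: power_mult_distrib)
  have "2 * t + 2 * (m - s)\<^sup>2 = s\<^sup>2"
  proof -
    have "t = m\<^sup>2 - l\<^sup>2 / 2" using l(2) m(2) by (simp add: field_simps)
    then show ?thesis unfolding s_def by (simp add: power2_eq_square algebra_simps)
  qed
  moreover have "pos (m - s) = m - s" using \<open>m \<le> l\<close> by (simp add: s_def)
  ultimately show ?thesis using False val \<open>l < 2 * m\<close>
    by (intro that[of s]) (auto simp: m_def[symmetric] s_def)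
qed

lemma crossing_lasso_single:
  assumes "0 \<le> \<eta>" "\<eta> < 1" "0 < r"
  obtains s where "0 < s" "(1 - \<eta>) / (1 + \<eta>) * s\<^sup>2 = (1 - \<eta>) * r / (2 * (1 + sqrt (1 - \<eta>\<^sup>2)))"
    "(pos (sqrt r - s))\<^sup>2 = (1 - \<eta>) * r / (2 * (1 + sqrt (1 - \<eta>\<^sup>2)))"
proof -
  define m where "m = sqrt r"
  have m: "0 < m" "r = m\<^sup>2" using assms by (auto simp: m_def)
  define k where "k = sqrt ((1 - \<eta>) / (1 + \<eta>))"
  have k: "0 < k" "k\<^sup>2 = (1 - \<eta>) / (1 + \<eta>)" using assms by (auto simp: k_def)
  have "(1 + \<eta>) * k = sqrt (1 - \<eta>\<^sup>2)"
  proof (rule sym, rule real_sqrt_unique)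
    show "((1 + \<eta>) * k)\<^sup>2 = 1 - \<eta>\<^sup>2"
      using assms by (simp add: power_mult_distrib k(2)) (simp add: power2_eq_square field_simps)
  qed (use assms k in auto)
  moreover have "(1 + \<eta>) * k\<^sup>2 = 1 - \<eta>" using assms k by simp
  ultimately have den: "2 * (1 + sqrt (1 - \<eta>\<^sup>2)) = (1 + \<eta>) * (1 + k)\<^sup>2" by (simp add: power2_eq_square algebra_simps)
  have val: "(1 - \<eta>) * r / (2 * (1 + sqrt (1 - \<eta>\<^sup>2))) = k\<^sup>2 * (m / (1 + k))\<^sup>2"
    unfolding den k(2) m(2) using assms by (simp add: power_divide)
  show ?thesis
  proof (rule that[of "m / (1 + k)"])
    have "m - m / (1 + k) = k * (m / (1 + k))" using k by (simp add: field_simps)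
    then have "(pos (m - m / (1 + k)))\<^sup>2 = (k * (m / (1 + k)))\<^sup>2" using k m by simp
    then show "(pos (sqrt r - m / (1 + k)))\<^sup>2 = (1 - \<eta>) * r / (2 * (1 + sqrt (1 - \<eta>\<^sup>2)))"
      unfolding val m_def[symmetric] by (simp only: power_mult_distrib)
  qed (use k m val in auto)
qed

lemma rho_lasso1_alt: assumes "0 < th" "\<bar>h\<bar> < 1"
  shows "rho_lasso1 th r h = (if (1 - \<bar>h\<bar>)\<^sup>2 * r \<le> 2 * th then 2 * th else rho_lasso3 th r h)"
proof -
  have "0 < (1 - \<bar>h\<bar>)\<^sup>2" using assms by simp
  then have "r / th \<le> 2 / (1 - \<bar>h\<bar>)\<^sup>2 \<longleftrightarrow> (1 - \<bar>h\<bar>)\<^sup>2 * r \<le> 2 * th"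
    using assms(1) by (simp add: divide_le_eq le_divide_eq mult_ac)
  then show ?thesis by (simp add: rho_lasso1_def)
qed

lemma rho_lasso2_alt: assumes "0 < th" "\<bar>h\<bar> < 1"
  shows "rho_lasso2 th r h = (if (1 - \<bar>h\<bar>) ^ 3 * r \<le> (1 + \<bar>h\<bar>) * th then 2 * th else rho_lasso4 th r h)"
proof -
  have "0 < (1 - \<bar>h\<bar>) ^ 3" using assms by simp
  then have "r / th \<le> (1 + \<bar>h\<bar>) / (1 - \<bar>h\<bar>) ^ 3 \<longleftrightarrow> (1 - \<bar>h\<bar>) ^ 3 * r \<le> (1 + \<bar>h\<bar>) * th"
    using assms(1) by (simp add: divide_le_eq le_divide_eq mult_ac)
  then show ?thesis by (simp add: rho_lasso2_def)
qed

lemma crossing_lasso1: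
  assumes th: "0 < th" and h: "\<bar>h\<bar> < 1" and r: "0 < r"
  obtains s where "0 < s" "s\<^sup>2 = rho_lasso1 th r h"
    "2 * th + (pos ((1 - h\<^sup>2) * sqrt r - (1 + \<bar>h\<bar>) * s))\<^sup>2 / (1 - h\<^sup>2) = rho_lasso1 th r h"
proof -
  define \<eta> where "\<eta> = \<bar>h\<bar>"
  define m where "m = sqrt r"
  have m: "0 < m" "r = m\<^sup>2" using r by (auto simp: m_def)
  have \<eta>: "0 \<le> \<eta>" "\<eta> < 1" "h\<^sup>2 = \<eta>\<^sup>2" using h by (auto simp: \<eta>_def)
  have a: "1 - \<eta>\<^sup>2 = (1 + \<eta>) * (1 - \<eta>)" by (simp add: power2_eq_square algebra_simps)
  note goal = that[unfolded rho_lasso1_alt[OF th h] \<eta>_def[symmetric] \<eta>(3) m_def[symmetric]]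
  consider "(1 - \<eta>)\<^sup>2 * r \<le> 2 * th" | "2 * th < (1 - \<eta>)\<^sup>2 * r" "\<eta> = 0" | "2 * th < (1 - \<eta>)\<^sup>2 * r" "0 < \<eta>"
    using \<eta> by linarith
  then show ?thesis
  proof cases
    case 1
    have "((1 - \<eta>) * m)\<^sup>2 \<le> (sqrt (2 * th))\<^sup>2" using 1 th m by (simp add: power_mult_distrib)
    then have "(1 - \<eta>) * m \<le> sqrt (2 * th)" by (rule power2_le_imp_le) (use th in simp)
    then have "(1 + \<eta>) * ((1 - \<eta>) * m) \<le> (1 + \<eta>) * sqrt (2 * th)" using \<eta> by (intro mult_left_mono) auto
    then have "(1 - \<eta>\<^sup>2) * m - (1 + \<eta>) * sqrt (2 * th) \<le> 0" by (simp add: a mult.assoc)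
    then show ?thesis using 1 th by (intro goal[of "sqrt (2 * th)"]) auto
  next
    case 2
    obtain s where "0 < s" "s\<^sup>2 = (if r \<le> 2 * th then 2 * th else (2 * th + r)\<^sup>2 / (4 * r))"
      "2 * th + (pos (sqrt r - s))\<^sup>2 = (if r \<le> 2 * th then 2 * th else (2 * th + r)\<^sup>2 / (4 * r))"
      using crossing_hard[of "2 * th" r] th r by auto
    then show ?thesis using 2 \<eta> by (intro goal[of s]) (auto simp: rho_lasso3_def \<eta>_def m_def add.commute)
  next
    case 3
    define E where "E = (1 - \<eta>\<^sup>2) * m"
    define D where "D = sqrt ((1 - \<eta>\<^sup>2) * (1 - \<eta>)\<^sup>2 * r - 4 * \<eta> * (1 - \<eta>) * th)"
    define s where "s = (E - D) / (2 * \<eta>)"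
    have id: "(1 - \<eta>\<^sup>2) * (1 - \<eta>)\<^sup>2 * r - 4 * \<eta> * (1 - \<eta>) * th
        = ((1 - \<eta>)\<^sup>2 * m)\<^sup>2 + 2 * \<eta> * (1 - \<eta>) * ((1 - \<eta>)\<^sup>2 * r - 2 * th)"
      unfolding m(2) by algebra
    have "0 < 2 * \<eta> * (1 - \<eta>) * ((1 - \<eta>)\<^sup>2 * r - 2 * th)" using 3 \<eta> by simp
    then have ge: "((1 - \<eta>)\<^sup>2 * m)\<^sup>2 \<le> (1 - \<eta>\<^sup>2) * (1 - \<eta>)\<^sup>2 * r - 4 * \<eta> * (1 - \<eta>) * th" unfolding id by simp
    then have "0 \<le> (1 - \<eta>\<^sup>2) * (1 - \<eta>)\<^sup>2 * r - 4 * \<eta> * (1 - \<eta>) * th" using zero_le_power2 order_trans by blast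
    then have D2: "D\<^sup>2 = (1 - \<eta>\<^sup>2) * (1 - \<eta>)\<^sup>2 * r - 4 * \<eta> * (1 - \<eta>) * th" by (simp add: D_def)
    have Dge: "(1 - \<eta>)\<^sup>2 * m \<le> D" unfolding D_def using ge by (rule real_le_rsqrt)
    have D0: "0 \<le> D" using Dge m by (meson order_trans mult_nonneg_nonneg zero_le_power2 less_imp_le)
    have "E\<^sup>2 - D\<^sup>2 = 2 * \<eta> * ((1 - \<eta>) * ((1 - \<eta>\<^sup>2) * r + 2 * th))"
      unfolding D2 E_def m(2) by algebra
    moreover have "0 < 2 * \<eta> * ((1 - \<eta>) * ((1 - \<eta>\<^sup>2) * r + 2 * th))"
      using 3 \<eta> th r a by (intro mult_pos_pos add_pos_pos) auto
    ultimately have "D\<^sup>2 < E\<^sup>2" by linarith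
    then have "D < E" by (rule power_less_imp_less_base) (use \<eta> m a in \<open>simp add: E_def\<close>)
    then have s0: "0 < s" using 3 by (simp add: s_def)
    have DE: "D = E - 2 * \<eta> * s" using 3 by (simp add: s_def)
    have "2 * \<eta> * s \<le> 2 * \<eta> * ((1 - \<eta>) * m)"
    proof -
      have "2 * \<eta> * s = E - D" using DE by simp
      also have "\<dots> \<le> E - (1 - \<eta>)\<^sup>2 * m" using Dge by simp
      also have "\<dots> = 2 * \<eta> * ((1 - \<eta>) * m)" unfolding E_def by algebra
      finally show ?thesis .
    qed
    then have "s \<le> (1 - \<eta>) * m" using 3 by simp
    then have "(1 + \<eta>) * s \<le> (1 + \<eta>) * ((1 - \<eta>) * m)" using \<eta> by (intro mult_left_mono) auto
    then have le: "0 \<le> (1 - \<eta>\<^sup>2) * m - (1 + \<eta>) * s" by (simp add: a mult.assoc)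
    have "2 * \<eta> * (2 * (1 - \<eta>\<^sup>2) * th + ((1 - \<eta>\<^sup>2) * m - (1 + \<eta>) * s)\<^sup>2 - (1 - \<eta>\<^sup>2) * s\<^sup>2) = 0"
    proof -
      have "(E - 2 * \<eta> * s)\<^sup>2 = (1 - \<eta>\<^sup>2) * (1 - \<eta>)\<^sup>2 * m\<^sup>2 - 4 * \<eta> * (1 - \<eta>) * th" using D2 DE m by simp
      then show ?thesis unfolding E_def by algebra
    qed
    then have "2 * (1 - \<eta>\<^sup>2) * th + ((1 - \<eta>\<^sup>2) * m - (1 + \<eta>) * s)\<^sup>2 = (1 - \<eta>\<^sup>2) * s\<^sup>2" using 3 by simp
    moreover have "0 < 1 - \<eta>\<^sup>2" using a \<eta> by simp
    ultimately have eq: "2 * th + ((1 - \<eta>\<^sup>2) * m - (1 + \<eta>) * s)\<^sup>2 / (1 - \<eta>\<^sup>2) = s\<^sup>2"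
      by (simp add: field_simps)
    have "s\<^sup>2 = rho_lasso3 th r h"
      using 3 unfolding rho_lasso3_def s_def E_def D_def m_def by (auto simp: \<eta>_def)
    then show ?thesis using 3 eq le s0 by (intro goal[of s]) auto
  qed
qed

lemma crossing_lasso2:
  assumes th: "0 < th" and h: "\<bar>h\<bar> < 1" and r: "th < r"
  obtains s where "0 < s" "th + (1 - \<bar>h\<bar>) / (1 + \<bar>h\<bar>) * s\<^sup>2 = rho_lasso2 th r h"
    "2 * th + (pos ((1 - h\<^sup>2) * sqrt r - (1 + \<bar>h\<bar>) * s))\<^sup>2 / (1 - h\<^sup>2) = rho_lasso2 th r h"
proof -
  define \<eta> where "\<eta> = \<bar>h\<bar>"
  define m where "m = sqrt r"
  have m: "0 < m" "r = m\<^sup>2" using r th by (auto simp: m_def)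
  have \<eta>: "0 \<le> \<eta>" "\<eta> < 1" "h\<^sup>2 = \<eta>\<^sup>2" using h by (auto simp: \<eta>_def)
  have a: "1 - \<eta>\<^sup>2 = (1 + \<eta>) * (1 - \<eta>)" by (simp add: power2_eq_square algebra_simps)
  note goal = that[unfolded rho_lasso2_alt[OF th h] \<eta>_def[symmetric] \<eta>(3) m_def[symmetric]]
  consider "(1 - \<eta>) ^ 3 * r \<le> (1 + \<eta>) * th" | "(1 + \<eta>) * th < (1 - \<eta>) ^ 3 * r" "\<eta> = 0"
    | "(1 + \<eta>) * th < (1 - \<eta>) ^ 3 * r" "0 < \<eta>"
    using \<eta> by linarith
  then show ?thesis
  proof cases
    case 1
    define s where "s = sqrt (th * (1 + \<eta>) / (1 - \<eta>))"
    have s: "0 < s" "s\<^sup>2 = th * (1 + \<eta>) / (1 - \<eta>)" using th \<eta> by (auto simp: s_def)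
    have "(1 - \<eta>) * ((1 - \<eta>)\<^sup>2 * r) \<le> (1 + \<eta>) * th" using 1 by (simp add: power3_eq_cube power2_eq_square mult_ac)
    then have "((1 - \<eta>) * m)\<^sup>2 \<le> s\<^sup>2" unfolding s(2) using \<eta> m by (simp add: power_mult_distrib le_divide_eq mult_ac)
    then have "(1 - \<eta>) * m \<le> s" by (rule power2_le_imp_le) (use s in simp)
    then have "(1 + \<eta>) * ((1 - \<eta>) * m) \<le> (1 + \<eta>) * s" using \<eta> by (intro mult_left_mono) auto
    then have "(1 - \<eta>\<^sup>2) * m - (1 + \<eta>) * s \<le> 0" by (simp add: a mult.assoc)
    then show ?thesis using 1 th s \<eta> by (intro goal[of s]) auto
  next
    case 2
    obtain s where "0 < s" "s\<^sup>2 = (if r \<le> th then th else (th + r)\<^sup>2 / (4 * r))"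
      "th + (pos (sqrt r - s))\<^sup>2 = (if r \<le> th then th else (th + r)\<^sup>2 / (4 * r))"
      using crossing_hard[of th r] th r by auto
    then show ?thesis using 2 \<eta> r by (intro goal[of s]) (auto simp: rho_lasso4_def \<eta>_def m_def)
  next
    case 3
    have pa: "0 < 1 - \<eta>\<^sup>2" using a \<eta> by simp
    define D where "D = sqrt ((1 - \<eta>)\<^sup>2 * r - 4 * \<eta> * th / (1 - \<eta>\<^sup>2))"
    define s where "s = (1 - \<eta>\<^sup>2) / (4 * \<eta>) * ((1 + \<eta>) * m - D)"
    define g where "g = (1 - \<eta>)\<^sup>2 * r - 4 * \<eta> * th / (1 - \<eta>\<^sup>2)"
    have ga: "(1 - \<eta>\<^sup>2) * g = (1 - \<eta>\<^sup>2) * (1 - \<eta>)\<^sup>2 * r - 4 * \<eta> * th" using pa by (simp add: g_def right_diff_distrib mult.assoc)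
    have "((1 + \<eta>)\<^sup>2 * g - ((1 - \<eta>)\<^sup>2 * m)\<^sup>2) * (1 - \<eta>) = 4 * \<eta> * ((1 - \<eta>) ^ 3 * r - (1 + \<eta>) * th)"
    proof -
      have "(1 + \<eta>) * ((1 - \<eta>) * g) = (1 + \<eta>) * ((1 - \<eta>) * (1 - \<eta>)\<^sup>2 * r) - 4 * \<eta> * th" using ga unfolding a by (simp add: mult.assoc)
      then show ?thesis unfolding m(2) by algebra
    qed
    moreover have "0 \<le> 4 * \<eta> * ((1 - \<eta>) ^ 3 * r - (1 + \<eta>) * th)" using 3 by simp
    ultimately have "0 \<le> ((1 + \<eta>)\<^sup>2 * g - ((1 - \<eta>)\<^sup>2 * m)\<^sup>2) * (1 - \<eta>)" by simp
    then have ge: "((1 - \<eta>)\<^sup>2 * m)\<^sup>2 \<le> (1 + \<eta>)\<^sup>2 * g" using \<eta>(2) by (simp only: zero_le_mult_iff) linarith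
    then have "0 \<le> (1 + \<eta>)\<^sup>2 * g" using zero_le_power2 order_trans by blast
    then have g0: "0 \<le> g" using \<eta> by (simp add: zero_le_mult_iff)
    have D2: "0 \<le> D" "D\<^sup>2 = g" using g0 by (auto simp: D_def g_def)
    have "((1 - \<eta>)\<^sup>2 * m)\<^sup>2 \<le> ((1 + \<eta>) * D)\<^sup>2" using ge D2 by (simp add: power_mult_distrib)
    then have Dge: "(1 - \<eta>)\<^sup>2 * m \<le> (1 + \<eta>) * D" by (rule power2_le_imp_le) (use D2 \<eta> in simp)
    have "g < ((1 + \<eta>) * m)\<^sup>2"
    proof -
      have "g \<le> (1 - \<eta>)\<^sup>2 * r" using 3 th pa by (simp add: g_def)
      also have "\<dots> < (1 + \<eta>)\<^sup>2 * r" using 3 \<eta> m r th by (intro mult_strict_right_mono power_strict_mono) auto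
      finally show ?thesis by (simp add: m power_mult_distrib)
    qed
    then have "D\<^sup>2 < ((1 + \<eta>) * m)\<^sup>2" by (simp only: D2(2))
    then have "D < (1 + \<eta>) * m" by (rule power_less_imp_less_base) (use m \<eta> in simp)
    then have s0: "0 < s" using 3 pa by (simp add: s_def)
    have sD: "4 * \<eta> * s = (1 - \<eta>\<^sup>2) * ((1 + \<eta>) * m - D)" using 3 by (simp add: s_def)
    have "4 * \<eta> * s \<le> 4 * \<eta> * ((1 - \<eta>) * m)"
    proof -
      have "4 * \<eta> * s = (1 - \<eta>) * ((1 + \<eta>) * ((1 + \<eta>) * m) - (1 + \<eta>) * D)" unfolding sD by algebra
      also have "\<dots> \<le> (1 - \<eta>) * ((1 + \<eta>) * ((1 + \<eta>) * m) - (1 - \<eta>)\<^sup>2 * m)" using Dge \<eta> by (intro mult_left_mono) auto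
      also have "\<dots> = 4 * \<eta> * ((1 - \<eta>) * m)" by algebra
      finally show ?thesis .
    qed
    then have "s \<le> (1 - \<eta>) * m" using 3 by simp
    then have "(1 + \<eta>) * s \<le> (1 + \<eta>) * ((1 - \<eta>) * m)" using \<eta> by (intro mult_left_mono) auto
    then have le: "0 \<le> (1 - \<eta>\<^sup>2) * m - (1 + \<eta>) * s" by (simp add: a mult.assoc)
    have "4 * \<eta> * ((1 - \<eta>\<^sup>2) * th + ((1 - \<eta>\<^sup>2) * m - (1 + \<eta>) * s)\<^sup>2 - (1 - \<eta>)\<^sup>2 * s\<^sup>2) = 0"
    proof -
      have "(1 - \<eta>\<^sup>2) * D = (1 - \<eta>\<^sup>2) * (1 + \<eta>) * m - 4 * \<eta> * s" unfolding sD by algebra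
      then have "((1 - \<eta>\<^sup>2) * (1 + \<eta>) * m - 4 * \<eta> * s)\<^sup>2 = (1 - \<eta>\<^sup>2)\<^sup>2 * D\<^sup>2" by (metis power_mult_distrib)
      also have "\<dots> = (1 - \<eta>\<^sup>2) * ((1 - \<eta>\<^sup>2) * (1 - \<eta>)\<^sup>2 * m\<^sup>2 - 4 * \<eta> * th)" unfolding D2(2) power2_eq_square[of "1 - \<eta>\<^sup>2"] mult.assoc[of "1 - \<eta>\<^sup>2" "1 - \<eta>\<^sup>2"] ga m(2) ..
      finally show ?thesis by algebra
    qed
    then have "(1 - \<eta>\<^sup>2) * th + ((1 - \<eta>\<^sup>2) * m - (1 + \<eta>) * s)\<^sup>2 = (1 - \<eta>)\<^sup>2 * s\<^sup>2" using 3 by simp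
    then have "th + ((1 - \<eta>\<^sup>2) * m - (1 + \<eta>) * s)\<^sup>2 / (1 - \<eta>\<^sup>2) = (1 - \<eta>)\<^sup>2 * s\<^sup>2 / (1 - \<eta>\<^sup>2)"
      using pa by (simp add: field_simps)
    also have "\<dots> = (1 - \<eta>) / (1 + \<eta>) * s\<^sup>2" unfolding a using \<eta> by (simp add: power2_eq_square)
    finally have eq: "th + ((1 - \<eta>\<^sup>2) * m - (1 + \<eta>) * s)\<^sup>2 / (1 - \<eta>\<^sup>2) = (1 - \<eta>) / (1 + \<eta>) * s\<^sup>2" .
    have "rho_lasso4 th r h = th + (1 - \<eta>) ^ 3 * (1 + \<eta>) / (16 * \<eta>\<^sup>2) * ((1 + \<eta>) * m - D)\<^sup>2"
      using 3 unfolding rho_lasso4_def D_def m_def by (auto simp: \<eta>_def)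
    also have "(1 - \<eta>) ^ 3 * (1 + \<eta>) / (16 * \<eta>\<^sup>2) * ((1 + \<eta>) * m - D)\<^sup>2 = (1 - \<eta>) / (1 + \<eta>) * s\<^sup>2"
      unfolding s_def a using \<eta> 3 by (simp add: power_mult_distrib power_divide) (simp add: power2_eq_square power3_eq_cube)
    finally show ?thesis using 3 eq le s0 by (intro goal[of s]) auto
  qed
qed

lemma Min4_le: "Min {a, b, c, d} \<le> a" "Min {a, b, c, d} \<le> b" "Min {a, b, c, d} \<le> c" "Min {a, b, c, d} \<le> d"
  for a b c d :: real by auto

lemma rho_ss1_alt: assumes "0 < th" "\<bar>h\<bar> < 1"
  shows "rho_ss1 th r h = (if (1 - h\<^sup>2) * r \<le> 2 * th then 2 * th else (2 * th + (1 - h\<^sup>2) * r)\<^sup>2 / (4 * ((1 - h\<^sup>2) * r)))"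
  using assms abs_less_one_sq[OF assms(2)] by (simp add: rho_ss1_def divide_le_eq le_divide_eq mult_ac)

lemma rho_ss2_alt: assumes "0 < th" "\<bar>h\<bar> < 1"
  shows "rho_ss2 th r h = (if (1 - \<bar>h\<bar>) * r \<le> 2 * th then 2 * th else 2 * (sqrt (2 * ((1 - \<bar>h\<bar>) * r)) - sqrt ((1 - \<bar>h\<bar>) * r - th))\<^sup>2)"
  using assms by (simp add: rho_ss2_def divide_le_eq le_divide_eq mult_ac)

section \<open>Graphlet Screening on a block\<close>

definition adm :: "real \<Rightarrow> real \<Rightarrow> bool" where "adm v x \<longleftrightarrow> x = 0 \<or> v \<le> \<bar>x\<bar>"

text \<open>The cleaning step on a component of one or two nodes, up to a constant; \<open>w\<close> is the correlation with \<open>Y\<close>.\<close>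
definition Gmin1 :: "real \<Rightarrow> real \<Rightarrow> real \<Rightarrow> real \<Rightarrow> bool" where
  "Gmin1 u v w x \<longleftrightarrow> adm v x \<and> (\<forall>x'. adm v x' \<longrightarrow>
     x\<^sup>2 - 2 * w * x + u\<^sup>2 * of_bool (x \<noteq> 0) \<le> x'\<^sup>2 - 2 * w * x' + u\<^sup>2 * of_bool (x' \<noteq> 0))"

definition Gmin2 :: "real \<Rightarrow> real \<Rightarrow> real \<Rightarrow> real \<Rightarrow> real \<Rightarrow> real \<Rightarrow> real \<Rightarrow> bool" where
  "Gmin2 h u v w1 w2 x y \<longleftrightarrow> adm v x \<and> adm v y \<and> (\<forall>x' y'. adm v x' \<and> adm v y' \<longrightarrow>
     qf h x y - 2 * (w1 * x + w2 * y) + u\<^sup>2 * (of_bool (x \<noteq> 0) + of_bool (y \<noteq> 0))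
     \<le> qf h x' y' - 2 * (w1 * x' + w2 * y') + u\<^sup>2 * (of_bool (x' \<noteq> 0) + of_bool (y' \<noteq> 0)))"

lemma Gmin2_swap: "Gmin2 h u v w1 w2 x y \<Longrightarrow> Gmin2 h u v w2 w1 y x"
  unfolding Gmin2_def
proof (elim conjE, intro conjI allI impI)
  fix x' y' assume *: "adm v x' \<and> adm v y'" and "\<forall>x' y'. adm v x' \<and> adm v y' \<longrightarrow>
     qf h x y - 2 * (w1 * x + w2 * y) + u\<^sup>2 * (of_bool (x \<noteq> 0) + of_bool (y \<noteq> 0))
     \<le> qf h x' y' - 2 * (w1 * x' + w2 * y') + u\<^sup>2 * (of_bool (x' \<noteq> 0) + of_bool (y' \<noteq> 0))"
  then have "qf h x y - 2 * (w1 * x + w2 * y) + u\<^sup>2 * (of_bool (x \<noteq> 0) + of_bool (y \<noteq> 0))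
     \<le> qf h y' x' - 2 * (w1 * y' + w2 * x') + u\<^sup>2 * (of_bool (y' \<noteq> 0) + of_bool (x' \<noteq> 0))" by blast
  then show "qf h y x - 2 * (w2 * y + w1 * x) + u\<^sup>2 * (of_bool (y \<noteq> 0) + of_bool (x \<noteq> 0))
     \<le> qf h x' y' - 2 * (w2 * x' + w1 * y') + u\<^sup>2 * (of_bool (x' \<noteq> 0) + of_bool (y' \<noteq> 0))"
    unfolding qf_swap[of h y x] qf_swap[of h x' y'] by (simp only: add.commute)
qed

lemma Gmin1_compare:
  assumes "Gmin1 u v (b + n) x" "adm v b"
  shows "(x - b)\<^sup>2 + u\<^sup>2 * (of_bool (x \<noteq> 0) - of_bool (b \<noteq> 0)) \<le> 2 * (n * (x - b))"
proof -
  have "x\<^sup>2 - 2 * (b + n) * x + u\<^sup>2 * of_bool (x \<noteq> 0) \<le> b\<^sup>2 - 2 * (b + n) * b + u\<^sup>2 * of_bool (b \<noteq> 0)"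
    using assms unfolding Gmin1_def by blast
  moreover have "(x\<^sup>2 - 2 * (b + n) * x) - (b\<^sup>2 - 2 * (b + n) * b) = (x - b)\<^sup>2 - 2 * (n * (x - b))" by algebra
  ultimately show ?thesis unfolding right_diff_distrib by linarith
qed

lemma Gmin2_compare:
  assumes "Gmin2 h u v (b1 + h * b2 + n1) (h * b1 + b2 + n2) x y" "adm v b1" "adm v b2"
  shows "qf h (x - b1) (y - b2) + u\<^sup>2 * (of_bool (x \<noteq> 0) + of_bool (y \<noteq> 0) - of_bool (b1 \<noteq> 0) - of_bool (b2 \<noteq> 0))
     \<le> 2 * ((x - b1) * n1 + (y - b2) * n2)"
proof -
  let ?o = "\<lambda>x y. qf h x y - 2 * ((b1 + h * b2 + n1) * x + (h * b1 + b2 + n2) * y)"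
  have "?o x y + u\<^sup>2 * (of_bool (x \<noteq> 0) + of_bool (y \<noteq> 0)) \<le> ?o b1 b2 + u\<^sup>2 * (of_bool (b1 \<noteq> 0) + of_bool (b2 \<noteq> 0))"
    using assms unfolding Gmin2_def by blast
  moreover have "?o x y - ?o b1 b2 = qf h (x - b1) (y - b2) - 2 * ((x - b1) * n1 + (y - b2) * n2)" unfolding qf_def by algebra
  ultimately show ?thesis unfolding right_diff_distrib distrib_left by linarith
qed

lemma ratio_le_of_sq:
  fixes D0 D e R :: real
  assumes "0 < D0" "D0 \<le> D" "e\<^sup>2 \<le> D0 * D" "(D + e)\<^sup>2 \<le> 4 * D * R"
  shows "(D0 + e)\<^sup>2 / (4 * D0) \<le> R"
proof -
  have "(D + e)\<^sup>2 * D0 - (D0 + e)\<^sup>2 * D = (D - D0) * (D0 * D - e\<^sup>2)" by algebra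
  moreover have "0 \<le> (D - D0) * (D0 * D - e\<^sup>2)" using assms by (intro mult_nonneg_nonneg) auto
  ultimately have "(D0 + e)\<^sup>2 * D \<le> (D + e)\<^sup>2 * D0" by linarith
  also have "\<dots> \<le> 4 * D * R * D0" using assms by (intro mult_right_mono) auto
  finally have "D * (D0 + e)\<^sup>2 \<le> D * (4 * D0 * R)" by (simp add: mult_ac)
  then have "(D0 + e)\<^sup>2 \<le> 4 * D0 * R" using assms by simp
  then show ?thesis using assms by (simp add: divide_le_eq mult_ac)
qed

lemma gain_pos:
  fixes D0 D e R N :: real
  assumes "0 < D0" "D0 \<le> D" "0 \<le> e" "D + e \<le> 2 * N" "N\<^sup>2 \<le> D * R"
  shows "e \<le> D0 \<Longrightarrow> (D0 + e)\<^sup>2 / (4 * D0) \<le> R" "e \<le> R"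
proof -
  have "(D + e)\<^sup>2 \<le> (2 * N)\<^sup>2" using assms by (intro power_mono) auto
  then have sq: "(D + e)\<^sup>2 \<le> 4 * D * R" using assms(5) by (simp add: power_mult_distrib)
  show "e \<le> D0 \<Longrightarrow> (D0 + e)\<^sup>2 / (4 * D0) \<le> R"
  proof (rule ratio_le_of_sq[OF assms(1,2) _ sq])
    assume "e \<le> D0"
    then have "e * e \<le> D0 * D" using assms by (intro mult_mono) auto
    then show "e\<^sup>2 \<le> D0 * D" by (simp add: power2_eq_square)
  qed
  have "4 * D * e \<le> (D + e)\<^sup>2" using zero_le_power2[of "D - e"] by (simp add: power2_eq_square algebra_simps)
  with sq have "4 * D * e \<le> 4 * D * R" by linarith
  then show "e \<le> R" using assms by simp
qed

lemma gain_neg: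
  fixes D0 D e R N :: real
  assumes "0 < D0" "D0 \<le> D" "0 \<le> e" "D - e \<le> 2 * N" "N\<^sup>2 \<le> D * R" "0 \<le> R"
  shows "(pos (D0 - e))\<^sup>2 / (4 * D0) \<le> R"
proof (cases "D0 \<le> e")
  case True then show ?thesis using assms by simp
next
  case False
  have "(D - e)\<^sup>2 \<le> (2 * N)\<^sup>2" using assms False by (intro power_mono) auto
  then have sq: "(D + - e)\<^sup>2 \<le> 4 * D * R" using assms(5) by (simp add: power_mult_distrib)
  have "e * e \<le> D0 * D" using assms False by (intro mult_mono) auto
  then have "(- e)\<^sup>2 \<le> D0 * D" by (simp add: power2_eq_square)
  from ratio_le_of_sq[OF assms(1,2) this sq] False show ?thesis by simp
qed

lemma opposite_gap: "4 * r \<le> (x - b)\<^sup>2" if "sgn x \<noteq> sgn b" "x \<noteq> 0" "b \<noteq> 0" "adm (sqrt r) x" "adm (sqrt r) b" "0 \<le> r"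
proof -
  have "2 * sqrt r \<le> \<bar>x - b\<bar>" using that by (auto simp: adm_def sgn_if split: if_splits)
  then have "(2 * sqrt r)\<^sup>2 \<le> \<bar>x - b\<bar>\<^sup>2" using that(6) by (intro power_mono) auto
  then show ?thesis using that(6) by (simp add: power_mult_distrib)
qed

lemma adm_sq: "r \<le> x\<^sup>2" if "adm (sqrt r) x" "x \<noteq> 0" "0 \<le> r"
proof -
  have "(sqrt r)\<^sup>2 \<le> \<bar>x\<bar>\<^sup>2" using that by (intro power_mono) (auto simp: adm_def)
  then show ?thesis using that by simp
qed

lemma miss_screen:
  assumes "0 < A" "0 \<le> t" "sqrt t \<le> (A + th) / (2 * sqrt A)" "th \<le> A" "sqrt A \<le> \<bar>b\<bar>" "(b + n)\<^sup>2 \<le> t"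
  shows "(A - th)\<^sup>2 / (4 * A) \<le> n\<^sup>2"
proof -
  have "(b + n)\<^sup>2 \<le> (sqrt t)\<^sup>2" using assms by simp
  from abs_gap[OF assms(5) this] have 1: "(pos (sqrt A - sqrt t))\<^sup>2 \<le> n\<^sup>2" using assms by simp
  have "sqrt A * sqrt A = A" using assms by simp
  then have "sqrt A - (A + th) / (2 * sqrt A) = (A - th) / (2 * sqrt A)" using assms by (simp add: field_simps)
  then have "(A - th) / (2 * sqrt A) \<le> sqrt A - sqrt t" using assms by linarith
  from pos_mono[OF this] have "((A - th) / (2 * sqrt A))\<^sup>2 \<le> (pos (sqrt A - sqrt t))\<^sup>2" using assms by simp
  with 1 show ?thesis using assms by (simp add: power_divide power_mult_distrib)
qed

lemma gs_upper_isolated: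
  assumes th: "0 < th" "th < r" and t: "0 \<le> t" "sqrt t \<le> (r + th) / (2 * sqrt r)"
    and b: "b = 0 \<or> sqrt r \<le> \<bar>b\<bar>"
    and E: "Gmin1 (sqrt th) (sqrt r) (b + n) x \<or> x = 0 \<and> (b + n)\<^sup>2 \<le> t"
    and err: "sgn x \<noteq> sgn b" and rho: "\<rho> \<le> (th + r)\<^sup>2 / (4 * r)"
  shows "\<rho> - th * of_bool (b \<noteq> 0) \<le> n\<^sup>2"
proof (cases "b = 0")
  case True
  with err E have x: "x \<noteq> 0" "Gmin1 (sqrt th) (sqrt r) (b + n) x" by auto
  have "(x - b)\<^sup>2 + (sqrt th)\<^sup>2 * (of_bool (x \<noteq> 0) - of_bool (b \<noteq> 0)) \<le> 2 * (n * (x - b))"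
    using x(2) by (rule Gmin1_compare) (simp add: adm_def True)
  then have "x\<^sup>2 + th \<le> 2 * (n * x)" using True x th by simp
  moreover have "r \<le> x\<^sup>2" using x th by (intro adm_sq) (auto simp: Gmin1_def)
  ultimately have "(r + th)\<^sup>2 / (4 * r) \<le> n\<^sup>2" using th by (intro gain_pos(1)[of r "x\<^sup>2" th "n * x"]) (auto simp: power_mult_distrib)
  then show ?thesis using rho True by (simp add: add.commute)
next
  case False
  have eq: "(th + r)\<^sup>2 / (4 * r) - th = (r - th)\<^sup>2 / (4 * r)" using th by (simp add: field_simps power2_eq_square)
  have rb: "r \<le> b\<^sup>2" using b False th by (intro adm_sq) (auto simp: adm_def)
  have "(r - th)\<^sup>2 / (4 * r) \<le> n\<^sup>2"
  proof (cases "Gmin1 (sqrt th) (sqrt r) (b + n) x")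
    case False
    then have "(b + n)\<^sup>2 \<le> t" using E by simp
    then show ?thesis using t th b \<open>b \<noteq> 0\<close> by (intro miss_screen) auto
  next
    case G: True
    have c: "(x - b)\<^sup>2 + th * (of_bool (x \<noteq> 0) - 1) \<le> 2 * (n * (x - b))"
      using Gmin1_compare[OF G] False b th by (simp add: adm_def)
    show ?thesis
    proof (cases "x = 0")
      case True
      then have "b\<^sup>2 - th \<le> 2 * (n * (- b))" using c by simp
      then have "(pos (r - th))\<^sup>2 / (4 * r) \<le> n\<^sup>2" using th rb
        by (intro gain_neg[of r "b\<^sup>2" th "n * (- b)"]) (auto simp: power_mult_distrib)
      then show ?thesis using th by simp
    next
      case False
      then have "4 * r \<le> (x - b)\<^sup>2" using G \<open>b \<noteq> 0\<close> b err th by (intro opposite_gap) (auto simp: Gmin1_def adm_def)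
      moreover have "(x - b)\<^sup>2 + 0 \<le> 2 * (n * (x - b))" using c False by simp
      ultimately have "(4 * r + 0)\<^sup>2 / (4 * (4 * r)) \<le> n\<^sup>2" using th
        by (intro gain_pos(1)[of "4 * r" "(x - b)\<^sup>2" 0 "n * (x - b)"]) (auto simp: power_mult_distrib)
      then have "r \<le> n\<^sup>2" using th by (simp add: power2_eq_square)
      moreover have "(r - th)\<^sup>2 / (4 * r) \<le> r"
      proof -
        have "(r - th) * (r - th) \<le> r * (4 * r)" using th by (intro mult_mono) auto
        then show ?thesis using th by (simp add: divide_le_eq power2_eq_square)
      qed
      ultimately show ?thesis by simp
    qed
  qed
  with eq rho False show ?thesis by simp
qed

lemma sq_ratio_le: "(pos (A - e))\<^sup>2 / (4 * A) \<le> A / 4" if "0 < A" "0 \<le> e"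
proof -
  have "(pos (A - e))\<^sup>2 \<le> A\<^sup>2" using that by (intro power_mono) (auto simp: pos_def)
  then show ?thesis using that by (simp add: divide_le_eq power2_eq_square)
qed

lemma gs_joint_null:
  assumes h: "\<bar>h\<bar> < 1" and th: "0 < th" "th < r" and G: "Gmin2 h (sqrt th) (sqrt r) n1 n2 x y"
    and err: "\<not> (x = 0 \<and> y = 0)"
    and rho: "\<rho> \<le> (th + r)\<^sup>2 / (4 * r)" "\<rho> \<le> th + (1 - \<bar>h\<bar>) * r / 2"
  shows "\<rho> \<le> rad2 h n1 n2"
proof -
  let ?R = "rad2 h n1 n2"
  define C where "C = (1 - \<bar>h\<bar>) * r"
  have C: "0 < C" using h th by (simp add: C_def)
  have N: "(x * n1 + y * n2)\<^sup>2 \<le> qf h x y * ?R" by (rule qf_rad2_cauchy[OF h])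
  have G': "Gmin2 h (sqrt th) (sqrt r) (0 + h * 0 + n1) (h * 0 + 0 + n2) x y" using G by simp
  have c: "qf h x y + th * (of_bool (x \<noteq> 0) + of_bool (y \<noteq> 0)) \<le> 2 * (x * n1 + y * n2)"
    using Gmin2_compare[OF G'] th by (simp add: adm_def)
  show ?thesis
  proof (cases "x \<noteq> 0 \<and> y \<noteq> 0")
    case True
    have "2 * (1 - \<bar>h\<bar>) * (sqrt r)\<^sup>2 \<le> qf h x y" using G True th by (intro qf_ge_both[OF h]) (auto simp: Gmin2_def adm_def)
    then have D: "2 * C \<le> qf h x y" using th by (simp add: C_def algebra_simps)
    have c2: "qf h x y + 2 * th \<le> 2 * (x * n1 + y * n2)" using c True by simp
    show ?thesis
    proof (cases "th \<le> C")
      case True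
      have "(2 * C + 2 * th)\<^sup>2 / (4 * (2 * C)) \<le> ?R"
        using C th True by (intro gain_pos(1)[OF _ D _ c2 N]) auto
      moreover have "th + C / 2 \<le> (2 * C + 2 * th)\<^sup>2 / (4 * (2 * C))"
        using C th by (simp add: le_divide_eq power2_eq_square algebra_simps)
      ultimately show ?thesis using rho(2) by (simp add: C_def)
    next
      case False
      have "2 * th \<le> ?R" using C th by (intro gain_pos(2)[OF _ D _ c2 N]) auto
      then show ?thesis using False rho(2) th by (simp add: C_def[symmetric])
    qed
  next
    case False
    then have one: "qf h x y + th \<le> 2 * (x * n1 + y * n2)" "r \<le> qf h x y"
      using c err G th adm_sq[of r x] adm_sq[of r y] by (auto simp: qf_def Gmin2_def)
    have "(r + th)\<^sup>2 / (4 * r) \<le> ?R" using th by (intro gain_pos(1)[OF _ one(2) _ one(1) N]) auto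
    then show ?thesis using rho(1) by (simp add: add.commute)
  qed
qed

lemma gs_joint_single:
  assumes h: "\<bar>h\<bar> < 1" and th: "0 < th" "th < r" and G: "Gmin2 h (sqrt th) (sqrt r) (b + n1) (h * b + n2) x y"
    and b: "sqrt r \<le> \<bar>b\<bar>" and err: "\<not> (sgn x = sgn b \<and> y = 0)"
    and rho: "\<rho> \<le> (th + r)\<^sup>2 / (4 * r)" "\<rho> \<le> th + (1 - \<bar>h\<bar>) * r / 2"
     "\<rho> \<le> 2 * th + (pos ((1 - h\<^sup>2) * r - th))\<^sup>2 / (4 * ((1 - h\<^sup>2) * r))"
  shows "\<rho> - th \<le> rad2 h n1 n2"
proof -
  let ?R = "rad2 h n1 n2"
  have R: "0 \<le> ?R" by (rule rad2_ge(5)[OF h])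
  define A where "A = (1 - h\<^sup>2) * r"
  have A: "0 < A" using abs_less_one_sq[OF h] th by (simp add: A_def)
  have b0: "b \<noteq> 0" using b th by auto
  have rb: "r \<le> b\<^sup>2" using b b0 th by (intro adm_sq) (auto simp: adm_def)
  have ax: "adm (sqrt r) x" "adm (sqrt r) y" using G by (auto simp: Gmin2_def)
  have N: "((x - b) * n1 + y * n2)\<^sup>2 \<le> qf h (x - b) y * ?R" by (rule qf_rad2_cauchy[OF h])
  have G': "Gmin2 h (sqrt th) (sqrt r) (b + h * 0 + n1) (h * b + 0 + n2) x y" using G by simp
  have c: "qf h (x - b) y + th * (of_bool (x \<noteq> 0) + of_bool (y \<noteq> 0) - 1) \<le> 2 * ((x - b) * n1 + y * n2)"
    using Gmin2_compare[OF G'] th b b0 by (simp add: adm_def)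
  have eq: "(th + r)\<^sup>2 / (4 * r) - th = (r - th)\<^sup>2 / (4 * r)" using th by (simp add: field_simps power2_eq_square)
  consider "x = 0" "y = 0" | "x \<noteq> 0" "y = 0" | "x = 0" "y \<noteq> 0" | "x \<noteq> 0" "y \<noteq> 0" by blast
  then show ?thesis
  proof cases
    case 1
    have D: "r \<le> qf h (x - b) y" using 1 rb by (simp add: qf_def)
    have c1: "qf h (x - b) y - th \<le> 2 * ((x - b) * n1 + y * n2)" using c 1 by simp
    have "(pos (r - th))\<^sup>2 / (4 * r) \<le> ?R" using th by (intro gain_neg[OF _ D _ c1 N R]) auto
    then show ?thesis using eq rho(1) th by simp
  next
    case 2
    then have s: "sgn x \<noteq> sgn b" using err by auto
    have "4 * r \<le> (x - b)\<^sup>2" using s 2 b0 ax b th by (intro opposite_gap) (auto simp: adm_def)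
    then have D: "4 * r \<le> qf h (x - b) y" using 2 by (simp add: qf_def)
    have c1: "qf h (x - b) y + 0 \<le> 2 * ((x - b) * n1 + y * n2)" using c 2 by simp
    have "(4 * r + 0)\<^sup>2 / (4 * (4 * r)) \<le> ?R" using th by (intro gain_pos(1)[OF _ D _ c1 N]) auto
    then have "r \<le> ?R" using th by (simp add: power2_eq_square)
    moreover have "(pos (r - th))\<^sup>2 / (4 * r) \<le> r / 4" using th by (intro sq_ratio_le) auto
    ultimately show ?thesis using eq rho(1) th by simp
  next
    case 3
    have "2 * (1 - \<bar>h\<bar>) * (sqrt r)\<^sup>2 \<le> qf h (x - b) y"
      using 3 ax b th by (intro qf_ge_both[OF h]) (auto simp: adm_def)
    then have D: "2 * ((1 - \<bar>h\<bar>) * r) \<le> qf h (x - b) y" using th by (simp add: algebra_simps)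
    have C: "0 < (1 - \<bar>h\<bar>) * r" using h th by simp
    have c1: "qf h (x - b) y + 0 \<le> 2 * ((x - b) * n1 + y * n2)" using c 3 by simp
    have "(2 * ((1 - \<bar>h\<bar>) * r) + 0)\<^sup>2 / (4 * (2 * ((1 - \<bar>h\<bar>) * r))) \<le> ?R" using C by (intro gain_pos(1)[OF _ D _ c1 N]) auto
    moreover have "(2 * z + 0)\<^sup>2 / (4 * (2 * z)) = z / 2" if "0 < z" for z :: real
      using that by (simp add: power2_eq_square)
    ultimately have "(1 - \<bar>h\<bar>) * r / 2 \<le> ?R" using C by metis
    then show ?thesis using rho(2) by simp
  next
    case 4
    have "r \<le> y\<^sup>2" using ax 4 th by (intro adm_sq) auto
    then have "(1 - h\<^sup>2) * r \<le> (1 - h\<^sup>2) * y\<^sup>2" using abs_less_one_sq[OF h] by simp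
    also have "\<dots> \<le> qf h (x - b) y" by (rule qf_ge(1)[OF h])
    finally have D: "A \<le> qf h (x - b) y" by (simp add: A_def)
    have c1: "qf h (x - b) y + th \<le> 2 * ((x - b) * n1 + y * n2)" using c 4 by simp
    show ?thesis
    proof (cases "th \<le> A")
      case True
      have "(A + th)\<^sup>2 / (4 * A) \<le> ?R" using th A True by (intro gain_pos(1)[OF _ D _ c1 N]) auto
      moreover have "th + (A - th)\<^sup>2 / (4 * A) = (A + th)\<^sup>2 / (4 * A)" using A by (simp add: field_simps power2_eq_square)
      ultimately show ?thesis using rho(3) True by (simp add: A_def[symmetric])
    next
      case False
      have "th \<le> ?R" using th A by (intro gain_pos(2)[OF _ D _ c1 N]) auto
      then show ?thesis using rho(3) False by (simp add: A_def[symmetric])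
    qed
  qed
qed

lemma gs_joint_both:
  assumes h: "\<bar>h\<bar> < 1" and th: "0 < th" "th < r"
    and G: "Gmin2 h (sqrt th) (sqrt r) (b1 + h * b2 + n1) (h * b1 + b2 + n2) x y"
    and b: "sqrt r \<le> \<bar>b1\<bar>" "sqrt r \<le> \<bar>b2\<bar>" and err: "\<not> (sgn x = sgn b1 \<and> sgn y = sgn b2)"
    and rho: "\<rho> \<le> th + (1 - \<bar>h\<bar>) * r / 2"
     "\<rho> \<le> 2 * th + (pos ((1 - h\<^sup>2) * r - th))\<^sup>2 / (4 * ((1 - h\<^sup>2) * r))"
  shows "\<rho> - 2 * th \<le> rad2 h n1 n2"
proof -
  let ?R = "rad2 h n1 n2" and ?D = "qf h (x - b1) (y - b2)" and ?N = "(x - b1) * n1 + (y - b2) * n2"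
  have R: "0 \<le> ?R" by (rule rad2_ge(5)[OF h])
  define A where "A = (1 - h\<^sup>2) * r"
  have a: "0 < 1 - h\<^sup>2" using abs_less_one_sq[OF h] .
  have A: "0 < A" using a th by (simp add: A_def)
  have b0: "b1 \<noteq> 0" "b2 \<noteq> 0" using b th by auto
  have ab: "adm (sqrt r) b1" "adm (sqrt r) b2" using b by (auto simp: adm_def)
  have ax: "adm (sqrt r) x" "adm (sqrt r) y" using G by (auto simp: Gmin2_def)
  have N: "?N\<^sup>2 \<le> ?D * ?R" by (rule qf_rad2_cauchy[OF h])
  have c: "?D + th * (of_bool (x \<noteq> 0) + of_bool (y \<noteq> 0) - 2) \<le> 2 * ?N"
    using Gmin2_compare[OF G ab] th b0 by simp
  have Dx: "(1 - h\<^sup>2) * (x - b1)\<^sup>2 \<le> ?D" "(1 - h\<^sup>2) * (y - b2)\<^sup>2 \<le> ?D"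
    using qf_ge(2)[OF h] qf_ge(1)[OF h] by blast+
  consider "x = 0" "y = 0" | "(x = 0) \<noteq> (y = 0)" | "x \<noteq> 0" "y \<noteq> 0" by blast
  then show ?thesis
  proof cases
    case 1
    define C where "C = (1 - \<bar>h\<bar>) * r"
    have C: "0 < C" using h th by (simp add: C_def)
    have "2 * (1 - \<bar>h\<bar>) * (sqrt r)\<^sup>2 \<le> ?D" using 1 b th by (intro qf_ge_both[OF h]) auto
    then have D: "2 * C \<le> ?D" using th by (simp add: C_def algebra_simps)
    have c1: "?D - 2 * th \<le> 2 * ?N" using c 1 by simp
    have "(pos (2 * C - 2 * th))\<^sup>2 / (4 * (2 * C)) \<le> ?R" using th C by (intro gain_neg[OF _ D _ c1 N R]) auto
    moreover have "C / 2 - th \<le> (pos (2 * C - 2 * th))\<^sup>2 / (4 * (2 * C))"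
    proof (cases "th \<le> C")
      case True
      then show ?thesis using C th by (simp add: le_divide_eq power2_eq_square algebra_simps)
    next
      case False
      then show ?thesis using C th by simp
    qed
    ultimately show ?thesis using rho(1) by (simp add: C_def)
  next
    case 2
    have c1: "?D - th \<le> 2 * ?N" using c 2 by auto
    have "(1 - h\<^sup>2) * r \<le> ?D"
    proof (cases "x = 0")
      case True
      have "r \<le> (x - b1)\<^sup>2" using True ab b0 th adm_sq[of r b1] by simp
      then have "(1 - h\<^sup>2) * r \<le> (1 - h\<^sup>2) * (x - b1)\<^sup>2" using a by simp
      with Dx show ?thesis by linarith
    next
      case False
      then have "y = 0" using 2 by auto
      then have "r \<le> (y - b2)\<^sup>2" using ab b0 th adm_sq[of r b2] by simp
      then have "(1 - h\<^sup>2) * r \<le> (1 - h\<^sup>2) * (y - b2)\<^sup>2" using a by simp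
      with Dx show ?thesis by linarith
    qed
    then have D: "A \<le> ?D" by (simp add: A_def)
    have "(pos (A - th))\<^sup>2 / (4 * A) \<le> ?R" using th A by (intro gain_neg[OF _ D _ c1 N R]) auto
    then show ?thesis using rho(2) by (simp add: A_def)
  next
    case 3
    have c1: "?D + 0 \<le> 2 * ?N" using c 3 by simp
    have "4 * r \<le> (x - b1)\<^sup>2 \<or> 4 * r \<le> (y - b2)\<^sup>2"
      using err opposite_gap[of x b1 r] opposite_gap[of y b2 r] 3 b0 ab ax th by auto
    then have "(1 - h\<^sup>2) * (4 * r) \<le> (1 - h\<^sup>2) * (x - b1)\<^sup>2 \<or> (1 - h\<^sup>2) * (4 * r) \<le> (1 - h\<^sup>2) * (y - b2)\<^sup>2"
      using a by simp
    then have "(1 - h\<^sup>2) * (4 * r) \<le> ?D" using Dx by linarith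
    then have D: "4 * A \<le> ?D" by (simp add: A_def)
    have "(4 * A + 0)\<^sup>2 / (4 * (4 * A)) \<le> ?R" using A by (intro gain_pos(1)[OF _ D _ c1 N]) auto
    then have "A \<le> ?R" using A by (simp add: power2_eq_square)
    moreover have "(pos (A - th))\<^sup>2 / (4 * A) \<le> A / 4" using A th by (intro sq_ratio_le) auto
    ultimately show ?thesis using rho(2) A by (simp add: A_def[symmetric])
  qed
qed

text \<open>The final set of the screening step restricted to a block whose two nodes are adjacent: u1
  and u2 tell whether the nodes survive.\<close>
definition gs_screen :: "real \<Rightarrow> real \<Rightarrow> real \<Rightarrow> real \<Rightarrow> real \<Rightarrow> real \<Rightarrow> real \<Rightarrow> real \<Rightarrow> bool \<Rightarrow> bool \<Rightarrow> bool" where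
  "gs_screen h ta tb tab tba tp w1 w2 u1 u2 \<longleftrightarrow>
    (u1 \<longleftrightarrow> w1\<^sup>2 > ta \<or> (w2\<^sup>2 > tb \<and> (w1 - h * w2)\<^sup>2 / (1 - h\<^sup>2) > tab) \<or> (\<not> w2\<^sup>2 > tb \<and> rad2 h w1 w2 > tp)) \<and>
    (u2 \<longleftrightarrow> w2\<^sup>2 > tb \<or> (w1\<^sup>2 > ta \<and> (w2 - h * w1)\<^sup>2 / (1 - h\<^sup>2) > tba) \<or> (\<not> w1\<^sup>2 > ta \<and> rad2 h w1 w2 > tp))"

definition gs_block :: "real \<Rightarrow> real \<Rightarrow> real \<Rightarrow> real \<Rightarrow> real \<Rightarrow> bool \<Rightarrow> bool \<Rightarrow> real \<Rightarrow> real \<Rightarrow> bool" where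
  "gs_block h u v w1 w2 u1 u2 x y \<longleftrightarrow>
    (if u1 \<and> u2 then Gmin2 h u v w1 w2 x y
     else (if u1 then Gmin1 u v w1 x else x = 0) \<and> (if u2 then Gmin1 u v w2 y else y = 0))"

lemma gs_screen_swap: "gs_screen h ta tb tab tba tp w1 w2 u1 u2 \<Longrightarrow> gs_screen h tb ta tba tab tp w2 w1 u2 u1"
  unfolding gs_screen_def by (auto simp: rad2_swap)

lemma gs_block_swap: "gs_block h u v w1 w2 u1 u2 x y \<Longrightarrow> gs_block h u v w2 w1 u2 u1 y x"
  unfolding gs_block_def by (auto intro: Gmin2_swap split: if_splits)

lemma gs_upper_single:
  assumes h: "\<bar>h\<bar> < 1" and th: "0 < th" "th < r"
    and ta: "0 \<le> ta" "sqrt ta \<le> (r + th) / (2 * sqrt r)"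
    and S: "gs_screen h ta tb tab tba tp (b + n1) (h * b + n2) u1 u2"
    and B: "gs_block h (sqrt th) (sqrt r) (b + n1) (h * b + n2) u1 u2 x y"
    and b: "sqrt r \<le> \<bar>b\<bar>" and err: "\<not> (sgn x = sgn b \<and> sgn y = 0)"
    and rho: "\<rho> \<le> (th + r)\<^sup>2 / (4 * r)" "\<rho> \<le> th + (1 - \<bar>h\<bar>) * r / 2"
     "\<rho> \<le> 2 * th + (pos ((1 - h\<^sup>2) * r - th))\<^sup>2 / (4 * ((1 - h\<^sup>2) * r))"
  shows "\<rho> - th \<le> rad2 h n1 n2"
proof (cases "u1 \<and> u2")
  case True
  then show ?thesis using B err by (intro gs_joint_single[OF h th _ b _ rho]) (auto simp: gs_block_def sgn_0_0)
next
  case False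
  have b0: "b \<noteq> 0" using b th by auto
  have "Gmin1 (sqrt th) (sqrt r) (b + n1) x \<and> y = 0 \<or> x = 0 \<and> (b + n1)\<^sup>2 \<le> ta"
    using False S B unfolding gs_screen_def gs_block_def by (cases u1; cases u2) auto
  then have "Gmin1 (sqrt th) (sqrt r) (b + n1) x \<or> x = 0 \<and> (b + n1)\<^sup>2 \<le> ta" "sgn x \<noteq> sgn b"
    using err b0 by (auto simp: sgn_0_0)
  from gs_upper_isolated[OF th ta _ this rho(1)] b b0 have "\<rho> - th \<le> n1\<^sup>2" by simp
  also have "\<dots> \<le> rad2 h n1 n2" by (rule rad2_ge(1)[OF h])
  finally show ?thesis .
qed

lemma gs_conditional_miss:
  assumes h: "\<bar>h\<bar> < 1" and r: "0 < r" and th: "0 < th"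
    and t: "0 \<le> t" "th < (1 - h\<^sup>2) * r \<Longrightarrow> sqrt t \<le> ((1 - h\<^sup>2) * r + th) / (2 * sqrt ((1 - h\<^sup>2) * r))"
    and b: "sqrt r \<le> \<bar>b\<bar>" and w: "((1 - h\<^sup>2) * b + n)\<^sup>2 / (1 - h\<^sup>2) \<le> t"
  shows "(pos ((1 - h\<^sup>2) * r - th))\<^sup>2 / (4 * ((1 - h\<^sup>2) * r)) \<le> n\<^sup>2 / (1 - h\<^sup>2)"
proof (cases "th < (1 - h\<^sup>2) * r")
  case True
  have a: "0 < 1 - h\<^sup>2" using abs_less_one_sq[OF h] .
  have "((1 - h\<^sup>2) * b + n) / sqrt (1 - h\<^sup>2) = sqrt (1 - h\<^sup>2) * b + n / sqrt (1 - h\<^sup>2)"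
  proof -
    have "(1 - h\<^sup>2) * b / sqrt (1 - h\<^sup>2) = (1 - h\<^sup>2) / sqrt (1 - h\<^sup>2) * b" by simp
    also have "(1 - h\<^sup>2) / sqrt (1 - h\<^sup>2) = sqrt (1 - h\<^sup>2)" using a by (intro real_div_sqrt) simp
    finally show ?thesis by (simp add: add_divide_distrib)
  qed
  then have 1: "(sqrt (1 - h\<^sup>2) * b + n / sqrt (1 - h\<^sup>2))\<^sup>2 \<le> t"
    using w sqrt_a_div[OF a] by metis
  have 2: "sqrt ((1 - h\<^sup>2) * r) \<le> \<bar>sqrt (1 - h\<^sup>2) * b\<bar>"
    using b a by (simp add: real_sqrt_mult abs_mult)
  have "((1 - h\<^sup>2) * r - th)\<^sup>2 / (4 * ((1 - h\<^sup>2) * r)) \<le> (n / sqrt (1 - h\<^sup>2))\<^sup>2"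
    by (rule miss_screen[OF _ t(1) t(2)[OF True] _ 2 1]) (use True a r in auto)
  then show ?thesis using True sqrt_a_div[OF a] by simp
next
  case False
  have a: "0 < 1 - h\<^sup>2" using abs_less_one_sq[OF h] .
  then have "0 \<le> n\<^sup>2 / (1 - h\<^sup>2)" by simp
  moreover have "pos ((1 - h\<^sup>2) * r - th) = 0" using False by simp
  ultimately show ?thesis by (simp only: power_zero_numeral div_0)
qed

lemma gs_pair_miss:
  assumes h: "\<bar>h\<bar> < 1" and r: "0 < r"
    and t: "0 \<le> tp" "2 * th \<le> (1 - \<bar>h\<bar>) * r \<Longrightarrow> sqrt tp \<le> sqrt (2 * ((1 - \<bar>h\<bar>) * r)) - sqrt ((1 - \<bar>h\<bar>) * r / 2 - th)"
    and b: "sqrt r \<le> \<bar>b1\<bar>" "sqrt r \<le> \<bar>b2\<bar>" and w: "rad2 h (b1 + h * b2 + n1) (h * b1 + b2 + n2) \<le> tp"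
  shows "(1 - \<bar>h\<bar>) * r / 2 - th \<le> rad2 h n1 n2"
proof (cases "2 * th \<le> (1 - \<bar>h\<bar>) * r")
  case True
  define C where "C = (1 - \<bar>h\<bar>) * r"
  have C: "0 < C" using h r by (simp add: C_def)
  have "2 * (1 - \<bar>h\<bar>) * (sqrt r)\<^sup>2 \<le> qf h b1 b2" by (rule qf_ge_both[OF h b]) (use r in simp)
  then have "2 * C \<le> qf h b1 b2" using r by (simp add: C_def algebra_simps)
  then have "(sqrt (2 * C))\<^sup>2 \<le> qf h b1 b2" using C by simp
  then have 1: "(pos (sqrt (2 * C) - sqrt tp))\<^sup>2 \<le> rad2 h n1 n2"
    using w t C by (intro qf_triangle[OF h, of b1 b2]) auto
  have "sqrt (C / 2 - th) \<le> sqrt (2 * C) - sqrt tp" using t(2)[OF True] unfolding C_def by linarith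
  from pos_mono[OF this] have "C / 2 - th \<le> (pos (sqrt (2 * C) - sqrt tp))\<^sup>2" using True by (simp add: C_def)
  with 1 show ?thesis by (simp add: C_def)
next
  case False
  then show ?thesis using rad2_ge(5)[OF h, of n1 n2] by linarith
qed

lemma gs_upper:
  assumes h: "\<bar>h\<bar> < 1" and th: "0 < th" "th < r"
    and ta: "0 \<le> ta" "sqrt ta \<le> (r + th) / (2 * sqrt r)"
    and tb: "0 \<le> tb" "sqrt tb \<le> (r + th) / (2 * sqrt r)"
    and tab: "0 \<le> tab" "th < (1 - h\<^sup>2) * r \<Longrightarrow> sqrt tab \<le> ((1 - h\<^sup>2) * r + th) / (2 * sqrt ((1 - h\<^sup>2) * r))"
    and tba: "0 \<le> tba" "th < (1 - h\<^sup>2) * r \<Longrightarrow> sqrt tba \<le> ((1 - h\<^sup>2) * r + th) / (2 * sqrt ((1 - h\<^sup>2) * r))"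
    and tp: "0 \<le> tp" "2 * th \<le> (1 - \<bar>h\<bar>) * r \<Longrightarrow> sqrt tp \<le> sqrt (2 * ((1 - \<bar>h\<bar>) * r)) - sqrt ((1 - \<bar>h\<bar>) * r / 2 - th)"
    and S: "gs_screen h ta tb tab tba tp (b1 + h * b2 + n1) (h * b1 + b2 + n2) u1 u2"
    and B: "gs_block h (sqrt th) (sqrt r) (b1 + h * b2 + n1) (h * b1 + b2 + n2) u1 u2 x y"
    and b: "b1 = 0 \<or> sqrt r \<le> \<bar>b1\<bar>" "b2 = 0 \<or> sqrt r \<le> \<bar>b2\<bar>"
    and err: "\<not> (sgn x = sgn b1 \<and> sgn y = sgn b2)"
    and rho: "\<rho> \<le> (th + r)\<^sup>2 / (4 * r)" "\<rho> \<le> th + (1 - \<bar>h\<bar>) * r / 2"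
     "\<rho> \<le> 2 * th + (pos ((1 - h\<^sup>2) * r - th))\<^sup>2 / (4 * ((1 - h\<^sup>2) * r))"
  shows "\<rho> - th * (of_bool (b1 \<noteq> 0) + of_bool (b2 \<noteq> 0)) \<le> rad2 h n1 n2"
proof (cases "b1 = 0"; cases "b2 = 0")
  assume 0: "b1 = 0" "b2 = 0"
  have "\<rho> \<le> rad2 h n1 n2"
  proof (cases "u1 \<and> u2")
    case True
    then show ?thesis using B 0 err by (intro gs_joint_null[OF h th, of n1 n2 x y, OF _ _ rho(1,2)]) (auto simp: gs_block_def)
  next
    case False
    then have "x \<noteq> 0 \<and> Gmin1 (sqrt th) (sqrt r) (0 + n1) x \<or> y \<noteq> 0 \<and> Gmin1 (sqrt th) (sqrt r) (0 + n2) y"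
      using B 0 err unfolding gs_block_def by (auto split: if_splits)
    then have "\<rho> \<le> n1\<^sup>2 \<or> \<rho> \<le> n2\<^sup>2"
      using gs_upper_isolated[OF th ta, of 0 n1 x \<rho>] gs_upper_isolated[OF th tb, of 0 n2 y \<rho>] rho(1) by (auto simp: sgn_0_0)
    then show ?thesis using rad2_ge(1,2)[where x=n1 and y=n2, OF h] by linarith
  qed
  then show ?thesis using 0 by simp
next
  assume 0: "b1 \<noteq> 0" "b2 = 0"
  have "\<rho> - th \<le> rad2 h n1 n2"
    by (rule gs_upper_single[OF h th ta _ _ _ _ rho, of tb tab tba tp b1 n1 n2 u1 u2 x y]) (use 0 S B b err in auto)
  then show ?thesis using 0 by simp
next
  assume 0: "b1 = 0" "b2 \<noteq> 0"
  have "\<rho> - th \<le> rad2 h n2 n1"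
    by (rule gs_upper_single[OF h th tb _ _ _ _ rho, of ta tba tab tp b2 n2 n1 u2 u1 y x])
      (use 0 gs_screen_swap[OF S] gs_block_swap[OF B] b err in auto)
  then show ?thesis using 0 by (simp add: rad2_swap[of h n1 n2])
next
  assume 0: "b1 \<noteq> 0" "b2 \<noteq> 0"
  then have bb: "sqrt r \<le> \<bar>b1\<bar>" "sqrt r \<le> \<bar>b2\<bar>" using b by auto
  have r: "0 < r" using th by simp
  let ?w1 = "b1 + h * b2 + n1" and ?w2 = "h * b1 + b2 + n2"
  have e1: "?w1 - h * ?w2 = (1 - h\<^sup>2) * b1 + (n1 - h * n2)"
   and e2: "?w2 - h * ?w1 = (1 - h\<^sup>2) * b2 + (n2 - h * n1)"
    by (simp_all add: power2_eq_square algebra_simps)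
  have "\<rho> - 2 * th \<le> rad2 h n1 n2"
  proof (cases "u1 \<and> u2")
    case True
    then show ?thesis using B by (intro gs_joint_both[OF h th _ bb err rho(2,3)]) (auto simp: gs_block_def)
  next
    case False
    then have "rad2 h ?w1 ?w2 \<le> tp \<or> (?w2 - h * ?w1)\<^sup>2 / (1 - h\<^sup>2) \<le> tba \<or> (?w1 - h * ?w2)\<^sup>2 / (1 - h\<^sup>2) \<le> tab"
      using S unfolding gs_screen_def by force
    then show ?thesis
    proof (elim disjE)
      assume "rad2 h ?w1 ?w2 \<le> tp"
      from gs_pair_miss[OF h r tp bb this] rho(2) show ?thesis by linarith
    next
      assume "(?w2 - h * ?w1)\<^sup>2 / (1 - h\<^sup>2) \<le> tba"
      from gs_conditional_miss[OF h r th(1) tba bb(2) this[unfolded e2]] rad2_ge(3)[where x=n1 and y=n2, OF h] rho(3)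
      show ?thesis by linarith
    next
      assume "(?w1 - h * ?w2)\<^sup>2 / (1 - h\<^sup>2) \<le> tab"
      from gs_conditional_miss[OF h r th(1) tab bb(1) this[unfolded e1]] rad2_ge(4)[where x=n1 and y=n2, OF h] rho(3)
      show ?thesis by linarith
    qed
  qed
  then show ?thesis using 0 by simp
qed

lemma gs_lower_null_isolated:
  assumes "0 < r" "Gmin1 (sqrt th) (sqrt r) w x" "0 \<le> th" "(r + th) / (2 * sqrt r) < w"
  shows "x \<noteq> 0"
proof
  assume "x = 0"
  then have "0 \<le> (sqrt r)\<^sup>2 - 2 * w * sqrt r + th * of_bool (sqrt r \<noteq> 0)"
    using assms unfolding Gmin1_def by (auto simp: adm_def dest: spec[of _ "sqrt r"])
  then show False using assms by (simp add: divide_less_eq)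
qed

lemma gs_lower_null:
  assumes "0 < r" "Gmin2 h (sqrt th) (sqrt r) w1 w2 x y" "0 \<le> th" "(r + th) / (2 * sqrt r) < w1"
  shows "\<not> (x = 0 \<and> y = 0)"
proof
  assume "x = 0 \<and> y = 0"
  with assms(2) have "Gmin2 h (sqrt th) (sqrt r) w1 w2 0 0" by simp
  moreover have "adm (sqrt r) (sqrt r)" "adm (sqrt r) 0" using assms(1) by (auto simp: adm_def)
  ultimately have "qf h 0 0 - 2 * (w1 * 0 + w2 * 0) + (sqrt th)\<^sup>2 * (of_bool ((0::real) \<noteq> 0) + of_bool ((0::real) \<noteq> 0))
    \<le> qf h (sqrt r) 0 - 2 * (w1 * sqrt r + w2 * 0) + (sqrt th)\<^sup>2 * (of_bool (sqrt r \<noteq> 0) + of_bool ((0::real) \<noteq> 0))"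
    unfolding Gmin2_def by blast
  then show False using assms by (simp add: divide_less_eq qf_def)
qed

lemma gs_lower_swap:
  assumes "0 < r" "Gmin2 h u (sqrt r) w1 w2 x y" "w1 < \<bar>w2\<bar>"
  shows "\<not> (sgn x = 1 \<and> y = 0)"
proof
  assume "sgn x = 1 \<and> y = 0"
  then have x: "0 < x" "y = 0" by (auto simp: sgn_1_pos)
  define e where "e = (if 0 \<le> w2 then x else - x)"
  have a: "adm (sqrt r) 0" "adm (sqrt r) e" "e \<noteq> 0" using assms x by (auto simp: Gmin2_def adm_def e_def)
  have "qf h x y - 2 * (w1 * x + w2 * y) + u\<^sup>2 * (of_bool (x \<noteq> 0) + of_bool (y \<noteq> 0))
     \<le> qf h 0 e - 2 * (w1 * 0 + w2 * e) + u\<^sup>2 * (of_bool ((0::real) \<noteq> 0) + of_bool (e \<noteq> 0))"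
    using assms(2) a unfolding Gmin2_def by blast
  moreover have "e\<^sup>2 = x\<^sup>2" "w2 * e = \<bar>w2\<bar> * x" by (auto simp: e_def)
  ultimately have "\<bar>w2\<bar> * x \<le> w1 * x" using x a by (simp add: qf_def)
  then show False using x assms(3) by simp
qed

lemma gs_lower_false:
  assumes r: "0 < r" and G: "Gmin2 h (sqrt th) (sqrt r) w1 w2 x y" and th: "0 \<le> th"
    and w: "((1 - h\<^sup>2) * r + th) / (2 * sqrt r) < w2 - h * w1" "sqrt r \<le> w1 - h * sqrt r"
  shows "\<not> (sgn x = 1 \<and> y = 0)"
proof
  assume "sgn x = 1 \<and> y = 0"
  then have x: "0 < x" "y = 0" by (auto simp: sgn_1_pos)
  have s: "0 < sqrt r" using r by simp
  define x' where "x' = w1 - h * sqrt r"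
  have a: "adm (sqrt r) x'" "adm (sqrt r) (sqrt r)" "x' \<noteq> 0" using w s by (auto simp: adm_def x'_def)
  have "qf h x y - 2 * (w1 * x + w2 * y) + (sqrt th)\<^sup>2 * (of_bool (x \<noteq> 0) + of_bool (y \<noteq> 0))
     \<le> qf h x' (sqrt r) - 2 * (w1 * x' + w2 * sqrt r) + (sqrt th)\<^sup>2 * (of_bool (x' \<noteq> 0) + of_bool (sqrt r \<noteq> 0))"
    using G a unfolding Gmin2_def by blast
  then have "x\<^sup>2 - 2 * (w1 * x) \<le> qf h x' (sqrt r) - 2 * (w1 * x' + w2 * sqrt r) + th"
    using x a s th by (simp add: qf_def)
  moreover have "qf h x' (sqrt r) - 2 * (w1 * x' + w2 * sqrt r) = - w1\<^sup>2 + (1 - h\<^sup>2) * (sqrt r)\<^sup>2 - 2 * (w2 - h * w1) * sqrt r"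
    unfolding x'_def qf_def by algebra
  moreover have "- w1\<^sup>2 \<le> x\<^sup>2 - 2 * (w1 * x)" using zero_le_power2[of "x - w1"] by (simp add: power2_eq_square algebra_simps)
  moreover have "(sqrt r)\<^sup>2 = r" using r by simp
  ultimately have "2 * (w2 - h * w1) * sqrt r \<le> (1 - h\<^sup>2) * r + th" by simp
  moreover have "(1 - h\<^sup>2) * r + th < (w2 - h * w1) * (2 * sqrt r)" using w(1) s by (simp add: pos_divide_less_eq)
  moreover have "2 * (w2 - h * w1) * sqrt r = (w2 - h * w1) * (2 * sqrt r)" by simp
  ultimately show False by linarith
qed

section \<open>Lower bounds for subset selection, and the lasso, on a block\<close>

lemma ss_lower_null:
  assumes "\<bar>h\<bar> < 1" "Bmin h (ss_pen s) w1 w2 x y" "0 \<le> s" "s < w1"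
  shows "\<not> (sgn x = 0 \<and> sgn y = 0)"
proof
  assume "sgn x = 0 \<and> sgn y = 0"
  then have xy: "x = 0" "y = 0" by (auto simp: sgn_0_0)
  have "s\<^sup>2 < w1\<^sup>2" using assms by (intro power_strict_mono) auto
  with assms(1,2) xy show False by (cases rule: ss_cases) linarith+
qed

lemma ss_lower_single:
  assumes "\<bar>h\<bar> < 1" "Bmin h (ss_pen s) w1 w2 x y" "0 < s" "w1 < s \<or> w1 < \<bar>w2\<bar>"
  shows "\<not> (sgn x = 1 \<and> sgn y = 0)"
proof
  assume "sgn x = 1 \<and> sgn y = 0"
  then have xy: "0 < x" "y = 0" by (auto simp: sgn_0_0 sgn_1_pos)
  from assms(1,2) show False
  proof (cases rule: ss_cases)
    case first
    then have "0 < w1" using xy by simp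
    then have "w1\<^sup>2 < s\<^sup>2 \<or> w1\<^sup>2 < \<bar>w2\<bar>\<^sup>2"
      using assms(4) power_strict_mono[of w1 s 2] power_strict_mono[of w1 "\<bar>w2\<bar>" 2] by linarith
    with first show False by simp
  qed (use xy in simp_all)
qed

lemma ss_lower_pair:
  assumes "\<bar>h\<bar> < 1" "Bmin h (ss_pen s) w1 w2 x y" "0 < s" "w2 - h * w1 < s * sqrt (1 - h\<^sup>2)"
  shows "\<not> (sgn x \<noteq> 0 \<and> sgn y = 1)"
proof
  assume "sgn x \<noteq> 0 \<and> sgn y = 1"
  then have xy: "x \<noteq> 0" "0 < y" by (auto simp: sgn_0_0 sgn_1_pos)
  have a: "0 < 1 - h\<^sup>2" using abs_less_one_sq[OF assms(1)] .
  from assms(1,2) show False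
  proof (cases rule: ss_cases)
    case both
    then have *: "w2 - h * w1 < s * sqrt (1 - h\<^sup>2)" using assms(4) by simp
    have "0 < w2 - h * w1" using both(4) xy a by (simp add: zero_less_divide_iff)
    with * have "(w2 - h * w1)\<^sup>2 < (s * sqrt (1 - h\<^sup>2))\<^sup>2" using assms by (intro power_strict_mono) auto
    also have "\<dots> = s\<^sup>2 * (1 - h\<^sup>2)" using a by (simp add: power_mult_distrib)
    also have "\<dots> \<le> (w2 - h * w1)\<^sup>2" using both(6) a by (simp add: pos_le_divide_eq)
    finally show False by simp
  qed (use xy in simp_all)
qed

lemma ss_lower_pair_ball:
  assumes "\<bar>h\<bar> < 1" "Bmin h (ss_pen s) w1 w2 x y" "rad2 h w1 w2 < 2 * s\<^sup>2"
  shows "\<not> (sgn x \<noteq> 0 \<and> sgn y \<noteq> 0)"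
proof
  assume "sgn x \<noteq> 0 \<and> sgn y \<noteq> 0"
  then have xy: "x \<noteq> 0" "y \<noteq> 0" by (auto simp: sgn_0_0)
  from assms(1,2) show False by (cases rule: ss_cases) (use xy assms(3) in linarith)+
qed

definition lasso_pen :: "real \<Rightarrow> real \<Rightarrow> real" where "lasso_pen s x = 2 * s * \<bar>x\<bar>"

definition subgrad :: "real \<Rightarrow> real \<Rightarrow> real \<Rightarrow> bool" where
  "subgrad s g x \<longleftrightarrow> (0 < x \<longrightarrow> g = s) \<and> (x < 0 \<longrightarrow> g = - s) \<and> \<bar>g\<bar> \<le> s"

lemma soft_threshold:
  assumes s: "0 < s" and m: "\<And>x'. x\<^sup>2 - 2 * v * x + 2 * s * \<bar>x\<bar> \<le> x'\<^sup>2 - 2 * v * x' + 2 * s * \<bar>x'\<bar>"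
  shows "subgrad s (v - x) x"
proof -
  consider "s < v" | "v < - s" | "\<bar>v\<bar> \<le> s" by linarith
  then show ?thesis
  proof cases
    case 1
    have "x\<^sup>2 - 2 * v * x + 2 * s * \<bar>x\<bar> \<le> (v - s)\<^sup>2 - 2 * v * (v - s) + 2 * s * (v - s)" using m[of "v - s"] 1 by simp
    also have "\<dots> = - (v - s)\<^sup>2" by (simp add: power2_eq_square algebra_simps)
    finally have "(x - (v - s))\<^sup>2 + 2 * s * (\<bar>x\<bar> - x) \<le> 0" by (simp add: power2_eq_square algebra_simps)
    moreover have "0 \<le> 2 * s * (\<bar>x\<bar> - x)" using s by simp
    ultimately have "(x - (v - s))\<^sup>2 \<le> 0" by linarith
    then have "x = v - s" by simp
    then show ?thesis using 1 s by (simp add: subgrad_def)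
  next
    case 2
    have "x\<^sup>2 - 2 * v * x + 2 * s * \<bar>x\<bar> \<le> (v + s)\<^sup>2 - 2 * v * (v + s) - 2 * s * (v + s)" using m[of "v + s"] 2 by (simp add: algebra_simps)
    also have "\<dots> = - (v + s)\<^sup>2" by (simp add: power2_eq_square algebra_simps)
    finally have "(x - (v + s))\<^sup>2 + 2 * s * (\<bar>x\<bar> + x) \<le> 0" by (simp add: power2_eq_square algebra_simps)
    moreover have "0 \<le> 2 * s * (\<bar>x\<bar> + x)" using s by simp
    ultimately have "(x - (v + s))\<^sup>2 \<le> 0" by linarith
    then have "x = v + s" by simp
    then show ?thesis using 2 s by (simp add: subgrad_def)
  next
    case 3
    have "v * x \<le> \<bar>v\<bar> * \<bar>x\<bar>" by (metis abs_ge_self abs_mult)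
    also have "\<dots> \<le> s * \<bar>x\<bar>" using 3 by (intro mult_right_mono) auto
    finally have "v * x \<le> s * \<bar>x\<bar>" .
    moreover have "x\<^sup>2 - 2 * (v * x) + 2 * (s * \<bar>x\<bar>) \<le> 0" using m[of 0] by (simp add: mult.assoc)
    ultimately have "x\<^sup>2 \<le> 0" by linarith
    then have "x = 0" by (simp only: power2_less_eq_zero_iff)
    then show ?thesis using 3 s by (simp add: subgrad_def)
  qed
qed

lemma lasso_kkt:
  assumes s: "0 < s" and B: "Bmin h (lasso_pen s) w1 w2 x y"
  shows "subgrad s (w1 - x - h * y) x" "subgrad s (w2 - h * x - y) y"
proof -
  have "subgrad s (w1 - h * y - x) x"
  proof (rule soft_threshold[OF s])
    fix x'
    have "qf h x y - 2 * (w1 * x + w2 * y) + lasso_pen s x + lasso_pen s y \<le> qf h x' y - 2 * (w1 * x' + w2 * y) + lasso_pen s x' + lasso_pen s y"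
      using B unfolding Bmin_def by blast
    then show "x\<^sup>2 - 2 * (w1 - h * y) * x + 2 * s * \<bar>x\<bar> \<le> x'\<^sup>2 - 2 * (w1 - h * y) * x' + 2 * s * \<bar>x'\<bar>"
      by (simp add: qf_def lasso_pen_def algebra_simps)
  qed
  then show "subgrad s (w1 - x - h * y) x" by (simp add: algebra_simps)
  have "subgrad s (w2 - h * x - y) y"
  proof (rule soft_threshold[OF s])
    fix y'
    have "qf h x y - 2 * (w1 * x + w2 * y) + lasso_pen s x + lasso_pen s y \<le> qf h x y' - 2 * (w1 * x + w2 * y') + lasso_pen s x + lasso_pen s y'"
      using B unfolding Bmin_def by blast
    then show "y\<^sup>2 - 2 * (w2 - h * x) * y + 2 * s * \<bar>y\<bar> \<le> y'\<^sup>2 - 2 * (w2 - h * x) * y' + 2 * s * \<bar>y'\<bar>"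
      by (simp add: qf_def lasso_pen_def algebra_simps)
  qed
  then show "subgrad s (w2 - h * x - y) y" .
qed

lemma subgrad_monotone: "subgrad s g x \<Longrightarrow> subgrad s g' x' \<Longrightarrow> 0 \<le> (g - g') * (x - x')"
  unfolding subgrad_def
  by (cases "x < 0"; cases "0 < x"; cases "x' < 0"; cases "0 < x'")
    (auto simp: zero_le_mult_iff mult_le_0_iff abs_le_iff)

lemma kkt_unique:
  assumes h: "\<bar>h\<bar> < 1"
    and "subgrad s (w1 - x - h * y) x" "subgrad s (w2 - h * x - y) y"
    and "subgrad s (w1 - x' - h * y') x'" "subgrad s (w2 - h * x' - y') y'"
  shows "x = x'" "y = y'"
proof -
  have "0 \<le> ((w1 - x - h * y) - (w1 - x' - h * y')) * (x - x') + ((w2 - h * x - y) - (w2 - h * x' - y')) * (y - y')"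
    using subgrad_monotone[OF assms(2,4)] subgrad_monotone[OF assms(3,5)] by linarith
  also have "\<dots> = - qf h (x - x') (y - y')" unfolding qf_def by algebra
  finally have "qf h (x - x') (y - y') \<le> 0" by simp
  from qf_eq_0[OF h this] show "x = x'" "y = y'" by auto
qed

lemma abs_lt_of_sq: "\<bar>x\<bar> < m" if "x\<^sup>2 < m\<^sup>2" "0 \<le> m" for x m :: real
  using that by (metis abs_of_nonneg power2_abs power_less_imp_less_base)

lemma lasso_upper_single:
  assumes h: "\<bar>h\<bar> < 1" and B: "Bmin h (lasso_pen s) (b + n1) (h * b + n2) x y" and s: "0 < s"
    and b: "m \<le> \<bar>b\<bar>" "0 < m" and err: "\<not> (sgn x = sgn b \<and> sgn y = 0)"
    and H: "\<kappa> \<le> (pos (m - s))\<^sup>2" "\<kappa> \<le> (1 - \<bar>h\<bar>) / (1 + \<bar>h\<bar>) * s\<^sup>2"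
  shows "\<kappa> \<le> rad2 h n1 n2"
proof (rule ccontr)
  assume "\<not> \<kappa> \<le> rad2 h n1 n2"
  then have R: "rad2 h n1 n2 < \<kappa>" by simp
  have a: "0 < 1 - h\<^sup>2" using abs_less_one_sq[OF h] .
  have "n1\<^sup>2 < (pos (m - s))\<^sup>2" using R H rad2_ge(1)[OF h, of n1 n2] by linarith
  then have "\<bar>n1\<bar> < pos (m - s)" by (rule abs_lt_of_sq) (simp add: pos_def)
  then have n1: "\<bar>n1\<bar> < m - s" by (auto simp: pos_def max_def split: if_splits)
  have "(n2 - h * n1)\<^sup>2 / (1 - h\<^sup>2) < (1 - \<bar>h\<bar>) / (1 + \<bar>h\<bar>) * s\<^sup>2"
    using R H rad2_ge(3)[where x=n1 and y=n2, OF h] by linarith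
  then have "(n2 - h * n1)\<^sup>2 < (1 - \<bar>h\<bar>) / (1 + \<bar>h\<bar>) * s\<^sup>2 * (1 - h\<^sup>2)" using a by (simp add: pos_divide_less_eq)
  also have "1 - h\<^sup>2 = (1 + \<bar>h\<bar>) * (1 - \<bar>h\<bar>)" by (simp add: power2_eq_square algebra_simps flip: abs_mult)
  also have "(1 - \<bar>h\<bar>) / (1 + \<bar>h\<bar>) * s\<^sup>2 * ((1 + \<bar>h\<bar>) * (1 - \<bar>h\<bar>)) = ((1 - \<bar>h\<bar>) * s)\<^sup>2"
  proof -
    have "1 + \<bar>h\<bar> \<noteq> 0" by linarith
    then show ?thesis by (simp add: power2_eq_square)
  qed
  finally have n2: "\<bar>n2 - h * n1\<bar> < (1 - \<bar>h\<bar>) * s" using h s by (intro abs_lt_of_sq) auto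
  define x' where "x' = b + n1 - sgn b * s"
  have sx: "sgn x' = sgn b"
    using b n1 by (cases "0 < b") (auto simp: x'_def sgn_if)
  have k1: "subgrad s (b + n1 - x' - h * 0) x'"
    using sx b s by (auto simp: x'_def subgrad_def sgn_if split: if_splits)
  have "\<bar>h * sgn b * s\<bar> = \<bar>h\<bar> * s" using b s by (auto simp: abs_mult sgn_if)
  then have "\<bar>n2 - h * n1 + h * sgn b * s\<bar> \<le> s"
    using n2 abs_triangle_ineq[of "n2 - h * n1" "h * sgn b * s"] by (simp add: algebra_simps)
  moreover have "h * b + n2 - h * x' - 0 = n2 - h * n1 + h * sgn b * s" by (simp add: x'_def algebra_simps)
  ultimately have k2: "subgrad s (h * b + n2 - h * x' - 0) 0" by (simp add: subgrad_def)
  from kkt_unique[OF h lasso_kkt[OF s B] k1 k2] sx err show False by simp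
qed

lemma lasso_upper_both:
  assumes h: "\<bar>h\<bar> < 1" and B: "Bmin h (lasso_pen s) (b1 + h * b2 + n1) (h * b1 + b2 + n2) x y" and s: "0 < s"
    and b: "m \<le> \<bar>b1\<bar>" "m \<le> \<bar>b2\<bar>" "0 < m" and err: "\<not> (sgn x = sgn b1 \<and> sgn y = sgn b2)"
    and H: "\<kappa> \<le> (pos ((1 - h\<^sup>2) * m - (1 + \<bar>h\<bar>) * s))\<^sup>2 / (1 - h\<^sup>2)"
  shows "\<kappa> \<le> rad2 h n1 n2"
proof (rule ccontr)
  assume "\<not> \<kappa> \<le> rad2 h n1 n2"
  then have R: "rad2 h n1 n2 < \<kappa>" by simp
  have a: "0 < 1 - h\<^sup>2" using abs_less_one_sq[OF h] .
  have bd: "\<bar>n\<bar> < (1 - h\<^sup>2) * m - (1 + \<bar>h\<bar>) * s" if "n\<^sup>2 / (1 - h\<^sup>2) \<le> rad2 h n1 n2" for n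
  proof -
    have "n\<^sup>2 / (1 - h\<^sup>2) < (pos ((1 - h\<^sup>2) * m - (1 + \<bar>h\<bar>) * s))\<^sup>2 / (1 - h\<^sup>2)" using that R H by linarith
    then have "n\<^sup>2 < (pos ((1 - h\<^sup>2) * m - (1 + \<bar>h\<bar>) * s))\<^sup>2" using a by (simp add: divide_less_cancel)
    then have "\<bar>n\<bar> < pos ((1 - h\<^sup>2) * m - (1 + \<bar>h\<bar>) * s)" by (rule abs_lt_of_sq) (simp add: pos_def)
    then show ?thesis by (auto simp: pos_def max_def split: if_splits)
  qed
  define s1 where "s1 = sgn b1" define s2 where "s2 = sgn b2"
  have s12: "\<bar>s1\<bar> = 1" "\<bar>s2\<bar> = 1" using b by (auto simp: s1_def s2_def abs_sgn_eq)
  define x' where "x' = b1 + ((n1 - h * n2) - s * (s1 - h * s2)) / (1 - h\<^sup>2)"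
  define y' where "y' = b2 + ((n2 - h * n1) - s * (s2 - h * s1)) / (1 - h\<^sup>2)"
  have sg: "sgn (b + (n - s * (e - h * f)) / (1 - h\<^sup>2)) = sgn b"
    if "m \<le> \<bar>b\<bar>" "e = sgn b" "\<bar>f\<bar> = 1" "\<bar>n\<bar> < (1 - h\<^sup>2) * m - (1 + \<bar>h\<bar>) * s" for b n e f
  proof -
    have "\<bar>e\<bar> = 1" using that b by (auto simp: abs_sgn_eq)
    then have "\<bar>e - h * f\<bar> \<le> 1 + \<bar>h\<bar>" using that(3) abs_triangle_ineq4[of e "h * f"] by (simp add: abs_mult)
    then have "s * \<bar>e - h * f\<bar> \<le> s * (1 + \<bar>h\<bar>)" using s by (intro mult_left_mono) auto
    then have "\<bar>s * (e - h * f)\<bar> \<le> (1 + \<bar>h\<bar>) * s" using s by (simp add: abs_mult mult.commute)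
    then have "\<bar>n - s * (e - h * f)\<bar> < (1 - h\<^sup>2) * m" using that(4) abs_triangle_ineq4[of n "s * (e - h * f)"] by linarith
    also have "\<dots> \<le> (1 - h\<^sup>2) * \<bar>b\<bar>" using that(1) a by simp
    finally have "\<bar>(n - s * (e - h * f)) / (1 - h\<^sup>2)\<bar> < \<bar>b\<bar>" using a by (simp add: pos_divide_less_eq mult.commute)
    moreover have "sgn (b + v) = sgn b" if "\<bar>v\<bar> < \<bar>b\<bar>" for v using that by (auto simp: sgn_if)
    ultimately show ?thesis by blast
  qed
  have sx: "sgn x' = s1" unfolding x'_def using sg[OF b(1) s1_def s12(2) bd[OF rad2_ge(4)[where x=n1 and y=n2, OF h]]] by (simp add: s1_def)
  have sy: "sgn y' = s2" unfolding y'_def using sg[OF b(2) s2_def s12(1) bd[OF rad2_ge(3)[where x=n1 and y=n2, OF h]]] by (simp add: s2_def)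
  have "(1 - h\<^sup>2) * (x' - b1) = (n1 - h * n2) - s * (s1 - h * s2)" "(1 - h\<^sup>2) * (y' - b2) = (n2 - h * n1) - s * (s2 - h * s1)"
    using a by (simp_all add: x'_def y'_def)
  then have "(1 - h\<^sup>2) * (b1 + h * b2 + n1 - x' - h * y') = (1 - h\<^sup>2) * (s * s1)"
    "(1 - h\<^sup>2) * (h * b1 + b2 + n2 - h * x' - y') = (1 - h\<^sup>2) * (s * s2)" by algebra+
  then have "b1 + h * b2 + n1 - x' - h * y' = s * s1" "h * b1 + b2 + n2 - h * x' - y' = s * s2" using a by auto
  moreover have "subgrad s (s * sgn t) t" if "\<bar>sgn t\<bar> = 1" for t using that s by (auto simp: subgrad_def sgn_if)
  ultimately have k1: "subgrad s (b1 + h * b2 + n1 - x' - h * y') x'" and k2: "subgrad s (h * b1 + b2 + n2 - h * x' - y') y'"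
    using sx sy s12 by metis+
  from kkt_unique[OF h lasso_kkt[OF s B] k1 k2] sx sy err show False by (simp add: s1_def s2_def)
qed

lemma lasso_upper:
  assumes h: "\<bar>h\<bar> < 1" and B: "Bmin h (lasso_pen s) (b1 + h * b2 + n1) (h * b1 + b2 + n2) x y" and s: "0 < s" and m: "0 < m"
    and b: "b1 = 0 \<or> m \<le> \<bar>b1\<bar>" "b2 = 0 \<or> m \<le> \<bar>b2\<bar>" and err: "\<not> (sgn x = sgn b1 \<and> sgn y = sgn b2)"
    and H: "\<rho> \<le> s\<^sup>2" "\<rho> \<le> th + (pos (m - s))\<^sup>2" "\<rho> \<le> th + (1 - \<bar>h\<bar>) / (1 + \<bar>h\<bar>) * s\<^sup>2"
     "\<rho> \<le> 2 * th + (pos ((1 - h\<^sup>2) * m - (1 + \<bar>h\<bar>) * s))\<^sup>2 / (1 - h\<^sup>2)"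
  shows "\<rho> - th * (of_bool (b1 \<noteq> 0) + of_bool (b2 \<noteq> 0)) \<le> rad2 h n1 n2"
proof (cases "b1 = 0"; cases "b2 = 0")
  assume 0: "b1 = 0" "b2 = 0"
  with B have B0: "Bmin h (lasso_pen s) n1 n2 x y" by simp
  have "s\<^sup>2 \<le> rad2 h n1 n2"
  proof (rule ccontr)
    assume "\<not> s\<^sup>2 \<le> rad2 h n1 n2"
    then have "n1\<^sup>2 < s\<^sup>2" "n2\<^sup>2 < s\<^sup>2" using rad2_ge(1,2)[where x=n1 and y=n2, OF h] by linarith+
    then have "\<bar>n1\<bar> \<le> s" "\<bar>n2\<bar> \<le> s" using abs_lt_of_sq[of n1 s] abs_lt_of_sq[of n2 s] s by auto
    then have "subgrad s (n1 - 0 - h * 0) 0" "subgrad s (n2 - h * 0 - 0) 0" by (auto simp: subgrad_def)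
    from kkt_unique[OF h lasso_kkt[OF s B0] this] err 0 show False by simp
  qed
  then show ?thesis using 0 H by simp
next
  assume 0: "b1 \<noteq> 0" "b2 = 0"
  with B have "Bmin h (lasso_pen s) (b1 + n1) (h * b1 + n2) x y" by simp
  from lasso_upper_single[OF h this s, of m "\<rho> - th"] show ?thesis using 0 H err b m by simp
next
  assume 0: "b1 = 0" "b2 \<noteq> 0"
  with Bmin_swap[OF B] have "Bmin h (lasso_pen s) (b2 + n2) (h * b2 + n1) y x" by simp
  moreover have "\<not> (sgn y = sgn b2 \<and> sgn x = 0)" using err 0 by auto
  ultimately have "\<rho> - th \<le> rad2 h n2 n1" using 0 H b m s by (intro lasso_upper_single[OF h _ s, of b2 n2 n1 y x m]) auto
  then show ?thesis using 0 by (simp add: rad2_swap[of h n1 n2])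
next
  assume 0: "b1 \<noteq> 0" "b2 \<noteq> 0"
  from lasso_upper_both[OF h B s, of m "\<rho> - 2 * th"] show ?thesis using 0 H err b m by simp
qed

lemma lasso_lower_null:
  assumes "0 < s" "Bmin h (lasso_pen s) w1 w2 x y" "s < w1"
  shows "\<not> (sgn x = 0 \<and> sgn y = 0)"
  using lasso_kkt[OF assms(1,2)] assms by (auto simp: subgrad_def sgn_0_0)

lemma lasso_lower_miss:
  assumes "0 < s" "Bmin h (lasso_pen s) w1 w2 x y" "w1 < s"
  shows "\<not> (sgn x = 1 \<and> sgn y = 0)"
  using lasso_kkt[OF assms(1,2)] assms by (auto simp: subgrad_def sgn_0_0 sgn_1_pos)

lemma lasso_lower_pair:
  assumes h: "\<bar>h\<bar> < 1" and s: "0 < s" and B: "Bmin h (lasso_pen s) w1 w2 x y" and e: "e = 1 \<or> e = -1" "e * h = - \<bar>h\<bar>"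
    and w: "w1 - h * w2 < (1 + \<bar>h\<bar>) * s"
  shows "\<not> (sgn x = 1 \<and> sgn y = e)"
proof
  assume sg: "sgn x = 1 \<and> sgn y = e"
  have a: "0 < 1 - h\<^sup>2" using abs_less_one_sq[OF h] .
  have x: "0 < x" using sg by (simp add: sgn_1_pos)
  have "w2 - h * x - y = s * e" using lasso_kkt(2)[OF s B] sg e(1) by (auto simp: subgrad_def sgn_if split: if_splits)
  moreover have "w1 - x - h * y = s" using lasso_kkt(1)[OF s B] x by (auto simp: subgrad_def)
  ultimately have "w1 - h * w2 = (1 - h\<^sup>2) * x + s * (1 - e * h)" by algebra
  moreover have "0 < (1 - h\<^sup>2) * x" using a x by simp
  ultimately show False using w e(2) by (simp add: mult.commute)
qed

section \<open>Decoupling of the penalized estimators\<close>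

lemma quad_min_exists:
  fixes f :: "real \<times> real \<Rightarrow> real"
  assumes h: "\<bar>h\<bar> < 1" and S: "closed S" "S \<noteq> {}" and f: "continuous_on UNIV f"
    and ge: "\<And>x y. qf h x y - 2 * (w1 * x + w2 * y) \<le> f (x, y)"
  shows "\<exists>z\<in>S. \<forall>z'\<in>S. f z \<le> f z'"
proof -
  obtain z0 where z0: "z0 \<in> S" using S by auto
  have a: "0 < 1 - h\<^sup>2" using abs_less_one_sq[OF h] .
  define u where "u = (w1 - h * w2) / (1 - h\<^sup>2)"
  define v where "v = (w2 - h * w1) / (1 - h\<^sup>2)"
  define K where "K = sqrt ((f z0 + rad2 h w1 w2) / (1 - h\<^sup>2))"
  let ?B = "cbox (u - K, v - K) (u + K, v + K)"
  have in_box: "z \<in> ?B" if "f z \<le> f z0" for z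
  proof (cases z)
    case (Pair x y)
    have "qf h (x - u) (y - v) - rad2 h w1 w2 \<le> f (x, y)"
      using ge[of x y] obj_complete_square[OF h, of x y w1 w2] by (simp add: u_def v_def)
    then have q: "qf h (x - u) (y - v) \<le> f z0 + rad2 h w1 w2" using that Pair by simp
    have "(1 - h\<^sup>2) * (x - u)\<^sup>2 \<le> f z0 + rad2 h w1 w2" "(1 - h\<^sup>2) * (y - v)\<^sup>2 \<le> f z0 + rad2 h w1 w2"
      using qf_ge(1)[OF h, where x="x - u" and y="y - v"] qf_ge(2)[OF h, where x="x - u" and y="y - v"] q by linarith+
    then have "(x - u)\<^sup>2 \<le> (f z0 + rad2 h w1 w2) / (1 - h\<^sup>2)" "(y - v)\<^sup>2 \<le> (f z0 + rad2 h w1 w2) / (1 - h\<^sup>2)"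
      using a by (simp_all add: le_divide_eq mult.commute)
    then have "\<bar>x - u\<bar> \<le> K" "\<bar>y - v\<bar> \<le> K" unfolding K_def by (metis real_sqrt_abs real_sqrt_le_mono)+
    then show ?thesis unfolding Pair cbox_Pair_eq by auto
  qed
  have "compact (S \<inter> ?B)" using S by (intro closed_Int_compact compact_cbox)
  moreover have "z0 \<in> S \<inter> ?B" using z0 in_box by auto
  ultimately obtain z where z: "z \<in> S \<inter> ?B" "\<forall>z'\<in>S \<inter> ?B. f z \<le> f z'"
    using continuous_attains_inf[of "S \<inter> ?B" f] continuous_on_subset[OF f] by blast
  have "f z \<le> f z'" if "z' \<in> S" for z'
  proof (cases "f z' \<le> f z0")
    case True
    then show ?thesis using z in_box that by auto
  next
    case False
    have "f z \<le> f z0" using z \<open>z0 \<in> S \<inter> ?B\<close> by auto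
    then show ?thesis using False by simp
  qed
  with z(1) show ?thesis by blast
qed

text \<open>The penalty is lower semicontinuous only, so we minimise over the four support patterns separately.\<close>
lemma support_min_exists:
  assumes h: "\<bar>h\<bar> < 1" and K: "closed K" "K \<noteq> {}" and e: "0 \<le> (e::real)"
  shows "\<exists>x y. x \<in> insert 0 K \<and> y \<in> insert 0 K \<and> (fl \<or> y = 0) \<and>
    (\<forall>x' y'. x' \<in> insert 0 K \<longrightarrow> y' \<in> insert 0 K \<longrightarrow> fl \<or> y' = 0 \<longrightarrow>
      qf h x y - 2 * (w1 * x + w2 * y) + e * (of_bool (x \<noteq> 0) + of_bool (y \<noteq> 0))
      \<le> qf h x' y' - 2 * (w1 * x' + w2 * y') + e * (of_bool (x' \<noteq> 0) + of_bool (y' \<noteq> 0)))"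
proof -
  define Q where "Q = (\<lambda>(x, y). qf h x y - 2 * (w1 * x + w2 * y))"
  define S where "S i = (if i then K else {0::real})" for i
  define I :: "(bool \<times> bool) set" where "I = {(i, j). fl \<or> \<not> j}"
  have cQ: "continuous_on UNIV Q" unfolding Q_def qf_def case_prod_beta by (intro continuous_intros)
  have "\<exists>z\<in>S i \<times> S j. \<forall>z'\<in>S i \<times> S j. Q z \<le> Q z'" for i j
    using K by (intro quad_min_exists[OF h _ _ cQ, of _ w1 w2] closed_Times) (auto simp: S_def Q_def)
  then obtain m where m: "\<And>i j. m i j \<in> S i \<times> S j" "\<And>i j z'. z' \<in> S i \<times> S j \<Longrightarrow> Q (m i j) \<le> Q z'" by metis
  define V where "V = (\<lambda>(i, j). Q (m i j) + e * (of_bool i + of_bool j))"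
  have fin: "finite (V ` I)" "V ` I \<noteq> {}" by (auto simp: I_def)
  have "Min (V ` I) \<in> V ` I" by (rule Min_in[OF fin])
  then obtain i j where ij: "(i, j) \<in> I" "V (i, j) = Min (V ` I)" by auto
  then have best: "V (i, j) \<le> V (i', j')" if "(i', j') \<in> I" for i' j' using that fin by auto
  obtain x y where xy: "m i j = (x, y)" by fastforce
  then have mem: "x \<in> S i" "y \<in> S j" using m(1)[of i j] by auto
  show ?thesis
  proof (rule exI[of _ x], rule exI[of _ y], intro conjI allI impI)
    show "x \<in> insert 0 K" "y \<in> insert 0 K" using mem by (auto simp: S_def split: if_splits)
    show "fl \<or> y = 0" using mem ij(1) by (auto simp: S_def I_def)
    fix x' y' assume x': "x' \<in> insert 0 K" "y' \<in> insert 0 K" "fl \<or> y' = 0"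
    have "e * (of_bool (x \<noteq> 0) + of_bool (y \<noteq> 0)) \<le> e * (of_bool i + of_bool j)"
      using mem e by (intro mult_left_mono add_mono) (auto simp: S_def split: if_splits)
    then have "Q (x, y) + e * (of_bool (x \<noteq> 0) + of_bool (y \<noteq> 0)) \<le> V (i, j)" by (simp add: V_def xy)
    also have "\<dots> \<le> V (x' \<noteq> 0, y' \<noteq> 0)" using x' by (intro best) (auto simp: I_def)
    also have "\<dots> \<le> Q (x', y') + e * (of_bool (x' \<noteq> 0) + of_bool (y' \<noteq> 0))"
      using m(2)[of "(x', y')" "x' \<noteq> 0" "y' \<noteq> 0"] x' by (auto simp: V_def S_def)
    finally show "qf h x y - 2 * (w1 * x + w2 * y) + e * (of_bool (x \<noteq> 0) + of_bool (y \<noteq> 0))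
      \<le> qf h x' y' - 2 * (w1 * x' + w2 * y') + e * (of_bool (x' \<noteq> 0) + of_bool (y' \<noteq> 0))" by (simp add: Q_def)
  qed
qed

definition free_blk :: "nat \<Rightarrow> nat \<Rightarrow> real \<Rightarrow> bool" where "free_blk p k y \<longleftrightarrow> 2 * k + 2 \<le> p \<or> y = 0"

lemma separable_min:
  assumes obj: "\<And>b. b \<in> coefs p \<Longrightarrow> obj b = c + (\<Sum>k<(p + 1) div 2. F k (b (2 * k + 1)) (b (2 * k + 2)) :: real)"
    and ex: "\<And>k. k < (p + 1) div 2 \<Longrightarrow> \<exists>x y. free_blk p k y \<and> (\<forall>x' y'. free_blk p k y' \<longrightarrow> F k x y \<le> F k x' y')"
    and est: "est = (SOME b. b \<in> coefs p \<and> (\<forall>b'\<in>coefs p. obj b \<le> obj b'))"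
  shows "est \<in> coefs p" "\<And>k x' y'. k < (p + 1) div 2 \<Longrightarrow> free_blk p k y' \<Longrightarrow>
      F k (est (2 * k + 1)) (est (2 * k + 2)) \<le> F k x' y'"
proof -
  let ?M = "(p + 1) div 2"
  obtain f g where fg: "\<And>k. k < ?M \<Longrightarrow> free_blk p k (g k) \<and> (\<forall>x' y'. free_blk p k y' \<longrightarrow> F k (f k) (g k) \<le> F k x' y')"
    using ex by metis
  define b0 where "b0 j = (if j \<in> {1..p} then if odd j then f ((j - 1) div 2) else g ((j - 1) div 2) else 0)" for j
  have b0: "b0 \<in> coefs p" by (auto simp: coefs_def b0_def)
  have b0v: "b0 (2 * k + 1) = f k" "b0 (2 * k + 2) = g k" if "k < ?M" for k
    using that fg[OF that] by (auto simp: b0_def free_blk_def)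
  have "b0 \<in> coefs p \<and> (\<forall>b'\<in>coefs p. obj b0 \<le> obj b')"
  proof (intro conjI ballI b0)
    fix b' assume b': "b' \<in> coefs p"
    have "(\<Sum>k<?M. F k (b0 (2 * k + 1)) (b0 (2 * k + 2))) \<le> (\<Sum>k<?M. F k (b' (2 * k + 1)) (b' (2 * k + 2)))"
    proof (rule sum_mono)
      fix k assume "k \<in> {..<?M}"
      then have k: "k < ?M" by simp
      have "free_blk p k (b' (2 * k + 2))" using b' by (auto simp: free_blk_def coefs_def)
      with fg[OF k] have "F k (f k) (g k) \<le> F k (b' (2 * k + 1)) (b' (2 * k + 2))" by blast
      then show "F k (b0 (2 * k + 1)) (b0 (2 * k + 2)) \<le> F k (b' (2 * k + 1)) (b' (2 * k + 2))"
        by (simp only: b0v[OF k])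
    qed
    then show "obj b0 \<le> obj b'" using obj[OF b0] obj[OF b'] by simp
  qed
  then have E: "est \<in> coefs p \<and> (\<forall>b'\<in>coefs p. obj est \<le> obj b')" unfolding est by (rule someI[of "\<lambda>b. b \<in> coefs p \<and> (\<forall>b'\<in>coefs p. obj b \<le> obj b')" b0])
  then show ec: "est \<in> coefs p" by simp
  fix k x' y' assume k: "k < ?M" and fr: "free_blk p k y'"
  define b where "b = est(2 * k + 1 := x', 2 * k + 2 := y')"
  have b: "b \<in> coefs p" using ec k fr by (auto simp: coefs_def b_def free_blk_def)
  have ne: "b (2 * i + 1) = est (2 * i + 1)" "b (2 * i + 2) = est (2 * i + 2)" if "i \<noteq> k" for i
    using that by (auto simp: b_def)
  have "(\<Sum>i<?M. F i (est (2 * i + 1)) (est (2 * i + 2))) \<le> (\<Sum>i<?M. F i (b (2 * i + 1)) (b (2 * i + 2)))"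
    using E b obj[OF ec] obj[OF b] by auto
  moreover have "(\<Sum>i<?M. G i) = G k + (\<Sum>i\<in>{..<?M} - {k}. G i)" for G :: "nat \<Rightarrow> real"
    using k by (intro sum.remove) auto
  moreover have "(\<Sum>i\<in>{..<?M} - {k}. F i (b (2 * i + 1)) (b (2 * i + 2))) = (\<Sum>i\<in>{..<?M} - {k}. F i (est (2 * i + 1)) (est (2 * i + 2)))"
    by (intro sum.cong) (auto simp: ne[simplified])
  moreover have "F k (b (2 * k + 1)) (b (2 * k + 2)) = F k x' y'" by (simp add: b_def)
  ultimately show "F k (est (2 * k + 1)) (est (2 * k + 2)) \<le> F k x' y'" by simp
qed

definition cor :: "nat \<Rightarrow> (nat \<Rightarrow> nat \<Rightarrow> real) \<Rightarrow> (nat \<Rightarrow> real) \<Rightarrow> nat \<Rightarrow> real" where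
  "cor n X Y j = (\<Sum>k\<in>{1..n}. X k j * Y k)"

lemma sqn_residual:
  assumes "gram_is n p X G"
  shows "sqn n (\<lambda>k. Y k - Xmul n p X b k)
    = sqn n Y - 2 * (\<Sum>j\<in>{1..p}. cor n X Y j * b j) + (\<Sum>i\<in>{1..p}. b i * (\<Sum>j\<in>{1..p}. G i j * b j))"
proof -
  have "sqn n (\<lambda>k. Y k - Xmul n p X b k) = (\<Sum>k\<in>{1..n}. (Y k)\<^sup>2 - 2 * (Y k * (\<Sum>j\<in>{1..p}. X k j * b j))
      + (\<Sum>i\<in>{1..p}. X k i * b i) * (\<Sum>j\<in>{1..p}. X k j * b j))"
    unfolding sqn_def Xmul_def by (intro sum.cong) (auto simp: power2_eq_square algebra_simps)
  also have "\<dots> = sqn n Y - 2 * (\<Sum>k\<in>{1..n}. \<Sum>j\<in>{1..p}. X k j * Y k * b j)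
     + (\<Sum>k\<in>{1..n}. \<Sum>i\<in>{1..p}. \<Sum>j\<in>{1..p}. b i * (X k i * X k j * b j))"
    unfolding sqn_def by (simp add: sum.distrib sum_subtractf sum_distrib_left sum_product mult_ac)
  also have "(\<Sum>k\<in>{1..n}. \<Sum>j\<in>{1..p}. X k j * Y k * b j) = (\<Sum>j\<in>{1..p}. cor n X Y j * b j)"
    by (subst sum.swap) (simp add: cor_def sum_distrib_right)
  also have "(\<Sum>k\<in>{1..n}. \<Sum>i\<in>{1..p}. \<Sum>j\<in>{1..p}. b i * (X k i * X k j * b j))
      = (\<Sum>i\<in>{1..p}. \<Sum>j\<in>{1..p}. b i * ((\<Sum>k\<in>{1..n}. X k i * X k j) * b j))"
    unfolding sum_distrib_left sum_distrib_right
    by (subst sum.swap, rule sum.cong[OF refl], subst sum.swap, rule refl)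
  also have "\<dots> = (\<Sum>i\<in>{1..p}. \<Sum>j\<in>{1..p}. b i * (G i j * b j))"
    using assms unfolding gram_is_def by (intro sum.cong) auto
  finally show ?thesis by (simp add: sum_distrib_left)
qed

lemma Gmat_off_block: "i \<in> blk p k \<Longrightarrow> j \<notin> blk p k \<Longrightarrow> j \<in> {1..p} \<Longrightarrow> Gmat h i j = 0"
  by (auto simp: blk_def Gmat_def)

lemma Gmat_row_sum:
  assumes i: "i \<in> blk p k" shows "(\<Sum>j\<in>{1..p}. Gmat h i j * b j) = (\<Sum>j\<in>blk p k. Gmat h i j * b j)"
proof (rule sum.mono_neutral_right)
  show "\<forall>j\<in>{1..p} - blk p k. Gmat h i j * b j = 0" using Gmat_off_block[OF i] by simp
qed (auto simp: blk_def)

lemma blk_cases: assumes "2 * k + 1 \<le> p"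
  shows "blk p k = (if 2 * k + 2 \<le> p then {2 * k + 1, 2 * k + 2} else {2 * k + 1})"
  using assms by (auto simp: blk_def)

lemma objective_blocks:
  assumes G: "gram_is n p X (Gmat h)" and b: "b \<in> coefs p"
  shows "sqn n (\<lambda>k. Y k - Xmul n p X b k) = sqn n Y + (\<Sum>k<(p + 1) div 2.
    qf h (b (2 * k + 1)) (b (2 * k + 2)) - 2 * (cor n X Y (2 * k + 1) * b (2 * k + 1) + cor n X Y (2 * k + 2) * b (2 * k + 2)))"
proof -
  have "(\<Sum>j\<in>blk p k. b j * (\<Sum>i\<in>{1..p}. Gmat h j i * b i)) - 2 * (\<Sum>j\<in>blk p k. cor n X Y j * b j)
     = qf h (b (2 * k + 1)) (b (2 * k + 2)) - 2 * (cor n X Y (2 * k + 1) * b (2 * k + 1) + cor n X Y (2 * k + 2) * b (2 * k + 2))"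
    if k: "k < (p + 1) div 2" for k
  proof -
    have k1: "2 * k + 1 \<le> p" using k by auto
    have "(\<Sum>j\<in>blk p k. b j * (\<Sum>i\<in>{1..p}. Gmat h j i * b i)) = (\<Sum>j\<in>blk p k. b j * (\<Sum>i\<in>blk p k. Gmat h j i * b i))"
      by (intro sum.cong refl) (simp only: Gmat_row_sum)
    also have "\<dots> = qf h (b (2 * k + 1)) (b (2 * k + 2))"
    proof (cases "2 * k + 2 \<le> p")
      case True
      define i where "i = 2 * k + 1"
      define j where "j = 2 * k + 2"
      have "i \<noteq> j" "Gmat h i i = 1" "Gmat h j j = 1" "Gmat h i j = h" "Gmat h j i = h"
        using Gmat_block[of h k] by (simp_all add: i_def j_def)
      moreover have "blk p k = {i, j}" using True unfolding blk_cases[OF k1] by (simp add: i_def j_def)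
      ultimately show ?thesis unfolding i_def[symmetric] j_def[symmetric]
        by (simp add: qf_def power2_eq_square algebra_simps)
    next
      case False
      then have "b (2 * k + 2) = 0" using b by (auto simp: coefs_def)
      with False show ?thesis unfolding blk_cases[OF k1]
        by (simp add: Gmat_block[simplified] qf_def power2_eq_square)
    qed
    moreover have "(\<Sum>j\<in>blk p k. cor n X Y j * b j) = cor n X Y (2 * k + 1) * b (2 * k + 1) + cor n X Y (2 * k + 2) * b (2 * k + 2)"
      unfolding blk_cases[OF k1] using b by (auto simp: coefs_def)
    ultimately show ?thesis by simp
  qed
  then have "(\<Sum>k<(p + 1) div 2. qf h (b (2 * k + 1)) (b (2 * k + 2)) - 2 * (cor n X Y (2 * k + 1) * b (2 * k + 1) + cor n X Y (2 * k + 2) * b (2 * k + 2)))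
    = (\<Sum>k<(p + 1) div 2. (\<Sum>j\<in>blk p k. b j * (\<Sum>i\<in>{1..p}. Gmat h j i * b i)) - 2 * (\<Sum>j\<in>blk p k. cor n X Y j * b j))"
    by (intro sum.cong) auto
  then show ?thesis unfolding sqn_residual[OF G] sum_blocks[of _ p] by (simp only: sum_subtractf sum_distrib_left)
qed

lemma sum_coefs_blocks:
  assumes b: "b \<in> coefs p" and f0: "f 0 = (0::real)"
  shows "(\<Sum>j\<in>{1..p}. f (b j)) = (\<Sum>k<(p + 1) div 2. f (b (2 * k + 1)) + f (b (2 * k + 2)))"
proof -
  have "(\<Sum>j\<in>blk p k. f (b j)) = f (b (2 * k + 1)) + f (b (2 * k + 2))" if k: "k < (p + 1) div 2" for k
  proof -
    have k1: "2 * k + 1 \<le> p" using k by auto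
    show ?thesis unfolding blk_cases[OF k1] using b f0 by (auto simp: coefs_def)
  qed
  then show ?thesis unfolding sum_blocks by (intro sum.cong) auto
qed

lemma single_to_pair:
  assumes h: "\<bar>h\<bar> < 1" and pen: "\<And>x y. pen (x + h * y) \<le> pen x + pen y" "pen 0 = 0"
   and m: "\<And>x'. x\<^sup>2 - 2 * w * x + pen x \<le> x'\<^sup>2 - 2 * w * x' + pen x'"
  shows "Bmin h pen w (h * w) x 0"
  unfolding Bmin_def
proof (intro allI)
  fix x' y'
  have "qf h x 0 - 2 * (w * x + h * w * 0) + pen x + pen 0 = x\<^sup>2 - 2 * w * x + pen x" using pen by (simp add: qf_def)
  also have "\<dots> \<le> (x' + h * y')\<^sup>2 - 2 * w * (x' + h * y') + pen (x' + h * y')" by (rule m)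
  also have "\<dots> \<le> (x' + h * y')\<^sup>2 - 2 * w * (x' + h * y') + pen x' + pen y' + (1 - h\<^sup>2) * y'\<^sup>2"
  proof -
    have "0 \<le> (1 - h\<^sup>2) * y'\<^sup>2" using abs_less_one_sq[OF h] by simp
    with pen(1)[of x' y'] show ?thesis by linarith
  qed
  also have "\<dots> = qf h x' y' - 2 * (w * x' + h * w * y') + pen x' + pen y'" unfolding qf_alt by (simp add: algebra_simps)
  finally show "qf h x 0 - 2 * (w * x + h * w * 0) + pen x + pen 0 \<le> qf h x' y' - 2 * (w * x' + h * w * y') + pen x' + pen y'" .
qed

text \<open>An odd last coordinate is treated as a block whose second signal is zero and whose second noise is \<open>h\<close>
  times the first: \<open>rad2\<close> then is the square of the first noise, and a minimiser has second entry zero.\<close>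
definition bet2 :: "nat \<Rightarrow> (nat \<Rightarrow> real) \<Rightarrow> nat \<Rightarrow> real" where
  "bet2 p be k = (if 2 * k + 2 \<le> p then be (2 * k + 2) else 0)"

definition noise2 :: "nat \<Rightarrow> nat \<Rightarrow> (nat \<Rightarrow> nat \<Rightarrow> real) \<Rightarrow> real \<Rightarrow> nat \<Rightarrow> (nat \<Rightarrow> real) \<Rightarrow> real" where
  "noise2 n p X h k z = h * lin n (fstdir X k) z + sqrt (1 - h\<^sup>2) * lin n (snddir p X h k) z"

lemma noise2_eq:
  assumes h: "\<bar>h\<bar> < 1"
  shows "2 * k + 2 \<le> p \<Longrightarrow> noise2 n p X h k z = (\<Sum>i\<in>{1..n}. X i (2 * k + 2) * z i)"
    "\<not> 2 * k + 2 \<le> p \<Longrightarrow> noise2 n p X h k z = h * lin n (fstdir X k) z"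
proof -
  assume p: "2 * k + 2 \<le> p"
  have "sqrt (1 - h\<^sup>2) \<noteq> 0" using abs_less_one_sq[OF h] by simp
  then show "noise2 n p X h k z = (\<Sum>i\<in>{1..n}. X i (2 * k + 2) * z i)"
    unfolding noise2_def sum_distrib_left sum.distrib[symmetric]
    using p by (intro sum.cong) (auto simp: fstdir_def snddir_def field_simps)
qed (simp add: noise2_def snddir_def)

lemma rad2_noise: assumes h: "\<bar>h\<bar> < 1"
  shows "rad2 h (s * lin n (fstdir X k) z) (s * noise2 n p X h k z) = s\<^sup>2 * ((lin n (fstdir X k) z)\<^sup>2 + (lin n (snddir p X h k) z)\<^sup>2)"
proof -
  have a: "0 < 1 - h\<^sup>2" using abs_less_one_sq[OF h] .
  have "s * noise2 n p X h k z - h * (s * lin n (fstdir X k) z) = sqrt (1 - h\<^sup>2) * (s * lin n (snddir p X h k) z)"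
    by (simp add: noise2_def algebra_simps)
  then have "(s * noise2 n p X h k z - h * (s * lin n (fstdir X k) z))\<^sup>2 = (1 - h\<^sup>2) * (s * lin n (snddir p X h k) z)\<^sup>2"
    using a by (simp only: power_mult_distrib) simp
  then have "(s * noise2 n p X h k z - h * (s * lin n (fstdir X k) z))\<^sup>2 / (1 - h\<^sup>2) = (s * lin n (snddir p X h k) z)\<^sup>2"
    using a by simp
  then show ?thesis unfolding rad2_alt[OF h] by (simp only: power_mult_distrib distrib_left)
qed

lemma cor_obs:
  assumes G: "gram_is n p X (Gmat h)" and h: "\<bar>h\<bar> < 1" and k: "k < (p + 1) div 2"
  shows "cor n X (Yobs n p X sig be z) (2 * k + 1) = be (2 * k + 1) + h * bet2 p be k + sig * lin n (fstdir X k) z"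
    "2 * k + 2 \<le> p \<Longrightarrow> cor n X (Yobs n p X sig be z) (2 * k + 2) = h * be (2 * k + 1) + bet2 p be k + sig * noise2 n p X h k z"
proof -
  have k1: "2 * k + 1 \<le> p" using k by auto
  have gen: "cor n X (Yobs n p X sig be z) j = (\<Sum>i\<in>blk p k. Gmat h j i * be i) + sig * (\<Sum>i\<in>{1..n}. X i j * z i)" if j: "j \<in> blk p k" for j
  proof -
    have jp: "j \<in> {1..p}" using j by (auto simp: blk_def)
    have "cor n X (Yobs n p X sig be z) j = (\<Sum>l\<in>{1..n}. (\<Sum>i\<in>{1..p}. X l j * X l i * be i) + sig * (X l j * z l))"
      unfolding cor_def Yobs_def Xmul_def by (intro sum.cong refl) (auto simp: sum_distrib_left algebra_simps)
    also have "\<dots> = (\<Sum>i\<in>{1..p}. (\<Sum>l\<in>{1..n}. X l j * X l i) * be i) + sig * (\<Sum>i\<in>{1..n}. X i j * z i)"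
      unfolding sum.distrib sum_distrib_left[symmetric] by (subst sum.swap) (simp add: sum_distrib_right)
    also have "(\<Sum>i\<in>{1..p}. (\<Sum>l\<in>{1..n}. X l j * X l i) * be i) = (\<Sum>i\<in>{1..p}. Gmat h j i * be i)"
      using G jp unfolding gram_is_def by (intro sum.cong) auto
    finally show ?thesis by (simp only: Gmat_row_sum[OF j])
  qed
  have "2 * k + 1 \<in> blk p k" using k1 by (auto simp: blk_def)
  from gen[OF this] show "cor n X (Yobs n p X sig be z) (2 * k + 1) = be (2 * k + 1) + h * bet2 p be k + sig * lin n (fstdir X k) z"
    unfolding blk_cases[OF k1] by (simp add: Gmat_block[simplified] bet2_def fstdir_def)
  assume k2: "2 * k + 2 \<le> p"
  then have "2 * k + 2 \<in> blk p k" by (auto simp: blk_def)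
  from gen[OF this] k2 show "cor n X (Yobs n p X sig be z) (2 * k + 2) = h * be (2 * k + 1) + bet2 p be k + sig * noise2 n p X h k z"
    unfolding blk_cases[OF k1] by (simp add: Gmat_block[simplified] bet2_def noise2_eq(1)[OF h k2])
qed

lemma Bmin_of_block_min:
  assumes G: "gram_is n p X (Gmat h)" and h: "\<bar>h\<bar> < 1" and k: "k < (p + 1) div 2"
    and pen: "\<And>x y. pen (x + h * y) \<le> pen x + pen y" "pen 0 = 0"
    and Y: "Y = Yobs n p X sig be z"
    and fr: "free_blk p k y"
    and m: "\<And>x' y'. free_blk p k y' \<Longrightarrow>
       qf h x y - 2 * (cor n X Y (2 * k + 1) * x + cor n X Y (2 * k + 2) * y) + pen x + pen y
       \<le> qf h x' y' - 2 * (cor n X Y (2 * k + 1) * x' + cor n X Y (2 * k + 2) * y') + pen x' + pen y'"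
  shows "Bmin h pen (be (2 * k + 1) + h * bet2 p be k + sig * lin n (fstdir X k) z)
     (h * be (2 * k + 1) + bet2 p be k + sig * noise2 n p X h k z) x y"
proof (cases "2 * k + 2 \<le> p")
  case True
  then show ?thesis using m unfolding Bmin_def free_blk_def Y cor_obs(1)[OF G h k] cor_obs(2)[OF G h k True] by blast
next
  case False
  then have y: "y = 0" using fr by (simp add: free_blk_def)
  define w where "w = be (2 * k + 1) + sig * lin n (fstdir X k) z"
  have cw: "cor n X Y (2 * k + 1) = w" unfolding Y cor_obs(1)[OF G h k] using False by (simp add: bet2_def w_def)
  have "Bmin h pen w (h * w) x 0"
  proof (rule single_to_pair[OF h pen])
    fix x'
    show "x\<^sup>2 - 2 * w * x + pen x \<le> x'\<^sup>2 - 2 * w * x' + pen x'"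
      using m[of 0 x'] unfolding y cw by (simp add: qf_def free_blk_def pen mult.assoc)
  qed
  then show ?thesis using False by (simp add: bet2_def y noise2_eq(2)[OF h False] w_def algebra_simps)
qed

lemma ss_est_block:
  fixes z be :: "nat \<Rightarrow> real" and sig lam :: real
  assumes G: "gram_is n p X (Gmat h)" and h: "\<bar>h\<bar> < 1" and k: "k < (p + 1) div 2"
  defines "bh \<equiv> ss_est n p X lam (Yobs n p X sig be z)"
  shows "Bmin h (ss_pen lam) (be (2 * k + 1) + h * bet2 p be k + sig * lin n (fstdir X k) z)
     (h * be (2 * k + 1) + bet2 p be k + sig * noise2 n p X h k z) (bh (2 * k + 1)) (bh (2 * k + 2))"
    "bh \<in> coefs p"
proof -
  define Y where "Y = Yobs n p X sig be z"
  define F where "F k x y = (qf h x y - 2 * (cor n X Y (2 * k + 1) * x + cor n X Y (2 * k + 2) * y) + ss_pen lam x + ss_pen lam y) / 2" for k x y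
  define obj where "obj b = sqn n (\<lambda>k. Y k - Xmul n p X b k) / 2 + lam\<^sup>2 * real (l0 p b) / 2" for b
  have 1: "obj b = sqn n Y / 2 + (\<Sum>k<(p + 1) div 2. F k (b (2 * k + 1)) (b (2 * k + 2)))" if b: "b \<in> coefs p" for b
  proof -
    have "lam\<^sup>2 * real (l0 p b) = (\<Sum>j\<in>{1..p}. ss_pen lam (b j))"
      unfolding l0_def ss_pen_def by (simp add: sum.If_cases Int_def conj_commute)
    also have "\<dots> = (\<Sum>k<(p + 1) div 2. ss_pen lam (b (2 * k + 1)) + ss_pen lam (b (2 * k + 2)))"
      by (rule sum_coefs_blocks[OF b]) (simp add: ss_pen_def)
    finally show ?thesis unfolding obj_def objective_blocks[OF G b] F_def
      by (simp add: sum.distrib add_divide_distrib sum_divide_distrib[symmetric] add.assoc)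
  qed
  have 2: "\<exists>x y. free_blk p k y \<and> (\<forall>x' y'. free_blk p k y' \<longrightarrow> F k x y \<le> F k x' y')" for k
  proof -
    define H where "H x y = qf h x y - 2 * (cor n X Y (2 * k + 1) * x + cor n X Y (2 * k + 2) * y) + lam\<^sup>2 * (of_bool (x \<noteq> 0) + of_bool (y \<noteq> 0))" for x y
    have eq: "F k x y = H x y / 2" for x y by (simp add: F_def ss_pen_def H_def)
    have "\<exists>x y. x \<in> insert 0 UNIV \<and> y \<in> insert 0 UNIV \<and> (2 * k + 2 \<le> p \<or> y = 0) \<and>
      (\<forall>x' y'. x' \<in> insert 0 UNIV \<longrightarrow> y' \<in> insert 0 UNIV \<longrightarrow> 2 * k + 2 \<le> p \<or> y' = 0 \<longrightarrow> H x y \<le> H x' y')"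
      unfolding H_def
      by (rule support_min_exists[OF h closed_UNIV UNIV_not_empty zero_le_power2[of lam],
          of "2 * k + 2 \<le> p" "cor n X Y (2 * k + 1)" "cor n X Y (2 * k + 2)"])
    then obtain x y where "(2 * k + 2 \<le> p \<or> y = 0) \<and>
      (\<forall>x' y'. x' \<in> insert 0 UNIV \<longrightarrow> y' \<in> insert 0 UNIV \<longrightarrow> 2 * k + 2 \<le> p \<or> y' = 0 \<longrightarrow> H x y \<le> H x' y')"
      by (elim exE conjE) (erule that[OF conjI])
    then have xy: "2 * k + 2 \<le> p \<or> y = 0"
      "\<And>x' y'. 2 * k + 2 \<le> p \<or> y' = 0 \<Longrightarrow> H x y \<le> H x' y'" by auto
    show ?thesis
    proof (intro exI conjI allI impI)
      show "free_blk p k y" using xy(1) by (simp add: free_blk_def)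
      show "F k x y \<le> F k x' y'" if "free_blk p k y'" for x' y'
        unfolding eq using xy(2)[of y' x'] that by (simp add: free_blk_def)
    qed
  qed
  have 3: "bh = (SOME b. b \<in> coefs p \<and> (\<forall>b'\<in>coefs p. obj b \<le> obj b'))"
    unfolding bh_def ss_est_def obj_def Y_def ..
  note sep = separable_min[where obj=obj and F=F and est=bh and p=p, OF 1 2 3]
  have sep2: "F k (bh (2 * k + 1)) (bh (2 * k + 2)) \<le> F k x' y'" if "free_blk p k y'" for x' y'
    by (rule sep(2)) (use k that in auto)
  show c: "bh \<in> coefs p" by (rule sep(1))
  show "Bmin h (ss_pen lam) (be (2 * k + 1) + h * bet2 p be k + sig * lin n (fstdir X k) z)
     (h * be (2 * k + 1) + bet2 p be k + sig * noise2 n p X h k z) (bh (2 * k + 1)) (bh (2 * k + 2))"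
  proof (rule Bmin_of_block_min[OF G h k _ _ Y_def])
    show "free_blk p k (bh (2 * k + 2))" using c by (auto simp: free_blk_def coefs_def)
    fix x' y' assume "free_blk p k y'"
    from sep2[OF this, of x'] show "qf h (bh (2 * k + 1)) (bh (2 * k + 2)) - 2 * (cor n X Y (2 * k + 1) * bh (2 * k + 1) + cor n X Y (2 * k + 2) * bh (2 * k + 2))
         + ss_pen lam (bh (2 * k + 1)) + ss_pen lam (bh (2 * k + 2))
       \<le> qf h x' y' - 2 * (cor n X Y (2 * k + 1) * x' + cor n X Y (2 * k + 2) * y') + ss_pen lam x' + ss_pen lam y'"
      unfolding F_def by simp
  qed (auto simp: ss_pen_def)
qed

lemma lasso_est_block:
  fixes z be :: "nat \<Rightarrow> real" and sig lam :: real
  assumes G: "gram_is n p X (Gmat h)" and h: "\<bar>h\<bar> < 1" and k: "k < (p + 1) div 2" and lam: "0 < lam"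
  defines "bh \<equiv> lasso_est n p X lam (Yobs n p X sig be z)"
  shows "Bmin h (lasso_pen lam) (be (2 * k + 1) + h * bet2 p be k + sig * lin n (fstdir X k) z)
     (h * be (2 * k + 1) + bet2 p be k + sig * noise2 n p X h k z) (bh (2 * k + 1)) (bh (2 * k + 2))"
    "bh \<in> coefs p"
proof -
  define Y where "Y = Yobs n p X sig be z"
  define F where "F k x y = (qf h x y - 2 * (cor n X Y (2 * k + 1) * x + cor n X Y (2 * k + 2) * y) + lasso_pen lam x + lasso_pen lam y) / 2" for k x y
  define obj where "obj b = sqn n (\<lambda>k. Y k - Xmul n p X b k) / 2 + lam * l1 p b" for b
  have 1: "obj b = sqn n Y / 2 + (\<Sum>k<(p + 1) div 2. F k (b (2 * k + 1)) (b (2 * k + 2)))" if b: "b \<in> coefs p" for b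
  proof -
    have "2 * (lam * l1 p b) = (\<Sum>j\<in>{1..p}. lasso_pen lam (b j))"
      unfolding l1_def lasso_pen_def by (simp add: sum_distrib_left mult.assoc)
    also have "\<dots> = (\<Sum>k<(p + 1) div 2. lasso_pen lam (b (2 * k + 1)) + lasso_pen lam (b (2 * k + 2)))"
      by (rule sum_coefs_blocks[OF b]) (simp add: lasso_pen_def)
    finally have "lam * l1 p b = (\<Sum>k<(p + 1) div 2. lasso_pen lam (b (2 * k + 1)) + lasso_pen lam (b (2 * k + 2))) / 2" by simp
    then show ?thesis unfolding obj_def objective_blocks[OF G b] F_def
      by (simp add: sum.distrib add_divide_distrib sum_divide_distrib[symmetric] add.assoc)
  qed
  have 2: "\<exists>x y. free_blk p k y \<and> (\<forall>x' y'. free_blk p k y' \<longrightarrow> F k x y \<le> F k x' y')" for k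
  proof -
    let ?f = "\<lambda>z::real\<times>real. qf h (fst z) (snd z) - 2 * (cor n X Y (2 * k + 1) * fst z + cor n X Y (2 * k + 2) * snd z) + lasso_pen lam (fst z) + lasso_pen lam (snd z)"
    let ?S = "if 2 * k + 2 \<le> p then UNIV else UNIV \<times> {0::real}"
    have "\<exists>z\<in>?S. \<forall>z'\<in>?S. ?f z \<le> ?f z'"
    proof (rule quad_min_exists[OF h])
      show "closed ?S" by (auto intro: closed_Times)
      show "continuous_on UNIV ?f" unfolding qf_def lasso_pen_def by (intro continuous_intros)
      show "qf h x y - 2 * (cor n X Y (2 * k + 1) * x + cor n X Y (2 * k + 2) * y) \<le> ?f (x, y)" for x y
        using lam by (simp add: lasso_pen_def)
    qed auto
    then obtain z where z: "z \<in> ?S" "\<And>z'. z' \<in> ?S \<Longrightarrow> ?f z \<le> ?f z'" by blast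
    have mem: "z' \<in> ?S \<longleftrightarrow> free_blk p k (snd z')" for z' by (auto simp: free_blk_def mem_Times_iff)
    show ?thesis
    proof (intro exI conjI allI impI)
      show "free_blk p k (snd z)" using z(1) mem by blast
      show "F k (fst z) (snd z) \<le> F k x' y'" if "free_blk p k y'" for x' y'
      proof -
        have "(x', y') \<in> ?S" using that mem[of "(x', y')"] by simp
        from z(2)[OF this] show ?thesis by (simp add: F_def)
      qed
    qed
  qed
  have 3: "bh = (SOME b. b \<in> coefs p \<and> (\<forall>b'\<in>coefs p. obj b \<le> obj b'))"
    unfolding bh_def lasso_est_def obj_def Y_def ..
  note sep = separable_min[where obj=obj and F=F and est=bh and p=p, OF 1 2 3]
  have sep2: "F k (bh (2 * k + 1)) (bh (2 * k + 2)) \<le> F k x' y'" if "free_blk p k y'" for x' y'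
    by (rule sep(2)) (use k that in auto)
  show c: "bh \<in> coefs p" by (rule sep(1))
  show "Bmin h (lasso_pen lam) (be (2 * k + 1) + h * bet2 p be k + sig * lin n (fstdir X k) z)
     (h * be (2 * k + 1) + bet2 p be k + sig * noise2 n p X h k z) (bh (2 * k + 1)) (bh (2 * k + 2))"
  proof (rule Bmin_of_block_min[OF G h k _ _ Y_def])
    show "free_blk p k (bh (2 * k + 2))" using c by (auto simp: free_blk_def coefs_def)
    fix x' y' assume "free_blk p k y'"
    from sep2[OF this, of x'] show "qf h (bh (2 * k + 1)) (bh (2 * k + 2)) - 2 * (cor n X Y (2 * k + 1) * bh (2 * k + 1) + cor n X Y (2 * k + 2) * bh (2 * k + 2))
         + lasso_pen lam (bh (2 * k + 1)) + lasso_pen lam (bh (2 * k + 2))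
       \<le> qf h x' y' - 2 * (cor n X Y (2 * k + 1) * x' + cor n X Y (2 * k + 2) * y') + lasso_pen lam x' + lasso_pen lam y'"
      unfolding F_def by simp
  next
    fix x y
    have "\<bar>h * y\<bar> \<le> 1 * \<bar>y\<bar>" unfolding abs_mult using h by (intro mult_right_mono) auto
    then have "\<bar>x + h * y\<bar> \<le> \<bar>x\<bar> + \<bar>y\<bar>" using abs_triangle_ineq[of x "h * y"] by linarith
    then have "2 * lam * \<bar>x + h * y\<bar> \<le> 2 * lam * (\<bar>x\<bar> + \<bar>y\<bar>)" using lam by (intro mult_left_mono) auto
    then show "lasso_pen lam (x + h * y) \<le> lasso_pen lam x + lasso_pen lam y" by (simp add: lasso_pen_def distrib_left)
  qed (simp add: lasso_pen_def)
qed

lemma blk_err_iff: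
  assumes "bh \<in> coefs p" "2 * k + 1 \<le> p"
  shows "blk_err p bh be k \<longleftrightarrow> \<not> (sgn (bh (2 * k + 1)) = sgn (be (2 * k + 1)) \<and> sgn (bh (2 * k + 2)) = sgn (bet2 p be k))"
  using assms unfolding blk_err_def blk_cases[OF assms(2)] bet2_def by (auto simp: coefs_def)

lemma Bmin_scale:
  assumes T: "0 < T" and pen: "\<And>x. pen' (x / T) = pen x / T\<^sup>2" and B: "Bmin h pen w1 w2 x y"
  shows "Bmin h pen' (w1 / T) (w2 / T) (x / T) (y / T)"
  unfolding Bmin_def
proof (intro allI)
  fix x' y'
  have *: "qf h (x / T) (y / T) - 2 * (w1 / T * (x / T) + w2 / T * (y / T)) + pen' (x / T) + pen' (y / T)
      = (qf h x y - 2 * (w1 * x + w2 * y) + pen x + pen y) / T\<^sup>2" for x y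
    unfolding pen qf_def using T by (simp add: field_simps power2_eq_square)
  have "qf h x y - 2 * (w1 * x + w2 * y) + pen x + pen y
    \<le> qf h (T * x') (T * y') - 2 * (w1 * (T * x') + w2 * (T * y')) + pen (T * x') + pen (T * y')"
    using B unfolding Bmin_def by blast
  then have "(qf h x y - 2 * (w1 * x + w2 * y) + pen x + pen y) / T\<^sup>2
    \<le> (qf h (T * x') (T * y') - 2 * (w1 * (T * x') + w2 * (T * y')) + pen (T * x') + pen (T * y')) / T\<^sup>2"
    by (rule divide_right_mono) simp
  then show "qf h (x / T) (y / T) - 2 * (w1 / T * (x / T) + w2 / T * (y / T)) + pen' (x / T) + pen' (y / T)
    \<le> qf h x' y' - 2 * (w1 / T * x' + w2 / T * y') + pen' x' + pen' y'"
    using *[of x y] *[of "T * x'" "T * y'"] T by simp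
qed

section \<open>Decoupling of Graphlet Screening\<close>

lemma gedge_iff:
  "gedge (Gmat h) 0 i j \<longleftrightarrow> h \<noteq> 0 \<and> (\<exists>k. (i = 2 * k + 1 \<and> j = 2 * k + 2) \<or> (i = 2 * k + 2 \<and> j = 2 * k + 1))"
proof
  assume e: "gedge (Gmat h) 0 i j"
  then have c: "h \<noteq> 0" "i = j + 1 \<or> j = i + 1" "even (max i j)" by (auto simp: gedge_def Gmat_def split: if_splits)
  then obtain m where m: "max i j = 2 * m" by blast
  with c(2) have "m \<noteq> 0" by auto
  then obtain k where "m = Suc k" by (cases m) auto
  with m c(2) have "(i = 2 * k + 1 \<and> j = 2 * k + 2) \<or> (i = 2 * k + 2 \<and> j = 2 * k + 1)" by auto
  with c(1) show "h \<noteq> 0 \<and> (\<exists>k. (i = 2 * k + 1 \<and> j = 2 * k + 2) \<or> (i = 2 * k + 2 \<and> j = 2 * k + 1))" by blast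
qed (auto simp: gedge_def Gmat_def)

lemma induced_star_block:
  assumes "(i, j) \<in> (induced_rel (Gmat h) 0 U)\<^sup>*"
  shows "i = j \<or> h \<noteq> 0 \<and> i \<in> U \<and> j \<in> U \<and> (\<exists>k. i \<in> {2 * k + 1, 2 * k + 2} \<and> j \<in> {2 * k + 1, 2 * k + 2})"
  using assms
proof (induction rule: rtrancl_induct)
  case (step y z)
  have yz: "h \<noteq> 0" "y \<in> U" "z \<in> U" using step(2) by (auto simp: induced_rel_def gedge_iff)
  obtain k where k: "y \<in> {2 * k + 1, 2 * k + 2}" "z \<in> {2 * k + 1, 2 * k + 2}"
    using step(2) by (auto simp: induced_rel_def gedge_iff)
  from step(3) show ?case
  proof
    assume "i = y" then show ?thesis using yz k by auto
  next
    assume "h \<noteq> 0 \<and> i \<in> U \<and> y \<in> U \<and> (\<exists>k. i \<in> {2 * k + 1, 2 * k + 2} \<and> y \<in> {2 * k + 1, 2 * k + 2})"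
    then obtain k' where k': "i \<in> U" "i \<in> {2 * k' + 1, 2 * k' + 2}" "y \<in> {2 * k' + 1, 2 * k' + 2}" by auto
    have "k' = k" using k(1) k'(3) by auto
    then show ?thesis using k' k yz by auto
  qed
qed simp

lemma component_single:
  assumes "j \<in> U" "j \<in> {2 * k + 1, 2 * k + 2}" "h = 0 \<or> U \<inter> {2 * k + 1, 2 * k + 2} = {j}"
  shows "component (Gmat h) 0 U j = {j}"
proof -
  have "x = j" if "(j, x) \<in> (induced_rel (Gmat h) 0 U)\<^sup>*" for x
  proof (rule ccontr)
    assume "x \<noteq> j"
    with induced_star_block[OF that] obtain k' where x: "h \<noteq> 0" "x \<in> U" "j \<in> {2 * k' + 1, 2 * k' + 2}" "x \<in> {2 * k' + 1, 2 * k' + 2}" by auto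
    then have "k' = k" using assms(2) by auto
    with x assms(3) \<open>x \<noteq> j\<close> show False by auto
  qed
  then show ?thesis using assms(1) by (auto simp: component_def)
qed

lemma component_pair:
  assumes "2 * k + 1 \<in> U" "2 * k + 2 \<in> U" "h \<noteq> 0" "j \<in> {2 * k + 1, 2 * k + 2}"
  shows "component (Gmat h) 0 U j = {2 * k + 1, 2 * k + 2}"
proof -
  have e: "(2 * k + 1, 2 * k + 2) \<in> induced_rel (Gmat h) 0 U" "(2 * k + 2, 2 * k + 1) \<in> induced_rel (Gmat h) 0 U"
    using assms unfolding induced_rel_def gedge_iff by blast+
  show ?thesis
  proof (intro set_eqI iffI)
    fix x assume "x \<in> component (Gmat h) 0 U j"
    then have "(j, x) \<in> (induced_rel (Gmat h) 0 U)\<^sup>*" by (simp add: component_def)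
    from induced_star_block[OF this] show "x \<in> {2 * k + 1, 2 * k + 2}"
    proof
      assume "h \<noteq> 0 \<and> j \<in> U \<and> x \<in> U \<and> (\<exists>k. j \<in> {2 * k + 1, 2 * k + 2} \<and> x \<in> {2 * k + 1, 2 * k + 2})"
      then obtain k' where x: "j \<in> {2 * k' + 1, 2 * k' + 2}" "x \<in> {2 * k' + 1, 2 * k' + 2}" by auto
      then have "k' = k" using assms(4) by auto
      with x show ?thesis by simp
    qed (use assms in simp)
  next
    fix x assume "x \<in> {2 * k + 1, 2 * k + 2}"
    then show "x \<in> component (Gmat h) 0 U j" using e assms unfolding component_def by auto
  qed
qed

lemma connected_small:
  assumes "I \<subseteq> {1..p}" "card I \<le> 2"
  shows "connected_in (Gmat h) 0 I \<longleftrightarrow> (\<exists>i\<in>{1..p}. I = {i}) \<or> h \<noteq> 0 \<and> (\<exists>k. 2 * k + 2 \<le> p \<and> I = {2 * k + 1, 2 * k + 2})"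
proof
  assume c: "connected_in (Gmat h) 0 I"
  have fin: "finite I" using assms finite_subset by blast
  have "I \<noteq> {}" using c by (simp add: connected_in_def)
  then have "card I = 1 \<or> card I = 2" using assms fin by (metis card_gt_0_iff le_eq_less_or_eq less_2_cases_iff less_one nat_neq_iff not_less_eq Suc_1)
  then show "(\<exists>i\<in>{1..p}. I = {i}) \<or> h \<noteq> 0 \<and> (\<exists>k. 2 * k + 2 \<le> p \<and> I = {2 * k + 1, 2 * k + 2})"
  proof
    assume "card I = 1"
    then show ?thesis using assms by (auto simp: card_1_singleton_iff)
  next
    assume "card I = 2"
    then obtain i j where ij: "I = {i, j}" "i \<noteq> j" by (auto simp: card_2_iff)
    then have "(i, j) \<in> (induced_rel (Gmat h) 0 I)\<^sup>*" using c by (auto simp: connected_in_def)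
    from induced_star_block[OF this] ij obtain k where "h \<noteq> 0" "i \<in> {2 * k + 1, 2 * k + 2}" "j \<in> {2 * k + 1, 2 * k + 2}" by auto
    with ij have "h \<noteq> 0" "I = {2 * k + 1, 2 * k + 2}" by auto
    with assms show ?thesis by auto
  qed
next
  assume "(\<exists>i\<in>{1..p}. I = {i}) \<or> h \<noteq> 0 \<and> (\<exists>k. 2 * k + 2 \<le> p \<and> I = {2 * k + 1, 2 * k + 2})"
  then show "connected_in (Gmat h) 0 I"
  proof
    assume "\<exists>i\<in>{1..p}. I = {i}" then show ?thesis by (auto simp: connected_in_def)
  next
    assume "h \<noteq> 0 \<and> (\<exists>k. 2 * k + 2 \<le> p \<and> I = {2 * k + 1, 2 * k + 2})"
    then obtain k where k: "h \<noteq> 0" "I = {2 * k + 1, 2 * k + 2}" by auto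
    then have "(2 * k + 1, 2 * k + 2) \<in> induced_rel (Gmat h) 0 I" "(2 * k + 2, 2 * k + 1) \<in> induced_rel (Gmat h) 0 I"
      unfolding induced_rel_def gedge_iff by blast+
    then show ?thesis using k(2) unfolding connected_in_def by auto
  qed
qed

definition pairs_list :: "real \<Rightarrow> nat \<Rightarrow> nat list" where
  "pairs_list h p = (if h = 0 then [] else [0..<p div 2])"

lemma gs_list_eq:
  "gs_list p (Gmat h) 0 2 = map (\<lambda>i. {i}) [1..<p + 1] @ map (\<lambda>k. {2 * k + 1, 2 * k + 2}) (pairs_list h p)"
proof -
  let ?xs = "map (\<lambda>i. [1, i]) [1..<p + 1] @ map (\<lambda>k. [2, 2 * k + 1, 2 * k + 2]) (pairs_list h p)"
  have key1: "card {i} # sorted_list_of_set {i} = [1, i]" for i :: nat by simp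
  have key2: "card {2 * k + 1, 2 * k + 2} # sorted_list_of_set {2 * k + 1, 2 * k + 2} = [2, 2 * k + 1, 2 * k + 2]" for k :: nat
  proof -
    have "sorted_list_of_set (set [2 * k + 1, 2 * k + 2]) = [2 * k + 1, 2 * k + 2]"
      by (rule sorted_list_of_set.idem_if_sorted_distinct) auto
    then show ?thesis by simp
  qed
  have "{card I # sorted_list_of_set I | I. I \<subseteq> {1..p} \<and> card I \<le> 2 \<and> connected_in (Gmat h) 0 I}
     = {card I # sorted_list_of_set I | I. (\<exists>i\<in>{1..p}. I = {i}) \<or> h \<noteq> 0 \<and> (\<exists>k. 2 * k + 2 \<le> p \<and> I = {2 * k + 1, 2 * k + 2})}"
  proof -
    have "(I \<subseteq> {1..p} \<and> card I \<le> 2 \<and> connected_in (Gmat h) 0 I)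
      \<longleftrightarrow> ((\<exists>i\<in>{1..p}. I = {i}) \<or> h \<noteq> 0 \<and> (\<exists>k. 2 * k + 2 \<le> p \<and> I = {2 * k + 1, 2 * k + 2}))" (is "?A \<longleftrightarrow> ?B") for I
    proof
      assume ?A then show ?B using connected_small[of I p h] by blast
    next
      assume B: ?B
      then have "I \<subseteq> {1..p} \<and> card I \<le> 2" by auto
      then show ?A using B connected_small[of I p h] by blast
    qed
    then show ?thesis by simp
  qed
  also have "\<dots> = (\<lambda>I. card I # sorted_list_of_set I) ` {I. (\<exists>i\<in>{1..p}. I = {i}) \<or> h \<noteq> 0 \<and> (\<exists>k. 2 * k + 2 \<le> p \<and> I = {2 * k + 1, 2 * k + 2})}"
    by (rule setcompr_eq_image)
  also have "{I. (\<exists>i\<in>{1..p}. I = {i}) \<or> h \<noteq> 0 \<and> (\<exists>k. 2 * k + 2 \<le> p \<and> I = {2 * k + 1, 2 * k + 2})}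
     = (\<lambda>i. {i}) ` {1..p} \<union> (\<lambda>k. {2 * k + 1, 2 * k + 2}) ` (if h = 0 then {} else {k. 2 * k + 2 \<le> p})"
    by auto
  also have "(\<lambda>I. card I # sorted_list_of_set I) ` \<dots> = (\<lambda>i. card {i} # sorted_list_of_set {i}) ` {1..p}
      \<union> (\<lambda>k. card {2 * k + 1, 2 * k + 2} # sorted_list_of_set {2 * k + 1, 2 * k + 2}) ` (if h = 0 then {} else {k. 2 * k + 2 \<le> p})"
    by (simp only: image_Un image_image)
  also have "\<dots> = set ?xs" unfolding key1 key2 by (auto simp: pairs_list_def image_iff)
  finally have set_eq: "{card I # sorted_list_of_set I | I. I \<subseteq> {1..p} \<and> card I \<le> 2 \<and> connected_in (Gmat h) 0 I} = set ?xs" .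
  have "sorted (map (\<lambda>i. [1, i]) [1..<p + 1])" by (auto simp: sorted_iff_nth_mono simp del: upt_Suc)
  moreover have "sorted (map (\<lambda>k. [2, 2 * k + 1, 2 * k + 2]) (pairs_list h p))"
    by (auto simp: sorted_iff_nth_mono pairs_list_def)
  ultimately have "sorted ?xs" unfolding sorted_append by auto
  moreover have "distinct ?xs" by (auto simp: distinct_map inj_on_def pairs_list_def)
  ultimately have "sorted_list_of_set (set ?xs) = ?xs" by (rule sorted_list_of_set.idem_if_sorted_distinct)
  then show ?thesis unfolding gs_list_def set_eq by simp
qed

definition screen_step :: "nat \<Rightarrow> (nat \<Rightarrow> nat \<Rightarrow> real) \<Rightarrow> (nat set \<Rightarrow> nat set \<Rightarrow> real) \<Rightarrow> (nat \<Rightarrow> real) \<Rightarrow> nat set \<Rightarrow> nat set \<Rightarrow> nat set" where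
  "screen_step n X t Y U I0 = (let F = I0 \<inter> U; D = I0 - U in
       if D \<noteq> {} \<and> sqn n (proj n X I0 Y) - sqn n (proj n X F Y) > t D F then U \<union> D else U)"

lemma gs_step_eq: "gs_step n p X G del m0 t Y = foldl (screen_step n X t Y) {} (gs_list p G del m0)"
  unfolding gs_step_def screen_step_def ..

lemma screen_step_off: "i \<notin> I0 \<Longrightarrow> i \<in> screen_step n X t Y U I0 \<longleftrightarrow> i \<in> U"
  by (auto simp: screen_step_def Let_def)

lemma screen_step_cong: "U \<inter> I0 = V \<inter> I0 \<Longrightarrow> i \<in> I0 \<Longrightarrow> i \<in> screen_step n X t Y U I0 \<longleftrightarrow> i \<in> screen_step n X t Y V I0"
proof -
  assume a: "U \<inter> I0 = V \<inter> I0" "i \<in> I0"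
  then have "I0 \<inter> U = I0 \<inter> V" "I0 - U = I0 - V" "i \<in> U \<longleftrightarrow> i \<in> V" by blast+
  then show ?thesis unfolding screen_step_def Let_def by auto
qed

lemma screen_singles:
  "foldl (screen_step n X t Y) {} (map (\<lambda>i. {i}) [1..<m + 1])
    = {i \<in> {1..m}. sqn n (proj n X {i} Y) - sqn n (proj n X {} Y) > t {i} {}}"
proof (induction m)
  case (Suc m)
  let ?U = "{i \<in> {1..m}. sqn n (proj n X {i} Y) - sqn n (proj n X {} Y) > t {i} {}}"
  have 1: "{Suc m} \<inter> ?U = {}" "{Suc m} - ?U = {Suc m}" by auto
  have "foldl (screen_step n X t Y) {} (map (\<lambda>i. {i}) [1..<Suc m + 1]) = screen_step n X t Y ?U {Suc m}"
    using Suc by simp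
  also have "\<dots> = {i \<in> {1..Suc m}. sqn n (proj n X {i} Y) - sqn n (proj n X {} Y) > t {i} {}}"
    unfolding screen_step_def Let_def 1 by (auto simp: le_Suc_eq)
  finally show ?case .
qed simp

lemma screen_pairs:
  "i \<in> foldl (screen_step n X t Y) U (map (\<lambda>k. {2 * k + 1, 2 * k + 2}) [0..<m])
    \<longleftrightarrow> (if i \<noteq> 0 \<and> (i - 1) div 2 < m then i \<in> screen_step n X t Y U {2 * ((i - 1) div 2) + 1, 2 * ((i - 1) div 2) + 2} else i \<in> U)"
proof (induction m arbitrary: i)
  case (Suc m)
  let ?V = "foldl (screen_step n X t Y) U (map (\<lambda>k. {2 * k + 1, 2 * k + 2}) [0..<m])"
  let ?P = "{2 * m + 1, 2 * m + 2}"
  have F: "foldl (screen_step n X t Y) U (map (\<lambda>k. {2 * k + 1, 2 * k + 2}) [0..<Suc m]) = screen_step n X t Y ?V ?P" by simp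
  have VP: "?V \<inter> ?P = U \<inter> ?P"
  proof (intro set_eqI)
    fix x show "x \<in> ?V \<inter> ?P \<longleftrightarrow> x \<in> U \<inter> ?P" using Suc[of x] by auto
  qed
  show ?case
  proof (cases "i \<in> ?P")
    case True
    then have "i \<noteq> 0" "(i - 1) div 2 = m" by auto
    then show ?thesis unfolding F screen_step_cong[OF VP True] by simp
  next
    case False
    have "i = 0 \<or> (i - 1) div 2 \<noteq> m" using False by auto
    then show ?thesis unfolding F screen_step_off[OF False] Suc by (auto simp: less_Suc_eq)
  qed
qed simp

lemma ipn_column: "ipn n Y (\<lambda>k. if k \<in> {1..n} then (\<Sum>j\<in>I. c j * X k j) else 0) = (\<Sum>j\<in>I. c j * cor n X Y j)"
proof -
  have "ipn n Y (\<lambda>k. if k \<in> {1..n} then (\<Sum>j\<in>I. c j * X k j) else 0) = (\<Sum>k\<in>{1..n}. \<Sum>j\<in>I. c j * (X k j * Y k))"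
    unfolding ipn_def by (intro sum.cong) (auto simp: sum_distrib_left mult_ac)
  also have "\<dots> = (\<Sum>j\<in>I. \<Sum>k\<in>{1..n}. c j * (X k j * Y k))" by (rule sum.swap)
  finally show ?thesis by (simp only: cor_def sum_distrib_left)
qed

lemma proj_eqI:
  assumes v: "v \<in> colspan n X I" and o: "\<And>j. j \<in> I \<Longrightarrow> cor n X (\<lambda>k. Y k - v k) j = 0"
  shows "proj n X I Y = v" "sqn n v = ipn n Y v"
proof -
  have orth: "ipn n (\<lambda>k. Y k - v k) w = 0" if "w \<in> colspan n X I" for w
  proof -
    obtain c where w: "w = (\<lambda>k. if k \<in> {1..n} then (\<Sum>j\<in>I. c j * X k j) else 0)"
      using \<open>w \<in> colspan n X I\<close> unfolding colspan_def by blast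
    show ?thesis unfolding w ipn_column using o by (intro sum.neutral) simp
  qed
  show "proj n X I Y = v" unfolding proj_def
  proof (rule the_equality)
    show "v \<in> colspan n X I \<and> (\<forall>w\<in>colspan n X I. ipn n (\<lambda>k. Y k - v k) w = 0)" using v orth by blast
    fix v' assume v': "v' \<in> colspan n X I \<and> (\<forall>w\<in>colspan n X I. ipn n (\<lambda>k. Y k - v' k) w = 0)"
    obtain c c' where c: "v = (\<lambda>k. if k \<in> {1..n} then (\<Sum>j\<in>I. c j * X k j) else 0)"
      "v' = (\<lambda>k. if k \<in> {1..n} then (\<Sum>j\<in>I. c' j * X k j) else 0)" using v v' by (auto simp: colspan_def)
    have "(\<lambda>k. v k - v' k) = (\<lambda>k. if k \<in> {1..n} then (\<Sum>j\<in>I. (c j - c' j) * X k j) else 0)"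
      by (rule ext) (simp add: c left_diff_distrib sum_subtractf)
    then have d: "(\<lambda>k. v k - v' k) \<in> colspan n X I"
      unfolding colspan_def by (intro CollectI exI[of _ "\<lambda>j. c j - c' j"]) simp
    have "(\<Sum>k\<in>{1..n}. (v k - v' k)\<^sup>2) = ipn n (\<lambda>k. Y k - v' k) (\<lambda>k. v k - v' k) - ipn n (\<lambda>k. Y k - v k) (\<lambda>k. v k - v' k)"
      unfolding ipn_def sum_subtractf[symmetric] by (intro sum.cong) (auto simp: power2_eq_square algebra_simps)
    also have "\<dots> = 0" using orth[OF d] v' d by simp
    finally have z: "\<forall>k\<in>{1..n}. (v k - v' k)\<^sup>2 = 0" by (subst (asm) sum_nonneg_eq_0_iff) auto
    show "v' = v"
    proof
      fix k show "v' k = v k"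
      proof (cases "k \<in> {1..n}")
        case True
        with z have "(v k - v' k)\<^sup>2 = 0" by blast
        then show ?thesis by simp
      next
        case False then show ?thesis unfolding c by auto
      qed
    qed
  qed
  have "ipn n Y v - sqn n v = ipn n (\<lambda>k. Y k - v k) v"
    unfolding ipn_def sqn_def sum_subtractf[symmetric] by (intro sum.cong) (auto simp: power2_eq_square algebra_simps)
  then show "sqn n v = ipn n Y v" using orth[OF v] by simp
qed

lemma sqn_proj:
  assumes G: "gram_is n p X G" and I: "I \<subseteq> {1..p}" and c: "\<And>i. i \<in> I \<Longrightarrow> (\<Sum>j\<in>I. G i j * c j) = cor n X Y i"
  shows "sqn n (proj n X I Y) = (\<Sum>j\<in>I. c j * cor n X Y j)"
proof -
  define v where "v = (\<lambda>k. if k \<in> {1..n} then (\<Sum>j\<in>I. c j * X k j) else 0)"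
  have v: "v \<in> colspan n X I" unfolding colspan_def v_def by blast
  have o: "cor n X (\<lambda>k. Y k - v k) i = 0" if i: "i \<in> I" for i
  proof -
    have "cor n X (\<lambda>k. Y k - v k) i = cor n X Y i - (\<Sum>k\<in>{1..n}. \<Sum>j\<in>I. X k i * X k j * c j)"
      unfolding cor_def v_def sum_subtractf[symmetric] by (intro sum.cong) (auto simp: sum_distrib_left algebra_simps)
    also have "(\<Sum>k\<in>{1..n}. \<Sum>j\<in>I. X k i * X k j * c j) = (\<Sum>j\<in>I. (\<Sum>k\<in>{1..n}. X k i * X k j) * c j)"
      by (subst sum.swap) (simp add: sum_distrib_right)
    also have "\<dots> = (\<Sum>j\<in>I. G i j * c j)" using G I i unfolding gram_is_def by (intro sum.cong) auto
    finally show ?thesis using c[OF i] by simp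
  qed
  have "proj n X I Y = v" by (rule proj_eqI(1)[OF v]) (rule o)
  then have "sqn n (proj n X I Y) = sqn n v" by simp
  also have "\<dots> = ipn n Y v" by (rule proj_eqI(2)[OF v]) (rule o)
  also have "\<dots> = (\<Sum>j\<in>I. c j * cor n X Y j)" unfolding v_def by (rule ipn_column)
  finally show ?thesis .
qed

lemma sqn_proj_empty: "sqn n (proj n X {} Y) = 0"
proof -
  have "(\<lambda>k. 0) \<in> colspan n X {}"
    unfolding colspan_def by (rule CollectI, rule exI[of _ "\<lambda>_. 0"]) (simp add: fun_eq_iff)
  then have "proj n X {} Y = (\<lambda>k. 0)" by (rule proj_eqI(1)) simp
  then show ?thesis by (simp add: sqn_def)
qed

lemma sqn_proj_single:
  assumes "gram_is n p X (Gmat h)" "i \<in> {1..p}" shows "sqn n (proj n X {i} Y) = (cor n X Y i)\<^sup>2"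
  using sqn_proj[OF assms(1), of "{i}" "\<lambda>_. cor n X Y i" Y] assms(2) by (simp add: Gmat_def power2_eq_square)

lemma sqn_proj_pair:
  assumes G: "gram_is n p X (Gmat h)" and h: "\<bar>h\<bar> < 1" and k: "2 * k + 2 \<le> p"
  shows "sqn n (proj n X {2 * k + 1, 2 * k + 2} Y) = rad2 h (cor n X Y (2 * k + 1)) (cor n X Y (2 * k + 2))"
proof -
  define i where "i = 2 * k + 1"
  define j where "j = 2 * k + 2"
  have ij: "i \<noteq> j" "Gmat h i i = 1" "Gmat h j j = 1" "Gmat h i j = h" "Gmat h j i = h"
    using Gmat_block[of h k] by (simp_all add: i_def j_def)
  have a: "1 - h\<^sup>2 \<noteq> 0" using abs_less_one_sq[OF h] by simp
  let ?w1 = "cor n X Y i" and ?w2 = "cor n X Y j"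
  define x where "x = (?w1 - h * ?w2) / (1 - h\<^sup>2)"
  define y where "y = (?w2 - h * ?w1) / (1 - h\<^sup>2)"
  have "(1 - h\<^sup>2) * x = ?w1 - h * ?w2" "(1 - h\<^sup>2) * y = ?w2 - h * ?w1" using a by (simp_all add: x_def y_def)
  then have "(1 - h\<^sup>2) * (x + h * y) = (1 - h\<^sup>2) * ?w1" "(1 - h\<^sup>2) * (h * x + y) = (1 - h\<^sup>2) * ?w2" by algebra+
  then have xy: "x + h * y = ?w1" "h * x + y = ?w2" using a by auto
  define c where "c = (\<lambda>l. if l = i then x else y)"
  have "sqn n (proj n X {i, j} Y) = (\<Sum>l\<in>{i, j}. c l * cor n X Y l)"
  proof (rule sqn_proj[OF G])
    show "{i, j} \<subseteq> {1..p}" using k by (auto simp: i_def j_def)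
    fix l assume "l \<in> {i, j}"
    then show "(\<Sum>l'\<in>{i, j}. Gmat h l l' * c l') = cor n X Y l"
      using ij xy by (auto simp: c_def)
  qed
  also have "\<dots> = x * ?w1 + y * ?w2" using ij(1) by (simp add: c_def)
  also have "\<dots> = rad2 h ?w1 ?w2"
    by (simp add: x_def y_def rad2_def add_divide_distrib[symmetric]) (simp add: power2_eq_square algebra_simps)
  finally show ?thesis by (simp add: i_def j_def)
qed

lemma cor_residual:
  assumes G: "gram_is n p X (Gmat h)" and i: "i \<in> blk p k"
  shows "cor n X (\<lambda>l. Y l - Xmul n p X xi l) i = cor n X Y i - (\<Sum>j\<in>blk p k. Gmat h i j * xi j)"
proof -
  have ip: "i \<in> {1..p}" using i by (auto simp: blk_def)
  have "cor n X (\<lambda>l. Y l - Xmul n p X xi l) i = cor n X Y i - (\<Sum>l\<in>{1..n}. \<Sum>j\<in>{1..p}. X l i * X l j * xi j)"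
    unfolding cor_def Xmul_def sum_subtractf[symmetric] by (intro sum.cong) (auto simp: sum_distrib_left algebra_simps)
  also have "(\<Sum>l\<in>{1..n}. \<Sum>j\<in>{1..p}. X l i * X l j * xi j) = (\<Sum>j\<in>{1..p}. (\<Sum>l\<in>{1..n}. X l i * X l j) * xi j)"
    by (subst sum.swap) (simp add: sum_distrib_right)
  also have "\<dots> = (\<Sum>j\<in>{1..p}. Gmat h i j * xi j)" using G ip unfolding gram_is_def by (intro sum.cong) auto
  finally show ?thesis by (simp only: Gmat_row_sum[OF i])
qed

lemma Gmin1_exists: "\<exists>x. Gmin1 u v w x"
proof -
  define K where "K = {x::real. v \<le> \<bar>x\<bar>}"
  have "closed K" unfolding K_def by (intro closed_Collect_le continuous_intros)
  moreover have "max 0 v \<in> K" by (auto simp: K_def)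
  then have "K \<noteq> {}" by blast
  ultimately have "\<exists>x y. x \<in> insert 0 K \<and> y \<in> insert 0 K \<and> (False \<or> y = 0) \<and>
    (\<forall>x' y'. x' \<in> insert 0 K \<longrightarrow> y' \<in> insert 0 K \<longrightarrow> False \<or> y' = 0 \<longrightarrow>
      qf 0 x y - 2 * (w * x + 0 * y) + u\<^sup>2 * (of_bool (x \<noteq> 0) + of_bool (y \<noteq> 0))
      \<le> qf 0 x' y' - 2 * (w * x' + 0 * y') + u\<^sup>2 * (of_bool (x' \<noteq> 0) + of_bool (y' \<noteq> 0)))"
    by (intro support_min_exists[of 0 K "u\<^sup>2" False w 0]) simp_all
  then obtain x y where xy: "x \<in> insert 0 K" "y \<in> insert 0 K" "False \<or> y = 0"
    "\<forall>x' y'. x' \<in> insert 0 K \<longrightarrow> y' \<in> insert 0 K \<longrightarrow> False \<or> y' = 0 \<longrightarrow>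
      qf 0 x y - 2 * (w * x + 0 * y) + u\<^sup>2 * (of_bool (x \<noteq> 0) + of_bool (y \<noteq> 0))
      \<le> qf 0 x' y' - 2 * (w * x' + 0 * y') + u\<^sup>2 * (of_bool (x' \<noteq> 0) + of_bool (y' \<noteq> 0))"
    by (elim exE conjE) (rule that)
  have m: "x' \<in> insert 0 K \<longleftrightarrow> adm v x'" for x' by (auto simp: K_def adm_def)
  have "Gmin1 u v w x" unfolding Gmin1_def
  proof (intro conjI allI impI)
    show "adm v x" using xy(1) m by simp
    fix x' assume "adm v x'"
    with m xy(4)[rule_format, of x' 0] xy(3) show "x\<^sup>2 - 2 * w * x + u\<^sup>2 * of_bool (x \<noteq> 0) \<le> x'\<^sup>2 - 2 * w * x' + u\<^sup>2 * of_bool (x' \<noteq> 0)"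
      by (simp add: qf_def mult.assoc)
  qed
  then show ?thesis ..
qed

lemma Gmin2_exists: assumes h: "\<bar>h\<bar> < 1" shows "\<exists>x y. Gmin2 h u v w1 w2 x y"
proof -
  define K where "K = {x::real. v \<le> \<bar>x\<bar>}"
  have "closed K" unfolding K_def by (intro closed_Collect_le continuous_intros)
  moreover have "max 0 v \<in> K" by (auto simp: K_def)
  then have "K \<noteq> {}" by blast
  moreover have m: "x \<in> insert 0 K \<longleftrightarrow> adm v x" for x by (auto simp: K_def adm_def)
  ultimately have "\<exists>x y. x \<in> insert 0 K \<and> y \<in> insert 0 K \<and> (True \<or> y = 0) \<and>
    (\<forall>x' y'. x' \<in> insert 0 K \<longrightarrow> y' \<in> insert 0 K \<longrightarrow> True \<or> y' = 0 \<longrightarrow>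
      qf h x y - 2 * (w1 * x + w2 * y) + u\<^sup>2 * (of_bool (x \<noteq> 0) + of_bool (y \<noteq> 0))
      \<le> qf h x' y' - 2 * (w1 * x' + w2 * y') + u\<^sup>2 * (of_bool (x' \<noteq> 0) + of_bool (y' \<noteq> 0)))"
    by (intro support_min_exists[OF h, of K "u\<^sup>2" True w1 w2]) simp_all
  then show ?thesis unfolding m mem_Collect_eq Gmin2_def by blast
qed

lemma gc_fit_single:
  assumes G: "gram_is n p X (Gmat h)" and i: "i \<in> {1..p}"
  shows "Gmin1 u v (cor n X Y i) (gc_fit n p X u v {i} Y i)"
proof -
  define w where "w = cor n X Y i"
  define A where "A = {xi::nat \<Rightarrow> real. (\<forall>k. k \<notin> {i} \<longrightarrow> xi k = 0) \<and> (\<forall>k\<in>{i}. xi k \<noteq> 0 \<longrightarrow> \<bar>xi k\<bar> \<ge> v)}"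
  define obj where "obj = (\<lambda>xi. sqn n (proj n X {i} (\<lambda>k. Y k - Xmul n p X xi k)) + u\<^sup>2 * real (card {k\<in>{i}. xi k \<noteq> 0}))"
  define k where "k = (i - 1) div 2"
  have ib: "i \<in> blk p k" using i by (auto simp: blk_def k_def)
  have obj: "obj xi = (w - xi i)\<^sup>2 + u\<^sup>2 * of_bool (xi i \<noteq> 0)" if "xi \<in> A" for xi
  proof -
    have "(\<Sum>j\<in>blk p k. Gmat h i j * xi j) = (\<Sum>j\<in>{i}. Gmat h i j * xi j)"
      using that ib by (intro sum.mono_neutral_right) (auto simp: A_def blk_def)
    then have "cor n X (\<lambda>k. Y k - Xmul n p X xi k) i = w - xi i"
      unfolding cor_residual[OF G ib] w_def by (simp add: Gmat_def)
    moreover have "{k \<in> {i}. xi k \<noteq> 0} = (if xi i \<noteq> 0 then {i} else {})" by auto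
    ultimately show ?thesis unfolding obj_def sqn_proj_single[OF G i] by simp
  qed
  obtain x where x: "Gmin1 u v w x" using Gmin1_exists by blast
  have admA: "xi \<in> A \<Longrightarrow> adm v (xi i)" for xi by (auto simp: A_def adm_def)
  have Aadm: "adm v x \<Longrightarrow> (\<lambda>_. 0)(i := x) \<in> A" for x by (auto simp: A_def adm_def)
  have sq: "(w - x)\<^sup>2 = w\<^sup>2 + (x\<^sup>2 - 2 * w * x)" for x by (simp add: power2_diff)
  let ?xi = "(\<lambda>_. 0)(i := x)"
  have "?xi \<in> A \<and> (\<forall>xi'\<in>A. obj ?xi \<le> obj xi')"
  proof (intro conjI ballI)
    show xiA: "?xi \<in> A" using x Aadm by (auto simp: Gmin1_def)
    fix xi' assume xi': "xi' \<in> A"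
    have "x\<^sup>2 - 2 * w * x + u\<^sup>2 * of_bool (x \<noteq> 0) \<le> (xi' i)\<^sup>2 - 2 * w * (xi' i) + u\<^sup>2 * of_bool (xi' i \<noteq> 0)"
      using x admA[OF xi'] unfolding Gmin1_def by blast
    then show "obj ?xi \<le> obj xi'" unfolding obj[OF xiA] obj[OF xi'] sq by simp
  qed
  then have S: "gc_fit n p X u v {i} Y \<in> A \<and> (\<forall>xi'\<in>A. obj (gc_fit n p X u v {i} Y) \<le> obj xi')"
    unfolding gc_fit_def Let_def A_def[symmetric] obj_def[symmetric] by (rule someI[of "\<lambda>xi. xi \<in> A \<and> (\<forall>xi'\<in>A. obj xi \<le> obj xi')"])
  show ?thesis unfolding Gmin1_def w_def[symmetric]
  proof (intro conjI allI impI)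
    show "adm v (gc_fit n p X u v {i} Y i)" using S admA by blast
    fix x' assume x': "adm v x'"
    from S Aadm[OF x'] have "obj (gc_fit n p X u v {i} Y) \<le> obj ((\<lambda>_. 0)(i := x'))" by blast
    then show "(gc_fit n p X u v {i} Y i)\<^sup>2 - 2 * w * gc_fit n p X u v {i} Y i + u\<^sup>2 * of_bool (gc_fit n p X u v {i} Y i \<noteq> 0)
       \<le> x'\<^sup>2 - 2 * w * x' + u\<^sup>2 * of_bool (x' \<noteq> 0)"
      using obj[OF conjunct1[OF S]] obj[OF Aadm[OF x']] unfolding sq by simp
  qed
qed

lemma gc_fit_pair:
  fixes u v :: real and Y :: "nat \<Rightarrow> real"
  assumes G: "gram_is n p X (Gmat h)" and h: "\<bar>h\<bar> < 1" and k: "2 * k + 2 \<le> p"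
  defines "fit \<equiv> gc_fit n p X u v {2 * k + 1, 2 * k + 2} Y"
  shows "Gmin2 h u v (cor n X Y (2 * k + 1)) (cor n X Y (2 * k + 2)) (fit (2 * k + 1)) (fit (2 * k + 2))"
proof -
  define i where "i = 2 * k + 1"
  define j where "j = 2 * k + 2"
  have ij: "i \<noteq> j" "Gmat h i i = 1" "Gmat h j j = 1" "Gmat h i j = h" "Gmat h j i = h"
    using Gmat_block[of h k] by (simp_all add: i_def j_def)
  have blk: "blk p k = {i, j}" using k by (auto simp: blk_def i_def j_def)
  define w1 where "w1 = cor n X Y i"
  define w2 where "w2 = cor n X Y j"
  define A where "A = {xi::nat \<Rightarrow> real. (\<forall>k. k \<notin> {i, j} \<longrightarrow> xi k = 0) \<and> (\<forall>k\<in>{i, j}. xi k \<noteq> 0 \<longrightarrow> \<bar>xi k\<bar> \<ge> v)}"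
  define obj where "obj = (\<lambda>xi. sqn n (proj n X {i, j} (\<lambda>k. Y k - Xmul n p X xi k)) + u\<^sup>2 * real (card {k\<in>{i, j}. xi k \<noteq> 0}))"
  define Q where "Q x y = qf h x y - 2 * (w1 * x + w2 * y) + u\<^sup>2 * (of_bool (x \<noteq> 0) + of_bool (y \<noteq> 0))" for x y
  have a: "1 - h\<^sup>2 \<noteq> 0" using abs_less_one_sq[OF h] by simp
  have obj: "obj xi = rad2 h w1 w2 + Q (xi i) (xi j)" if "xi \<in> A" for xi
  proof -
    have "cor n X (\<lambda>k. Y k - Xmul n p X xi k) i = w1 - (xi i + h * xi j)"
      "cor n X (\<lambda>k. Y k - Xmul n p X xi k) j = w2 - (h * xi i + xi j)"
      using cor_residual[OF G, of i k Y xi] cor_residual[OF G, of j k Y xi] ij blk by (simp_all add: w1_def w2_def)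
    then have "sqn n (proj n X {i, j} (\<lambda>k. Y k - Xmul n p X xi k)) = rad2 h (w1 - (xi i + h * xi j)) (w2 - (h * xi i + xi j))"
      using sqn_proj_pair[OF G h k] by (simp add: i_def j_def)
    also have "\<dots> = rad2 h w1 w2 + (qf h (xi i) (xi j) - 2 * (w1 * xi i + w2 * xi j))"
      using a unfolding rad2_def qf_def by (simp add: field_simps power2_eq_square)
    finally have 1: "sqn n (proj n X {i, j} (\<lambda>k. Y k - Xmul n p X xi k)) = rad2 h w1 w2 + (qf h (xi i) (xi j) - 2 * (w1 * xi i + w2 * xi j))" .
    have "{k \<in> {i, j}. xi k \<noteq> 0} = (if xi i \<noteq> 0 then {i} else {}) \<union> (if xi j \<noteq> 0 then {j} else {})" by auto
    then have "real (card {k \<in> {i, j}. xi k \<noteq> 0}) = of_bool (xi i \<noteq> 0) + of_bool (xi j \<noteq> 0)" using ij(1) by simp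
    with 1 show ?thesis by (simp only: obj_def Q_def add.assoc)
  qed
  obtain x y where xy: "Gmin2 h u v w1 w2 x y" using Gmin2_exists[OF h] by blast
  have admA: "xi \<in> A \<Longrightarrow> adm v (xi i) \<and> adm v (xi j)" for xi by (auto simp: A_def adm_def)
  let ?f = "\<lambda>x y. (\<lambda>_. 0)(i := x, j := y)"
  have Aadm: "adm v x \<and> adm v y \<Longrightarrow> ?f x y \<in> A" for x y by (auto simp: A_def adm_def)
  have fv: "?f x y i = x" "?f x y j = y" for x y :: real using ij(1) by auto
  have "?f x y \<in> A \<and> (\<forall>xi'\<in>A. obj (?f x y) \<le> obj xi')"
  proof (intro conjI ballI)
    show xiA: "?f x y \<in> A" using xy Aadm unfolding Gmin2_def by blast
    fix xi' assume xi': "xi' \<in> A"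
    have "Q x y \<le> Q (xi' i) (xi' j)" using xy admA[OF xi'] unfolding Gmin2_def Q_def by blast
    then show "obj (?f x y) \<le> obj xi'" unfolding obj[OF xiA] obj[OF xi'] fv by simp
  qed
  then have S: "fit \<in> A \<and> (\<forall>xi'\<in>A. obj fit \<le> obj xi')"
    unfolding fit_def i_def[symmetric] j_def[symmetric] gc_fit_def Let_def A_def[symmetric] obj_def[symmetric]
    by (rule someI[of "\<lambda>xi. xi \<in> A \<and> (\<forall>xi'\<in>A. obj xi \<le> obj xi')"])
  have "Gmin2 h u v w1 w2 (fit i) (fit j)" unfolding Gmin2_def Q_def[symmetric]
  proof (intro conjI allI impI)
    show "adm v (fit i)" "adm v (fit j)" using S admA by blast+
    fix x' y' assume x': "adm v x' \<and> adm v y'"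
    from S Aadm[OF x'] have "obj fit \<le> obj (?f x' y')" by blast
    then show "Q (fit i) (fit j) \<le> Q x' y'" using obj[OF conjunct1[OF S]] obj[OF Aadm[OF x']] by (simp only: fv)
  qed
  then show ?thesis by (simp add: w1_def w2_def i_def j_def)
qed

lemma gs_step_mem:
  assumes G: "gram_is n p X (Gmat h)"
  shows "x \<in> gs_step n p X (Gmat h) 0 2 t Y \<longleftrightarrow>
    (let U = {i \<in> {1..p}. (cor n X Y i)\<^sup>2 > t {i} {}} in
     if h \<noteq> 0 \<and> x \<noteq> 0 \<and> (x - 1) div 2 < p div 2
     then x \<in> screen_step n X t Y U {2 * ((x - 1) div 2) + 1, 2 * ((x - 1) div 2) + 2} else x \<in> U)"
proof -
  have U: "{i \<in> {1..p}. sqn n (proj n X {i} Y) - sqn n (proj n X {} Y) > t {i} {}} = {i \<in> {1..p}. (cor n X Y i)\<^sup>2 > t {i} {}}"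
    using sqn_proj_single[OF G] by (auto simp: sqn_proj_empty)
  show ?thesis
  proof (cases "h = 0")
    case True
    then show ?thesis
      unfolding gs_step_eq gs_list_eq foldl_append screen_singles U pairs_list_def Let_def by simp
  next
    case False
    then have pl: "pairs_list h p = [0..<p div 2]" by (simp add: pairs_list_def)
    show ?thesis
      unfolding gs_step_eq gs_list_eq foldl_append screen_singles U pl screen_pairs Let_def
      using False by (simp only: simp_thms)
  qed
qed

lemma gs_screen_pair:
  assumes G: "gram_is n p X (Gmat h)" and h: "\<bar>h\<bar> < 1" and h0: "h \<noteq> 0" and k: "2 * k + 2 \<le> p"
    and i: "i = 2 * k + 1" and j: "j = 2 * k + 2"
  shows "gs_screen h (t {i} {}) (t {j} {}) (t {i} {j}) (t {j} {i}) (t {i, j} {}) (cor n X Y i) (cor n X Y j)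
    (i \<in> gs_step n p X (Gmat h) 0 2 t Y) (j \<in> gs_step n p X (Gmat h) 0 2 t Y)"
proof -
  let ?w1 = "cor n X Y i" and ?w2 = "cor n X Y j"
  define U where "U = {i \<in> {1..p}. (cor n X Y i)\<^sup>2 > t {i} {}}"
  have ne: "i \<noteq> j" "i \<in> {1..p}" "j \<in> {1..p}" using k by (auto simp: i j)
  have "k < p div 2" using k by auto
  then have mem: "x \<in> gs_step n p X (Gmat h) 0 2 t Y \<longleftrightarrow> x \<in> screen_step n X t Y U {i, j}" if "x \<in> {i, j}" for x
    using that h0 unfolding gs_step_mem[OF G] U_def[symmetric] Let_def by (auto simp: i j)
  have P: "sqn n (proj n X {i, j} Y) = rad2 h ?w1 ?w2" unfolding i j by (rule sqn_proj_pair[OF G h k])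
  have S: "sqn n (proj n X {i} Y) = ?w1\<^sup>2" "sqn n (proj n X {j} Y) = ?w2\<^sup>2" using sqn_proj_single[OF G] ne by auto
  have R: "rad2 h ?w1 ?w2 - ?w1\<^sup>2 = (?w2 - h * ?w1)\<^sup>2 / (1 - h\<^sup>2)" "rad2 h ?w1 ?w2 - ?w2\<^sup>2 = (?w1 - h * ?w2)\<^sup>2 / (1 - h\<^sup>2)"
    using rad2_alt[OF h, of ?w1 ?w2] rad2_alt'[OF h, of ?w1 ?w2] by simp_all
  have Ui: "i \<in> U \<longleftrightarrow> ?w1\<^sup>2 > t {i} {}" "j \<in> U \<longleftrightarrow> ?w2\<^sup>2 > t {j} {}" using ne by (auto simp: U_def)
  consider "i \<in> U" "j \<in> U" | "i \<in> U" "j \<notin> U" | "i \<notin> U" "j \<in> U" | "i \<notin> U" "j \<notin> U" by blast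
  then show ?thesis
  proof cases
    case 1
    then have "screen_step n X t Y U {i, j} = U" by (auto simp: screen_step_def Let_def)
    then show ?thesis using 1 Ui mem by (auto simp: gs_screen_def)
  next
    case 2
    then have F: "{i, j} \<inter> U = {i}" "{i, j} - U = {j}" using ne by auto
    have "screen_step n X t Y U {i, j} = (if (?w2 - h * ?w1)\<^sup>2 / (1 - h\<^sup>2) > t {j} {i} then U \<union> {j} else U)"
      unfolding screen_step_def Let_def F P S R by simp
    then show ?thesis using 2 Ui mem ne by (auto simp: gs_screen_def)
  next
    case 3
    then have F: "{i, j} \<inter> U = {j}" "{i, j} - U = {i}" using ne by auto
    have "screen_step n X t Y U {i, j} = (if (?w1 - h * ?w2)\<^sup>2 / (1 - h\<^sup>2) > t {i} {j} then U \<union> {i} else U)"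
      unfolding screen_step_def Let_def F P S R by simp
    then show ?thesis using 3 Ui mem ne by (auto simp: gs_screen_def)
  next
    case 4
    then have F: "{i, j} \<inter> U = {}" "{i, j} - U = {i, j}" using ne by auto
    have "screen_step n X t Y U {i, j} = (if rad2 h ?w1 ?w2 > t {i, j} {} then U \<union> {i, j} else U)"
      unfolding screen_step_def Let_def F P sqn_proj_empty by simp
    then show ?thesis using 4 Ui mem ne by (auto simp: gs_screen_def)
  qed
qed

lemma gs_est_pair:
  fixes Y :: "nat \<Rightarrow> real" and u v :: real and t :: "nat set \<Rightarrow> nat set \<Rightarrow> real"
  assumes G: "gram_is n p X (Gmat h)" and h: "\<bar>h\<bar> < 1" and h0: "h \<noteq> 0" and k: "2 * k + 2 \<le> p"
    and i: "i = 2 * k + 1" and j: "j = 2 * k + 2"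
  defines "bh \<equiv> gs_est n p X (Gmat h) 0 2 t u v Y"
  obtains u1 u2 where "gs_screen h (t {i} {}) (t {j} {}) (t {i} {j}) (t {j} {i}) (t {i, j} {}) (cor n X Y i) (cor n X Y j) u1 u2"
    "gs_block h u v (cor n X Y i) (cor n X Y j) u1 u2 (bh i) (bh j)"
proof -
  define U where "U = gs_step n p X (Gmat h) 0 2 t Y"
  have ip: "i \<in> {1..p}" "j \<in> {1..p}" "i \<noteq> j" using k by (auto simp: i j)
  have bh: "bh x = (if x \<in> U then gc_fit n p X u v (component (Gmat h) 0 U x) Y x else 0)" for x
    by (simp add: bh_def gs_est_def U_def Let_def)
  have "gs_block h u v (cor n X Y i) (cor n X Y j) (i \<in> U) (j \<in> U) (bh i) (bh j)"
  proof (cases "i \<in> U \<and> j \<in> U")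
    case True
    then have "component (Gmat h) 0 U i = {i, j}" "component (Gmat h) 0 U j = {i, j}"
      using component_pair[of k U h] h0 by (auto simp: i j)
    then show ?thesis using True gc_fit_pair[OF G h k, of u v Y] unfolding gs_block_def bh by (simp add: i j)
  next
    case False
    have "Gmin1 u v (cor n X Y x) (bh x)" if x: "x \<in> {i, j}" "x \<in> U" for x
    proof -
      have "U \<inter> {i, j} = {x}" using x False by auto
      then have "component (Gmat h) 0 U x = {x}" using x component_single[of x U k h] by (auto simp: i j)
      then show ?thesis using x gc_fit_single[OF G, of x u v Y] ip by (auto simp: bh)
    qed
    then show ?thesis using False unfolding gs_block_def by (auto simp: bh)
  qed
  moreover have "gs_screen h (t {i} {}) (t {j} {}) (t {i} {j}) (t {j} {i}) (t {i, j} {}) (cor n X Y i) (cor n X Y j) (i \<in> U) (j \<in> U)"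
    unfolding U_def by (rule gs_screen_pair[OF G h h0 k i j])
  ultimately show ?thesis by (rule that[rotated])
qed

lemma gs_est_isolated:
  fixes Y :: "nat \<Rightarrow> real" and u v :: real and t :: "nat set \<Rightarrow> nat set \<Rightarrow> real"
  assumes G: "gram_is n p X (Gmat h)" and i: "i \<in> {1..p}" and iso: "h = 0 \<or> i = p \<and> odd p"
  defines "bh \<equiv> gs_est n p X (Gmat h) 0 2 t u v Y"
  shows "if (cor n X Y i)\<^sup>2 > t {i} {} then Gmin1 u v (cor n X Y i) (bh i) else bh i = 0"
proof -
  define U where "U = gs_step n p X (Gmat h) 0 2 t Y"
  define k where "k = (i - 1) div 2"
  have ik: "i \<in> {2 * k + 1, 2 * k + 2}" using i by (auto simp: k_def)
  have bh: "bh x = (if x \<in> U then gc_fit n p X u v (component (Gmat h) 0 U x) Y x else 0)" for x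
    by (simp add: bh_def gs_est_def U_def Let_def)
  have memU: "x \<in> U \<longleftrightarrow> x \<in> {1..p} \<and> (cor n X Y x)\<^sup>2 > t {x} {}" if "h = 0 \<or> x = p \<and> odd p \<or> x = p + 1 \<and> odd p" for x
  proof -
    have "\<not> (h \<noteq> 0 \<and> x \<noteq> 0 \<and> (x - 1) div 2 < p div 2)" using that by (auto elim!: oddE)
    then show ?thesis unfolding U_def gs_step_mem[OF G] Let_def by auto
  qed
  have "component (Gmat h) 0 U i = {i}" if iU: "i \<in> U"
  proof (rule component_single[OF iU ik])
    show "h = 0 \<or> U \<inter> {2 * k + 1, 2 * k + 2} = {i}"
    proof (cases "h = 0")
      case False
      then have p: "i = p" "odd p" using iso by auto
      then have k2: "2 * k + 1 = p" using i by (auto simp: k_def elim!: oddE)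
      have "p + 1 \<notin> U" using memU[of "p + 1"] p by auto
      then show ?thesis using iU p k2 by auto
    qed simp
  qed
  then show ?thesis using memU[of i] iso i gc_fit_single[OF G i, of u v Y] by (auto simp: bh)
qed

lemma subinv_single: "G j j = 1 \<Longrightarrow> subinv G {j} j j = 1"
proof -
  assume G: "G j j = 1"
  have "subinv G {j} = (\<lambda>a b. if a = j \<and> b = j then 1 else 0)"
    unfolding subinv_def
  proof (rule the_equality)
    show "(\<forall>i\<in>{j}. \<forall>k\<in>{j}. (\<Sum>l\<in>{j}. G i l * (if l = j \<and> k = j then 1 else 0)) = (if i = k then 1 else 0)) \<and>
      (\<forall>i l. i \<notin> {j} \<or> l \<notin> {j} \<longrightarrow> (if i = j \<and> l = j then 1 else 0) = (0::real))" using G by auto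
    fix M assume M: "(\<forall>i\<in>{j}. \<forall>k\<in>{j}. (\<Sum>l\<in>{j}. G i l * M l k) = (if i = k then 1 else 0)) \<and> (\<forall>i l. i \<notin> {j} \<or> l \<notin> {j} \<longrightarrow> M i l = 0)"
    then have "M j j = 1" using G by simp
    with M show "M = (\<lambda>a b. if a = j \<and> b = j then 1 else 0)" by (intro ext) auto
  qed
  then show ?thesis by simp
qed

lemma omega_single: "omega (Gmat h) {i} {} = 1"
  unfolding omega_def
proof (rule cInf_eq_minimum)
  show "1 \<in> {(\<Sum>ia\<in>{i}. \<Sum>j\<in>{i}. xi ia * (Gmat h ia j - (\<Sum>k\<in>{}. \<Sum>l\<in>{}. Gmat h ia k * subinv (Gmat h) {} k l * Gmat h l j)) * xi j) |xi. \<forall>i\<in>{i}. 1 \<le> \<bar>xi i\<bar>}"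
    by (rule CollectI, rule exI[of _ "\<lambda>_. 1"]) (simp add: Gmat_def)
  fix y assume "y \<in> {(\<Sum>ia\<in>{i}. \<Sum>j\<in>{i}. xi ia * (Gmat h ia j - (\<Sum>k\<in>{}. \<Sum>l\<in>{}. Gmat h ia k * subinv (Gmat h) {} k l * Gmat h l j)) * xi j) |xi. \<forall>i\<in>{i}. 1 \<le> \<bar>xi i\<bar>}"
  then obtain xi where "y = xi i * xi i" "1 \<le> \<bar>xi i\<bar>" by (auto simp: Gmat_def)
  then show "1 \<le> y" using power2_le_abs_mult[of 1 "xi i" "xi i"] by simp
qed

lemma omega_conditional:
  assumes h: "\<bar>h\<bar> < 1" and g: "Gmat h i i = 1" "Gmat h j j = 1" "Gmat h i j = h" "Gmat h j i = h"
  shows "omega (Gmat h) {i} {j} = 1 - h\<^sup>2"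
proof -
  have a: "0 < 1 - h\<^sup>2" using abs_less_one_sq[OF h] .
  have eq: "(\<Sum>ia\<in>{i}. \<Sum>ja\<in>{i}. xi ia * (Gmat h ia ja - (\<Sum>k\<in>{j}. \<Sum>l\<in>{j}. Gmat h ia k * subinv (Gmat h) {j} k l * Gmat h l ja)) * xi ja)
     = (1 - h\<^sup>2) * (xi i * xi i)" for xi
    using g subinv_single[of "Gmat h" j] by (simp add: power2_eq_square)
  show ?thesis unfolding omega_def eq
  proof (rule cInf_eq_minimum)
    show "1 - h\<^sup>2 \<in> {(1 - h\<^sup>2) * (xi i * xi i) |xi. \<forall>i\<in>{i}. 1 \<le> \<bar>xi i\<bar>}"
      by (rule CollectI, rule exI[of _ "\<lambda>_. 1"]) simp
    fix y assume "y \<in> {(1 - h\<^sup>2) * (xi i * xi i) |xi. \<forall>i\<in>{i}. 1 \<le> \<bar>xi i\<bar>}"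
    then obtain xi where y: "y = (1 - h\<^sup>2) * (xi i * xi i)" "1 \<le> \<bar>xi i\<bar>" by auto
    then have "1 \<le> xi i * xi i" using power2_le_abs_mult[of 1 "xi i" "xi i"] by simp
    then have "(1 - h\<^sup>2) * 1 \<le> (1 - h\<^sup>2) * (xi i * xi i)" using a by (intro mult_left_mono) auto
    then show "1 - h\<^sup>2 \<le> y" using y by simp
  qed
qed

lemma omega_pair:
  assumes h: "\<bar>h\<bar> < 1" and g: "i \<noteq> j" "Gmat h i i = 1" "Gmat h j j = 1" "Gmat h i j = h" "Gmat h j i = h"
  shows "omega (Gmat h) {i, j} {} = 2 * (1 - \<bar>h\<bar>)"
proof -
  have eq: "(\<Sum>ia\<in>{i, j}. \<Sum>ja\<in>{i, j}. xi ia * (Gmat h ia ja - (\<Sum>k\<in>{}. \<Sum>l\<in>{}. Gmat h ia k * subinv (Gmat h) {} k l * Gmat h l ja)) * xi ja)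
     = qf h (xi i) (xi j)" for xi
    using g by (simp add: qf_def power2_eq_square algebra_simps)
  show ?thesis unfolding omega_def eq
  proof (rule cInf_eq_minimum)
    have "2 * (1 - \<bar>h\<bar>) = qf h 1 (if 0 \<le> h then - 1 else 1)" by (auto simp: qf_def)
    then show "2 * (1 - \<bar>h\<bar>) \<in> {qf h (xi i) (xi j) |xi. \<forall>i\<in>{i, j}. 1 \<le> \<bar>xi i\<bar>}"
      using g(1) by (intro CollectI exI[of _ "\<lambda>x. if x = i then 1 else if 0 \<le> h then - 1 else 1"]) auto
    fix y assume "y \<in> {qf h (xi i) (xi j) |xi. \<forall>i\<in>{i, j}. 1 \<le> \<bar>xi i\<bar>}"
    then obtain xi where "y = qf h (xi i) (xi j)" "1 \<le> \<bar>xi i\<bar>" "1 \<le> \<bar>xi j\<bar>" by auto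
    then show "2 * (1 - \<bar>h\<bar>) \<le> y" using qf_ge_both[OF h, of 1 "xi i" "xi j"] by simp
  qed
qed

lemma odd_threshold:
  assumes "0 < A" "th \<le> A" "0 \<le> th"
  shows "sqrt A - sqrt ((th + A)\<^sup>2 / (4 * A) - (1 + 1) * th / 2) = (A + th) / (2 * sqrt A)"
proof -
  have s: "sqrt A * sqrt A = A" "0 < sqrt A" using assms by auto
  have "(th + A)\<^sup>2 / (4 * A) - (1 + 1) * th / 2 = ((A - th) / (2 * sqrt A))\<^sup>2"
    using assms by (simp add: power_divide power_mult_distrib) (simp add: field_simps power2_eq_square)
  moreover have "0 \<le> (A - th) / (2 * sqrt A)" using assms by simp
  ultimately have "sqrt ((th + A)\<^sup>2 / (4 * A) - (1 + 1) * th / 2) = (A - th) / (2 * sqrt A)" by (simp only: real_sqrt_unique real_sqrt_abs abs_of_nonneg)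
  then show ?thesis using s by (simp add: field_simps)
qed

lemma q_single:
  assumes Q: "q_admissible th r h q0 qc q" and th: "0 < th" "th < r" and i: "i \<in> {1..p}"
  shows "0 \<le> q p {i} {} \<and> sqrt (q p {i} {}) \<le> (r + th) / (2 * sqrt r)"
proof -
  have c: "1 * r / th > 1 + sqrt (1\<^sup>2 - 1)" using th by (simp add: less_divide_eq)
  show ?thesis
    using Q[unfolded q_admissible_def, rule_format, of "{i}" p "{}"] i c odd_threshold[of r th] th
    unfolding omega_single Let_def by (simp add: mult.assoc)
qed

lemma q_conditional:
  assumes Q: "q_admissible th r h q0 qc q" and q0: "0 < q0" and th: "0 < th" "th < r" and ij: "i \<in> {1..p}" "j \<in> {1..p}" "i \<noteq> j"
    and h: "\<bar>h\<bar> < 1" and g: "Gmat h i i = 1" "Gmat h j j = 1" "Gmat h i j = h" "Gmat h j i = h"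
  shows "0 \<le> q p {i} {j} \<and> (th < (1 - h\<^sup>2) * r \<longrightarrow> sqrt (q p {i} {j}) \<le> ((1 - h\<^sup>2) * r + th) / (2 * sqrt ((1 - h\<^sup>2) * r)))"
proof -
  define A where "A = (1 - h\<^sup>2) * r"
  have a: "0 < A" using abs_less_one_sq[OF h] th by (simp add: A_def)
  have c: "A / th > 1 + sqrt (1\<^sup>2 - 1) \<longleftrightarrow> th < A" using th by (simp add: less_divide_eq)
  show ?thesis
    using Q[unfolded q_admissible_def, rule_format, of "{i}" p "{j}"] ij c odd_threshold[OF a, of th] th q0
    unfolding omega_conditional[OF h g] Let_def mult.assoc A_def[symmetric] by (auto split: if_splits)
qed

lemma q_pair:
  assumes Q: "q_admissible th r h q0 qc q" and q0: "0 < q0" and th: "0 < th" "th < r" and ij: "i \<in> {1..p}" "j \<in> {1..p}"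
    and h: "\<bar>h\<bar> < 1" and g: "i \<noteq> j" "Gmat h i i = 1" "Gmat h j j = 1" "Gmat h i j = h" "Gmat h j i = h"
  shows "0 \<le> q p {i, j} {} \<and> (2 * th \<le> (1 - \<bar>h\<bar>) * r \<longrightarrow>
    sqrt (q p {i, j} {}) \<le> sqrt (2 * ((1 - \<bar>h\<bar>) * r)) - sqrt ((1 - \<bar>h\<bar>) * r / 2 - th))"
proof -
  define C where "C = (1 - \<bar>h\<bar>) * r"
  have c: "2 * C / th \<ge> 2 * 2 \<longleftrightarrow> 2 * th \<le> C" using th by (simp add: le_divide_eq)
  have card: "card {i, j} = 2" using g by simp
  show ?thesis
    using Q[unfolded q_admissible_def, rule_format, of "{i, j}" p "{}"] ij c th q0
    unfolding omega_pair[OF h g] Let_def card mult.assoc C_def[symmetric] by (auto split: if_splits)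
qed

lemma Gmin1_scale: assumes T: "0 < T" and G: "Gmin1 (T * u) (T * v) w x" shows "Gmin1 u v (w / T) (x / T)"
proof -
  have ad: "adm (T * v) (T * x') \<longleftrightarrow> adm v x'" for x' using T by (auto simp: adm_def abs_mult)
  have *: "(T * x')\<^sup>2 - 2 * w * (T * x') + (T * u)\<^sup>2 * of_bool (T * x' \<noteq> 0) = T\<^sup>2 * (x'\<^sup>2 - 2 * (w / T) * x' + u\<^sup>2 * of_bool (x' \<noteq> 0))" for x'
    using T by (simp add: power2_eq_square algebra_simps)
  have xT: "x = T * (x / T)" using T by simp
  show ?thesis unfolding Gmin1_def
  proof (intro conjI allI impI)
    show "adm v (x / T)" using G ad[of "x / T"] T unfolding Gmin1_def by simp
    fix x' assume "adm v x'"
    then have "(T * (x / T))\<^sup>2 - 2 * w * (T * (x / T)) + (T * u)\<^sup>2 * of_bool (T * (x / T) \<noteq> 0)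
       \<le> (T * x')\<^sup>2 - 2 * w * (T * x') + (T * u)\<^sup>2 * of_bool (T * x' \<noteq> 0)"
      using G unfolding Gmin1_def xT[symmetric] ad[symmetric] by blast
    then show "(x / T)\<^sup>2 - 2 * (w / T) * (x / T) + u\<^sup>2 * of_bool (x / T \<noteq> 0) \<le> x'\<^sup>2 - 2 * (w / T) * x' + u\<^sup>2 * of_bool (x' \<noteq> 0)"
      unfolding * using T by simp
  qed
qed

lemma Gmin2_scale: assumes T: "0 < T" and G: "Gmin2 h (T * u) (T * v) w1 w2 x y" shows "Gmin2 h u v (w1 / T) (w2 / T) (x / T) (y / T)"
proof -
  have ad: "adm (T * v) (T * x') \<longleftrightarrow> adm v x'" for x' using T by (auto simp: adm_def abs_mult)
  have *: "qf h (T * x') (T * y') - 2 * (w1 * (T * x') + w2 * (T * y')) + (T * u)\<^sup>2 * (of_bool (T * x' \<noteq> 0) + of_bool (T * y' \<noteq> 0))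
     = T\<^sup>2 * (qf h x' y' - 2 * (w1 / T * x' + w2 / T * y') + u\<^sup>2 * (of_bool (x' \<noteq> 0) + of_bool (y' \<noteq> 0)))" for x' y'
    using T by (simp add: qf_def power2_eq_square algebra_simps)
  have xT: "T * (x / T) = x" "T * (y / T) = y" using T by simp_all
  show ?thesis unfolding Gmin2_def
  proof (intro conjI allI impI)
    show "adm v (x / T)" "adm v (y / T)" using G ad[of "x / T"] ad[of "y / T"] T unfolding Gmin2_def by simp_all
    fix x' y' assume "adm v x' \<and> adm v y'"
    then have "adm (T * v) (T * x') \<and> adm (T * v) (T * y')" by (simp add: ad)
    then have "qf h x y - 2 * (w1 * x + w2 * y) + (T * u)\<^sup>2 * (of_bool (x \<noteq> 0) + of_bool (y \<noteq> 0))
      \<le> qf h (T * x') (T * y') - 2 * (w1 * (T * x') + w2 * (T * y')) + (T * u)\<^sup>2 * (of_bool (T * x' \<noteq> 0) + of_bool (T * y' \<noteq> 0))"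
      using G unfolding Gmin2_def by blast
    with *[of "x / T" "y / T"] *[of x' y'] T
    show "qf h (x / T) (y / T) - 2 * (w1 / T * (x / T) + w2 / T * (y / T)) + u\<^sup>2 * (of_bool (x / T \<noteq> 0) + of_bool (y / T \<noteq> 0))
     \<le> qf h x' y' - 2 * (w1 / T * x' + w2 / T * y') + u\<^sup>2 * (of_bool (x' \<noteq> 0) + of_bool (y' \<noteq> 0))"
      unfolding xT by (metis mult_le_cancel_left_pos zero_less_power)
  qed
qed

lemma gs_block_scale:
  assumes T: "0 < T" and B: "gs_block h (T * u) (T * v) w1 w2 u1 u2 x y"
  shows "gs_block h u v (w1 / T) (w2 / T) u1 u2 (x / T) (y / T)"
  using B Gmin2_scale[OF T] Gmin1_scale[OF T] unfolding gs_block_def by (auto split: if_splits)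

lemma gs_screen_scale:
  assumes T: "0 < T" and S: "gs_screen h (T\<^sup>2 * ta) (T\<^sup>2 * tb) (T\<^sup>2 * tab) (T\<^sup>2 * tba) (T\<^sup>2 * tp) w1 w2 u1 u2"
  shows "gs_screen h ta tb tab tba tp (w1 / T) (w2 / T) u1 u2"
proof -
  have T2: "0 < T\<^sup>2" using T by simp
  have 1: "(w / T)\<^sup>2 > t \<longleftrightarrow> w\<^sup>2 > T\<^sup>2 * t" for w t
    using T2 by (simp add: power_divide less_divide_eq mult.commute)
  have 2: "(w / T - h * (w' / T))\<^sup>2 / (1 - h\<^sup>2) > t \<longleftrightarrow> (w - h * w')\<^sup>2 / (1 - h\<^sup>2) > T\<^sup>2 * t" for w w' t
  proof -
    have "(w / T - h * (w' / T))\<^sup>2 / (1 - h\<^sup>2) = ((w - h * w')\<^sup>2 / (1 - h\<^sup>2)) / T\<^sup>2"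
      by (simp add: power_divide flip: diff_divide_distrib)
    then show ?thesis by (simp only: pos_less_divide_eq[OF T2] mult.commute)
  qed
  have 3: "rad2 h (w1 / T) (w2 / T) > t \<longleftrightarrow> rad2 h w1 w2 > T\<^sup>2 * t" for t
  proof -
    have "rad2 h (w1 / T) (w2 / T) = rad2 h w1 w2 / T\<^sup>2"
      using T unfolding rad2_def by (simp add: power_divide power2_eq_square flip: diff_divide_distrib add_divide_distrib)
    then show ?thesis using T2 by (simp add: less_divide_eq mult.commute)
  qed
  show ?thesis using S unfolding gs_screen_def 1 2 3 .
qed

section \<open>Scaling and rates\<close>

lemma Lp_factor_of_bounds:
  fixes f :: "nat \<Rightarrow> ennreal" and \<kappa> :: real
  assumes up: "\<And>d. 0 < d \<Longrightarrow> \<forall>\<^sub>F p in sequentially. f p \<le> ennreal (real p powr (\<kappa> + d))"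
    and lo: "\<And>d. 0 < d \<Longrightarrow> \<forall>\<^sub>F p in sequentially. ennreal (real p powr (\<kappa> - d)) \<le> f p"
  shows "\<exists>L. Lp_factor L \<and> (\<forall>\<^sub>F p in sequentially. f p = ennreal (L p * real p powr \<kappa>))"
proof -
  define L where "L p = (if 0 < enn2real (f p) \<and> 1 \<le> p then enn2real (f p) / real p powr \<kappa> else 1)" for p
  have bd: "\<forall>\<^sub>F p in sequentially. f p = ennreal (L p * real p powr \<kappa>) \<and> real p powr (- d) \<le> L p \<and> L p \<le> real p powr d"
    if d: "0 < d" for d
    using up[OF d] lo[OF d] eventually_ge_at_top[of 1]
  proof eventually_elim
    case (elim p)
    then have "f p < \<top>" by (metis ennreal_less_top le_less_trans)
    then have f: "f p = ennreal (enn2real (f p))" by simp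
    have b: "real p powr (\<kappa> - d) \<le> enn2real (f p)" "enn2real (f p) \<le> real p powr (\<kappa> + d)"
      using elim f by (metis ennreal_le_iff enn2real_nonneg) (metis elim(1) f ennreal_le_iff powr_ge_zero)
    have pk: "0 < real p powr \<kappa>" "0 < real p powr (\<kappa> - d)" using elim by auto
    then have "0 < enn2real (f p)" using b by linarith
    then have L: "L p = enn2real (f p) / real p powr \<kappa>" using elim by (simp add: L_def)
    have "real p powr (- d) = real p powr (\<kappa> - d) / real p powr \<kappa>" "real p powr d = real p powr (\<kappa> + d) / real p powr \<kappa>"
      using elim by (simp_all flip: powr_diff)
    then show ?case using f b pk L by (auto intro!: divide_right_mono)
  qed
  have "Lp_factor L" unfolding Lp_factor_def
  proof (intro conjI allI impI)
    show "0 < L p" for p by (simp add: L_def)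
    fix d :: real assume d: "0 < d"
    then have d2: "0 < d / 2" by simp
    have top: "filterlim (\<lambda>p. real p powr (d / 2)) at_top sequentially"
      by (rule filterlim_compose[OF real_powr_at_top[OF d2] filterlim_real_sequentially])
    show "filterlim (\<lambda>p. L p * real p powr d) at_top sequentially"
    proof (rule filterlim_at_top_mono[OF top])
      show "\<forall>\<^sub>F p in sequentially. real p powr (d / 2) \<le> L p * real p powr d"
        using bd[OF d2] eventually_ge_at_top[of 1]
      proof eventually_elim
        case (elim p)
        have "real p powr (d / 2) = real p powr (- (d / 2)) * real p powr d" using elim by (simp flip: powr_add)
        also have "\<dots> \<le> L p * real p powr d" using elim by (intro mult_right_mono) auto
        finally show ?case .
      qed
    qed
    show "(\<lambda>p. L p * real p powr (- d)) \<longlonglongrightarrow> 0"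
    proof (rule tendsto_sandwich[of "\<lambda>_. 0" _ _ "\<lambda>p. real p powr (- (d / 2))"])
      show "\<forall>\<^sub>F p in sequentially. 0 \<le> L p * real p powr (- d)" by (auto simp: L_def)
      show "\<forall>\<^sub>F p in sequentially. L p * real p powr (- d) \<le> real p powr (- (d / 2))"
        using bd[OF d2] eventually_ge_at_top[of 1]
      proof eventually_elim
        case (elim p)
        have "L p * real p powr (- d) \<le> real p powr (d / 2) * real p powr (- d)" using elim by (intro mult_right_mono) auto
        also have "\<dots> = real p powr (- (d / 2))" using elim by (simp flip: powr_add)
        finally show ?case .
      qed
      show "(\<lambda>p. real p powr (- (d / 2))) \<longlonglongrightarrow> 0"
        using tendsto_neg_powr[of "- (d / 2)" real sequentially] d2 filterlim_real_sequentially by simp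
    qed simp
  qed
  moreover have "\<forall>\<^sub>F p in sequentially. f p = ennreal (L p * real p powr \<kappa>)"
    using bd[of 1] by (auto elim: eventually_mono)
  ultimately show ?thesis by blast
qed

definition tscale :: "real \<Rightarrow> nat \<Rightarrow> real" where "tscale sig p = sig * sqrt (2 * ln p)"

definition nu1 :: "nat \<Rightarrow> nat \<Rightarrow> (nat \<Rightarrow> nat \<Rightarrow> real) \<Rightarrow> real \<Rightarrow> nat \<Rightarrow> (nat \<Rightarrow> real) \<Rightarrow> real" where
  "nu1 n p X sig k z = sig * lin n (fstdir X k) z / tscale sig p"

definition nu2 :: "nat \<Rightarrow> nat \<Rightarrow> (nat \<Rightarrow> nat \<Rightarrow> real) \<Rightarrow> real \<Rightarrow> real \<Rightarrow> nat \<Rightarrow> (nat \<Rightarrow> real) \<Rightarrow> real" where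
  "nu2 n p X h sig k z = sig * noise2 n p X h k z / tscale sig p"

lemma tscale: assumes "2 \<le> p" "0 < sig"
  shows "0 < tscale sig p" "(tscale sig p)\<^sup>2 = 2 * sig\<^sup>2 * ln p" "sig * sqrt (2 * r * ln p) = tscale sig p * sqrt r"
proof -
  have l: "0 < ln (real p)" using assms by simp
  show "0 < tscale sig p" using l assms by (simp add: tscale_def)
  show "(tscale sig p)\<^sup>2 = 2 * sig\<^sup>2 * ln p" using l by (simp add: tscale_def power_mult_distrib)
  show "sig * sqrt (2 * r * ln p) = tscale sig p * sqrt r" by (simp add: tscale_def real_sqrt_mult)
qed

lemma nu_eq: assumes "2 \<le> p" "0 < sig"
  shows "nu1 n p X sig k z = lin n (fstdir X k) z / sqrt (2 * ln p)"
    "nu2 n p X h sig k z = noise2 n p X h k z / sqrt (2 * ln p)"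
  using assms by (simp_all add: nu1_def nu2_def tscale_def)

lemma rad2_nu: assumes p: "2 \<le> p" "0 < sig" and h: "\<bar>h\<bar> < 1"
  shows "rad2 h (nu1 n p X sig k z) (nu2 n p X h sig k z)
    = ((lin n (fstdir X k) z)\<^sup>2 + (lin n (snddir p X h k) z)\<^sup>2) / (2 * ln p)"
proof -
  have l: "0 < ln (real p)" using p by simp
  have "rad2 h (nu1 n p X sig k z) (nu2 n p X h sig k z)
    = rad2 h (1 / sqrt (2 * ln p) * lin n (fstdir X k) z) (1 / sqrt (2 * ln p) * noise2 n p X h k z)"
    unfolding nu_eq[OF p] by simp
  also have "\<dots> = (1 / sqrt (2 * ln p))\<^sup>2 * ((lin n (fstdir X k) z)\<^sup>2 + (lin n (snddir p X h k) z)\<^sup>2)"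
    by (rule rad2_noise[OF h])
  finally show ?thesis using l by (simp add: power_divide)
qed

text \<open>By \<open>qf_rad2_cauchy\<close> the two constraints leave only a small cap around the point of the half plane closest to
  the origin in the metric \<open>rad2\<close>; the cap has probability \<open>p\<close> to the power \<open>- \<kappa>\<close>, up to small powers of \<open>p\<close>.\<close>
definition reach :: "real \<Rightarrow> real \<Rightarrow> real \<Rightarrow> real \<Rightarrow> (real \<Rightarrow> real \<Rightarrow> bool) \<Rightarrow> bool" where
  "reach h c1 c2 \<kappa>0 P \<longleftrightarrow> (\<forall>\<delta>>0. \<exists>\<kappa> \<eta>. 0 < \<kappa> \<and> \<kappa> \<le> \<kappa>0 + \<delta> \<and> 0 < \<eta> \<and>
     (\<forall>n1 n2. sqrt \<kappa> * sqrt (qf h c1 c2) \<le> c1 * n1 + c2 * n2 \<longrightarrow> rad2 h n1 n2 \<le> (1 + \<eta>)\<^sup>2 * \<kappa> \<longrightarrow> P n1 n2))"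

lemma reach_open:
  assumes h: "\<bar>h\<bar> < 1" and q: "0 < qf h c1 c2" and op: "open {(n1, n2). P n1 n2}" and x0: "0 \<le> x0" and \<zeta>0: "0 < \<zeta>0"
    and P: "\<And>x. x0 < x \<Longrightarrow> x < x0 + \<zeta>0 \<Longrightarrow> P (x * ((c1 + h * c2) / sqrt (qf h c1 c2))) (x * ((h * c1 + c2) / sqrt (qf h c1 c2)))"
  shows "reach h c1 c2 (x0\<^sup>2) P"
  unfolding reach_def
proof (intro allI impI)
  fix \<delta> :: real assume \<delta>: "0 < \<delta>"
  define Q where "Q = sqrt (qf h c1 c2)"
  have Q: "0 < Q" "Q\<^sup>2 = qf h c1 c2" using q by (auto simp: Q_def)
  define z where "z = min (\<zeta>0 / 2) (sqrt (x0\<^sup>2 + \<delta>) - x0)"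
  have "x0 < sqrt (x0\<^sup>2 + \<delta>)" using \<delta> x0 by (intro real_less_rsqrt) simp
  then have z: "0 < z" "z < \<zeta>0" "z \<le> sqrt (x0\<^sup>2 + \<delta>) - x0" using \<zeta>0 by (auto simp: z_def)
  define x where "x = x0 + z"
  have x: "0 < x" "x0 < x" "x < x0 + \<zeta>0" using z x0 by (auto simp: x_def)
  have "x \<le> sqrt (x0\<^sup>2 + \<delta>)" using z by (simp add: x_def)
  then have "x\<^sup>2 \<le> (sqrt (x0\<^sup>2 + \<delta>))\<^sup>2" using x by (intro power_mono) auto
  then have xd: "x\<^sup>2 \<le> x0\<^sup>2 + \<delta>" using \<delta> by simp
  define a1 where "a1 = (c1 + h * c2) / Q"
  define a2 where "a2 = (h * c1 + c2) / Q"
  have "P (x * a1) (x * a2)" using P[OF x(2,3)] by (simp add: a1_def a2_def Q_def)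
  then have "(x * a1, x * a2) \<in> {(n1, n2). P n1 n2}" by simp
  then obtain e where e: "0 < e" "ball (x * a1, x * a2) e \<subseteq> {(n1, n2). P n1 n2}" using op openE by metis
  define \<eta> where "\<eta> = min 1 (e\<^sup>2 / (12 * x\<^sup>2))"
  have \<eta>: "0 < \<eta>" "\<eta> \<le> 1" "3 * \<eta> * x\<^sup>2 \<le> e\<^sup>2 / 4" using e x by (auto simp: \<eta>_def min_def field_simps)
  show "\<exists>\<kappa> \<eta>. 0 < \<kappa> \<and> \<kappa> \<le> x0\<^sup>2 + \<delta> \<and> 0 < \<eta> \<and>
     (\<forall>n1 n2. sqrt \<kappa> * sqrt (qf h c1 c2) \<le> c1 * n1 + c2 * n2 \<longrightarrow> rad2 h n1 n2 \<le> (1 + \<eta>)\<^sup>2 * \<kappa> \<longrightarrow> P n1 n2)"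
  proof (rule exI[of _ "x\<^sup>2"], rule exI[of _ \<eta>], intro conjI allI impI)
    show "0 < x\<^sup>2" "x\<^sup>2 \<le> x0\<^sup>2 + \<delta>" "0 < \<eta>" using x xd \<eta> by auto
    fix n1 n2 assume n: "sqrt (x\<^sup>2) * sqrt (qf h c1 c2) \<le> c1 * n1 + c2 * n2" "rad2 h n1 n2 \<le> (1 + \<eta>)\<^sup>2 * x\<^sup>2"
    have a: "1 - h\<^sup>2 \<noteq> 0" using abs_less_one_sq[OF h] by simp
    have "rad2 h (n1 - y * (c1 + h * c2)) (n2 - y * (h * c1 + c2)) = rad2 h n1 n2 - 2 * y * (c1 * n1 + c2 * n2) + y\<^sup>2 * qf h c1 c2" for y
      using a unfolding rad2_def qf_def by (simp add: field_simps power2_eq_square)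
    from this[of "x / Q"] have "rad2 h (n1 - x * a1) (n2 - x * a2) = rad2 h n1 n2 - 2 * (x / Q) * (c1 * n1 + c2 * n2) + (x / Q)\<^sup>2 * Q\<^sup>2"
      unfolding a1_def a2_def Q(2) by simp
    also have "(x / Q)\<^sup>2 * Q\<^sup>2 = x\<^sup>2" using Q q by (simp add: power_divide)
    also have "rad2 h n1 n2 - 2 * (x / Q) * (c1 * n1 + c2 * n2) + x\<^sup>2 \<le> (1 + \<eta>)\<^sup>2 * x\<^sup>2 - 2 * (x / Q) * (x * Q) + x\<^sup>2"
    proof -
      have "2 * (x / Q) * (x * Q) \<le> 2 * (x / Q) * (c1 * n1 + c2 * n2)"
        using n(1) x Q by (intro mult_left_mono) (auto simp: Q_def)
      then show ?thesis using n(2) by linarith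
    qed
    also have "\<dots> = (2 + \<eta>) * \<eta> * x\<^sup>2" using Q by (simp add: power2_eq_square algebra_simps)
    also have "\<dots> \<le> 3 * \<eta> * x\<^sup>2" using \<eta> by (intro mult_right_mono) auto
    also have "\<dots> \<le> (e / 2)\<^sup>2" using \<eta> by (simp add: power_divide)
    finally have r: "rad2 h (n1 - x * a1) (n2 - x * a2) \<le> (e / 2)\<^sup>2" .
    have "(n1 - x * a1)\<^sup>2 \<le> (e / 2)\<^sup>2" "(n2 - x * a2)\<^sup>2 \<le> (e / 2)\<^sup>2"
      using r rad2_ge(1,2)[OF h, where x="n1 - x * a1" and y="n2 - x * a2"] by linarith+
    then have "(dist (x * a1, x * a2) (n1, n2))\<^sup>2 \<le> (e / 2)\<^sup>2 + (e / 2)\<^sup>2"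
      by (simp add: dist_prod_def dist_real_def power2_commute[of "x * a1"] power2_commute[of "x * a2"])
    also have "\<dots> < e\<^sup>2" using e by (simp add: power_divide)
    finally have "dist (x * a1, x * a2) (n1, n2) < e" using e by (intro power_less_imp_less_base[of _ 2 e]) auto
    then show "P n1 n2" using e by auto
  qed
qed

lemma reach_halfplane:
  assumes h: "\<bar>h\<bar> < 1" and q: "0 < qf h c1 c2"
  shows "reach h c1 c2 ((pos t)\<^sup>2 / qf h c1 c2) (\<lambda>n1 n2. t < c1 * n1 + c2 * n2)"
proof -
  define Q where "Q = sqrt (qf h c1 c2)"
  have Q: "0 < Q" "Q * Q = qf h c1 c2" using q by (auto simp: Q_def)
  have "reach h c1 c2 ((pos t / Q)\<^sup>2) (\<lambda>n1 n2. t < c1 * n1 + c2 * n2)"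
  proof (rule reach_open[OF h q _ _ zero_less_one])
    show "open {(n1, n2). t < c1 * n1 + c2 * n2}"
      unfolding case_prod_beta by (intro open_Collect_less continuous_intros)
    show "0 \<le> pos t / Q" using Q by (simp add: pos_def)
    fix x assume "pos t / Q < x"
    then have "t < x * Q" using Q by (simp add: divide_less_eq pos_def)
    moreover have "c1 * (x * ((c1 + h * c2) / Q)) + c2 * (x * ((h * c1 + c2) / Q)) = x * (qf h c1 c2 / Q)"
      by (simp add: qf_def power2_eq_square add_divide_distrib[symmetric] algebra_simps)
    moreover have "qf h c1 c2 / Q = Q" using Q by (simp flip: Q(2))
    ultimately show "t < c1 * (x * ((c1 + h * c2) / sqrt (qf h c1 c2))) + c2 * (x * ((h * c1 + c2) / sqrt (qf h c1 c2)))"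
      unfolding Q_def[symmetric] by simp
  qed
  moreover have "(pos t / Q)\<^sup>2 = (pos t)\<^sup>2 / qf h c1 c2" using q by (simp add: power_divide Q_def)
  ultimately show ?thesis by simp
qed

lemma risk_lower_reach:
  assumes R: "reach h c1 c2 \<kappa>0 P" and h: "\<bar>h\<bar> < 1" and q: "0 < qf h c1 c2" and th: "0 < th" and d: "0 < d"
  shows "\<forall>\<^sub>F p in sequentially. \<forall>n X sig est mu. gram_is n p X (Gmat h) \<longrightarrow> 0 < sig \<longrightarrow>
    (\<forall>b z k. 2 * k + 2 \<le> p \<longrightarrow> b (2 * k + 1) = s1 \<longrightarrow> b (2 * k + 2) = s2 \<longrightarrow> P (nu1 n p X sig k z) (nu2 n p X h sig k z) \<longrightarrow>
       blk_err p (est (Yobs n p X sig (beta_of b mu) z)) (beta_of b mu) k) \<longrightarrow>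
    ennreal (real p powr (1 - ((of_bool s1 + of_bool s2) * th + \<kappa>0) - d)) \<le> risk n p X sig (real p powr (- th)) est mu"
proof -
  have d2: "0 < d / 2" using d by simp
  obtain \<kappa> \<eta> where k: "0 < \<kappa>" "\<kappa> \<le> \<kappa>0 + d / 2" "0 < \<eta>"
    "\<And>n1 n2. sqrt \<kappa> * sqrt (qf h c1 c2) \<le> c1 * n1 + c2 * n2 \<Longrightarrow> rad2 h n1 n2 \<le> (1 + \<eta>)\<^sup>2 * \<kappa> \<Longrightarrow> P n1 n2"
    using R d2 unfolding reach_def by meson
  define Q where "Q = sqrt (qf h c1 c2)"
  have Q: "0 < Q" "Q\<^sup>2 = qf h c1 c2" using q by (auto simp: Q_def)
  have a: "0 < 1 - h\<^sup>2" using abs_less_one_sq[OF h] .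
  define \<alpha> where "\<alpha> = (c1 + h * c2) / Q"
  define \<beta> where "\<beta> = c2 * sqrt (1 - h\<^sup>2) / Q"
  have ab: "\<alpha>\<^sup>2 + \<beta>\<^sup>2 = 1"
  proof -
    have "\<alpha>\<^sup>2 + \<beta>\<^sup>2 = ((c1 + h * c2)\<^sup>2 + (1 - h\<^sup>2) * c2\<^sup>2) / Q\<^sup>2"
      unfolding \<alpha>_def \<beta>_def power_divide power_mult_distrib
      using a by (simp add: mult.commute flip: add_divide_distrib)
    then show ?thesis using Q q by (simp add: qf_alt)
  qed
  show ?thesis
    using risk_lower[OF th k(1,3) d2 h, of s1 s2] eventually_ge_at_top[of 2]
  proof (eventually_elim, intro allI impI)
    fix p n :: nat and X sig est mu
    assume rl: "\<forall>n X sig est mu \<alpha> \<beta>. gram_is n p X (Gmat h) \<longrightarrow> \<alpha>\<^sup>2 + \<beta>\<^sup>2 = 1 \<longrightarrow>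
    (\<forall>b z k. 2 * k + 2 \<le> p \<longrightarrow> b (2 * k + 1) = s1 \<longrightarrow> b (2 * k + 2) = s2 \<longrightarrow>
       sqrt (2 * \<kappa> * ln p) \<le> \<alpha> * lin n (fstdir X k) z + \<beta> * lin n (snddir p X h k) z \<longrightarrow>
       (lin n (fstdir X k) z)\<^sup>2 + (lin n (snddir p X h k) z)\<^sup>2 \<le> (1 + \<eta>)\<^sup>2 * (2 * \<kappa> * ln p) \<longrightarrow>
       blk_err p (est (Yobs n p X sig (beta_of b mu) z)) (beta_of b mu) k) \<longrightarrow>
    ennreal (real p powr (1 - (of_bool s1 + of_bool s2) * th - \<kappa> - d / 2)) \<le> risk n p X sig (real p powr (- th)) est mu"
      and p: "2 \<le> p" and G: "gram_is n p X (Gmat h)" and sig: "0 < sig"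
      and E: "\<forall>b z k. 2 * k + 2 \<le> p \<longrightarrow> b (2 * k + 1) = s1 \<longrightarrow> b (2 * k + 2) = s2 \<longrightarrow> P (nu1 n p X sig k z) (nu2 n p X h sig k z) \<longrightarrow>
       blk_err p (est (Yobs n p X sig (beta_of b mu) z)) (beta_of b mu) k"
    have l: "0 < ln (real p)" using p by simp
    have star: "P (nu1 n p X sig k z) (nu2 n p X h sig k z)"
      if 1: "sqrt (2 * \<kappa> * ln p) \<le> \<alpha> * lin n (fstdir X k) z + \<beta> * lin n (snddir p X h k) z"
       and 2: "(lin n (fstdir X k) z)\<^sup>2 + (lin n (snddir p X h k) z)\<^sup>2 \<le> (1 + \<eta>)\<^sup>2 * (2 * \<kappa> * ln p)" for k z
    proof (rule k(4))
      define e1 where "e1 = lin n (fstdir X k) z"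
      define e2 where "e2 = lin n (snddir p X h k) z"
      define l where "l = sqrt (2 * ln p)"
      have l0: "0 < l" using \<open>0 < ln (real p)\<close> by (simp add: l_def)
      have QA: "Q * \<alpha> = c1 + h * c2" "Q * \<beta> = c2 * sqrt (1 - h\<^sup>2)" using Q(1) by (simp_all add: \<alpha>_def \<beta>_def)
      have "Q * (sqrt \<kappa> * l) \<le> Q * (\<alpha> * e1 + \<beta> * e2)"
        using 1 Q(1) by (intro mult_left_mono) (simp_all add: e1_def e2_def l_def real_sqrt_mult mult_ac)
      also have "\<dots> = (Q * \<alpha>) * e1 + (Q * \<beta>) * e2" by (simp only: distrib_left mult.assoc)
      also have "\<dots> = c1 * e1 + c2 * (h * e1 + sqrt (1 - h\<^sup>2) * e2)" unfolding QA by (simp only: distrib_left distrib_right mult_ac add_ac)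
      finally have "Q * (sqrt \<kappa> * l) / l \<le> (c1 * e1 + c2 * (h * e1 + sqrt (1 - h\<^sup>2) * e2)) / l"
        using l0 by (intro divide_right_mono) auto
      moreover have "Q * (sqrt \<kappa> * l) / l = sqrt \<kappa> * Q" using l0 by simp
      ultimately have "sqrt \<kappa> * Q \<le> c1 * (e1 / l) + c2 * ((h * e1 + sqrt (1 - h\<^sup>2) * e2) / l)"
        by (metis (no_types) add_divide_distrib times_divide_eq_right)
      then show "sqrt \<kappa> * sqrt (qf h c1 c2) \<le> c1 * nu1 n p X sig k z + c2 * nu2 n p X h sig k z"
        unfolding nu_eq[OF p sig] noise2_def Q_def e1_def e2_def l_def .
      show "rad2 h (nu1 n p X sig k z) (nu2 n p X h sig k z) \<le> (1 + \<eta>)\<^sup>2 * \<kappa>"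
        unfolding rad2_nu[OF p sig h] using 2 \<open>0 < ln (real p)\<close> by (simp add: divide_le_eq mult_ac)
    qed
    have "ennreal (real p powr (1 - (of_bool s1 + of_bool s2) * th - \<kappa> - d / 2)) \<le> risk n p X sig (real p powr (- th)) est mu"
    proof (rule rl[rule_format, OF G ab])
      fix b z k
      assume "2 * k + 2 \<le> p" "b (2 * k + 1) = s1" "b (2 * k + 2) = s2"
        "sqrt (2 * \<kappa> * ln p) \<le> \<alpha> * lin n (fstdir X k) z + \<beta> * lin n (snddir p X h k) z"
        "(lin n (fstdir X k) z)\<^sup>2 + (lin n (snddir p X h k) z)\<^sup>2 \<le> (1 + \<eta>)\<^sup>2 * (2 * \<kappa> * ln p)"
      then show "blk_err p (est (Yobs n p X sig (beta_of b mu) z)) (beta_of b mu) k"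
        by (intro E[rule_format] star)
    qed
    moreover have "real p powr (1 - ((of_bool s1 + of_bool s2) * th + \<kappa>0) - d) \<le> real p powr (1 - (of_bool s1 + of_bool s2) * th - \<kappa> - d / 2)"
      using p k(2) by (intro powr_mono) auto
    ultimately show "ennreal (real p powr (1 - ((of_bool s1 + of_bool s2) * th + \<kappa>0) - d)) \<le> risk n p X sig (real p powr (- th)) est mu"
      by (rule order_trans[OF ennreal_leI, rotated])
  qed
qed

definition sbeta1 :: "nat \<Rightarrow> real \<Rightarrow> (nat \<Rightarrow> real) \<Rightarrow> nat \<Rightarrow> real" where
  "sbeta1 p sig be k = be (2 * k + 1) / tscale sig p"

definition sbeta2 :: "nat \<Rightarrow> real \<Rightarrow> (nat \<Rightarrow> real) \<Rightarrow> nat \<Rightarrow> real" where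
  "sbeta2 p sig be k = bet2 p be k / tscale sig p"

lemma scaled_signal:
  assumes p: "2 \<le> p" "0 < sig" and r: "0 < r" and mu: "mu \<in> Theta p (sig * sqrt (2 * r * ln p))" and k: "k < (p + 1) div 2"
  shows "sbeta1 p sig (beta_of b mu) k = 0 \<or> sqrt r \<le> \<bar>sbeta1 p sig (beta_of b mu) k\<bar>"
    "sbeta2 p sig (beta_of b mu) k = 0 \<or> sqrt r \<le> \<bar>sbeta2 p sig (beta_of b mu) k\<bar>"
    "of_bool (sbeta1 p sig (beta_of b mu) k \<noteq> 0) + of_bool (sbeta2 p sig (beta_of b mu) k \<noteq> 0) = real (card {i\<in>blk p k. b i})"
proof -
  let ?T = "tscale sig p"
  have T: "0 < ?T" by (rule tscale(1)[OF p])
  have mu: "?T * sqrt r \<le> \<bar>mu i\<bar>" if "i \<in> {1..p}" for i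
    using mu that unfolding Theta_def tscale(3)[OF p] by blast
  have k1: "2 * k + 1 \<le> p" using k by auto
  have q: "sqrt r \<le> \<bar>mu i / ?T\<bar>" "mu i \<noteq> 0" if "i \<in> {1..p}" for i
  proof -
    show "sqrt r \<le> \<bar>mu i / ?T\<bar>" using mu[OF that] T by (simp add: le_divide_eq mult.commute)
    then show "mu i \<noteq> 0" using r by auto
  qed
  show "sbeta1 p sig (beta_of b mu) k = 0 \<or> sqrt r \<le> \<bar>sbeta1 p sig (beta_of b mu) k\<bar>"
    using q(1)[of "2 * k + 1"] k1 by (auto simp: sbeta1_def beta_of_def)
  show "sbeta2 p sig (beta_of b mu) k = 0 \<or> sqrt r \<le> \<bar>sbeta2 p sig (beta_of b mu) k\<bar>"
    using q(1)[of "2 * k + 2"] by (auto simp: sbeta2_def bet2_def beta_of_def)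
  have 1: "sbeta1 p sig (beta_of b mu) k \<noteq> 0 \<longleftrightarrow> b (2 * k + 1)"
    using q(2)[of "2 * k + 1"] k1 T by (auto simp: sbeta1_def beta_of_def)
  have 2: "sbeta2 p sig (beta_of b mu) k \<noteq> 0 \<longleftrightarrow> 2 * k + 2 \<le> p \<and> b (2 * k + 2)"
    using q(2)[of "2 * k + 2"] T by (auto simp: sbeta2_def bet2_def beta_of_def)
  have "{i\<in>blk p k. b i} = (if b (2 * k + 1) then {2 * k + 1} else {}) \<union> (if 2 * k + 2 \<le> p \<and> b (2 * k + 2) then {2 * k + 2} else {})"
    unfolding blk_cases[OF k1] by auto
  then have "card {i\<in>blk p k. b i} = of_bool (b (2 * k + 1)) + of_bool (2 * k + 2 \<le> p \<and> b (2 * k + 2))" by simp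
  then show "of_bool (sbeta1 p sig (beta_of b mu) k \<noteq> 0) + of_bool (sbeta2 p sig (beta_of b mu) k \<noteq> 0) = real (card {i\<in>blk p k. b i})"
    unfolding 1 2 by simp
qed

lemma blk_err_scaled:
  assumes p: "2 \<le> p" "0 < sig" and c: "bh \<in> coefs p" "k < (p + 1) div 2"
  shows "blk_err p bh be k \<longleftrightarrow> \<not> (sgn (bh (2 * k + 1) / tscale sig p) = sgn (sbeta1 p sig be k) \<and> sgn (bh (2 * k + 2) / tscale sig p) = sgn (sbeta2 p sig be k))"
proof -
  have k1: "2 * k + 1 \<le> p" using c by auto
  have s: "sgn (x / tscale sig p) = sgn x" for x using tscale(1)[OF p] by (simp add: sgn_divide)
  show ?thesis unfolding blk_err_iff[OF c(1) k1] sbeta1_def sbeta2_def s ..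
qed

lemma ss_scaled:
  assumes p: "2 \<le> p" "0 < sig" and G: "gram_is n p X (Gmat h)" and h: "\<bar>h\<bar> < 1" and k: "k < (p + 1) div 2"
  shows "Bmin h (ss_pen (lam / tscale sig p)) (sbeta1 p sig be k + h * sbeta2 p sig be k + nu1 n p X sig k z)
     (h * sbeta1 p sig be k + sbeta2 p sig be k + nu2 n p X h sig k z)
     (ss_est n p X lam (Yobs n p X sig be z) (2 * k + 1) / tscale sig p) (ss_est n p X lam (Yobs n p X sig be z) (2 * k + 2) / tscale sig p)"
proof -
  have T: "0 < tscale sig p" by (rule tscale(1)[OF p])
  have "ss_pen (lam / tscale sig p) (x / tscale sig p) = ss_pen lam x / (tscale sig p)\<^sup>2" for x
    using T by (simp add: ss_pen_def power_divide)
  from Bmin_scale[OF T this ss_est_block(1)[OF G h k]] show ?thesis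
    by (simp add: sbeta1_def sbeta2_def nu1_def nu2_def add_divide_distrib)
qed

lemma lasso_scaled:
  assumes p: "2 \<le> p" "0 < sig" and G: "gram_is n p X (Gmat h)" and h: "\<bar>h\<bar> < 1" and k: "k < (p + 1) div 2" and lam: "0 < lam"
  shows "Bmin h (lasso_pen (lam / tscale sig p)) (sbeta1 p sig be k + h * sbeta2 p sig be k + nu1 n p X sig k z)
     (h * sbeta1 p sig be k + sbeta2 p sig be k + nu2 n p X h sig k z)
     (lasso_est n p X lam (Yobs n p X sig be z) (2 * k + 1) / tscale sig p) (lasso_est n p X lam (Yobs n p X sig be z) (2 * k + 2) / tscale sig p)"
proof -
  have T: "0 < tscale sig p" by (rule tscale(1)[OF p])
  have "lasso_pen (lam / tscale sig p) (x / tscale sig p) = lasso_pen lam x / (tscale sig p)\<^sup>2" for x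
    using T by (simp add: lasso_pen_def power2_eq_square)
  from Bmin_scale[OF T this lasso_est_block(1)[OF G h k lam]] show ?thesis
    by (simp add: sbeta1_def sbeta2_def nu1_def nu2_def add_divide_distrib)
qed

lemma noise_budget:
  assumes p: "2 \<le> p" "0 < sig" and h: "\<bar>h\<bar> < 1" and le: "y \<le> rad2 h (nu1 n p X sig k z) (nu2 n p X h sig k z)"
  shows "2 * ln p * y \<le> (lin n (fstdir X k) z)\<^sup>2 + (lin n (snddir p X h k) z)\<^sup>2"
proof -
  have "0 < ln (real p)" using p by simp
  then show ?thesis using le unfolding rad2_nu[OF p h] by (simp add: le_divide_eq mult_ac)
qed

section \<open>Rate of the penalized estimators\<close>

definition two_level :: "real \<Rightarrow> nat \<Rightarrow> real \<Rightarrow> real \<Rightarrow> nat \<Rightarrow> real" where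
  "two_level sig p m1 m2 = (\<lambda>i. tscale sig p * (if odd i then m1 else m2))"

lemma two_level_Theta:
  assumes p: "2 \<le> p" "0 < sig" and m: "sqrt r \<le> \<bar>m1\<bar>" "sqrt r \<le> \<bar>m2\<bar>"
  shows "two_level sig p m1 m2 \<in> Theta p (sig * sqrt (2 * r * ln p))"
  unfolding Theta_def two_level_def tscale(3)[OF p] using tscale(1)[OF p] m by (auto simp: abs_mult)

lemma two_level_scaled:
  assumes p: "2 \<le> p" "0 < sig" and k: "2 * k + 2 \<le> p"
  shows "sbeta1 p sig (beta_of b (two_level sig p m1 m2)) k = (if b (2 * k + 1) then m1 else 0)"
    "sbeta2 p sig (beta_of b (two_level sig p m1 m2)) k = (if b (2 * k + 2) then m2 else 0)"
  using tscale(1)[OF p] k by (auto simp: sbeta1_def sbeta2_def bet2_def beta_of_def two_level_def)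

type_synonym estimator_family = "nat \<Rightarrow> nat \<Rightarrow> (nat \<Rightarrow> nat \<Rightarrow> real) \<Rightarrow> real \<Rightarrow> (nat \<Rightarrow> real) \<Rightarrow> nat \<Rightarrow> real"

definition block_separable :: "real \<Rightarrow> (real \<Rightarrow> real \<Rightarrow> real) \<Rightarrow> estimator_family \<Rightarrow> bool" where
  "block_separable h pen est \<longleftrightarrow> (\<forall>n p X sig k lam be z. 2 \<le> p \<longrightarrow> 0 < sig \<longrightarrow> gram_is n p X (Gmat h) \<longrightarrow> k < (p + 1) div 2 \<longrightarrow> 0 < lam \<longrightarrow>
     est n p X lam (Yobs n p X sig be z) \<in> coefs p \<and>
     Bmin h (pen (lam / tscale sig p)) (sbeta1 p sig be k + h * sbeta2 p sig be k + nu1 n p X sig k z)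
     (h * sbeta1 p sig be k + sbeta2 p sig be k + nu2 n p X h sig k z)
     (est n p X lam (Yobs n p X sig be z) (2 * k + 1) / tscale sig p) (est n p X lam (Yobs n p X sig be z) (2 * k + 2) / tscale sig p))"

lemma block_separable_ss: "\<bar>h\<bar> < 1 \<Longrightarrow> block_separable h ss_pen ss_est"
  unfolding block_separable_def using ss_scaled ss_est_block(2) by blast

lemma block_separable_lasso: "\<bar>h\<bar> < 1 \<Longrightarrow> block_separable h lasso_pen lasso_est"
  unfolding block_separable_def using lasso_scaled lasso_est_block(2) by blast

definition error_budget :: "real \<Rightarrow> (real \<Rightarrow> real) \<Rightarrow> real \<Rightarrow> real \<Rightarrow> real \<Rightarrow> bool" where
  "error_budget h pen r th \<rho> \<longleftrightarrow> (\<forall>b1 b2 n1 n2 x y. b1 = 0 \<or> sqrt r \<le> \<bar>b1\<bar> \<longrightarrow> b2 = 0 \<or> sqrt r \<le> \<bar>b2\<bar> \<longrightarrow>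
      Bmin h pen (b1 + h * b2 + n1) (h * b1 + b2 + n2) x y \<longrightarrow> \<not> (sgn x = sgn b1 \<and> sgn y = sgn b2) \<longrightarrow>
      \<rho> - th * (of_bool (b1 \<noteq> 0) + of_bool (b2 \<noteq> 0)) \<le> rad2 h n1 n2)"

lemma penalized_upper:
  assumes S: "block_separable h pen est" and h: "\<bar>h\<bar> < 1" and th: "0 < th" and r: "0 < r" and rho: "0 < \<rho>" and s: "0 < s" and d: "0 < d"
    and det: "error_budget h (pen s) r th \<rho>"
  shows "\<forall>\<^sub>F p in sequentially. \<forall>n X sig mu. gram_is n p X (Gmat h) \<longrightarrow> 0 < sig \<longrightarrow> mu \<in> Theta p (sig * sqrt (2 * r * ln p)) \<longrightarrow>
    risk n p X sig (real p powr (- th)) (est n p X (tscale sig p * s)) mu \<le> ennreal (real p powr (1 - \<rho> + d))"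
  using risk_upper[OF th rho d h] eventually_ge_at_top[of 2]
proof (eventually_elim, intro allI impI)
  fix p n :: nat and X sig mu
  assume U: "\<forall>n X sig est mu. gram_is n p X (Gmat h) \<longrightarrow>
    (\<forall>b z k. k < (p + 1) div 2 \<longrightarrow> blk_err p (est (Yobs n p X sig (beta_of b mu) z)) (beta_of b mu) k \<longrightarrow>
       2 * ln p * (\<rho> - card {i\<in>blk p k. b i} * th) \<le> (lin n (fstdir X k) z)\<^sup>2 + (lin n (snddir p X h k) z)\<^sup>2) \<longrightarrow>
    risk n p X sig (real p powr (- th)) est mu \<le> ennreal (real p powr (1 - \<rho> + d))"
   and p2: "2 \<le> p" and G: "gram_is n p X (Gmat h)" and sig: "0 < sig" and mu: "mu \<in> Theta p (sig * sqrt (2 * r * ln p))"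
  note p = p2 sig
  have T: "0 < tscale sig p" by (rule tscale(1)[OF p])
  show "risk n p X sig (real p powr (- th)) (est n p X (tscale sig p * s)) mu \<le> ennreal (real p powr (1 - \<rho> + d))"
  proof (rule U[rule_format, OF G])
    fix b z k assume k: "k < (p + 1) div 2"
      and err: "blk_err p (est n p X (tscale sig p * s) (Yobs n p X sig (beta_of b mu) z)) (beta_of b mu) k"
    let ?bh = "est n p X (tscale sig p * s) (Yobs n p X sig (beta_of b mu) z)" and ?be = "beta_of b mu"
    have lam: "0 < tscale sig p * s" using T s by simp
    have C: "?bh \<in> coefs p" and B: "Bmin h (pen s) (sbeta1 p sig ?be k + h * sbeta2 p sig ?be k + nu1 n p X sig k z)
       (h * sbeta1 p sig ?be k + sbeta2 p sig ?be k + nu2 n p X h sig k z) (?bh (2 * k + 1) / tscale sig p) (?bh (2 * k + 2) / tscale sig p)"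
      using S[unfolded block_separable_def, rule_format, OF p G k lam] T by simp_all
    have "\<rho> - th * (of_bool (sbeta1 p sig ?be k \<noteq> 0) + of_bool (sbeta2 p sig ?be k \<noteq> 0)) \<le> rad2 h (nu1 n p X sig k z) (nu2 n p X h sig k z)"
      using scaled_signal(1,2)[OF p r mu k] B err[unfolded blk_err_scaled[OF p C k]]
      by (rule det[unfolded error_budget_def, rule_format])
    then have "\<rho> - th * real (card {i\<in>blk p k. b i}) \<le> rad2 h (nu1 n p X sig k z) (nu2 n p X h sig k z)"
      unfolding scaled_signal(3)[OF p r mu k] .
    from noise_budget[OF p h this]
    show "2 * ln p * (\<rho> - card {i\<in>blk p k. b i} * th) \<le> (lin n (fstdir X k) z)\<^sup>2 + (lin n (snddir p X h k) z)\<^sup>2"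
      by (simp only: mult.commute[of th])
  qed
qed

lemma penalized_lower_event:
  assumes S: "block_separable h pen est" and h: "\<bar>h\<bar> < 1" and th: "0 < th" and d: "0 < d"
    and R: "reach h c1 c2 \<kappa>0 P" and q: "0 < qf h c1 c2"
    and e: "(of_bool s1 + of_bool s2) * th + \<kappa>0 \<le> e"
    and det: "\<And>lam n1 n2 x y. 0 < lam \<Longrightarrow> \<Lambda> lam \<Longrightarrow> P n1 n2 \<Longrightarrow>
      Bmin h (pen lam) ((if s1 then m1 else 0) + h * (if s2 then m2 else 0) + n1) (h * (if s1 then m1 else 0) + (if s2 then m2 else 0) + n2) x y \<Longrightarrow>
      \<not> (sgn x = sgn (if s1 then m1 else 0) \<and> sgn y = sgn (if s2 then m2 else 0))"
  shows "\<forall>\<^sub>F p in sequentially. \<forall>n X sig lam. gram_is n p X (Gmat h) \<longrightarrow> 0 < sig \<longrightarrow> 0 < lam \<longrightarrow> \<Lambda> (lam / tscale sig p) \<longrightarrow>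
    ennreal (real p powr (1 - e - d)) \<le> risk n p X sig (real p powr (- th)) (est n p X lam) (two_level sig p m1 m2)"
  using risk_lower_reach[OF R h q th d, of s1 s2] eventually_ge_at_top[of 2]
proof (eventually_elim, intro allI impI)
  fix p n :: nat and X sig lam
  assume L: "\<forall>n X sig est mu. gram_is n p X (Gmat h) \<longrightarrow> 0 < sig \<longrightarrow>
    (\<forall>b z k. 2 * k + 2 \<le> p \<longrightarrow> b (2 * k + 1) = s1 \<longrightarrow> b (2 * k + 2) = s2 \<longrightarrow> P (nu1 n p X sig k z) (nu2 n p X h sig k z) \<longrightarrow>
       blk_err p (est (Yobs n p X sig (beta_of b mu) z)) (beta_of b mu) k) \<longrightarrow>
    ennreal (real p powr (1 - ((of_bool s1 + of_bool s2) * th + \<kappa>0) - d)) \<le> risk n p X sig (real p powr (- th)) est mu"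
   and p2: "2 \<le> p" and G: "gram_is n p X (Gmat h)" and sig: "0 < sig" and lam: "0 < lam" "\<Lambda> (lam / tscale sig p)"
  note p = p2 sig
  have T: "0 < tscale sig p" by (rule tscale(1)[OF p])
  let ?mu = "two_level sig p m1 m2"
  have "ennreal (real p powr (1 - e - d)) \<le> ennreal (real p powr (1 - ((of_bool s1 + of_bool s2) * th + \<kappa>0) - d))"
    using e p by (intro ennreal_leI powr_mono) auto
  also have "\<dots> \<le> risk n p X sig (real p powr (- th)) (est n p X lam) ?mu"
  proof (rule L[rule_format, OF G sig])
    fix b z k assume k2: "2 * k + 2 \<le> p" and b: "b (2 * k + 1) = s1" "b (2 * k + 2) = s2" and P: "P (nu1 n p X sig k z) (nu2 n p X h sig k z)"
    let ?bh = "est n p X lam (Yobs n p X sig (beta_of b ?mu) z)" and ?be = "beta_of b ?mu"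
    have k: "k < (p + 1) div 2" using k2 by auto
    have C: "?bh \<in> coefs p" and B: "Bmin h (pen (lam / tscale sig p)) (sbeta1 p sig ?be k + h * sbeta2 p sig ?be k + nu1 n p X sig k z)
       (h * sbeta1 p sig ?be k + sbeta2 p sig ?be k + nu2 n p X h sig k z) (?bh (2 * k + 1) / tscale sig p) (?bh (2 * k + 2) / tscale sig p)"
      using S[unfolded block_separable_def, rule_format, OF p G k lam(1)] by simp_all
    have l: "0 < lam / tscale sig p" using lam T by simp
    show "blk_err p ?bh ?be k"
      unfolding blk_err_scaled[OF p C k] two_level_scaled[OF p k2] b
      by (rule det[OF l lam(2) P]) (use B in \<open>simp only: two_level_scaled[OF p k2] b\<close>)
  qed
  finally show "ennreal (real p powr (1 - e - d)) \<le> risk n p X sig (real p powr (- th)) (est n p X lam) ?mu" .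
qed

lemma penalized_rate:
  fixes est :: estimator_family
  assumes S: "block_separable h pen est" and h: "\<bar>h\<bar> < 1" and th: "0 < th" and r: "0 < r" and rho: "0 < \<rho>" and s: "0 < s"
    and sig: "0 < sig" and G: "\<forall>p. gram_is (nn p) p (X p) (Gmat h)"
    and det: "error_budget h (pen s) r th \<rho>"
    and A: "\<And>d. 0 < d \<Longrightarrow> \<forall>\<^sub>F p in sequentially. \<forall>n X sig lam. gram_is n p X (Gmat h) \<longrightarrow> 0 < sig \<longrightarrow> 0 < lam \<longrightarrow> lam / tscale sig p \<le> t \<longrightarrow>
      ennreal (real p powr (1 - \<rho> - d)) \<le> risk n p X sig (real p powr (- th)) (est n p X lam) (two_level sig p a1 a2)"
    and B: "\<And>d. 0 < d \<Longrightarrow> \<forall>\<^sub>F p in sequentially. \<forall>n X sig lam. gram_is n p X (Gmat h) \<longrightarrow> 0 < sig \<longrightarrow> 0 < lam \<longrightarrow> t \<le> lam / tscale sig p \<longrightarrow>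
      ennreal (real p powr (1 - \<rho> - d)) \<le> risk n p X sig (real p powr (- th)) (est n p X lam) (two_level sig p b1 b2)"
    and m: "sqrt r \<le> \<bar>a1\<bar>" "sqrt r \<le> \<bar>a2\<bar>" "sqrt r \<le> \<bar>b1\<bar>" "sqrt r \<le> \<bar>b2\<bar>"
  shows "\<exists>L. Lp_factor L \<and> (\<forall>\<^sub>F p in sequentially.
      (INF lam \<in> {0<..}. SUP mu \<in> Theta p (sig * sqrt (2 * r * ln p)). risk (nn p) p (X p) sig (real p powr (- th)) (est (nn p) p (X p) lam) mu)
      = ennreal (L p * real p powr (1 - \<rho>)))"
proof (rule Lp_factor_of_bounds)
  fix d :: real assume d: "0 < d"
  show "\<forall>\<^sub>F p in sequentially. (INF lam \<in> {0<..}. SUP mu \<in> Theta p (sig * sqrt (2 * r * ln p)). risk (nn p) p (X p) sig (real p powr (- th)) (est (nn p) p (X p) lam) mu)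
      \<le> ennreal (real p powr (1 - \<rho> + d))"
    using penalized_upper[OF S h th r rho s d det] eventually_ge_at_top[of 2]
  proof eventually_elim
    case (elim p)
    have "tscale sig p * s \<in> {0<..}" using tscale(1)[OF elim(2) sig] s by simp
    then have "(INF lam \<in> {0<..}. SUP mu \<in> Theta p (sig * sqrt (2 * r * ln p)). risk (nn p) p (X p) sig (real p powr (- th)) (est (nn p) p (X p) lam) mu)
      \<le> (SUP mu \<in> Theta p (sig * sqrt (2 * r * ln p)). risk (nn p) p (X p) sig (real p powr (- th)) (est (nn p) p (X p) (tscale sig p * s)) mu)"
      by (rule INF_lower)
    also have "\<dots> \<le> ennreal (real p powr (1 - \<rho> + d))"
      using elim(1) G sig by (intro SUP_least) blast
    finally show ?case .
  qed
  show "\<forall>\<^sub>F p in sequentially. ennreal (real p powr (1 - \<rho> - d))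
      \<le> (INF lam \<in> {0<..}. SUP mu \<in> Theta p (sig * sqrt (2 * r * ln p)). risk (nn p) p (X p) sig (real p powr (- th)) (est (nn p) p (X p) lam) mu)"
    using A[OF d] B[OF d] eventually_ge_at_top[of 2]
  proof eventually_elim
    case (elim p)
    show ?case
    proof (rule INF_greatest)
      fix lam :: real assume "lam \<in> {0<..}"
      then have lam: "0 < lam" by simp
      have Gp: "gram_is (nn p) p (X p) (Gmat h)" using G by blast
      show "ennreal (real p powr (1 - \<rho> - d)) \<le> (SUP mu \<in> Theta p (sig * sqrt (2 * r * ln p)). risk (nn p) p (X p) sig (real p powr (- th)) (est (nn p) p (X p) lam) mu)"
      proof (cases "lam / tscale sig p \<le> t")
        case True
        show ?thesis
          by (rule SUP_upper2[OF two_level_Theta[OF elim(3) sig m(1,2)]]) (rule elim(1)[rule_format, OF Gp sig lam True])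
      next
        case False
        then have "t \<le> lam / tscale sig p" by simp
        then show ?thesis
          by (intro SUP_upper2[OF two_level_Theta[OF elim(3) sig m(3,4)]]) (rule elim(2)[rule_format, OF Gp sig lam])
      qed
    qed
  qed
qed

lemma sgn_choice:
  fixes h :: real
  obtains e :: real where "e = 1 \<or> e = - 1" "e * h = \<bar>h\<bar>" "e\<^sup>2 = 1"
  by (cases "0 \<le> h") (auto intro: that[of 1] that[of "-1"])

lemma qf_shrink: assumes "e\<^sup>2 = 1" "e * h = \<bar>h\<bar>" shows "qf h (- 1) e = 2 * (1 - \<bar>h\<bar>)"
proof -
  have "qf h (- 1) e = 1 - 2 * (e * h) + e\<^sup>2" by (simp add: qf_def)
  then show ?thesis using assms by simp
qed

lemma qf_residual: "qf h h (- 1) = 1 - h\<^sup>2" "qf h (- 1) h = 1 - h\<^sup>2" "e\<^sup>2 = 1 \<Longrightarrow> qf h (- e * h) e = 1 - h\<^sup>2" for e h :: real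
  by (auto simp: qf_def power_mult_distrib) (simp_all add: power2_eq_square algebra_simps)

context
  fixes th r h :: real
  assumes th: "0 < th" "th < r" and h: "\<bar>h\<bar> < 1"
begin

lemma ss_low_null:
  assumes d: "0 < d" and s: "0 < s" "s\<^sup>2 \<le> e"
  shows "\<forall>\<^sub>F p in sequentially. \<forall>n X sig lam. gram_is n p X (Gmat h) \<longrightarrow> 0 < sig \<longrightarrow> 0 < lam \<longrightarrow> lam / tscale sig p \<le> s \<longrightarrow>
    ennreal (real p powr (1 - e - d)) \<le> risk n p X sig (real p powr (- th)) (ss_est n p X lam) (two_level sig p (sqrt r) (sqrt r))"
proof (rule penalized_lower_event[OF block_separable_ss[OF h] h th(1) d reach_halfplane[OF h, of 1 0 s], of False False])
  fix lam n1 n2 x y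
  assume "0 < lam" "lam \<le> s" "s < 1 * n1 + 0 * n2"
    "Bmin h (ss_pen lam) ((if False then sqrt r else 0) + h * (if False then sqrt r else 0) + n1) (h * (if False then sqrt r else 0) + (if False then sqrt r else 0) + n2) x y"
  then show "\<not> (sgn x = sgn (if False then sqrt r else 0) \<and> sgn y = sgn (if False then sqrt r else 0))"
    using ss_lower_null[OF h, of lam n1 n2 x y] by simp
qed (use s in \<open>simp_all add: qf_def\<close>)

lemma ss_low_miss:
  assumes d: "0 < d" and s: "0 < s" "th + (pos (sqrt r - s))\<^sup>2 \<le> e"
  shows "\<forall>\<^sub>F p in sequentially. \<forall>n X sig lam. gram_is n p X (Gmat h) \<longrightarrow> 0 < sig \<longrightarrow> 0 < lam \<longrightarrow> s \<le> lam / tscale sig p \<longrightarrow>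
    ennreal (real p powr (1 - e - d)) \<le> risk n p X sig (real p powr (- th)) (ss_est n p X lam) (two_level sig p (sqrt r) (sqrt r))"
proof (rule penalized_lower_event[OF block_separable_ss[OF h] h th(1) d reach_halfplane[OF h, of "- 1" 0 "sqrt r - s"], of True False])
  fix lam n1 n2 x y
  assume "0 < lam" "s \<le> lam" "sqrt r - s < - 1 * n1 + 0 * n2"
    "Bmin h (ss_pen lam) ((if True then sqrt r else 0) + h * (if False then sqrt r else 0) + n1) (h * (if True then sqrt r else 0) + (if False then sqrt r else 0) + n2) x y"
  then show "\<not> (sgn x = sgn (if True then sqrt r else 0) \<and> sgn y = sgn (if False then sqrt r else 0))"
    using ss_lower_single[OF h, of lam "sqrt r + n1" "h * sqrt r + n2" x y] less_trans[OF th] by simp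
qed (use s in \<open>simp_all add: qf_def\<close>)

lemma ss_low_swap:
  assumes d: "0 < d" and s: "th + (1 - \<bar>h\<bar>) * r / 2 \<le> e"
  shows "\<forall>\<^sub>F p in sequentially. \<forall>n X sig lam. gram_is n p X (Gmat h) \<longrightarrow> 0 < sig \<longrightarrow> 0 < lam \<longrightarrow> s \<le> lam / tscale sig p \<longrightarrow>
    ennreal (real p powr (1 - e - d)) \<le> risk n p X sig (real p powr (- th)) (ss_est n p X lam) (two_level sig p (sqrt r) (sqrt r))"
proof -
  obtain g where g: "g = 1 \<or> g = - 1" "g * h = \<bar>h\<bar>" "g\<^sup>2 = 1" using sgn_choice by metis
  have q: "qf h (- 1) g = 2 * (1 - \<bar>h\<bar>)" by (rule qf_shrink[OF g(3,2)])
  have pos: "pos ((1 - \<bar>h\<bar>) * sqrt r) = (1 - \<bar>h\<bar>) * sqrt r" using h less_trans[OF th] by simp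
  have k: "(pos ((1 - \<bar>h\<bar>) * sqrt r))\<^sup>2 / qf h (- 1) g = (1 - \<bar>h\<bar>) * r / 2"
  proof -
    have *: "(c * sqrt r)\<^sup>2 / (2 * c) = c * r / 2" if "0 < c" for c :: real
      using that less_trans[OF th] by (simp add: power_mult_distrib) (simp add: power2_eq_square)
    show ?thesis unfolding q pos by (rule *) (use h in simp)
  qed
  show ?thesis
  proof (rule penalized_lower_event[OF block_separable_ss[OF h] h th(1) d reach_halfplane[OF h, of "- 1" g "(1 - \<bar>h\<bar>) * sqrt r"], of True False])
    fix lam n1 n2 x y
    assume a: "0 < lam" "s \<le> lam" "(1 - \<bar>h\<bar>) * sqrt r < - 1 * n1 + g * n2"
      "Bmin h (ss_pen lam) ((if True then sqrt r else 0) + h * (if False then sqrt r else 0) + n1) (h * (if True then sqrt r else 0) + (if False then sqrt r else 0) + n2) x y"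
    have "g * (h * sqrt r + n2) = \<bar>h\<bar> * sqrt r + g * n2" unfolding g(2)[symmetric] by (simp add: algebra_simps)
    moreover have "g * (h * sqrt r + n2) \<le> \<bar>h * sqrt r + n2\<bar>" using g(1) by auto
    moreover have "(1 - \<bar>h\<bar>) * sqrt r = sqrt r - \<bar>h\<bar> * sqrt r" by (simp add: left_diff_distrib)
    ultimately have "sqrt r + n1 < \<bar>h * sqrt r + n2\<bar>" using a(3) by linarith
    then show "\<not> (sgn x = sgn (if True then sqrt r else 0) \<and> sgn y = sgn (if False then sqrt r else 0))"
      using a ss_lower_single[OF h, of lam "sqrt r + n1" "h * sqrt r + n2" x y] less_trans[OF th] by simp
  next
    show "(of_bool True + of_bool False) * th + (pos ((1 - \<bar>h\<bar>) * sqrt r))\<^sup>2 / qf h (- 1) g \<le> e"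
      unfolding k using s by simp
  qed (use h in \<open>simp_all only: q, simp_all\<close>)
qed

lemma ss_low_pair:
  assumes d: "0 < d" and s: "0 < s" "2 * th + (pos (sqrt ((1 - h\<^sup>2) * r) - s))\<^sup>2 \<le> e"
  shows "\<forall>\<^sub>F p in sequentially. \<forall>n X sig lam. gram_is n p X (Gmat h) \<longrightarrow> 0 < sig \<longrightarrow> 0 < lam \<longrightarrow> s \<le> lam / tscale sig p \<longrightarrow>
    ennreal (real p powr (1 - e - d)) \<le> risk n p X sig (real p powr (- th)) (ss_est n p X lam) (two_level sig p (sqrt r) (sqrt r))"
proof -
  define a where "a = sqrt (1 - h\<^sup>2)"
  have a: "0 < a" "a\<^sup>2 = 1 - h\<^sup>2" using abs_less_one_sq[OF h] by (auto simp: a_def)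
  have "(1 - h\<^sup>2) * sqrt r - s * a = a * (sqrt ((1 - h\<^sup>2) * r) - s)"
  proof -
    have "sqrt ((1 - h\<^sup>2) * r) = a * sqrt r" by (simp add: real_sqrt_mult a_def)
    then show ?thesis unfolding a(2)[symmetric] by (simp add: power2_eq_square algebra_simps)
  qed
  moreover have "pos (a * z) = a * pos z" for z using a by (auto simp: pos_def max_def zero_le_mult_iff mult_le_0_iff)
  ultimately have k: "(pos ((1 - h\<^sup>2) * sqrt r - s * a))\<^sup>2 / qf h h (- 1) = (pos (sqrt ((1 - h\<^sup>2) * r) - s))\<^sup>2"
    unfolding qf_residual(1) a(2)[symmetric] using a(1) by (simp add: power_mult_distrib)
  show ?thesis
  proof (rule penalized_lower_event[OF block_separable_ss[OF h] h th(1) d reach_halfplane[OF h, of h "- 1" "(1 - h\<^sup>2) * sqrt r - s * a"], of True True])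
    fix lam n1 n2 x y
    assume A: "0 < lam" "s \<le> lam" "(1 - h\<^sup>2) * sqrt r - s * a < h * n1 + - 1 * n2"
      "Bmin h (ss_pen lam) ((if True then sqrt r else 0) + h * (if True then sqrt r else 0) + n1) (h * (if True then sqrt r else 0) + (if True then sqrt r else 0) + n2) x y"
    have "(h * sqrt r + sqrt r + n2) - h * (sqrt r + h * sqrt r + n1) = (1 - h\<^sup>2) * sqrt r + n2 - h * n1"
      by (simp add: power2_eq_square algebra_simps)
    also have "\<dots> < s * a" using A(3) by simp
    also have "\<dots> \<le> lam * a" using A a by simp
    finally have "\<not> (sgn x \<noteq> 0 \<and> sgn y = 1)"
      using A ss_lower_pair[OF h, of lam "sqrt r + h * sqrt r + n1" "h * sqrt r + sqrt r + n2" x y] by (simp add: a_def)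
    then show "\<not> (sgn x = sgn (if True then sqrt r else 0) \<and> sgn y = sgn (if True then sqrt r else 0))"
      using less_trans[OF th] by auto
  next
    show "(of_bool True + of_bool True) * th + (pos ((1 - h\<^sup>2) * sqrt r - s * a))\<^sup>2 / qf h h (- 1) \<le> e"
      unfolding k using s by simp
  qed (use abs_less_one_sq[OF h] in \<open>simp_all only: qf_residual(1)\<close>)
qed

lemma ss_low_ball:
  assumes d: "0 < d" and s: "0 < s" "2 * th + 2 * (pos (sqrt ((1 - \<bar>h\<bar>) * r) - s))\<^sup>2 \<le> e"
    and g: "g = 1 \<or> g = - 1" "g * h = \<bar>h\<bar>" "g\<^sup>2 = 1"
  shows "\<forall>\<^sub>F p in sequentially. \<forall>n X sig lam. gram_is n p X (Gmat h) \<longrightarrow> 0 < sig \<longrightarrow> 0 < lam \<longrightarrow> s \<le> lam / tscale sig p \<longrightarrow>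
    ennreal (real p powr (1 - e - d)) \<le> risk n p X sig (real p powr (- th)) (ss_est n p X lam) (two_level sig p (sqrt r) (- g * sqrt r))"
proof -
  define c where "c = 1 - \<bar>h\<bar>"
  have c: "0 < c" using h by (simp add: c_def)
  have q: "qf h (- 1) g = 2 * c" unfolding c_def by (rule qf_shrink[OF g(3,2)])
  have hg: "h = g * \<bar>h\<bar>" using g by (metis mult.assoc mult.left_neutral power2_eq_square)
  have ca: "1 - h\<^sup>2 = c * (1 + \<bar>h\<bar>)" by (simp add: c_def power2_eq_square algebra_simps flip: abs_mult)
  define D where "D = sqrt (2 * (c * r))"
  define x0 where "x0 = pos (D - sqrt 2 * s)"
  define P where "P n1 n2 \<longleftrightarrow> rad2 h (c * sqrt r + n1) (- g * c * sqrt r + n2) < 2 * s\<^sup>2" for n1 n2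
  have R: "reach h (- 1) g (x0\<^sup>2) P"
  proof (rule reach_open[OF h])
    show "0 < qf h (- 1) g" using q c by simp
    show "open {(n1, n2). P n1 n2}" unfolding P_def case_prod_beta rad2_def
      using abs_less_one_sq[OF h] by (intro open_Collect_less continuous_intros) auto
    show "0 \<le> x0" by (simp add: x0_def pos_def)
    show "0 < sqrt 2 * s" using s by simp
    fix x assume x: "x0 < x" "x < x0 + sqrt 2 * s"
    have DX: "\<bar>D - x\<bar> < sqrt 2 * s"
    proof (cases "sqrt 2 * s \<le> D")
      case True
      then have "x0 = D - sqrt 2 * s" by (simp add: x0_def)
      then show ?thesis using x s by auto
    next
      case False
      then have "x0 = 0" by (simp add: x0_def)
      moreover have "0 \<le> D" using c less_trans[OF th] by (simp add: D_def)
      ultimately show ?thesis using x False by auto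
    qed
    define y where "y = c * (sqrt r - x / sqrt (2 * c))"
    have e1: "- 1 + h * g = - c" and e2: "h * - 1 + g = g * c" using g hg by (auto simp: c_def algebra_simps)
    have w: "c * sqrt r + x * (- c / sqrt (2 * c)) = y" "- g * c * sqrt r + x * (g * c / sqrt (2 * c)) = - g * y"
      by (simp_all add: y_def algebra_simps)
    have "rad2 h y (- g * y) = y\<^sup>2 * (1 + 2 * (g * h) + g\<^sup>2) / (1 - h\<^sup>2)"
      unfolding rad2_def by (simp add: power2_eq_square algebra_simps)
    also have "\<dots> = y\<^sup>2 * (2 * (1 + \<bar>h\<bar>)) / (c * (1 + \<bar>h\<bar>))" unfolding g ca by simp
    also have "\<dots> = 2 * y\<^sup>2 / c"
    proof -
      have "y\<^sup>2 * (2 * m) / (c * m) = 2 * y\<^sup>2 / c" if "m \<noteq> 0" for m using that by simp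
      moreover have "1 + \<bar>h\<bar> \<noteq> 0" by linarith
      ultimately show ?thesis by blast
    qed
    also have "\<dots> = (D - x)\<^sup>2"
    proof -
      have l: "sqrt (2 * c) * sqrt (2 * c) = 2 * c" "sqrt (2 * c) \<noteq> 0" using c by simp_all
      have "D - x = sqrt (2 * c) * (sqrt r - x / sqrt (2 * c))"
        using l(2) by (simp add: D_def real_sqrt_mult right_diff_distrib)
      then have "(D - x)\<^sup>2 = 2 * c * (sqrt r - x / sqrt (2 * c))\<^sup>2" using l(1) by (simp add: power_mult_distrib power2_eq_square)
      then show ?thesis using c by (simp add: y_def power_mult_distrib) (simp add: power2_eq_square)
    qed
    also have "\<dots> < (sqrt 2 * s)\<^sup>2" using DX s by (simp add: abs_square_less_1 power2_strict_mono)
    finally show "P (x * ((- 1 + h * g) / sqrt (qf h (- 1) g))) (x * ((h * - 1 + g) / sqrt (qf h (- 1) g)))"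
      unfolding P_def e1 e2 q w by (simp add: power_mult_distrib)
  qed
  have "D - sqrt 2 * s = sqrt 2 * (sqrt (c * r) - s)" by (simp add: D_def real_sqrt_mult right_diff_distrib)
  moreover have "pos (sqrt 2 * z) = sqrt 2 * pos z" for z by (auto simp: pos_def max_def zero_le_mult_iff mult_le_0_iff)
  ultimately have k: "x0\<^sup>2 = 2 * (pos (sqrt (c * r) - s))\<^sup>2" by (simp add: x0_def power_mult_distrib)
  show ?thesis
  proof (rule penalized_lower_event[OF block_separable_ss[OF h] h th(1) d R, of True True])
    show "0 < qf h (- 1) g" using q c by simp
    show "(of_bool True + of_bool True) * th + x0\<^sup>2 \<le> e" using s(2) by (simp add: k c_def)
    fix lam n1 n2 x y
    assume A: "0 < lam" "s \<le> lam" "P n1 n2"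
      "Bmin h (ss_pen lam) ((if True then sqrt r else 0) + h * (if True then - g * sqrt r else 0) + n1) (h * (if True then sqrt r else 0) + (if True then - g * sqrt r else 0) + n2) x y"
    have w: "sqrt r + h * (- g * sqrt r) + n1 = c * sqrt r + n1" "h * sqrt r + - g * sqrt r + n2 = - g * c * sqrt r + n2"
      using g(2) hg by (simp_all add: c_def algebra_simps)
    have "s\<^sup>2 \<le> lam\<^sup>2" using A s by (intro power_mono) auto
    then have "rad2 h (c * sqrt r + n1) (- g * c * sqrt r + n2) < 2 * lam\<^sup>2" using A(3) by (simp add: P_def)
    moreover have "Bmin h (ss_pen lam) (c * sqrt r + n1) (- g * c * sqrt r + n2) x y" using A(4) w by simp
    ultimately have "\<not> (sgn x \<noteq> 0 \<and> sgn y \<noteq> 0)" by (intro ss_lower_pair_ball[OF h])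
    then show "\<not> (sgn x = sgn (if True then sqrt r else 0) \<and> sgn y = sgn (if True then - g * sqrt r else 0))"
      using less_trans[OF th] g(1) by auto
  qed
qed

lemma ss_rate:
  assumes sig: "0 < sig" and G: "\<forall>p. gram_is (nn p) p (X p) (Gmat h)"
  shows "\<exists>L. Lp_factor L \<and> (\<forall>\<^sub>F p in sequentially.
      (INF lam \<in> {0<..}. SUP mu \<in> Theta p (sig * sqrt (2 * r * ln p)). risk (nn p) p (X p) sig (real p powr (- th)) (ss_est (nn p) p (X p) lam) mu)
      = ennreal (L p * real p powr (1 - rho_ss th r h)))"
proof -
  define A where "A = (1 - h\<^sup>2) * r"
  define C where "C = (1 - \<bar>h\<bar>) * r"
  have AC: "0 < A" "0 < C" using abs_less_one_sq[OF h] less_trans[OF th] h by (auto simp: A_def C_def)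
  obtain s1 where s1: "0 < s1" "s1\<^sup>2 = (th + r)\<^sup>2 / (4 * r)" "th + (pos (sqrt r - s1))\<^sup>2 = (th + r)\<^sup>2 / (4 * r)"
    using crossing_hard[of th r] th less_trans[OF th] by auto
  obtain s3 where s3: "0 < s3" "s3\<^sup>2 = rho_ss1 th r h" "2 * th + (pos (sqrt A - s3))\<^sup>2 = rho_ss1 th r h"
    using crossing_hard[of "2 * th" A] th AC unfolding rho_ss1_alt[OF th(1) h] A_def[symmetric] by auto
  obtain s4 where s4: "0 < s4" "s4\<^sup>2 = rho_ss2 th r h" "2 * th + 2 * (pos (sqrt C - s4))\<^sup>2 = rho_ss2 th r h"
    using crossing_ball[of th C] th AC unfolding rho_ss2_alt[OF th(1) h] C_def[symmetric] by auto
  define \<rho> where "\<rho> = rho_ss th r h"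
  have le: "\<rho> \<le> (th + r)\<^sup>2 / (4 * r)" "\<rho> \<le> th + C / 2" "\<rho> \<le> rho_ss1 th r h" "\<rho> \<le> rho_ss2 th r h"
    unfolding \<rho>_def rho_ss_def C_def by (simp_all add: Min4_le)
  have "\<rho> \<in> {(th + r)\<^sup>2 / (4 * r), th + C / 2, rho_ss1 th r h, rho_ss2 th r h}"
    unfolding \<rho>_def rho_ss_def C_def by (rule Min_in) auto
  then have cases: "\<rho> = s1\<^sup>2 \<or> \<rho> = th + C / 2 \<or> \<rho> = s3\<^sup>2 \<or> \<rho> = s4\<^sup>2" using s1 s3 s4 by auto
  have rho: "0 < \<rho>" using cases s1(1) s3(1) s4(1) th AC by (elim disjE) auto
  define s where "s = sqrt \<rho>"
  have s: "0 < s" "s\<^sup>2 = \<rho>" using rho by (auto simp: s_def)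
  have less: "s \<le> s1" "s \<le> s3" "s \<le> s4"
    using le s1 s3 s4 by (auto simp: s_def intro!: real_le_lsqrt)
  have det: "error_budget h (ss_pen s) r th \<rho>"
    unfolding error_budget_def
  proof (intro allI impI)
    fix b1 b2 n1 n2 x y
    assume that: "b1 = 0 \<or> sqrt r \<le> \<bar>b1\<bar>" "b2 = 0 \<or> sqrt r \<le> \<bar>b2\<bar>"
      "Bmin h (ss_pen s) (b1 + h * b2 + n1) (h * b1 + b2 + n2) x y" "\<not> (sgn x = sgn b1 \<and> sgn y = sgn b2)"
    show "\<rho> - th * (of_bool (b1 \<noteq> 0) + of_bool (b2 \<noteq> 0)) \<le> rad2 h n1 n2"
    proof (rule ss_upper[OF h that(3) _ less_trans[OF th] that(1,2,4)])
      show "\<rho> \<le> th + (pos (sqrt r - s))\<^sup>2" using le s1(3) pos_mono[of "sqrt r - s1" "sqrt r - s"] less by linarith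
      show "\<rho> \<le> 2 * th + (pos (sqrt ((1 - h\<^sup>2) * r) - s))\<^sup>2"
        using le s3(3) pos_mono[of "sqrt A - s3" "sqrt A - s"] less unfolding A_def by linarith
      show "\<rho> \<le> 2 * th + 2 * (pos (sqrt ((1 - \<bar>h\<bar>) * r) - s))\<^sup>2"
        using le s4(3) pos_mono[of "sqrt C - s4" "sqrt C - s"] less unfolding C_def by linarith
      show "\<rho> \<le> th + (1 - \<bar>h\<bar>) * r / 2" using le by (simp add: C_def)
    qed (use s th in auto)
  qed
  have m: "sqrt r \<le> \<bar>sqrt r\<bar>" using less_trans[OF th] by simp
  note rate = penalized_rate[OF block_separable_ss[OF h] h th(1) less_trans[OF th] rho s(1) sig G det]
  obtain g where g: "g = 1 \<or> g = - 1" "g * h = \<bar>h\<bar>" "g\<^sup>2 = 1" using sgn_choice by metis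
  have m': "sqrt r \<le> \<bar>- g * sqrt r\<bar>" using less_trans[OF th] g(1) by auto
  show ?thesis
    using cases
  proof (elim disjE)
    assume e: "\<rho> = s1\<^sup>2"
    show ?thesis unfolding \<rho>_def[symmetric]
      by (rule rate[OF ss_low_null[of _ s1] ss_low_miss[of _ s1] m m m m]) (use e s1 in auto)
  next
    assume e: "\<rho> = th + C / 2"
    show ?thesis unfolding \<rho>_def[symmetric]
      by (rule rate[OF ss_low_null[of _ s] ss_low_swap[of _ _ s] m m m m]) (use e s in \<open>auto simp: C_def\<close>)
  next
    assume e: "\<rho> = s3\<^sup>2"
    show ?thesis unfolding \<rho>_def[symmetric]
      by (rule rate[OF ss_low_null[of _ s3] ss_low_pair[of _ s3] m m m m]) (use e s3 in \<open>auto simp: A_def\<close>)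
  next
    assume e: "\<rho> = s4\<^sup>2"
    show ?thesis unfolding \<rho>_def[symmetric]
      by (rule rate[OF ss_low_null[of _ s4] ss_low_ball[of _ s4 _ g] m m m m']) (use e s4 g in \<open>auto simp: C_def\<close>)
  qed
qed

end

lemma lasso_lower_false:
  assumes s: "0 < s" and B: "Bmin h (lasso_pen s) w1 w2 x y" and g: "g = 1 \<or> g = - 1" "g * h = \<bar>h\<bar>"
    and w: "(1 - \<bar>h\<bar>) * s < g * (w2 - h * w1)"
  shows "\<not> (sgn x = 1 \<and> sgn y = 0)"
proof
  assume "sgn x = 1 \<and> sgn y = 0"
  then have "0 < x" "y = 0" by (auto simp: sgn_1_pos sgn_0_0)
  with lasso_kkt[OF s B] have x: "w1 - x = s" "\<bar>w2 - h * x\<bar> \<le> s" by (auto simp: subgrad_def)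
  have xe: "x = w1 - s" using x(1) by simp
  have "g * (w2 - h * x) = g * (w2 - h * w1) + (g * h) * s" unfolding xe by (simp add: algebra_simps)
  moreover have "g * (w2 - h * x) \<le> \<bar>w2 - h * x\<bar>" using g(1) by auto
  moreover have "(1 - \<bar>h\<bar>) * s = s - \<bar>h\<bar> * s" by (simp add: left_diff_distrib)
  ultimately show False using w x(2) unfolding g(2) by linarith
qed

context
  fixes th r h g :: real
  assumes th: "0 < th" "th < r" and h: "\<bar>h\<bar> < 1" and g: "g = 1 \<or> g = - 1" "g * h = \<bar>h\<bar>" "g\<^sup>2 = 1"
begin

lemma a_factor: "1 - h\<^sup>2 = (1 - \<bar>h\<bar>) * (1 + \<bar>h\<bar>)" by (simp add: power2_eq_square algebra_simps flip: abs_mult)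

lemma lasso_low_null:
  assumes d: "0 < d" and s: "0 < s" "s\<^sup>2 \<le> e"
  shows "\<forall>\<^sub>F p in sequentially. \<forall>n X sig lam. gram_is n p X (Gmat h) \<longrightarrow> 0 < sig \<longrightarrow> 0 < lam \<longrightarrow> lam / tscale sig p \<le> s \<longrightarrow>
    ennreal (real p powr (1 - e - d)) \<le> risk n p X sig (real p powr (- th)) (lasso_est n p X lam) (two_level sig p (sqrt r) (sqrt r))"
proof (rule penalized_lower_event[OF block_separable_lasso[OF h] h th(1) d reach_halfplane[OF h, of 1 0 s], of False False])
  fix lam n1 n2 x y
  assume "0 < lam" "lam \<le> s" "s < 1 * n1 + 0 * n2"
    "Bmin h (lasso_pen lam) ((if False then sqrt r else 0) + h * (if False then sqrt r else 0) + n1) (h * (if False then sqrt r else 0) + (if False then sqrt r else 0) + n2) x y"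
  then show "\<not> (sgn x = sgn (if False then sqrt r else 0) \<and> sgn y = sgn (if False then sqrt r else 0))"
    using lasso_lower_null[of lam h n1 n2 x y] by simp
qed (use s in \<open>simp_all add: qf_def\<close>)

lemma lasso_low_miss:
  assumes d: "0 < d" and s: "0 < s" "th + (pos (sqrt r - s))\<^sup>2 \<le> e"
  shows "\<forall>\<^sub>F p in sequentially. \<forall>n X sig lam. gram_is n p X (Gmat h) \<longrightarrow> 0 < sig \<longrightarrow> 0 < lam \<longrightarrow> s \<le> lam / tscale sig p \<longrightarrow>
    ennreal (real p powr (1 - e - d)) \<le> risk n p X sig (real p powr (- th)) (lasso_est n p X lam) (two_level sig p (sqrt r) (sqrt r))"
proof (rule penalized_lower_event[OF block_separable_lasso[OF h] h th(1) d reach_halfplane[OF h, of "- 1" 0 "sqrt r - s"], of True False])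
  fix lam n1 n2 x y
  assume "0 < lam" "s \<le> lam" "sqrt r - s < - 1 * n1 + 0 * n2"
    "Bmin h (lasso_pen lam) ((if True then sqrt r else 0) + h * (if False then sqrt r else 0) + n1) (h * (if True then sqrt r else 0) + (if False then sqrt r else 0) + n2) x y"
  then show "\<not> (sgn x = sgn (if True then sqrt r else 0) \<and> sgn y = sgn (if False then sqrt r else 0))"
    using lasso_lower_miss[of lam h "sqrt r + n1" "h * sqrt r + n2" x y] less_trans[OF th] by simp
qed (use s in \<open>simp_all add: qf_def\<close>)

lemma lasso_low_false:
  assumes d: "0 < d" and s: "0 < s" "th + (1 - \<bar>h\<bar>) / (1 + \<bar>h\<bar>) * s\<^sup>2 \<le> e"
  shows "\<forall>\<^sub>F p in sequentially. \<forall>n X sig lam. gram_is n p X (Gmat h) \<longrightarrow> 0 < sig \<longrightarrow> 0 < lam \<longrightarrow> lam / tscale sig p \<le> s \<longrightarrow>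
    ennreal (real p powr (1 - e - d)) \<le> risk n p X sig (real p powr (- th)) (lasso_est n p X lam) (two_level sig p (sqrt r) (sqrt r))"
proof -
  have q: "qf h (- g * h) g = 1 - h\<^sup>2" by (rule qf_residual(3)[OF g(3)])
  have "pos ((1 - \<bar>h\<bar>) * s) = (1 - \<bar>h\<bar>) * s" using h s by simp
  moreover have "(c * s)\<^sup>2 / (c * m) = c / m * s\<^sup>2" if "0 < c" for c m :: real using that by (simp add: power2_eq_square)
  ultimately have k: "(pos ((1 - \<bar>h\<bar>) * s))\<^sup>2 / qf h (- g * h) g = (1 - \<bar>h\<bar>) / (1 + \<bar>h\<bar>) * s\<^sup>2"
    unfolding q a_factor using h by simp
  show ?thesis
  proof (rule penalized_lower_event[OF block_separable_lasso[OF h] h th(1) d reach_halfplane[OF h, of "- g * h" g "(1 - \<bar>h\<bar>) * s"], of True False])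
    fix lam n1 n2 x y
    assume A: "0 < lam" "lam \<le> s" "(1 - \<bar>h\<bar>) * s < - g * h * n1 + g * n2"
      "Bmin h (lasso_pen lam) ((if True then sqrt r else 0) + h * (if False then sqrt r else 0) + n1) (h * (if True then sqrt r else 0) + (if False then sqrt r else 0) + n2) x y"
    have "(1 - \<bar>h\<bar>) * lam \<le> (1 - \<bar>h\<bar>) * s" using A h by (intro mult_left_mono) auto
    also have "\<dots> < g * ((h * sqrt r + n2) - h * (sqrt r + n1))" using A(3) by (simp add: algebra_simps)
    finally have "\<not> (sgn x = 1 \<and> sgn y = 0)"
      using A by (intro lasso_lower_false[OF A(1) _ g(1,2), of "sqrt r + n1" "h * sqrt r + n2"]) auto
    then show "\<not> (sgn x = sgn (if True then sqrt r else 0) \<and> sgn y = sgn (if False then sqrt r else 0))"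
      using less_trans[OF th] by simp
  next
    show "(of_bool True + of_bool False) * th + (pos ((1 - \<bar>h\<bar>) * s))\<^sup>2 / qf h (- g * h) g \<le> e"
      unfolding k using s by simp
  qed (use abs_less_one_sq[OF h] in \<open>simp_all only: q\<close>)
qed

lemma lasso_low_pair:
  assumes d: "0 < d" and s: "0 < s" "2 * th + (pos ((1 - h\<^sup>2) * sqrt r - (1 + \<bar>h\<bar>) * s))\<^sup>2 / (1 - h\<^sup>2) \<le> e"
  shows "\<forall>\<^sub>F p in sequentially. \<forall>n X sig lam. gram_is n p X (Gmat h) \<longrightarrow> 0 < sig \<longrightarrow> 0 < lam \<longrightarrow> s \<le> lam / tscale sig p \<longrightarrow>
    ennreal (real p powr (1 - e - d)) \<le> risk n p X sig (real p powr (- th)) (lasso_est n p X lam) (two_level sig p (sqrt r) (- g * sqrt r))"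
proof (rule penalized_lower_event[OF block_separable_lasso[OF h] h th(1) d reach_halfplane[OF h, of "- 1" h "(1 - h\<^sup>2) * sqrt r - (1 + \<bar>h\<bar>) * s"], of True True])
  fix lam n1 n2 x y
  assume A: "0 < lam" "s \<le> lam" "(1 - h\<^sup>2) * sqrt r - (1 + \<bar>h\<bar>) * s < - 1 * n1 + h * n2"
    "Bmin h (lasso_pen lam) ((if True then sqrt r else 0) + h * (if True then - g * sqrt r else 0) + n1) (h * (if True then sqrt r else 0) + (if True then - g * sqrt r else 0) + n2) x y"
  let ?w1 = "sqrt r + h * (- g * sqrt r) + n1" and ?w2 = "h * sqrt r + - g * sqrt r + n2"
  have "?w1 - h * ?w2 = (1 - h\<^sup>2) * sqrt r + n1 - h * n2" by (simp add: power2_eq_square algebra_simps)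
  also have "\<dots> < (1 + \<bar>h\<bar>) * s" using A(3) by simp
  also have "\<dots> \<le> (1 + \<bar>h\<bar>) * lam" using A by (intro mult_left_mono) auto
  finally have w: "?w1 - h * ?w2 < (1 + \<bar>h\<bar>) * lam" .
  have "\<not> (sgn x = 1 \<and> sgn y = - g)"
    by (rule lasso_lower_pair[OF h A(1) _ _ _ w]) (use A(4) g in auto)
  then show "\<not> (sgn x = sgn (if True then sqrt r else 0) \<and> sgn y = sgn (if True then - g * sqrt r else 0))"
    using less_trans[OF th] g(1) by auto
next
  show "(of_bool True + of_bool True) * th + (pos ((1 - h\<^sup>2) * sqrt r - (1 + \<bar>h\<bar>) * s))\<^sup>2 / qf h (- 1) h \<le> e"
    unfolding qf_residual(2) using s by simp
qed (use abs_less_one_sq[OF h] in \<open>simp_all only: qf_residual(2)\<close>)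

lemma lasso_rate:
  assumes sig: "0 < sig" and G: "\<forall>p. gram_is (nn p) p (X p) (Gmat h)"
  shows "\<exists>L. Lp_factor L \<and> (\<forall>\<^sub>F p in sequentially.
      (INF lam \<in> {0<..}. SUP mu \<in> Theta p (sig * sqrt (2 * r * ln p)). risk (nn p) p (X p) sig (real p powr (- th)) (lasso_est (nn p) p (X p) lam) mu)
      = ennreal (L p * real p powr (1 - rho_lasso th r h)))"
proof -
  define c where "c = (1 - \<bar>h\<bar>) / (1 + \<bar>h\<bar>)"
  have c: "0 < c" using h by (simp add: c_def)
  define f where "f s = (pos ((1 - h\<^sup>2) * sqrt r - (1 + \<bar>h\<bar>) * s))\<^sup>2 / (1 - h\<^sup>2)" for s
  have f_anti: "f s' \<le> f s" if "s \<le> s'" for s s'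
  proof -
    have "(1 + \<bar>h\<bar>) * s \<le> (1 + \<bar>h\<bar>) * s'" using that by (intro mult_left_mono) auto
    then show ?thesis unfolding f_def using abs_less_one_sq[OF h] by (intro divide_right_mono pos_mono) auto
  qed
  define v where "v = th + (1 - \<bar>h\<bar>) * r / (2 * (1 + sqrt (1 - h\<^sup>2)))"
  obtain s1 where s1: "0 < s1" "s1\<^sup>2 = (th + r)\<^sup>2 / (4 * r)" "th + (pos (sqrt r - s1))\<^sup>2 = (th + r)\<^sup>2 / (4 * r)"
    using crossing_hard[of th r] th less_trans[OF th] by auto
  obtain s2 where s2: "0 < s2" "th + c * s2\<^sup>2 = v" "th + (pos (sqrt r - s2))\<^sup>2 = v"
    using crossing_lasso_single[of "\<bar>h\<bar>" r] h less_trans[OF th] unfolding v_def c_def by auto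
  obtain s3 where s3: "0 < s3" "s3\<^sup>2 = rho_lasso1 th r h" "2 * th + f s3 = rho_lasso1 th r h"
    using crossing_lasso1[OF th(1) h less_trans[OF th]] unfolding f_def by blast
  obtain s4 where s4: "0 < s4" "th + c * s4\<^sup>2 = rho_lasso2 th r h" "2 * th + f s4 = rho_lasso2 th r h"
    using crossing_lasso2[OF th(1) h th(2)] unfolding f_def c_def by blast
  define \<rho> where "\<rho> = rho_lasso th r h"
  have le: "\<rho> \<le> (th + r)\<^sup>2 / (4 * r)" "\<rho> \<le> v" "\<rho> \<le> rho_lasso1 th r h" "\<rho> \<le> rho_lasso2 th r h"
    unfolding \<rho>_def rho_lasso_def v_def by (simp_all add: Min4_le)
  have "\<rho> \<in> {(th + r)\<^sup>2 / (4 * r), v, rho_lasso1 th r h, rho_lasso2 th r h}"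
    unfolding \<rho>_def rho_lasso_def v_def by (rule Min_in) auto
  then have cases: "\<rho> = s1\<^sup>2 \<or> \<rho> = th + c * s2\<^sup>2 \<or> \<rho> = s3\<^sup>2 \<or> \<rho> = th + c * s4\<^sup>2" using s1 s2 s3 s4 by auto
  have rho: "0 < \<rho>"
    using cases s1(1) s2(1) s3(1) s4(1) th c by (elim disjE) (auto intro!: add_pos_pos mult_pos_pos)
  define s where "s = sqrt (max \<rho> ((\<rho> - th) / c))"
  have mx: "0 < max \<rho> ((\<rho> - th) / c)" using rho by auto
  then have s: "0 < s" "s\<^sup>2 = max \<rho> ((\<rho> - th) / c)" by (auto simp: s_def)
  have up: "\<rho> \<le> s\<^sup>2" "\<rho> \<le> th + c * s\<^sup>2"
  proof -
    show "\<rho> \<le> s\<^sup>2" unfolding s(2) by simp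
    have "c * ((\<rho> - th) / c) \<le> c * s\<^sup>2" unfolding s(2) using c by (intro mult_left_mono) auto
    then show "\<rho> \<le> th + c * s\<^sup>2" using c by simp
  qed
  have sle: "s \<le> t \<or> s \<le> t'" if "0 < t" "0 < t'" "\<rho> \<le> t\<^sup>2" "\<rho> \<le> th + c * t'\<^sup>2" for t t'
  proof (cases "\<rho> \<le> (\<rho> - th) / c")
    case True
    then have "s\<^sup>2 = (\<rho> - th) / c" using s by simp
    also have "\<dots> \<le> t'\<^sup>2" using that c by (simp add: divide_le_eq mult.commute)
    finally show ?thesis using that by (auto intro: power2_le_imp_le)
  next
    case False
    then have "s\<^sup>2 \<le> t\<^sup>2" using s that by simp
    then show ?thesis using that by (auto intro: power2_le_imp_le)
  qed
  have H1: "\<rho> \<le> th + (pos (sqrt r - s))\<^sup>2"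
  proof -
    have "s \<le> s1 \<or> s \<le> s2" by (rule sle) (use s1 s2 le in auto)
    then show ?thesis using pos_mono[of "sqrt r - s1" "sqrt r - s"] pos_mono[of "sqrt r - s2" "sqrt r - s"] s1(3) s2(3) le by linarith
  qed
  have H2: "\<rho> \<le> 2 * th + f s"
  proof -
    have "s \<le> s3 \<or> s \<le> s4" by (rule sle) (use s3 s4 le in auto)
    then show ?thesis using f_anti[of s s3] f_anti[of s s4] s3(3) s4(3) le by linarith
  qed
  have det: "error_budget h (lasso_pen s) r th \<rho>"
    unfolding error_budget_def
  proof (intro allI impI)
    fix b1 b2 n1 n2 x y
    assume that: "b1 = 0 \<or> sqrt r \<le> \<bar>b1\<bar>" "b2 = 0 \<or> sqrt r \<le> \<bar>b2\<bar>"
      "Bmin h (lasso_pen s) (b1 + h * b2 + n1) (h * b1 + b2 + n2) x y" "\<not> (sgn x = sgn b1 \<and> sgn y = sgn b2)"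
    show "\<rho> - th * (of_bool (b1 \<noteq> 0) + of_bool (b2 \<noteq> 0)) \<le> rad2 h n1 n2"
      by (rule lasso_upper[OF h that(3) s(1) _ that(1,2,4) up(1) H1 up(2)[unfolded c_def] H2[unfolded f_def]]) (use less_trans[OF th] in simp)
  qed
  have m: "sqrt r \<le> \<bar>sqrt r\<bar>" using less_trans[OF th] by simp
  have m': "sqrt r \<le> \<bar>- g * sqrt r\<bar>" using less_trans[OF th] g(1) by auto
  note rate = penalized_rate[OF block_separable_lasso[OF h] h th(1) less_trans[OF th] rho s(1) sig G det]
  show ?thesis
    using cases
  proof (elim disjE)
    assume e: "\<rho> = s1\<^sup>2"
    show ?thesis unfolding \<rho>_def[symmetric]
      by (rule rate[OF lasso_low_null[of _ s1] lasso_low_miss[of _ s1] m m m m]) (use e s1 in auto)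
  next
    assume e: "\<rho> = th + c * s2\<^sup>2"
    show ?thesis unfolding \<rho>_def[symmetric]
      by (rule rate[OF lasso_low_false[of _ s2] lasso_low_miss[of _ s2] m m m m]) (use e s2 in \<open>auto simp: c_def\<close>)
  next
    assume e: "\<rho> = s3\<^sup>2"
    show ?thesis unfolding \<rho>_def[symmetric]
      by (rule rate[OF lasso_low_null[of _ s3] lasso_low_pair[of _ s3] m m m m']) (use e s3 in \<open>auto simp: f_def\<close>)
  next
    assume e: "\<rho> = th + c * s4\<^sup>2"
    show ?thesis unfolding \<rho>_def[symmetric]
      by (rule rate[OF lasso_low_false[of _ s4] lasso_low_pair[of _ s4] m m m m']) (use e s4 in \<open>auto simp: c_def f_def\<close>)
  qed
qed

end

section \<open>Rate of Graphlet Screening\<close>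

definition gs_levels :: "real \<Rightarrow> real \<Rightarrow> real \<Rightarrow> real \<Rightarrow> real \<Rightarrow> real \<Rightarrow> real \<Rightarrow> real \<Rightarrow> bool" where
  "gs_levels h th r ta tb tab tba tp \<longleftrightarrow>
     0 \<le> ta \<and> sqrt ta \<le> (r + th) / (2 * sqrt r) \<and> 0 \<le> tb \<and> sqrt tb \<le> (r + th) / (2 * sqrt r) \<and>
     0 \<le> tab \<and> (th < (1 - h\<^sup>2) * r \<longrightarrow> sqrt tab \<le> ((1 - h\<^sup>2) * r + th) / (2 * sqrt ((1 - h\<^sup>2) * r))) \<and>
     0 \<le> tba \<and> (th < (1 - h\<^sup>2) * r \<longrightarrow> sqrt tba \<le> ((1 - h\<^sup>2) * r + th) / (2 * sqrt ((1 - h\<^sup>2) * r))) \<and>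
     0 \<le> tp \<and> (2 * th \<le> (1 - \<bar>h\<bar>) * r \<longrightarrow> sqrt tp \<le> sqrt (2 * ((1 - \<bar>h\<bar>) * r)) - sqrt ((1 - \<bar>h\<bar>) * r / 2 - th))"

definition gs_single :: "real \<Rightarrow> real \<Rightarrow> real \<Rightarrow> real \<Rightarrow> real \<Rightarrow> bool" where
  "gs_single th r t w x \<longleftrightarrow> (if w\<^sup>2 > t then Gmin1 (sqrt th) (sqrt r) w x else x = 0)"

definition gs_pair :: "real \<Rightarrow> real \<Rightarrow> real \<Rightarrow> real \<Rightarrow> real \<Rightarrow> real \<Rightarrow> real \<Rightarrow> real \<Rightarrow> real \<Rightarrow> real \<Rightarrow> real \<Rightarrow> real \<Rightarrow> bool" where
  "gs_pair h th r ta tb tab tba tp w1 w2 x y \<longleftrightarrow>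
     (if h = 0 then gs_single th r ta w1 x \<and> gs_single th r tb w2 y
      else \<exists>u1 u2. gs_screen h ta tb tab tba tp w1 w2 u1 u2 \<and> gs_block h (sqrt th) (sqrt r) w1 w2 u1 u2 x y)"

lemma gs_single_upper:
  assumes th: "0 < th" "th < r" and t: "0 \<le> t" "sqrt t \<le> (r + th) / (2 * sqrt r)"
    and b: "b = 0 \<or> sqrt r \<le> \<bar>b\<bar>" and S: "gs_single th r t (b + n) x" and err: "sgn x \<noteq> sgn b"
  shows "rho_gs th r h - th * of_bool (b \<noteq> 0) \<le> n\<^sup>2"
proof (rule gs_upper_isolated[OF th t b _ err])
  show "rho_gs th r h \<le> (th + r)\<^sup>2 / (4 * r)" unfolding rho_gs_def by simp
  show "Gmin1 (sqrt th) (sqrt r) (b + n) x \<or> x = 0 \<and> (b + n)\<^sup>2 \<le> t"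
    using S by (auto simp: gs_single_def split: if_splits)
qed

lemma gs_pair_upper:
  assumes h: "\<bar>h\<bar> < 1" and th: "0 < th" "th < r" and L: "gs_levels h th r ta tb tab tba tp"
    and S: "gs_pair h th r ta tb tab tba tp (b1 + h * b2 + n1) (h * b1 + b2 + n2) x y"
    and b: "b1 = 0 \<or> sqrt r \<le> \<bar>b1\<bar>" "b2 = 0 \<or> sqrt r \<le> \<bar>b2\<bar>"
    and err: "\<not> (sgn x = sgn b1 \<and> sgn y = sgn b2)"
  shows "rho_gs th r h - th * (of_bool (b1 \<noteq> 0) + of_bool (b2 \<noteq> 0)) \<le> rad2 h n1 n2"
proof (cases "h = 0")
  case True
  have t: "0 \<le> ta" "sqrt ta \<le> (r + th) / (2 * sqrt r)" "0 \<le> tb" "sqrt tb \<le> (r + th) / (2 * sqrt r)"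
    using L by (auto simp: gs_levels_def)
  have S': "gs_single th r ta (b1 + n1) x" "gs_single th r tb (b2 + n2) y" using S True by (auto simp: gs_pair_def)
  have sum: "th * (of_bool (b1 \<noteq> 0) + of_bool (b2 \<noteq> 0)) = th * of_bool (b1 \<noteq> 0) + th * of_bool (b2 \<noteq> 0)"
    by (simp only: distrib_left)
  have nn: "0 \<le> th * of_bool (b1 \<noteq> 0)" "0 \<le> th * of_bool (b2 \<noteq> 0)" using th by auto
  from err consider "sgn x \<noteq> sgn b1" | "sgn y \<noteq> sgn b2" by blast
  then show ?thesis
  proof cases
    case 1
    show ?thesis
      using gs_single_upper[OF th t(1,2) b(1) S'(1) 1, of h] rad2_ge(1)[OF h, of n1 n2] nn unfolding sum by linarith
  next
    case 2
    show ?thesis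
      using gs_single_upper[OF th t(3,4) b(2) S'(2) 2, of h] rad2_ge(2)[OF h, of n2 n1] nn unfolding sum by linarith
  qed
next
  case False
  then obtain u1 u2 where u: "gs_screen h ta tb tab tba tp (b1 + h * b2 + n1) (h * b1 + b2 + n2) u1 u2"
    "gs_block h (sqrt th) (sqrt r) (b1 + h * b2 + n1) (h * b1 + b2 + n2) u1 u2 x y" using S by (auto simp: gs_pair_def)
  have rho: "rho_gs th r h \<le> (th + r)\<^sup>2 / (4 * r)" "rho_gs th r h \<le> th + (1 - \<bar>h\<bar>) * r / 2"
     "rho_gs th r h \<le> 2 * th + (pos ((1 - h\<^sup>2) * r - th))\<^sup>2 / (4 * ((1 - h\<^sup>2) * r))"
    unfolding rho_gs_def mult.assoc by (rule Min.coboundedI; simp)+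
  show ?thesis
    by (rule gs_upper[OF h th _ _ _ _ _ _ _ _ _ _ u b err rho]) (use L in \<open>simp_all add: gs_levels_def\<close>)
qed

lemma gs_pair_null:
  assumes th: "0 < th" "th < r" and L: "gs_levels h th r ta tb tab tba tp"
    and S: "gs_pair h th r ta tb tab tba tp w1 w2 x y" and w: "(r + th) / (2 * sqrt r) < w1"
  shows "\<not> (x = 0 \<and> y = 0)"
proof -
  have r: "0 < r" using th by simp
  have t: "0 \<le> ta" "sqrt ta \<le> (r + th) / (2 * sqrt r)" using L by (auto simp: gs_levels_def)
  have "sqrt ta < w1" using t w by linarith
  then have ta: "ta < w1\<^sup>2" using t(1) by (metis real_sqrt_ge_zero real_sqrt_less_iff real_sqrt_abs order_less_le_trans abs_ge_self)
  have "gs_single th r ta w1 x \<Longrightarrow> x \<noteq> 0"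
    using ta gs_lower_null_isolated[OF r _ _ w] th by (auto simp: gs_single_def)
  moreover have "\<not> (x = 0 \<and> y = 0)" if "gs_screen h ta tb tab tba tp w1 w2 u1 u2" "gs_block h (sqrt th) (sqrt r) w1 w2 u1 u2 x y" for u1 u2
  proof -
    have "u1" using that(1) ta by (simp add: gs_screen_def)
    then show ?thesis
      using that(2) gs_lower_null_isolated[OF r _ _ w] gs_lower_null[OF r _ _ w] th unfolding gs_block_def by (auto split: if_splits)
  qed
  ultimately show ?thesis using S unfolding gs_pair_def by (auto split: if_splits)
qed

lemma gs_pair_swap:
  assumes th: "0 < th" "th < r" and h0: "h \<noteq> 0" and L: "gs_levels h th r ta tb tab tba tp"
    and S: "gs_pair h th r ta tb tab tba tp w1 w2 x y"
    and w: "(r + th) / (2 * sqrt r) < w1" "w1 < \<bar>w2\<bar>"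
  shows "\<not> (sgn x = 1 \<and> y = 0)"
proof -
  have r: "0 < r" using th by simp
  have t: "0 \<le> ta" "sqrt ta \<le> (r + th) / (2 * sqrt r)" "0 \<le> tb" "sqrt tb \<le> (r + th) / (2 * sqrt r)"
    using L by (auto simp: gs_levels_def)
  have "sqrt ta < \<bar>w1\<bar>" "sqrt tb < \<bar>w2\<bar>" using t w by linarith+
  then have "ta < w1\<^sup>2" "tb < w2\<^sup>2" by (metis real_sqrt_abs real_sqrt_less_iff)+
  then have "Gmin2 h (sqrt th) (sqrt r) w1 w2 x y" using S h0 by (auto simp: gs_pair_def gs_screen_def gs_block_def)
  then show ?thesis by (rule gs_lower_swap[OF r _ w(2)])
qed

lemma gs_pair_false:
  assumes th: "0 < th" "th < r" and h: "\<bar>h\<bar> < 1" and h0: "h \<noteq> 0" and L: "gs_levels h th r ta tb tab tba tp"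
    and S: "gs_pair h th r ta tb tab tba tp w1 w2 x y" and A: "th < (1 - h\<^sup>2) * r"
    and w: "2 * sqrt r \<le> w1" "((1 - h\<^sup>2) * r + th) / (2 * sqrt r) < w2 - h * w1"
  shows "\<not> (sgn x = 1 \<and> y = 0)"
proof -
  have r: "0 < r" "0 < sqrt r" using th by simp_all
  have a: "0 < 1 - h\<^sup>2" "0 < sqrt (1 - h\<^sup>2)" using abs_less_one_sq[OF h] by simp_all
  have t: "0 \<le> ta" "sqrt ta \<le> (r + th) / (2 * sqrt r)" "0 \<le> tba"
    "sqrt tba \<le> ((1 - h\<^sup>2) * r + th) / (2 * sqrt ((1 - h\<^sup>2) * r))"
    using L A by (auto simp: gs_levels_def)
  have rr: "sqrt r * sqrt r = r" using r by simp
  have "(r + th) / (2 * sqrt r) < 2 * sqrt r" using th r rr by (simp add: pos_divide_less_eq)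
  then have "sqrt ta < \<bar>w1\<bar>" using t w by linarith
  then have 1: "ta < w1\<^sup>2" by (metis real_sqrt_abs real_sqrt_less_iff)
  have "sqrt tba \<le> ((1 - h\<^sup>2) * r + th) / (2 * sqrt r) / sqrt (1 - h\<^sup>2)"
    using t(4) by (simp add: real_sqrt_mult mult_ac)
  also have "\<dots> < (w2 - h * w1) / sqrt (1 - h\<^sup>2)" using w(2) a by (intro divide_strict_right_mono) auto
  also have "\<dots> \<le> sqrt ((w2 - h * w1)\<^sup>2 / (1 - h\<^sup>2))"
    using a by (simp add: real_sqrt_divide divide_right_mono)
  finally have 2: "tba < (w2 - h * w1)\<^sup>2 / (1 - h\<^sup>2)" by (simp only: real_sqrt_less_iff)
  have G: "Gmin2 h (sqrt th) (sqrt r) w1 w2 x y" using S h0 1 2 by (auto simp: gs_pair_def gs_screen_def gs_block_def)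
  have "h * sqrt r \<le> 1 * sqrt r" using h r by (intro mult_right_mono) auto
  then have "sqrt r \<le> w1 - h * sqrt r" using w(1) by simp
  then show ?thesis using th by (intro gs_lower_false[OF r(1) G _ w(2)]) auto
qed

definition gs_tuned :: "real \<Rightarrow> real \<Rightarrow> real \<Rightarrow> (nat \<Rightarrow> nat set \<Rightarrow> nat set \<Rightarrow> real) \<Rightarrow> real \<Rightarrow> nat \<Rightarrow> nat
    \<Rightarrow> (nat \<Rightarrow> nat \<Rightarrow> real) \<Rightarrow> (nat \<Rightarrow> real) \<Rightarrow> nat \<Rightarrow> real" where
  "gs_tuned th r h q sig n p X = gs_est n p X (Gmat h) 0 2 (\<lambda>D F. 2 * sig\<^sup>2 * q p D F * ln p)
     (sig * sqrt (2 * th * ln p)) (sig * sqrt (2 * r * ln p))"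

lemma gs_tuned_alt:
  assumes p: "2 \<le> p" "0 < sig"
  shows "gs_tuned th r h q sig n p X = gs_est n p X (Gmat h) 0 2 (\<lambda>D F. (tscale sig p)\<^sup>2 * q p D F) (tscale sig p * sqrt th) (tscale sig p * sqrt r)"
  unfolding gs_tuned_def tscale(2,3)[OF p] by (simp add: mult_ac)

lemma cor_scaled:
  assumes p: "2 \<le> p" "0 < sig" and G: "gram_is n p X (Gmat h)" and h: "\<bar>h\<bar> < 1" and k: "k < (p + 1) div 2"
  shows "cor n X (Yobs n p X sig be z) (2 * k + 1) / tscale sig p = sbeta1 p sig be k + h * sbeta2 p sig be k + nu1 n p X sig k z"
    "2 * k + 2 \<le> p \<Longrightarrow> cor n X (Yobs n p X sig be z) (2 * k + 2) / tscale sig p = h * sbeta1 p sig be k + sbeta2 p sig be k + nu2 n p X h sig k z"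
  by (simp_all only: cor_obs[OF G h k] sbeta1_def sbeta2_def nu1_def nu2_def add_divide_distrib times_divide_eq_right)

lemma gs_tuned_isolated:
  assumes p: "2 \<le> p" "0 < sig" and G: "gram_is n p X (Gmat h)" and i: "i \<in> {1..p}" and iso: "h = 0 \<or> i = p \<and> odd p"
  shows "gs_single th r (q p {i} {}) (cor n X Y i / tscale sig p) (gs_tuned th r h q sig n p X Y i / tscale sig p)"
proof -
  have T: "0 < tscale sig p" by (rule tscale(1)[OF p])
  have t: "(cor n X Y i / tscale sig p)\<^sup>2 > q p {i} {} \<longleftrightarrow> (cor n X Y i)\<^sup>2 > (tscale sig p)\<^sup>2 * q p {i} {}"
    using T by (simp add: power_divide less_divide_eq mult.commute)
  show ?thesis
    using gs_est_isolated[OF G i iso, where Y=Y and t="\<lambda>D F. (tscale sig p)\<^sup>2 * q p D F" and u="tscale sig p * sqrt th" and v="tscale sig p * sqrt r"]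
      Gmin1_scale[OF T]
    unfolding gs_single_def t gs_tuned_alt[OF p] by auto
qed

lemma gs_tuned_pair:
  assumes p: "2 \<le> p" "0 < sig" and G: "gram_is n p X (Gmat h)" and h: "\<bar>h\<bar> < 1" and k: "2 * k + 2 \<le> p"
    and i: "i = 2 * k + 1" and j: "j = 2 * k + 2"
  shows "gs_pair h th r (q p {i} {}) (q p {j} {}) (q p {i} {j}) (q p {j} {i}) (q p {i, j} {})
    (cor n X Y i / tscale sig p) (cor n X Y j / tscale sig p)
    (gs_tuned th r h q sig n p X Y i / tscale sig p) (gs_tuned th r h q sig n p X Y j / tscale sig p)"
proof (cases "h = 0")
  case True
  have "i \<in> {1..p}" "j \<in> {1..p}" using k by (auto simp: i j)
  then show ?thesis using True gs_tuned_isolated[OF p G] by (simp add: gs_pair_def)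
next
  case False
  have T: "0 < tscale sig p" by (rule tscale(1)[OF p])
  obtain u1 u2 where
    "gs_screen h ((tscale sig p)\<^sup>2 * q p {i} {}) ((tscale sig p)\<^sup>2 * q p {j} {}) ((tscale sig p)\<^sup>2 * q p {i} {j}) ((tscale sig p)\<^sup>2 * q p {j} {i})
       ((tscale sig p)\<^sup>2 * q p {i, j} {}) (cor n X Y i) (cor n X Y j) u1 u2"
    "gs_block h (tscale sig p * sqrt th) (tscale sig p * sqrt r) (cor n X Y i) (cor n X Y j) u1 u2
       (gs_tuned th r h q sig n p X Y i) (gs_tuned th r h q sig n p X Y j)"
    unfolding gs_tuned_alt[OF p] by (rule gs_est_pair[OF G h False k i j])
  from gs_screen_scale[OF T this(1)] gs_block_scale[OF T this(2)] show ?thesis using False by (auto simp: gs_pair_def)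
qed

lemma gs_levels_q:
  assumes Q: "q_admissible th r h q0 qc q" and q0: "0 < q0" and th: "0 < th" "th < r" and h: "\<bar>h\<bar> < 1"
    and k: "2 * k + 2 \<le> p" and i: "i = 2 * k + 1" and j: "j = 2 * k + 2"
  shows "gs_levels h th r (q p {i} {}) (q p {j} {}) (q p {i} {j}) (q p {j} {i}) (q p {i, j} {})"
proof -
  have ip: "i \<in> {1..p}" "j \<in> {1..p}" "i \<noteq> j" using k by (auto simp: i j)
  have g: "Gmat h i i = 1" "Gmat h j j = 1" "Gmat h i j = h" "Gmat h j i = h" unfolding i j by (rule Gmat_block)+
  show ?thesis unfolding gs_levels_def
    using q_single[OF Q th ip(1)] q_single[OF Q th ip(2)] q_conditional[OF Q q0 th ip h g]
      q_conditional[OF Q q0 th ip(2,1) ip(3)[symmetric] h g(2,1,4,3)] q_pair[OF Q q0 th ip(1,2) h ip(3) g] by blast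
qed

lemma blk_err_pair:
  assumes p: "2 \<le> p" "0 < sig" and k: "2 * k + 2 \<le> p"
  shows "blk_err p bh be k \<longleftrightarrow> \<not> (sgn (bh (2 * k + 1) / tscale sig p) = sgn (sbeta1 p sig be k) \<and> sgn (bh (2 * k + 2) / tscale sig p) = sgn (sbeta2 p sig be k))"
proof -
  have k1: "2 * k + 1 \<le> p" using k by simp
  have s: "sgn (x / tscale sig p) = sgn x" for x using tscale(1)[OF p] by (simp add: sgn_divide)
  show ?thesis unfolding blk_err_def blk_cases[OF k1] sbeta1_def sbeta2_def s using k by (auto simp: bet2_def)
qed

context
  fixes th r h q0 :: real and qc and q :: "nat \<Rightarrow> nat set \<Rightarrow> nat set \<Rightarrow> real"
  assumes th: "0 < th" "th < r" and h: "\<bar>h\<bar> < 1" and q0: "0 < q0" and Q: "q_admissible th r h q0 qc q"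
begin

lemma gs_budget:
  assumes p: "2 \<le> p" "0 < sig" and G: "gram_is n p X (Gmat h)" and k: "k < (p + 1) div 2"
    and mu: "mu \<in> Theta p (sig * sqrt (2 * r * ln p))"
    and err: "blk_err p (gs_tuned th r h q sig n p X (Yobs n p X sig (beta_of b mu) z)) (beta_of b mu) k"
  shows "rho_gs th r h - th * real (card {i\<in>blk p k. b i}) \<le> rad2 h (nu1 n p X sig k z) (nu2 n p X h sig k z)"
proof -
  have r: "0 < r" using th by simp
  note sc = scaled_signal[OF p r mu k, of b]
  let ?be = "beta_of b mu"
  let ?Y = "Yobs n p X sig ?be z"
  show ?thesis
  proof (cases "2 * k + 2 \<le> p")
    case True
    show ?thesis unfolding sc(3)[symmetric]
      by (rule gs_pair_upper[OF h th gs_levels_q[OF Q q0 th h True refl refl] _ sc(1,2) err[unfolded blk_err_pair[OF p True]]])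
        (rule gs_tuned_pair[OF p G h True refl refl, of th r q ?Y, unfolded cor_scaled[OF p G h k] cor_scaled(2)[OF p G h k True]])
  next
    case False
    then have kp: "2 * k + 1 = p" using k by auto
    have ip: "2 * k + 1 \<in> {1..p}" using kp by simp
    have b2: "sbeta2 p sig ?be k = 0" using False by (simp add: sbeta2_def bet2_def)
    have T: "0 < tscale sig p" by (rule tscale(1)[OF p])
    have odd: "odd p" using kp by presburger
    have "gs_single th r (q p {2 * k + 1} {}) (sbeta1 p sig ?be k + nu1 n p X sig k z) (gs_tuned th r h q sig n p X ?Y (2 * k + 1) / tscale sig p)"
      using gs_tuned_isolated[OF p G ip, of th r q ?Y] kp odd b2 unfolding cor_scaled(1)[OF p G h k] by simp
    moreover have "sgn (gs_tuned th r h q sig n p X ?Y (2 * k + 1) / tscale sig p) \<noteq> sgn (sbeta1 p sig ?be k)"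
      using err kp T unfolding blk_err_def blk_cases[OF eq_refl[OF kp]] sbeta1_def by (simp add: sgn_divide)
    ultimately have "rho_gs th r h - th * of_bool (sbeta1 p sig ?be k \<noteq> 0) \<le> (nu1 n p X sig k z)\<^sup>2"
      using q_single[OF Q th ip] sc(1) by (intro gs_single_upper[OF th, of "q p {2 * k + 1} {}"]) auto
    also have "\<dots> \<le> rad2 h (nu1 n p X sig k z) (nu2 n p X h sig k z)" by (rule rad2_ge(1)[OF h])
    finally show ?thesis using b2 unfolding sc(3)[symmetric] by simp
  qed
qed

lemma gs_risk_upper:
  assumes d: "0 < d" and rho: "0 < rho_gs th r h"
  shows "\<forall>\<^sub>F p in sequentially. \<forall>n X sig mu. gram_is n p X (Gmat h) \<longrightarrow> 0 < sig \<longrightarrow> mu \<in> Theta p (sig * sqrt (2 * r * ln p)) \<longrightarrow>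
    risk n p X sig (real p powr (- th)) (gs_tuned th r h q sig n p X) mu \<le> ennreal (real p powr (1 - rho_gs th r h + d))"
  using risk_upper[OF th(1) rho d h] eventually_ge_at_top[of 2]
proof (eventually_elim, intro allI impI)
  fix p n :: nat and X sig mu
  assume U: "\<forall>n X sig est mu. gram_is n p X (Gmat h) \<longrightarrow>
    (\<forall>b z k. k < (p + 1) div 2 \<longrightarrow> blk_err p (est (Yobs n p X sig (beta_of b mu) z)) (beta_of b mu) k \<longrightarrow>
       2 * ln p * (rho_gs th r h - card {i\<in>blk p k. b i} * th) \<le> (lin n (fstdir X k) z)\<^sup>2 + (lin n (snddir p X h k) z)\<^sup>2) \<longrightarrow>
    risk n p X sig (real p powr (- th)) est mu \<le> ennreal (real p powr (1 - rho_gs th r h + d))"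
   and p2: "2 \<le> p" and G: "gram_is n p X (Gmat h)" and sig: "0 < sig" and mu: "mu \<in> Theta p (sig * sqrt (2 * r * ln p))"
  show "risk n p X sig (real p powr (- th)) (gs_tuned th r h q sig n p X) mu \<le> ennreal (real p powr (1 - rho_gs th r h + d))"
  proof (rule U[rule_format, OF G])
    fix b z k assume "k < (p + 1) div 2"
      and "blk_err p (gs_tuned th r h q sig n p X (Yobs n p X sig (beta_of b mu) z)) (beta_of b mu) k"
    from noise_budget[OF p2 sig h gs_budget[OF p2 sig G this(1) mu this(2)]]
    show "2 * ln p * (rho_gs th r h - card {i\<in>blk p k. b i} * th) \<le> (lin n (fstdir X k) z)\<^sup>2 + (lin n (snddir p X h k) z)\<^sup>2"
      by (simp only: mult.commute[of th])
  qed
qed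

lemma gs_lower_event:
  assumes d: "0 < d" and R: "reach h c1 c2 \<kappa>0 P" and qf: "0 < qf h c1 c2"
    and e: "(of_bool s1 + of_bool s2) * th + \<kappa>0 \<le> e"
    and det: "\<And>ta tb tab tba tp n1 n2 x y. gs_levels h th r ta tb tab tba tp \<Longrightarrow> P n1 n2 \<Longrightarrow>
      gs_pair h th r ta tb tab tba tp ((if s1 then m1 else 0) + h * (if s2 then m2 else 0) + n1) (h * (if s1 then m1 else 0) + (if s2 then m2 else 0) + n2) x y \<Longrightarrow>
      \<not> (sgn x = sgn (if s1 then m1 else 0) \<and> sgn y = sgn (if s2 then m2 else 0))"
  shows "\<forall>\<^sub>F p in sequentially. \<forall>n X sig. gram_is n p X (Gmat h) \<longrightarrow> 0 < sig \<longrightarrow>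
    ennreal (real p powr (1 - e - d)) \<le> risk n p X sig (real p powr (- th)) (gs_tuned th r h q sig n p X) (two_level sig p m1 m2)"
  using risk_lower_reach[OF R h qf th(1) d, of s1 s2] eventually_ge_at_top[of 2]
proof (eventually_elim, intro allI impI)
  fix p n :: nat and X and sig :: real
  assume L: "\<forall>n X sig est mu. gram_is n p X (Gmat h) \<longrightarrow> 0 < sig \<longrightarrow>
    (\<forall>b z k. 2 * k + 2 \<le> p \<longrightarrow> b (2 * k + 1) = s1 \<longrightarrow> b (2 * k + 2) = s2 \<longrightarrow> P (nu1 n p X sig k z) (nu2 n p X h sig k z) \<longrightarrow>
       blk_err p (est (Yobs n p X sig (beta_of b mu) z)) (beta_of b mu) k) \<longrightarrow>
    ennreal (real p powr (1 - ((of_bool s1 + of_bool s2) * th + \<kappa>0) - d)) \<le> risk n p X sig (real p powr (- th)) est mu"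
   and p2: "2 \<le> p" and G: "gram_is n p X (Gmat h)" and sig: "0 < sig"
  note p = p2 sig
  let ?mu = "two_level sig p m1 m2"
  have "ennreal (real p powr (1 - e - d)) \<le> ennreal (real p powr (1 - ((of_bool s1 + of_bool s2) * th + \<kappa>0) - d))"
    using e p by (intro ennreal_leI powr_mono) auto
  also have "\<dots> \<le> risk n p X sig (real p powr (- th)) (gs_tuned th r h q sig n p X) ?mu"
  proof (rule L[rule_format, OF G sig])
    fix b z k assume k2: "2 * k + 2 \<le> p" and b: "b (2 * k + 1) = s1" "b (2 * k + 2) = s2" and P: "P (nu1 n p X sig k z) (nu2 n p X h sig k z)"
    let ?be = "beta_of b ?mu"
    have k: "k < (p + 1) div 2" using k2 by auto
    show "blk_err p (gs_tuned th r h q sig n p X (Yobs n p X sig ?be z)) ?be k"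
      unfolding blk_err_pair[OF p k2] two_level_scaled[OF p k2] b
      by (rule det[OF gs_levels_q[OF Q q0 th h k2 refl refl] P])
        (rule gs_tuned_pair[OF p G h k2 refl refl, of th r q "Yobs n p X sig ?be z",
          unfolded cor_scaled(1)[OF p G h k] cor_scaled(2)[OF p G h k k2] two_level_scaled[OF p k2] b])
  qed
  finally show "ennreal (real p powr (1 - e - d)) \<le> risk n p X sig (real p powr (- th)) (gs_tuned th r h q sig n p X) ?mu" .
qed

lemma gs_low_null:
  assumes d: "0 < d"
  shows "\<forall>\<^sub>F p in sequentially. \<forall>n X sig. gram_is n p X (Gmat h) \<longrightarrow> 0 < sig \<longrightarrow>
    ennreal (real p powr (1 - (th + r)\<^sup>2 / (4 * r) - d)) \<le> risk n p X sig (real p powr (- th)) (gs_tuned th r h q sig n p X) (two_level sig p (sqrt r) (sqrt r))"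
proof (rule gs_lower_event[OF d reach_halfplane[OF h, of 1 0 "(r + th) / (2 * sqrt r)"], of False False])
  fix ta tb tab tba tp n1 n2 x y
  assume "gs_levels h th r ta tb tab tba tp" "(r + th) / (2 * sqrt r) < 1 * n1 + 0 * n2"
    "gs_pair h th r ta tb tab tba tp ((if False then sqrt r else 0) + h * (if False then sqrt r else 0) + n1) (h * (if False then sqrt r else 0) + (if False then sqrt r else 0) + n2) x y"
  then show "\<not> (sgn x = sgn (if False then sqrt r else 0) \<and> sgn y = sgn (if False then sqrt r else 0))"
    using gs_pair_null[OF th, of h ta tb tab tba tp n1 n2 x y] by (simp add: sgn_0_0)
qed (use th in \<open>simp_all add: qf_def power_divide power_mult_distrib add.commute\<close>)

lemma gs_low_swap:
  assumes d: "0 < d" and c: "th < \<bar>h\<bar> * r"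
  shows "\<forall>\<^sub>F p in sequentially. \<forall>n X sig. gram_is n p X (Gmat h) \<longrightarrow> 0 < sig \<longrightarrow>
    ennreal (real p powr (1 - (th + (1 - \<bar>h\<bar>) * r / 2) - d)) \<le> risk n p X sig (real p powr (- th)) (gs_tuned th r h q sig n p X) (two_level sig p (sqrt r) (sqrt r))"
proof -
  have r: "0 < r" "0 < sqrt r" "sqrt r * sqrt r = r" using th by simp_all
  have h0: "h \<noteq> 0" using c th by auto
  obtain g where g: "g = 1 \<or> g = - 1" "g * h = \<bar>h\<bar>" "g\<^sup>2 = 1" using sgn_choice by metis
  have hg: "h * g = \<bar>h\<bar>" "g * g = 1" using g by (simp_all add: mult.commute power2_eq_square)
  have qs: "qf h (- 1) g = 2 * (1 - \<bar>h\<bar>)" by (rule qf_shrink[OF g(3,2)])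
  define m where "m = sqrt ((1 - \<bar>h\<bar>) / 2)"
  have m: "0 < m" "m * m = (1 - \<bar>h\<bar>) / 2" using h by (auto simp: m_def)
  have sq: "(1 - \<bar>h\<bar>) / sqrt (qf h (- 1) g) = m"
  proof -
    have "sqrt (qf h (- 1) g) = 2 * m"
      unfolding qs using m by (intro real_sqrt_unique) (auto simp: power2_eq_square)
    then show ?thesis using m by (simp add: field_simps)
  qed
  define thr where "thr = (r + th) / (2 * sqrt r)"
  have thr: "thr < (1 + \<bar>h\<bar>) / 2 * sqrt r" 
  proof -
    have "(1 + \<bar>h\<bar>) / 2 * sqrt r * (2 * sqrt r) = (1 + \<bar>h\<bar>) * (sqrt r * sqrt r)" by simp
    also have "\<dots> = r + \<bar>h\<bar> * r" unfolding r(3) by (simp add: distrib_right)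
    finally show ?thesis using c r(2) unfolding thr_def by (subst pos_divide_less_eq) auto
  qed
  define P where "P n1 n2 \<longleftrightarrow> (1 - \<bar>h\<bar>) * sqrt r < g * n2 - n1 \<and> thr < sqrt r + n1" for n1 n2
  define x0 where "x0 = m * sqrt r"
  define \<zeta> where "\<zeta> = ((1 + \<bar>h\<bar>) / 2 * sqrt r - thr) / m"
  have xm: "x0 * m = (1 - \<bar>h\<bar>) / 2 * sqrt r" unfolding x0_def m(2)[symmetric] by simp
  have R: "reach h (- 1) g (x0\<^sup>2) P"
  proof (rule reach_open[OF h, of "- 1" g P x0 \<zeta>])
    show "0 < qf h (- 1) g" unfolding qs using h by simp
    show "open {(n1, n2). P n1 n2}" unfolding P_def case_prod_beta
      by (intro open_Collect_conj open_Collect_less continuous_intros)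
    show "0 \<le> x0" "0 < \<zeta>" using m r thr by (auto simp: x0_def \<zeta>_def)
    fix x assume x: "x0 < x" "x < x0 + \<zeta>"
    have e1: "x * ((- 1 + h * g) / sqrt (qf h (- 1) g)) = - (x * m)"
    proof -
      have "- 1 + \<bar>h\<bar> = - (1 - \<bar>h\<bar>)" by simp
      then show ?thesis unfolding hg(1) by (simp only: minus_divide_left[symmetric] sq mult_minus_right)
    qed
    have e2: "g * (x * ((h * - 1 + g) / sqrt (qf h (- 1) g))) = x * m"
    proof -
      have "g * (x * ((h * - 1 + g) / sqrt (qf h (- 1) g))) = x * ((g * g - g * h) / sqrt (qf h (- 1) g))" by (simp add: algebra_simps)
      then show ?thesis unfolding hg(2) g(2) sq .
    qed
    have a: "x0 * m < x * m" using x m by (intro mult_strict_right_mono) auto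
    have "x * m < (x0 + \<zeta>) * m" using x m by (intro mult_strict_right_mono) auto
    also have "\<dots> = x0 * m + ((1 + \<bar>h\<bar>) / 2 * sqrt r - thr)" using m by (simp add: distrib_right \<zeta>_def)
    also have "\<dots> = sqrt r - thr"
      unfolding xm by (simp add: left_diff_distrib distrib_right add_divide_distrib diff_divide_distrib)
    finally show "P (x * ((- 1 + h * g) / sqrt (qf h (- 1) g))) (x * ((h * - 1 + g) / sqrt (qf h (- 1) g)))"
      unfolding P_def e1 e2 using a xm by (intro conjI) linarith+
  qed
  show ?thesis
  proof (rule gs_lower_event[OF d R, of True False])
    show "0 < qf h (- 1) g" unfolding qs using h by simp
    have "x0\<^sup>2 = (m * m) * (sqrt r * sqrt r)" by (simp add: x0_def power2_eq_square)
    then show "(of_bool True + of_bool False) * th + x0\<^sup>2 \<le> th + (1 - \<bar>h\<bar>) * r / 2" unfolding m(2) r(3) by simp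
    fix ta tb tab tba tp n1 n2 x y
    assume a: "gs_levels h th r ta tb tab tba tp" "P n1 n2"
      "gs_pair h th r ta tb tab tba tp ((if True then sqrt r else 0) + h * (if False then sqrt r else 0) + n1) (h * (if True then sqrt r else 0) + (if False then sqrt r else 0) + n2) x y"
    have "g * (h * sqrt r + n2) = \<bar>h\<bar> * sqrt r + g * n2" unfolding g(2)[symmetric] by (simp add: algebra_simps)
    moreover have "g * (h * sqrt r + n2) \<le> \<bar>h * sqrt r + n2\<bar>" using g(1) by auto
    moreover have "(1 - \<bar>h\<bar>) * sqrt r = sqrt r - \<bar>h\<bar> * sqrt r" by (simp add: left_diff_distrib)
    ultimately have "sqrt r + n1 < \<bar>h * sqrt r + n2\<bar>" using a(2) unfolding P_def by linarith
    then show "\<not> (sgn x = sgn (if True then sqrt r else 0) \<and> sgn y = sgn (if False then sqrt r else 0))"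
      using a gs_pair_swap[OF th h0 a(1), of "sqrt r + n1" "h * sqrt r + n2" x y] r by (simp add: P_def thr_def sgn_0_0)
  qed
qed

lemma gs_low_false:
  assumes d: "0 < d" and h0: "h \<noteq> 0" and A: "th < (1 - h\<^sup>2) * r"
  shows "\<forall>\<^sub>F p in sequentially. \<forall>n X sig. gram_is n p X (Gmat h) \<longrightarrow> 0 < sig \<longrightarrow>
    ennreal (real p powr (1 - (2 * th + (pos ((1 - h\<^sup>2) * r - th))\<^sup>2 / (4 * (1 - h\<^sup>2) * r)) - d))
      \<le> risk n p X sig (real p powr (- th)) (gs_tuned th r h q sig n p X) (two_level sig p (4 * sqrt r) (sqrt r))"
proof -
  have r: "0 < r" "0 < sqrt r" "sqrt r * sqrt r = r" using th by simp_all
  have a: "0 < 1 - h\<^sup>2" using abs_less_one_sq[OF h] .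
  have qr: "qf h (- h) 1 = 1 - h\<^sup>2" by (simp add: qf_def power2_eq_square)
  define t where "t = ((1 - h\<^sup>2) * r + th) / (2 * sqrt r)"
  have t: "0 < t" using a r th by (auto simp: t_def intro!: divide_pos_pos add_pos_pos mult_pos_pos)
  define s where "s = sqrt (1 - h\<^sup>2)"
  have s: "0 < s" "s * s = 1 - h\<^sup>2" using a by (auto simp: s_def)
  define P where "P n1 n2 \<longleftrightarrow> t < n2 - h * n1 \<and> \<bar>n1\<bar> < sqrt r" for n1 n2
  have R: "reach h (- h) 1 ((t / s)\<^sup>2) P"
  proof (rule reach_open[OF h _ _ _ zero_less_one])
    show "0 < qf h (- h) 1" unfolding qr by (rule a)
    show "open {(n1, n2). P n1 n2}" unfolding P_def case_prod_beta
      by (intro open_Collect_conj open_Collect_less continuous_intros)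
    show "0 \<le> t / s" using t s by simp
    fix x assume x: "t / s < x"
    have e: "h * - h + 1 = s * s" unfolding s(2) by (simp add: power2_eq_square)
    have "x * ((h * - h + 1) / sqrt (qf h (- h) 1)) = x * s" unfolding e qr s_def[symmetric] using s(1) by simp
    then show "P (x * ((- h + h * 1) / sqrt (qf h (- h) 1))) (x * ((h * - h + 1) / sqrt (qf h (- h) 1)))"
      using x s r by (simp add: P_def divide_less_eq)
  qed
  show ?thesis
  proof (rule gs_lower_event[OF d R, of True False])
    show "0 < qf h (- h) 1" unfolding qr by (rule a)
    show "(of_bool True + of_bool False) * th + (t / s)\<^sup>2 \<le> 2 * th + (pos ((1 - h\<^sup>2) * r - th))\<^sup>2 / (4 * (1 - h\<^sup>2) * r)"
    proof -
      define B where "B = (1 - h\<^sup>2) * r"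
      have B: "0 < B" "th < B" using a r A by (auto simp: B_def)
      have "(t / s)\<^sup>2 = (B + th)\<^sup>2 / (4 * B)"
        using r a by (simp add: t_def s_def B_def power_divide power_mult_distrib mult_ac)
      moreover have "(B + th)\<^sup>2 / (4 * B) = th + (B - th)\<^sup>2 / (4 * B)"
        using B by (simp add: field_simps power2_eq_square)
      moreover have "pos (B - th) = B - th" using B by (simp add: pos_def)
      ultimately have "th + (t / s)\<^sup>2 = 2 * th + (pos (B - th))\<^sup>2 / (4 * B)" by simp
      then show ?thesis unfolding B_def mult.assoc by simp
    qed
    fix ta tb tab tba tp n1 n2 x y
    assume L: "gs_levels h th r ta tb tab tba tp" "P n1 n2"
      "gs_pair h th r ta tb tab tba tp ((if True then 4 * sqrt r else 0) + h * (if False then sqrt r else 0) + n1) (h * (if True then 4 * sqrt r else 0) + (if False then sqrt r else 0) + n2) x y"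
    have "(h * (4 * sqrt r) + n2) - h * (4 * sqrt r + n1) = n2 - h * n1" by (simp add: algebra_simps)
    then have w: "((1 - h\<^sup>2) * r + th) / (2 * sqrt r) < (h * (4 * sqrt r) + n2) - h * (4 * sqrt r + n1)" "2 * sqrt r \<le> 4 * sqrt r + n1"
      using L(2) by (auto simp: P_def t_def)
    show "\<not> (sgn x = sgn (if True then 4 * sqrt r else 0) \<and> sgn y = sgn (if False then sqrt r else 0))"
      using L(3) gs_pair_false[OF th h h0 L(1) _ A w(2,1), of x y] r by (simp add: sgn_0_0)
  qed
qed

lemma gs_rate:
  assumes sig: "0 < sig" and G: "\<forall>p. gram_is (nn p) p (X p) (Gmat h)"
  shows "\<exists>L. Lp_factor L \<and> (\<forall>\<^sub>F p in sequentially.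
      (SUP mu \<in> Theta p (sig * sqrt (2 * r * ln p)). risk (nn p) p (X p) sig (real p powr (- th)) (gs_tuned th r h q sig (nn p) p (X p)) mu)
      = ennreal (L p * real p powr (1 - rho_gs th r h)))"
proof -
  have r: "0 < r" using th by simp
  have a: "0 < 1 - h\<^sup>2" using abs_less_one_sq[OF h] .
  define v1 where "v1 = (th + r)\<^sup>2 / (4 * r)"
  define v2 where "v2 = th + (1 - \<bar>h\<bar>) * r / 2"
  define v3 where "v3 = 2 * th + (pos ((1 - h\<^sup>2) * r - th))\<^sup>2 / (4 * (1 - h\<^sup>2) * r)"
  have v: "0 < v1" "0 < v2" "0 < v3"
    using th r h a by (auto simp: v1_def v2_def v3_def intro!: add_pos_nonneg divide_pos_pos)
  have rho: "rho_gs th r h = Min {v1, v2, v3}" by (simp add: rho_gs_def v1_def v2_def v3_def)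
  have pos: "0 < rho_gs th r h" unfolding rho using v by simp
  have v12: "v1 \<le> v2" if "\<bar>h\<bar> * r \<le> th"
  proof -
    have "v1 = th / 2 + r / 4 + th * (th / r) / 4" using r by (simp add: v1_def field_simps power2_eq_square)
    moreover have "th * (th / r) \<le> th * 1" using th r by (intro mult_left_mono) auto
    moreover have "v2 = th + r / 2 - \<bar>h\<bar> * r / 2" by (simp add: v2_def left_diff_distrib diff_divide_distrib)
    ultimately have "v1 \<le> th / 2 + r / 4 + th / 4" "v2 \<ge> th / 2 + r / 2" using that by auto
    then show ?thesis using th by linarith
  qed
  have v13: "v1 \<le> v3" if "h = 0"
  proof -
    have "v3 = 2 * th + (r - th)\<^sup>2 / (4 * r)" using that th by (simp add: v3_def pos_def)
    also have "\<dots> = th + v1" using r by (simp add: v1_def field_simps power2_eq_square)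
    finally show ?thesis using th by simp
  qed
  have v23: "v2 \<le> v3" if "(1 - h\<^sup>2) * r \<le> th"
  proof -
    have "(1 - \<bar>h\<bar>) * 1 \<le> (1 - \<bar>h\<bar>) * (1 + \<bar>h\<bar>)" using h by (intro mult_left_mono) auto
    also have "\<dots> = 1 - h\<^sup>2" by (simp add: power2_eq_square algebra_simps flip: abs_mult)
    finally have "(1 - \<bar>h\<bar>) * r \<le> (1 - h\<^sup>2) * r" using r by (intro mult_right_mono) auto
    moreover have "0 \<le> (pos ((1 - h\<^sup>2) * r - th))\<^sup>2 / (4 * (1 - h\<^sup>2) * r)" using a r by simp
    ultimately show ?thesis using that th unfolding v2_def v3_def by linarith
  qed
  consider "rho_gs th r h = v1" | "rho_gs th r h = v2" "th < \<bar>h\<bar> * r" | "rho_gs th r h = v3" "h \<noteq> 0" "th < (1 - h\<^sup>2) * r"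
  proof -
    have "Min {v1, v2, v3} = min v1 (min v2 v3)" by simp
    then show ?thesis using v12 v13 v23 that unfolding rho by (metis linorder_not_le min_def)
  qed
  then obtain m1 m2 where m: "sqrt r \<le> \<bar>m1\<bar>" "sqrt r \<le> \<bar>m2\<bar>"
    and low: "\<And>d. 0 < d \<Longrightarrow> \<forall>\<^sub>F p in sequentially. \<forall>n X sig. gram_is n p X (Gmat h) \<longrightarrow> 0 < sig \<longrightarrow>
      ennreal (real p powr (1 - rho_gs th r h - d)) \<le> risk n p X sig (real p powr (- th)) (gs_tuned th r h q sig n p X) (two_level sig p m1 m2)"
  proof cases
    case 1
    show ?thesis by (rule that[of "sqrt r" "sqrt r"]) (use r gs_low_null 1 in \<open>auto simp: v1_def\<close>)
  next
    case 2
    show ?thesis by (rule that[of "sqrt r" "sqrt r"]) (use r gs_low_swap[OF _ 2(2)] 2(1) in \<open>auto simp: v2_def\<close>)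
  next
    case 3
    show ?thesis by (rule that[of "4 * sqrt r" "sqrt r"]) (use r gs_low_false[OF _ 3(2,3)] 3(1) in \<open>auto simp: v3_def\<close>)
  qed
  show ?thesis
  proof (rule Lp_factor_of_bounds)
    fix d :: real assume d: "0 < d"
    show "\<forall>\<^sub>F p in sequentially. (SUP mu \<in> Theta p (sig * sqrt (2 * r * ln p)). risk (nn p) p (X p) sig (real p powr (- th)) (gs_tuned th r h q sig (nn p) p (X p)) mu)
        \<le> ennreal (real p powr (1 - rho_gs th r h + d))"
      using gs_risk_upper[OF d pos] by eventually_elim (use G sig in \<open>blast intro: SUP_least\<close>)
    show "\<forall>\<^sub>F p in sequentially. ennreal (real p powr (1 - rho_gs th r h - d))
        \<le> (SUP mu \<in> Theta p (sig * sqrt (2 * r * ln p)). risk (nn p) p (X p) sig (real p powr (- th)) (gs_tuned th r h q sig (nn p) p (X p)) mu)"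
      using low[OF d] eventually_ge_at_top[of 2]
    proof eventually_elim
      case (elim p)
      have Gp: "gram_is (nn p) p (X p) (Gmat h)" using G by blast
      show ?case
        by (rule SUP_upper2[OF two_level_Theta[OF elim(2) sig m]]) (rule elim(1)[rule_format, OF Gp sig])
    qed
  qed
qed

end

theorem theorem13:
  fixes th r h0 sig :: real
    and nn :: "nat \<Rightarrow> nat" and X :: "nat \<Rightarrow> nat \<Rightarrow> nat \<Rightarrow> real"
  assumes "0 < th" and "th < 1" and "th < r" and "-1 < h0" and "h0 < 1" and "0 < sig"
    and "\<forall>p. gram_is (nn p) p (X p) (Gmat h0)"
  shows "(\<forall>q0 qc q. 0 < q0 \<and> q_admissible th r h0 q0 qc q \<longrightarrow>
           (\<exists>L. Lp_factor L \<and> (\<forall>\<^sub>F p in sequentially.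
              (SUP mu \<in> Theta p (sig * sqrt (2 * r * ln p)).
                 risk (nn p) p (X p) sig (real p powr (- th))
                   (gs_est (nn p) p (X p) (Gmat h0) 0 2
                      (\<lambda>D F. 2 * sig\<^sup>2 * q p D F * ln p)
                      (sig * sqrt (2 * th * ln p)) (sig * sqrt (2 * r * ln p))) mu)
              = ennreal (L p * real p powr (1 - rho_gs th r h0)))))
       \<and> (\<exists>L. Lp_factor L \<and> (\<forall>\<^sub>F p in sequentially.
              (INF lam \<in> {0<..}. SUP mu \<in> Theta p (sig * sqrt (2 * r * ln p)).
                 risk (nn p) p (X p) sig (real p powr (- th)) (ss_est (nn p) p (X p) lam) mu)
              = ennreal (L p * real p powr (1 - rho_ss th r h0))))
       \<and> (\<exists>L. Lp_factor L \<and> (\<forall>\<^sub>F p in sequentially.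
              (INF lam \<in> {0<..}. SUP mu \<in> Theta p (sig * sqrt (2 * r * ln p)).
                 risk (nn p) p (X p) sig (real p powr (- th)) (lasso_est (nn p) p (X p) lam) mu)
              = ennreal (L p * real p powr (1 - rho_lasso th r h0))))"
proof -
  have h: "\<bar>h0\<bar> < 1" using assms(4,5) by auto
  obtain g where g: "g = 1 \<or> g = - 1" "g * h0 = \<bar>h0\<bar>" "g\<^sup>2 = 1" by (rule sgn_choice)
  show ?thesis
    using gs_rate[OF assms(1,3) h _ _ assms(6,7)] ss_rate[OF assms(1,3) h assms(6,7)] lasso_rate[OF assms(1,3) h g assms(6,7)]
    unfolding gs_tuned_def by blast
qed

end
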